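(* Under the standing assumptions on the control data $(A,f,\lambda,\ell,h)$ listed in the context, the value function $v:[0,T]\times\Omega\to\mathbb{R}$, $$v(s,x):=\inf_{a\in\mathcal{A}}\left[\int_s^T\chi^{s,x,a}(t)\,\ell^{s,x,a}(t)\,dt+\chi^{s,x,a}(T)\,h(\phi^{s,x,a})\right],$$ is the unique minimax $C_f$-solution of $$-\partial_t u(t,x)-H(t,x,u(t,x),\partial_x u(t,x))=0,\ (t,x)\in[0,T)\times\Omega,\qquad u(T,x)=h(x),\ x\in\Omega,$$ where $H(t,x,y,z):=\inf_{a\in A}\left[\ell(t,x,a)+f(t,x,a)\cdot z-\lambda(t,x,a)\,y\right]$ for $(t,x,y,z)\in[0,T]\times\Omega\times\mathbb{R}\times\mathbb{R}^d$.
   Context: Setting. Fix $T>0$ and $d\in\mathbb{N}$. $\Omega=D([0,T],\mathbb{R}^d)$ is the set of all right-continuous functions $x:[0,T]\to\mathbb{R}^d$ that have left limits, equipped with the supremum norm $\|\cdot\|_\infty$. The set $[0,T]\times\Omega$ is equipped with the pseudo-metric $\mathbf{d}_\infty((t,x),(s,\tilde x)):=|t-s|+\sup_{0\le r\le T}|x(r\wedge t)-\tilde x(r\wedge s)|$; upper semicontinuity (USC) and lower semicontinuity (LSC) on $[0,T]\times\Omega$ are with respect to $\mathbf{d}_\infty$. Control data and standing assumptions. $A$ is a non-empty subset of a Polish space and is the countable union of compact metrizable subsets of $A$. $\mathcal{A}$ is the set of all Borel measurable functions from $[0,T]$ to $A$. With $\mathbb{R}_+=[0,\infty)$, the data are $f:[0,T]\times\Omega\times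 A\to\mathbb{R}^d$, $\lambda:[0,T]\times\Omega\times A\to\mathbb{R}_+$, $\ell:[0,T]\times\Omega\times A\to\mathbb{R}$, $h:\Omega\to\mathbb{R}$ such that: (i) for a.e. $t\in[0,T]$ the map $(x,a)\mapsto(f,\lambda,\ell)(t,x,a)$ is continuous; (ii) for every $(x,a)\in\Omega\times A$ the map $t\mapsto(f,\lambda,\ell)(t,x,a)$ is Borel measurable; (iii) there are constants $C_f,C_\lambda\ge0$ such that for a.e. $t\in(0,T)$ and each $x\in\Omega$: $\sup_{a\in A}(|f(t,x,a)|+|\ell(t,x,a)|)\le C_f(1+\sup_{s\le t}|x(s)|)$ and $\sup_{a\in A}|\lambda(t,x,a)|\le C_\lambda$; (iv) there is a constant $L_f\ge0$ such that for a.e. $t\in(0,T)$ and every $x,\tilde x\in\Omega$: $\sup_{a\in A}(|f(t,x,a)-f(t,\tilde x,a)|+|\ell(t,x,a)-\ell(t,\tilde x,a)|+|\lambda(t,x,a)-\lambda(t,\tilde x,a)|)\le L_f\sup_{s\le t}|x(s)-\tilde x(s)|$ and $|h(x)-h(\tilde x)|\le L_f\sup_{s\le T}|x(s)-\tilde x(s)|$. For $(s,x,a)\in[0,T)\times\Omega\times\mathcal{A}$, $\phi^{s,x,a}$ is the solution $\phi\in\Omega$ (absolutely continuous on $[s,T]$) of $\phi'(t)=f(t,\phi,a(t))$ a.e. on $(s,T)$, $\phi=x$ on $[0,s]$; for $s=T$, $\phi^{T,x,a}=x$, so that $v(T,x)=h(x)$. For $t\in[s,T]$: $\lambda^{s,x,a}(t):=\lambda(t,\phi^{s,x,a},a(t))$,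 $\chi^{s,x,a}(t):=\exp(-\int_s^t\lambda^{s,x,a}(r)\,dr)$, $\ell^{s,x,a}(t):=\ell(t,\phi^{s,x,a},a(t))$. Path sets. For $L\ge0$ and $(s_0,x_0)\in[0,T)\times\Omega$, $\mathcal{X}^L(s_0,x_0)$ is the set of $x\in\Omega$ with $x=x_0$ on $[0,s_0]$, $x|_{[s_0,T]}$ absolutely continuous, and $|x'(t)|\le L(1+\sup_{s\le t}|x(s)|)$ a.e. on $(s_0,T)$. For $y_0\in\mathbb{R}$, $z\in\mathbb{R}^d$, $\mathcal{Y}^L(s_0,x_0,y_0,z)$ is the set of pairs $(x,y)\in\mathcal{X}^L(s_0,x_0)\times C([s_0,T])$ with $y(t)=y_0+\int_{s_0}^t[x'(s)\cdot z-H(s,x,y(s),z)]\,ds$ on $[s_0,T]$. Minimax solutions of the terminal-value problem. Let $L\ge0$ and $u:[0,T]\times\Omega\to\mathbb{R}$. - $u$ is a minimax $L$-supersolution if $u$ is LSC, $u(T,\cdot)\ge h$ on $\Omega$, and for every $(s_0,x_0,z)\in[0,T)\times\Omega\times\mathbb{R}^d$ and every $y_0\ge u(s_0,x_0)$ there is $(x,y)\in\mathcal{Y}^L(s_0,x_0,y_0,z)$ with $y(t)\ge u(t,x)$ for each $t\in[s_0,T]$. - $u$ is a minimax $L$-subsolution if $u$ is USC, $u(T,\cdot)\le h$ on $\Omega$, and for every $(s_0,x_0,z)\in[0,T)\times\Omega\times\mathbb{R}^d$ and every $y_0\le u(s_0,x_0)$ there is $(x,y)\in\mathcal{Y}^L(s_0,x_0,y_0,z)$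 with $y(t)\le u(t,x)$ for each $t\in[s_0,T]$. - $u$ is a minimax $L$-solution if it is both. *)

theory Defs
  imports "HOL-Analysis.Analysis"
begin

section \<open>The path space\<close>

text \<open>
  A path on \<open>[0,T]\<close> is a total function on the reals that takes the dummy value
  \<open>undefined\<close> off \<open>[0,T]\<close>. Hence equality of paths is equality on \<open>[0,T]\<close>, and functionals of
  paths depend on the values in \<open>[0,T]\<close> only.
\<close>

definition cadlag_paths :: "real \<Rightarrow> (real \<Rightarrow> 'd::euclidean_space) set" where
  "cadlag_paths T =
     {x \<in> extensional {0..T}.
        (\<forall>t\<in>{0..<T}. (x \<longlongrightarrow> x t) (at_right t)) \<and>
        (\<forall>t\<in>{0<..T}. \<exists>l. (x \<longlongrightarrow> l) (at_left t))}"

definition sup_dist :: "real \<Rightarrow> (real \<Rightarrow> 'd::euclidean_space) \<Rightarrow> (real \<Rightarrow> 'd) \<Rightarrow> real" where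
  "sup_dist T x x' = (SUP t\<in>{0..T}. norm (x t - x' t))"

text \<open>
  On \<open>cadlag_paths T\<close> the supremum is finite, and nonnegative for \<open>T \<ge> 0\<close>. The absolute value in
  the next definition is vacuous there: the locale \<open>Metric_space\<close> asks for a nonnegative distance
  also outside its carrier, where the supremum may be unspecified.
\<close>

definition path_topology :: "real \<Rightarrow> (real \<Rightarrow> 'd::euclidean_space) topology" where
  "path_topology T = Metric_space.mtopology (cadlag_paths T) (\<lambda>x x'. \<bar>sup_dist T x x'\<bar>)"

lemma cadlag_paths_bounded:
  fixes x :: "real \<Rightarrow> 'd::euclidean_space"
  assumes "x \<in> cadlag_paths T"
  shows "bounded (x ` {0..T})"
proof -
  have loc: "\<exists>U. open U \<and> t \<in> U \<and> bounded (x ` (U \<inter> {0..T}))" if t: "t \<in> {0..T}" for t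
  proof -
    have bnd: "\<exists>B. eventually (\<lambda>s. norm (x s) \<le> B) F" if "(x \<longlongrightarrow> l) F" for l F
    proof -
      have "eventually (\<lambda>s. dist (x s) l < 1) F"
        using that by (rule tendstoD) simp
      then have "eventually (\<lambda>s. norm (x s) \<le> norm l + 1) F"
      proof (rule eventually_mono)
        fix s assume "dist (x s) l < 1"
        then show "norm (x s) \<le> norm l + 1"
          using norm_triangle_sub[of "x s" l] by (simp add: dist_norm)
      qed
      then show ?thesis by blast
    qed
    have "\<exists>B. eventually (\<lambda>s. s \<in> {0..T} \<longrightarrow> norm (x s) \<le> B) (at_right t)"
    proof (cases "t < T")
      case True
      then have "(x \<longlongrightarrow> x t) (at_right t)"
        using assms t by (auto simp: cadlag_paths_def)
      from bnd[OF this] obtain B where "eventually (\<lambda>s. norm (x s) \<le> B) (at_right t)" by blast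
      then show ?thesis by (intro exI[of _ B]) (auto elim: eventually_mono)
    next
      case False
      then show ?thesis using t
        by (intro exI[of _ 0]) (auto simp: eventually_at_filter)
    qed
    then obtain B1 where B1: "eventually (\<lambda>s. s \<in> {0..T} \<longrightarrow> norm (x s) \<le> B1) (at_right t)" by blast
    have "\<exists>B. eventually (\<lambda>s. s \<in> {0..T} \<longrightarrow> norm (x s) \<le> B) (at_left t)"
    proof (cases "0 < t")
      case True
      then have "\<exists>l. (x \<longlongrightarrow> l) (at_left t)"
        using assms t by (simp add: cadlag_paths_def)
      then obtain l where "(x \<longlongrightarrow> l) (at_left t)" by blast
      from bnd[OF this] obtain B where "eventually (\<lambda>s. norm (x s) \<le> B) (at_left t)" by blast
      then show ?thesis by (intro exI[of _ B]) (auto elim: eventually_mono)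
    next
      case False
      then show ?thesis using t
        by (intro exI[of _ 0]) (auto simp: eventually_at_filter)
    qed
    then obtain B2 where B2: "eventually (\<lambda>s. s \<in> {0..T} \<longrightarrow> norm (x s) \<le> B2) (at_left t)" by blast
    let ?B = "max (max B1 B2) (norm (x t))"
    have "eventually (\<lambda>s. s \<in> {0..T} \<longrightarrow> norm (x s) \<le> ?B) (at t)"
      unfolding eventually_at_split
      using B1 B2 by (auto elim!: eventually_mono)
    then have "eventually (\<lambda>s. s \<in> {0..T} \<longrightarrow> norm (x s) \<le> ?B) (nhds t)"
      by (auto simp: eventually_at_filter elim!: eventually_mono)
    then obtain U where U: "open U" "t \<in> U" "\<forall>s\<in>U. s \<in> {0..T} \<longrightarrow> norm (x s) \<le> ?B"
      unfolding eventually_nhds by blast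
    then have "bounded (x ` (U \<inter> {0..T}))"
      unfolding bounded_iff by (intro exI[of _ ?B]) auto
    with U show ?thesis by blast
  qed
  then obtain U where U: "\<And>t. t \<in> {0..T} \<Longrightarrow> open (U t) \<and> t \<in> U t \<and> bounded (x ` (U t \<inter> {0..T}))"
    by metis
  have "compact {0..T}" by simp
  moreover have "\<And>t. t \<in> {0..T} \<Longrightarrow> open (U t)" using U by blast
  moreover have "{0..T} \<subseteq> (\<Union>t\<in>{0..T}. U t)" using U by blast
  ultimately obtain C where C: "C \<subseteq> {0..T}" "finite C" "{0..T} \<subseteq> (\<Union>t\<in>C. U t)"
    by (rule compactE_image) blast
  have "bounded (\<Union>t\<in>C. x ` (U t \<inter> {0..T}))"
    using C U by (intro bounded_UN) auto
  moreover have "x ` {0..T} \<subseteq> (\<Union>t\<in>C. x ` (U t \<inter> {0..T}))"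
    using C(3) by blast
  ultimately show ?thesis by (rule bounded_subset)
qed

lemma sup_dist_bdd_above:
  fixes x y :: "real \<Rightarrow> 'd::euclidean_space"
  assumes "x \<in> cadlag_paths T" "y \<in> cadlag_paths T"
  shows "bdd_above ((\<lambda>t. norm (x t - y t)) ` {0..T})"
proof -
  obtain B C where "\<forall>t\<in>{0..T}. norm (x t) \<le> B" "\<forall>t\<in>{0..T}. norm (y t) \<le> C"
    using cadlag_paths_bounded[OF assms(1)] cadlag_paths_bounded[OF assms(2)]
    unfolding bounded_iff by auto
  then have "norm (x t - y t) \<le> B + C" if "t \<in> {0..T}" for t
    using that norm_triangle_ineq4[of "x t" "y t"] by fastforce
  then show ?thesis by (rule bdd_aboveI2)
qed

lemma norm_le_sup_dist:
  fixes x y :: "real \<Rightarrow> 'd::euclidean_space"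
  assumes "x \<in> cadlag_paths T" "y \<in> cadlag_paths T" "t \<in> {0..T}"
  shows "norm (x t - y t) \<le> sup_dist T x y"
  unfolding sup_dist_def using sup_dist_bdd_above[OF assms(1,2)] assms(3)
  by (intro cSUP_upper) auto

lemma sup_dist_nonneg:
  fixes x y :: "real \<Rightarrow> 'd::euclidean_space"
  assumes "0 \<le> T" "x \<in> cadlag_paths T" "y \<in> cadlag_paths T"
  shows "0 \<le> sup_dist T x y"
  using norm_le_sup_dist[OF assms(2,3), of 0] assms(1) norm_ge_zero[of "x 0 - y 0"]
  by (simp del: norm_ge_zero)

lemma Metric_space_cadlag_paths:
  assumes T: "0 \<le> T"
  shows "Metric_space (cadlag_paths T :: (real \<Rightarrow> 'd::euclidean_space) set)
           (\<lambda>x x'. \<bar>sup_dist T x x'\<bar>)"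
proof
  fix x y :: "real \<Rightarrow> 'd"
  show "0 \<le> \<bar>sup_dist T x y\<bar>" by simp
  show "\<bar>sup_dist T x y\<bar> = \<bar>sup_dist T y x\<bar>"
    by (simp add: sup_dist_def norm_minus_commute)
next
  fix x y :: "real \<Rightarrow> 'd"
  assume x: "x \<in> cadlag_paths T" and y: "y \<in> cadlag_paths T"
  show "\<bar>sup_dist T x y\<bar> = 0 \<longleftrightarrow> x = y"
  proof
    assume "\<bar>sup_dist T x y\<bar> = 0"
    then have "x t = y t" if "t \<in> {0..T}" for t
      using norm_le_sup_dist[OF x y that] by simp
    moreover have "x \<in> extensional {0..T}" "y \<in> extensional {0..T}"
      using x y by (auto simp: cadlag_paths_def)
    ultimately show "x = y" by (intro extensionalityI) auto
  next
    assume "x = y"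
    then show "\<bar>sup_dist T x y\<bar> = 0" using T by (simp add: sup_dist_def)
  qed
next
  fix x y z :: "real \<Rightarrow> 'd"
  assume x: "x \<in> cadlag_paths T" and y: "y \<in> cadlag_paths T" and z: "z \<in> cadlag_paths T"
  have "sup_dist T x z \<le> sup_dist T x y + sup_dist T y z"
    unfolding sup_dist_def[of T x z]
  proof (rule cSUP_least)
    show "{0..T} \<noteq> {}" using T by simp
    fix t assume t: "t \<in> {0..T}"
    have "norm (x t - z t) \<le> norm (x t - y t) + norm (y t - z t)"
      using norm_triangle_ineq[of "x t - y t" "y t - z t"] by simp
    also have "\<dots> \<le> sup_dist T x y + sup_dist T y z"
      using norm_le_sup_dist[OF x y t] norm_le_sup_dist[OF y z t] by simp
    finally show "norm (x t - z t) \<le> sup_dist T x y + sup_dist T y z" .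
  qed
  then show "\<bar>sup_dist T x z\<bar> \<le> \<bar>sup_dist T x y\<bar> + \<bar>sup_dist T y z\<bar>"
    using sup_dist_nonneg[OF T x y] sup_dist_nonneg[OF T y z] sup_dist_nonneg[OF T x z] by simp
qed

definition sup_norm_upto :: "real \<Rightarrow> (real \<Rightarrow> 'd::euclidean_space) \<Rightarrow> real" where
  "sup_norm_upto t x = (SUP s\<in>{0..t}. norm (x s))"

definition stopped_dist ::
  "real \<Rightarrow> real \<times> (real \<Rightarrow> 'd::euclidean_space) \<Rightarrow> real \<times> (real \<Rightarrow> 'd) \<Rightarrow> real" where
  "stopped_dist T = (\<lambda>(t, x) (s, x'). \<bar>t - s\<bar> + (SUP r\<in>{0..T}. norm (x (min r t) - x' (min r s))))"

definition lsc_paths :: "real \<Rightarrow> (real \<Rightarrow> (real \<Rightarrow> 'd::euclidean_space) \<Rightarrow> real) \<Rightarrow> bool" where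
  "lsc_paths T u \<longleftrightarrow>
     (\<forall>t\<in>{0..T}. \<forall>x\<in>cadlag_paths T. \<forall>\<epsilon>>0. \<exists>\<delta>>0. \<forall>s\<in>{0..T}. \<forall>x'\<in>cadlag_paths T.
        stopped_dist T (t, x) (s, x') < \<delta> \<longrightarrow> u s x' > u t x - \<epsilon>)"

definition usc_paths :: "real \<Rightarrow> (real \<Rightarrow> (real \<Rightarrow> 'd::euclidean_space) \<Rightarrow> real) \<Rightarrow> bool" where
  "usc_paths T u \<longleftrightarrow>
     (\<forall>t\<in>{0..T}. \<forall>x\<in>cadlag_paths T. \<forall>\<epsilon>>0. \<exists>\<delta>>0. \<forall>s\<in>{0..T}. \<forall>x'\<in>cadlag_paths T.
        stopped_dist T (t, x) (s, x') < \<delta> \<longrightarrow> u s x' < u t x + \<epsilon>)"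

definition abs_continuous_on_Icc :: "real \<Rightarrow> real \<Rightarrow> (real \<Rightarrow> 'd::euclidean_space) \<Rightarrow> bool" where
  "abs_continuous_on_Icc s T x \<longleftrightarrow>
     (\<forall>\<epsilon>>0. \<exists>\<delta>>0. \<forall>(n::nat) a b.
        (\<forall>i<n. s \<le> a i \<and> a i \<le> b i \<and> b i \<le> T) \<longrightarrow>
        disjoint_family_on (\<lambda>i. {a i<..<b i}) {..<n} \<longrightarrow>
        (\<Sum>i<n. b i - a i) < \<delta> \<longrightarrow> (\<Sum>i<n. norm (x (b i) - x (a i))) < \<epsilon>)"


section \<open>The control problem\<close>

text \<open>
  Time integrals and null sets refer to the completed measure \<open>lebesgue\<close>: the data are continuous
  in the path and the control for almost every time only, so that, e.g., the Hamiltonian along a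
  path is Lebesgue but in general not Borel measurable in time.
\<close>

definition controls :: "real \<Rightarrow> 'p::polish_space set \<Rightarrow> (real \<Rightarrow> 'p) set" where
  "controls T A = measurable (restrict_space borel {0..T}) (restrict_space borel A)"

definition trajectory ::
  "real \<Rightarrow> (real \<Rightarrow> (real \<Rightarrow> 'd::euclidean_space) \<Rightarrow> 'p \<Rightarrow> 'd) \<Rightarrow>
   real \<Rightarrow> (real \<Rightarrow> 'd) \<Rightarrow> (real \<Rightarrow> 'p) \<Rightarrow> (real \<Rightarrow> 'd)" where
  "trajectory T f s x a =
     (THE \<phi>. \<phi> \<in> cadlag_paths T \<and> abs_continuous_on_Icc s T \<phi> \<and> (\<forall>t\<in>{0..s}. \<phi> t = x t) \<and>
        (AE t\<in>{s<..<T} in lebesgue. (\<phi> has_vector_derivative f t \<phi> (a t)) (at t)))"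

definition discount ::
  "real \<Rightarrow> (real \<Rightarrow> (real \<Rightarrow> 'd::euclidean_space) \<Rightarrow> 'p \<Rightarrow> 'd) \<Rightarrow>
   (real \<Rightarrow> (real \<Rightarrow> 'd) \<Rightarrow> 'p \<Rightarrow> real) \<Rightarrow> real \<Rightarrow> (real \<Rightarrow> 'd) \<Rightarrow> (real \<Rightarrow> 'p) \<Rightarrow> real \<Rightarrow> real" where
  "discount T f lam s x a t =
     exp (- (LINT r:{s..t}|lebesgue. lam r (trajectory T f s x a) (a r)))"

definition value_function ::
  "real \<Rightarrow> 'p::polish_space set \<Rightarrow> (real \<Rightarrow> (real \<Rightarrow> 'd::euclidean_space) \<Rightarrow> 'p \<Rightarrow> 'd) \<Rightarrow>
   (real \<Rightarrow> (real \<Rightarrow> 'd) \<Rightarrow> 'p \<Rightarrow> real) \<Rightarrow> (real \<Rightarrow> (real \<Rightarrow> 'd) \<Rightarrow> 'p \<Rightarrow> real) \<Rightarrow>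
   ((real \<Rightarrow> 'd) \<Rightarrow> real) \<Rightarrow> real \<Rightarrow> (real \<Rightarrow> 'd) \<Rightarrow> real" where
  "value_function T A f lam l h s x =
     (INF a\<in>controls T A.
        (LINT t:{s..T}|lebesgue. discount T f lam s x a t * l t (trajectory T f s x a) (a t)) +
        discount T f lam s x a T * h (trajectory T f s x a))"

definition hamiltonian ::
  "'p set \<Rightarrow> (real \<Rightarrow> (real \<Rightarrow> 'd::euclidean_space) \<Rightarrow> 'p \<Rightarrow> 'd) \<Rightarrow>
   (real \<Rightarrow> (real \<Rightarrow> 'd) \<Rightarrow> 'p \<Rightarrow> real) \<Rightarrow> (real \<Rightarrow> (real \<Rightarrow> 'd) \<Rightarrow> 'p \<Rightarrow> real) \<Rightarrow>
   real \<Rightarrow> (real \<Rightarrow> 'd) \<Rightarrow> real \<Rightarrow> 'd \<Rightarrow> real" where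
  "hamiltonian A f lam l t x y z = (INF a\<in>A. l t x a + f t x a \<bullet> z - lam t x a * y)"


section \<open>Minimax solutions\<close>

definition X_paths ::
  "real \<Rightarrow> real \<Rightarrow> real \<Rightarrow> (real \<Rightarrow> 'd::euclidean_space) \<Rightarrow> (real \<Rightarrow> 'd) set" where
  "X_paths T L s0 x0 =
     {x \<in> cadlag_paths T.
        (\<forall>t\<in>{0..s0}. x t = x0 t) \<and> abs_continuous_on_Icc s0 T x \<and>
        (AE t\<in>{s0<..<T} in lebesgue.
           x differentiable (at t) \<and>
           norm (vector_derivative x (at t)) \<le> L * (1 + sup_norm_upto t x))}"

text \<open>
  The integrability clause makes the integral equation meaningful, since the Bochner integral
  of a nonintegrable function is \<open>0\<close> by convention.
\<close>

definition Y_paths ::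
  "real \<Rightarrow> (real \<Rightarrow> (real \<Rightarrow> 'd::euclidean_space) \<Rightarrow> real \<Rightarrow> 'd \<Rightarrow> real) \<Rightarrow>
   real \<Rightarrow> real \<Rightarrow> (real \<Rightarrow> 'd) \<Rightarrow> real \<Rightarrow> 'd \<Rightarrow> ((real \<Rightarrow> 'd) \<times> (real \<Rightarrow> real)) set" where
  "Y_paths T H L s0 x0 y0 z =
     {(x, y). x \<in> X_paths T L s0 x0 \<and> continuous_on {s0..T} y \<and>
        set_integrable lebesgue {s0..T} (\<lambda>s. vector_derivative x (at s) \<bullet> z - H s x (y s) z) \<and>
        (\<forall>t\<in>{s0..T}.
           y t = y0 + (LINT s:{s0..t}|lebesgue. vector_derivative x (at s) \<bullet> z - H s x (y s) z))}"

definition minimax_supersolution ::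
  "real \<Rightarrow> (real \<Rightarrow> (real \<Rightarrow> 'd::euclidean_space) \<Rightarrow> real \<Rightarrow> 'd \<Rightarrow> real) \<Rightarrow>
   ((real \<Rightarrow> 'd) \<Rightarrow> real) \<Rightarrow> real \<Rightarrow> (real \<Rightarrow> (real \<Rightarrow> 'd) \<Rightarrow> real) \<Rightarrow> bool" where
  "minimax_supersolution T H h L u \<longleftrightarrow>
     lsc_paths T u \<and> (\<forall>x\<in>cadlag_paths T. u T x \<ge> h x) \<and>
     (\<forall>s0\<in>{0..<T}. \<forall>x0\<in>cadlag_paths T. \<forall>z. \<forall>y0 \<ge> u s0 x0.
        \<exists>(x, y)\<in>Y_paths T H L s0 x0 y0 z. \<forall>t\<in>{s0..T}. y t \<ge> u t x)"

definition minimax_subsolution ::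
  "real \<Rightarrow> (real \<Rightarrow> (real \<Rightarrow> 'd::euclidean_space) \<Rightarrow> real \<Rightarrow> 'd \<Rightarrow> real) \<Rightarrow>
   ((real \<Rightarrow> 'd) \<Rightarrow> real) \<Rightarrow> real \<Rightarrow> (real \<Rightarrow> (real \<Rightarrow> 'd) \<Rightarrow> real) \<Rightarrow> bool" where
  "minimax_subsolution T H h L u \<longleftrightarrow>
     usc_paths T u \<and> (\<forall>x\<in>cadlag_paths T. u T x \<le> h x) \<and>
     (\<forall>s0\<in>{0..<T}. \<forall>x0\<in>cadlag_paths T. \<forall>z. \<forall>y0 \<le> u s0 x0.
        \<exists>(x, y)\<in>Y_paths T H L s0 x0 y0 z. \<forall>t\<in>{s0..T}. y t \<le> u t x)"

definition minimax_solution ::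
  "real \<Rightarrow> (real \<Rightarrow> (real \<Rightarrow> 'd::euclidean_space) \<Rightarrow> real \<Rightarrow> 'd \<Rightarrow> real) \<Rightarrow>
   ((real \<Rightarrow> 'd) \<Rightarrow> real) \<Rightarrow> real \<Rightarrow> (real \<Rightarrow> (real \<Rightarrow> 'd) \<Rightarrow> real) \<Rightarrow> bool" where
  "minimax_solution T H h L u \<longleftrightarrow>
     minimax_supersolution T H h L u \<and> minimax_subsolution T H h L u"

end

theory Submission
  imports Defs "HOL-Complex_Analysis.Great_Picard"
begin

text \<open>
  Everything is expressed through increments along paths. If \<open>\<phi>\<close> is the trajectory of a control
  \<open>a\<close>, undoing the discount turns the payoff of \<open>a\<close> into the solution \<open>J\<close> of the linear backward
  equation \<open>J q - J p = integral {p..q} (lam J - l)\<close>, \<open>J T = h \<phi>\<close> (\<open>payoff_ode\<close>). For the value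
  function, dynamic programming gives the same relation as an inequality along every controlled
  trajectory, \<open>val q - val p \<ge> integral {p..q} (lam val - l)\<close>, with near equality for nearly
  optimal controls.

  That \<open>val\<close> is a minimax solution. Fix \<open>z\<close> and call
  \<open>(x q - x p) \<bullet> z - integral {p..q} (H r x (u r x) z)\<close> the drift of \<open>u\<close> along \<open>x\<close> on
  \<open>[p,q]\<close>. Let \<open>\<sigma> = 1\<close> stand for the subsolution and \<open>\<sigma> = -1\<close> for the supersolution
  property. If along some \<open>x\<close> in the path set the increments of \<open>\<sigma> u\<close> dominate \<open>\<sigma>\<close>
  times the drift, then the solution \<open>y\<close> of \<open>y' = x' \<bullet> z - H(t,x,y,z)\<close> stays on the required
  side of \<open>u\<close>, because \<open>H\<close> is Lipschitz in \<open>y\<close> (\<open>characteristic_exists\<close>). For \<open>val\<close> and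
  \<open>\<sigma> = -1\<close>, the trajectory of a nearly optimal control has this property up to a small error
  (\<open>val_super_approx\<close>). For \<open>\<sigma> = 1\<close>, one picks, on each cell of a fine mesh, a measurable
  control that almost attains the infimum in \<open>H\<close> for the path built so far and the value at the left
  end of the cell, and applies dynamic programming (\<open>val_sub_approx\<close>). The error is removed by
  compactness: a path belongs to the path set if and only if
  \<open>norm (x t - x r) \<le> L (1 + sup_norm_upto t x) (t - r)\<close> (\<open>X_paths_increment\<close>, \<open>X_pathsI\<close>); this
  condition survives uniform limits, so the path set is compact by the Arzela-Ascoli theorem, and
  the drift sees a path only through its increments and \<open>H\<close>, so it is continuous along uniform
  limits (\<open>charac_drift_limit\<close>).

  Uniqueness. Let \<open>u\<close> be a minimax solution; it is continuous, hence depends on the past of the path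
  only. The aim is to control \<open>\<sigma> (u - J)\<close> from above: for \<open>\<sigma> = 1\<close> with every control,
  for \<open>\<sigma> = -1\<close> with some control; taking the infimum over controls then yields \<open>u \<le> val\<close>
  and \<open>val \<le> u\<close>. Both follow from the inequality
  \<open>\<sigma> (u q \<phi> - u p \<phi>) \<ge> \<sigma> integral {p..q} (lam u - l) - \<eta>\<close> along a
  controlled trajectory \<open>\<phi>\<close>, since then \<open>\<sigma> (u - J)\<close> satisfies a linear inequality with
  rate \<open>lam \<ge> 0\<close> and vanishes at \<open>T\<close> (\<open>aiming_payoff\<close>). A minimax solution provides paths \<open>x\<close>
  along which \<open>u\<close> is controlled, but these are not trajectories. They are forced to stay close to
  \<open>\<phi>\<close> by extremal aiming: at each mesh point the characteristic is restarted in the direction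
  \<open>z = 2 \<sigma> (x - \<phi>) / \<epsilon>\<close>, for which the increment of \<open>u\<close> along \<open>x\<close> also pays for
  the growth of the penalty \<open>|x - \<phi>|^2 / \<epsilon>\<close> (\<open>aiming_cell\<close>). The data depend on the
  whole past, so the error of this step involves the largest past deviation \<open>D\<close> of \<open>x\<close> from \<open>\<phi>\<close>
  and is of size \<open>(2 Lf / \<epsilon>) D^2\<close> per unit of time. Running the scheme only over intervals
  of length \<open>h\<close> with \<open>Lf h \<le> 1/4\<close>, and starting it afresh from the trajectory itself on each of
  them, allows half of the penalty at the time of largest deviation to absorb this error. Hence
  \<open>D^2 / \<epsilon>\<close> is small, \<open>u\<close> may be transferred from \<open>x\<close> to \<open>\<phi>\<close> at cost \<open>\<eta> h\<close>
  (\<open>aiming_step\<close>), and the intervals add up (\<open>aiming_trajectory\<close>).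
\<close>

section \<open>Integrals on intervals, up to null sets\<close>

text \<open>
  The estimates on the data hold off a null set and inside an open interval only. The lemmas of this
  section absorb such a set \<open>N\<close> and the two end points once and for all.
\<close>

lemma ae_bounded_absolutely_integrable:
  fixes F :: "real \<Rightarrow> 'b::euclidean_space"
  assumes F: "F \<in> borel_measurable (lebesgue_on {a..b})" and N: "negligible N"
    and bnd: "\<And>t. t \<in> {a<..<b} - N \<Longrightarrow> norm (F t) \<le> B"
  shows "F absolutely_integrable_on {a..b}"
proof -
  let ?N = "N \<union> {a, b}"
  have neg: "negligible ?N" using N by auto
  let ?G = "\<lambda>t. if t \<in> ?N then 0 else F t"
  have "?N \<in> sets lebesgue" using neg negligible_imp_sets by blast
  then have "{a..b} \<inter> ?N \<in> sets (lebesgue_on {a..b})"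
    by (subst sets_restrict_space_iff) auto
  moreover have "{t \<in> space (lebesgue_on {a..b}). t \<in> ?N} = {a..b} \<inter> ?N" by auto
  ultimately have "{t \<in> space (lebesgue_on {a..b}). t \<in> ?N} \<in> sets (lebesgue_on {a..b})" by metis
  then have "?G \<in> borel_measurable (lebesgue_on {a..b})"
    by (intro measurable_If F) auto
  moreover have "norm (?G t) \<le> max B 0" if "t \<in> {a..b}" for t
    using that bnd[of t] by (cases "t \<in> ?N") (auto simp: le_max_iff_disj)
  ultimately have "?G absolutely_integrable_on {a..b}"
    by (intro measurable_bounded_by_integrable_imp_absolutely_integrable[where g="\<lambda>_. max B 0"]) auto
  then show ?thesis by (rule absolutely_integrable_spike[OF _ neg]) auto
qed

lemma integral_le_ae:
  fixes F G :: "real \<Rightarrow> real"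
  assumes "F integrable_on {a..b}" "G integrable_on {a..b}" and N: "negligible N"
    and le: "\<And>t. t \<in> {a<..<b} - N \<Longrightarrow> F t \<le> G t"
  shows "integral {a..b} F \<le> integral {a..b} G"
proof -
  let ?N = "N \<union> {a, b}"
  let ?F = "\<lambda>t. if t \<in> ?N then G t else F t"
  have neg: "negligible ?N" using N by auto
  have "?F integrable_on {a..b}"
    by (rule integrable_spike[OF assms(1) neg]) auto
  moreover have "integral {a..b} F = integral {a..b} ?F"
    by (rule integral_spike[OF neg]) auto
  moreover have "?F t \<le> G t" if "t \<in> {a..b}" for t using that le[of t] by auto
  ultimately show ?thesis using integral_le[OF _ assms(2), of ?F] by presburger
qed

lemma integral_eq_ae:
  fixes F G :: "real \<Rightarrow> 'b::real_normed_vector"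
  assumes N: "negligible N" and "\<And>t. t \<in> {a<..<b} - N \<Longrightarrow> F t = G t"
  shows "integral {a..b} F = integral {a..b} G"
  by (rule integral_spike[of "N \<union> {a, b}"]) (use assms in auto)

lemma norm_integral_le_ae:
  fixes F :: "real \<Rightarrow> 'b::euclidean_space"
  assumes "F integrable_on {a..b}" "G integrable_on {a..b}" and N: "negligible N"
    and le: "\<And>t. t \<in> {a<..<b} - N \<Longrightarrow> norm (F t) \<le> G t"
  shows "norm (integral {a..b} F) \<le> integral {a..b} G"
proof -
  let ?N = "N \<union> {a, b}"
  let ?F = "\<lambda>t. if t \<in> ?N then 0 else F t"
  let ?G = "\<lambda>t. if t \<in> ?N then 0 else G t"
  have neg: "negligible ?N" using N by auto
  have "?F integrable_on {a..b}" "?G integrable_on {a..b}"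
    by (rule integrable_spike[OF assms(1) neg], simp) (rule integrable_spike[OF assms(2) neg], simp)
  moreover have "integral {a..b} F = integral {a..b} ?F" "integral {a..b} G = integral {a..b} ?G"
    by (rule integral_spike[OF neg], simp)+
  moreover have "norm (?F t) \<le> ?G t" if "t \<in> {a..b}" for t using that le[of t] by auto
  ultimately show ?thesis
    using Henstock_Kurzweil_Integration.integral_norm_bound_integral[of ?F "{a..b}" ?G] by presburger
qed

lemma norm_integral_le_const_ae:
  fixes F :: "real \<Rightarrow> 'b::euclidean_space"
  assumes "F integrable_on {a..b}" "negligible N" "a \<le> b"
    and "\<And>t. t \<in> {a<..<b} - N \<Longrightarrow> norm (F t) \<le> B"
  shows "norm (integral {a..b} F) \<le> B * (b - a)"
  using norm_integral_le_ae[OF assms(1) _ assms(2), of "\<lambda>_. B"] assms(3,4) by (auto simp: mult.commute)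

lemma integral_diff_shift:
  fixes g k :: "real \<Rightarrow> real"
  assumes "g integrable_on {p..q}" "k integrable_on {p..q}" "p \<le> q"
  shows "integral {p..q} (\<lambda>r. g r - (k r + c)) = integral {p..q} g - integral {p..q} k - c * (q - p)"
proof -
  have "((\<lambda>r. g r - (k r + c)) has_integral (integral {p..q} g - (integral {p..q} k + c * (q - p)))) {p..q}"
    using assms has_integral_const_real[of c p q]
    by (intro has_integral_diff has_integral_add integrable_integral) (auto simp: mult.commute)
  then show ?thesis by (simp add: integral_unique)
qed

section \<open>Absolutely continuous and Lipschitz functions\<close>

text \<open>
  Lebesgue's differentiation theorem in the form of \<open>integrable_ccontinuous_explicit\<close> yields right
  derivatives; the left ones come from the reflected integrand.
\<close>

lemma indefinite_integral_ae_derivative: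
  fixes F :: "real \<Rightarrow> 'b::euclidean_space"
  assumes F: "F integrable_on {a..b}"
  obtains N where "negligible N"
    "\<And>t. t \<in> {a<..<b} - N \<Longrightarrow> ((\<lambda>u. integral {a..u} F) has_vector_derivative F t) (at t)"
proof -
  define G where "G = (\<lambda>t. if t \<in> {a..b} then F t else 0)"
  have "G integrable_on UNIV"
    unfolding G_def using F by (simp only: integrable_restrict_UNIV)
  then have G: "G integrable_on cbox c d" for c d by (rule integrable_on_subcbox) auto
  obtain N1 where N1: "negligible N1" and right: "\<And>x e. \<lbrakk>x \<notin> N1; 0 < e\<rbrakk> \<Longrightarrow>
      \<exists>d>0. \<forall>h. 0 < h \<and> h < d \<longrightarrow> norm (integral (cbox x (x + h)) G /\<^sub>R h - G x) < e"
    using integrable_ccontinuous_explicit[of G, OF G] by (auto simp: real_scaleR_def)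
  define G' where "G' = (\<lambda>t. G (- t))"
  have G': "G' integrable_on cbox c d" for c d
    using G[of "-d" "-c"] Henstock_Kurzweil_Integration.integrable_reflect_real[where f=G and a="-d" and b="-c"] unfolding G'_def by simp
  obtain N2 where N2: "negligible N2" and left: "\<And>x e. \<lbrakk>x \<notin> N2; 0 < e\<rbrakk> \<Longrightarrow>
      \<exists>d>0. \<forall>h. 0 < h \<and> h < d \<longrightarrow> norm (integral (cbox x (x + h)) G' /\<^sub>R h - G' x) < e"
    using integrable_ccontinuous_explicit[of G', OF G'] by (auto simp: real_scaleR_def)
  have "negligible (uminus ` N2)"
  proof (rule negligible_locally_Lipschitz_image[OF _ N2])
    fix x :: real
    show "\<exists>U B. open U \<and> x \<in> U \<and> (\<forall>y\<in>N2 \<inter> U. norm (- y - - x) \<le> B * norm (y - x))"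
      by (intro exI[of _ UNIV] exI[of _ 1]) (auto simp: abs_minus_commute)
  qed simp
  then have neg: "negligible (N1 \<union> uminus ` N2)" using N1 by (rule negligible_Un[rotated])
  show thesis
  proof (rule that[OF neg])
    fix t assume t: "t \<in> {a<..<b} - (N1 \<union> uminus ` N2)"
    then have t1: "t \<notin> N1" and t2: "- t \<notin> N2" and ab: "a < t" "t < b"
      by (auto simp: image_iff)
    have Gt: "G t = F t" using ab by (simp add: G_def)
    have intG: "integral {u..v} F = integral {u..v} G" if "a \<le> u" "v \<le> b" for u v
      by (rule integral_cong) (use that in \<open>auto simp: G_def\<close>)
    have diff: "integral {a..v} F - integral {a..u} F = integral {u..v} F"
      if "a \<le> u" "u \<le> v" "v \<le> b" for u v
      using Henstock_Kurzweil_Integration.integral_combine[of a u v F] that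
        integrable_on_subinterval[OF F, of a v] by (auto simp: algebra_simps)
    show "((\<lambda>u. integral {a..u} F) has_vector_derivative F t) (at t)"
      unfolding has_vector_derivative_def has_derivative_within_alt
    proof (intro conjI allI impI)
      show "bounded_linear (\<lambda>x. x *\<^sub>R F t)" by (rule bounded_linear_scaleR_left)
      fix e :: real assume e: "0 < e"
      obtain d1 where d1: "d1 > 0" "\<And>h. 0 < h \<Longrightarrow> h < d1 \<Longrightarrow>
          norm (integral (cbox t (t + h)) G /\<^sub>R h - G t) < e"
        using right[OF t1 e] by blast
      obtain d2 where d2: "d2 > 0" "\<And>h. 0 < h \<Longrightarrow> h < d2 \<Longrightarrow>
          norm (integral (cbox (-t) (-t + h)) G' /\<^sub>R h - G' (-t)) < e"
        using left[OF t2 e] by blast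
      have scale: "norm (I - h *\<^sub>R c) \<le> e * h" if "0 < h" "norm (I /\<^sub>R h - c) < e" for I c :: 'b and h
      proof -
        have "I - h *\<^sub>R c = h *\<^sub>R (I /\<^sub>R h - c)" using that by (simp add: algebra_simps)
        then have "norm (I - h *\<^sub>R c) = h * norm (I /\<^sub>R h - c)" using that by simp
        then show ?thesis using that by (simp add: mult.commute)
      qed
      show "\<exists>d>0. \<forall>y\<in>UNIV. norm (y - t) < d \<longrightarrow>
          norm (integral {a..y} F - integral {a..t} F - (y - t) *\<^sub>R F t) \<le> e * norm (y - t)"
      proof (intro exI[of _ "min (min d1 d2) (min (t - a) (b - t))"] conjI ballI impI)
        show "0 < min (min d1 d2) (min (t - a) (b - t))" using d1 d2 ab by simp
        fix y assume y: "norm (y - t) < min (min d1 d2) (min (t - a) (b - t))"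
        consider "y = t" | "t < y" | "y < t" by linarith
        then show "norm (integral {a..y} F - integral {a..t} F - (y - t) *\<^sub>R F t) \<le> e * norm (y - t)"
        proof cases
          case 2
          with y have "norm (integral {t..y} G - (y - t) *\<^sub>R G t) \<le> e * (y - t)"
            using d1(2)[of "y - t"] by (intro scale) auto
          then show ?thesis using 2 y ab diff[of t y] intG[of t y] Gt by auto
        next
          case 3
          have "integral {-t..-y} G' = integral {y..t} G"
            unfolding G'_def using integral_reflect_real[of "-t" "-y" G] by simp
          with 3 y have "norm (integral {y..t} G - (t - y) *\<^sub>R G t) \<le> e * (t - y)"
            using d2(2)[of "t - y"] by (intro scale) (auto simp: G'_def)
          moreover have "integral {a..y} F - integral {a..t} F - (y - t) *\<^sub>R F t
              = - (integral {y..t} G - (t - y) *\<^sub>R G t)"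
            using 3 y ab diff[of y t] intG[of y t] Gt by (auto simp: algebra_simps)
          ultimately show ?thesis using 3 by (metis norm_minus_cancel abs_minus_commute abs_of_nonneg diff_ge_0_iff_ge less_imp_le real_norm_def)
        qed simp
      qed
    qed
  qed
qed

text \<open>
  The fundamental theorem of calculus for absolutely continuous functions, by Riemann sums on a
  tagged division. At a tag where \<open>x\<close> is differentiable the gauge makes the increment of \<open>x\<close> close
  to the derivative times the length. The other tags form a null set; the gauge puts their intervals
  into an open set of small measure, where absolute continuity makes the sum of the increments
  small.
\<close>

lemma abs_continuous_has_integral_derivative:
  fixes x :: "real \<Rightarrow> 'b::euclidean_space"
  assumes "a \<le> b" and ac: "abs_continuous_on_Icc a b x" and N: "negligible N"
    and deriv: "\<And>t. t \<in> {a<..<b} - N \<Longrightarrow> (x has_vector_derivative x' t) (at t)"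
  shows "(x' has_integral (x b - x a)) {a..b}"
proof -
  define N' where "N' = N \<union> {a, b}"
  have neg: "negligible N'" using N by (auto simp: N'_def)
  define g where "g = (\<lambda>t. if t \<in> N' then 0 else x' t)"
  have "(g has_integral (x b - x a)) {a..b}"
    unfolding has_integral_real
  proof (intro allI impI)
    fix e :: real assume e: "0 < e"
    \<comment> \<open>half of \<open>e\<close> for the differentiable tags and half for the exceptional ones\<close>
    define e1 where "e1 = e / (2 * (b - a + 1))"
    have e1: "e1 > 0" and e1': "e1 * (b - a) < e / 2"
      using e \<open>a \<le> b\<close> by (auto simp: e1_def field_simps)
    obtain \<delta> where \<delta>: "\<delta> > 0" and acD: "\<And>(n::nat) u v.
        (\<forall>i<n. a \<le> u i \<and> u i \<le> v i \<and> v i \<le> b) \<Longrightarrow>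
        disjoint_family_on (\<lambda>i. {u i<..<v i}) {..<n} \<Longrightarrow>
        (\<Sum>i<n. v i - u i) < \<delta> \<Longrightarrow> (\<Sum>i<n. norm (x (v i) - x (u i))) < e / 2"
      using ac[unfolded abs_continuous_on_Icc_def, rule_format, of "e / 2"] e by auto
    obtain U where U: "open U" "N' \<subseteq> U" "emeasure lebesgue (U - N') < ennreal \<delta>"
      using sets_lebesgue_outer_open[OF negligible_imp_sets[OF neg] \<delta>] by metis
    have "emeasure lebesgue U \<le> emeasure lebesgue (U - N') + emeasure lebesgue N'"
      using U neg by (intro order_trans[OF emeasure_mono emeasure_subadditive])
        (auto simp: negligible_imp_sets borel_open intro!: sets.Diff)
    also have "emeasure lebesgue N' = 0"
      using neg unfolding negligible_iff_null_sets by (rule null_setsD1)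
    finally have mU: "emeasure lborel U < ennreal \<delta>"
      using U by simp
    have "\<exists>d>0. (t \<in> N' \<longrightarrow> ball t d \<subseteq> U) \<and> (t \<in> {a..b} - N' \<longrightarrow>
            (\<forall>y. norm (y - t) < d \<longrightarrow> norm (x y - x t - (y - t) *\<^sub>R g t) \<le> e1 * norm (y - t)))" for t
    proof (cases "t \<in> N'")
      case True
      then show ?thesis using U open_contains_ball by (metis DiffD2 subsetD)
    next
      case False
      show ?thesis
      proof (cases "t \<in> {a..b}")
        case True
        with False have "t \<in> {a<..<b} - N" by (auto simp: N'_def)
        from deriv[OF this] have "\<exists>d>0. \<forall>y. norm (y - t) < d \<longrightarrow>
              norm (x y - x t - (y - t) *\<^sub>R x' t) \<le> e1 * norm (y - t)"
          unfolding has_vector_derivative_def has_derivative_within_alt using e1 by auto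
        then show ?thesis using False by (auto simp: g_def)
      next
        case False' : False
        then show ?thesis using False by (intro exI[of _ 1]) auto
      qed
    qed
    then obtain d where d: "\<And>t. d t > 0" "\<And>t. t \<in> N' \<Longrightarrow> ball t (d t) \<subseteq> U"
      "\<And>t y. t \<in> {a..b} - N' \<Longrightarrow> norm (y - t) < d t \<Longrightarrow>
          norm (x y - x t - (y - t) *\<^sub>R g t) \<le> e1 * norm (y - t)"
      by metis
    show "\<exists>\<gamma>. gauge \<gamma> \<and> (\<forall>p. p tagged_division_of {a..b} \<and> \<gamma> fine p \<longrightarrow>
        norm ((\<Sum>(t, K)\<in>p. Henstock_Kurzweil_Integration.content K *\<^sub>R g t) - (x b - x a)) < e)"
    proof (intro exI[of _ "\<lambda>t. ball t (d t)"] conjI allI impI)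
      show "gauge (\<lambda>t. ball t (d t))" using d(1) gauge_ball_dependent by blast
      fix p assume p: "p tagged_division_of {a..b} \<and> (\<lambda>t. ball t (d t)) fine p"
      then have ptag: "p tagged_division_of {a..b}" and fine: "(\<lambda>t. ball t (d t)) fine p" by auto
      have finp: "finite p" using ptag by blast
      have K: "\<exists>u v. K = {u..v} \<and> u \<le> t \<and> t \<le> v \<and> a \<le> u \<and> v \<le> b \<and> K \<subseteq> ball t (d t)
             \<and> Inf K = u \<and> Sup K = v \<and> Henstock_Kurzweil_Integration.content K = v - u" if "(t, K) \<in> p" for t K
      proof -
        have "t \<in> K" "K \<subseteq> {a..b}" "\<exists>u v. K = cbox u v" "K \<subseteq> ball t (d t)"
          using tagged_division_ofD(2-4)[OF ptag that] fine that unfolding fine_def by auto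
        then obtain u v where uv: "K = {u..v}" by auto
        with \<open>t \<in> K\<close> have "u \<le> t" "t \<le> v" by auto
        then show ?thesis using uv \<open>K \<subseteq> {a..b}\<close> \<open>K \<subseteq> ball t (d t)\<close>
          by (intro exI[of _ u] exI[of _ v]) (auto simp: atLeastatMost_subset_iff)
      qed
      \<comment> \<open>discrepancy between the Riemann sum and the increment of \<open>x\<close> on one interval of the division\<close>
      define T1 where "T1 = (\<lambda>(t::real, K::real set). Henstock_Kurzweil_Integration.content K *\<^sub>R g t - (x (Sup K) - x (Inf K)))"
      define p1 where "p1 = {q \<in> p. fst q \<in> N'}"
      have "(\<Sum>(t, K)\<in>p. Henstock_Kurzweil_Integration.content K *\<^sub>R g t) - (x b - x a) = (\<Sum>q\<in>p. T1 q)"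
        unfolding T1_def additive_tagged_division_1[OF \<open>a \<le> b\<close> ptag, of x, symmetric]
        by (simp add: sum_subtractf case_prod_unfold)
      also have "\<dots> = (\<Sum>q\<in>p1. T1 q) + (\<Sum>q\<in>p - p1. T1 q)"
        using finp by (subst sum.subset_diff[of p1 p]) (auto simp: p1_def)
      finally have eq: "(\<Sum>(t, K)\<in>p. Henstock_Kurzweil_Integration.content K *\<^sub>R g t) - (x b - x a) = \<dots>" .
      have "norm (\<Sum>q\<in>p - p1. T1 q) \<le> (\<Sum>q\<in>p - p1. e1 * Henstock_Kurzweil_Integration.content (snd q))"
      proof (rule sum_norm_le)
        fix q assume q: "q \<in> p - p1"
        obtain t K' where tK: "q = (t, K')" by (cases q)
        obtain u v where uv: "K' = {u..v}" "u \<le> t" "t \<le> v" "a \<le> u" "v \<le> b" "K' \<subseteq> ball t (d t)"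
           "Inf K' = u" "Sup K' = v" "Henstock_Kurzweil_Integration.content K' = v - u"
          using K[of t K'] q tK by blast
        have "u \<in> K'" "v \<in> K'" using uv by auto
        then have "u \<in> ball t (d t)" "v \<in> ball t (d t)" using uv(6) by blast+
        then have n: "norm (u - t) < d t" "norm (v - t) < d t" by (auto simp: dist_norm norm_minus_commute)
        have t: "t \<in> {a..b} - N'" using q tK uv by (auto simp: p1_def)
        have "T1 q = (x u - x t - (u - t) *\<^sub>R g t) - (x v - x t - (v - t) *\<^sub>R g t)"
          using uv tK by (simp add: T1_def algebra_simps)
        also have "norm \<dots> \<le> norm (x u - x t - (u - t) *\<^sub>R g t) + norm (x v - x t - (v - t) *\<^sub>R g t)"
          by (rule norm_triangle_ineq4)
        also have "\<dots> \<le> e1 * norm (u - t) + e1 * norm (v - t)"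
          using d(3)[OF t n(1)] d(3)[OF t n(2)] by linarith
        also have "\<dots> = e1 * Henstock_Kurzweil_Integration.content (snd q)" using uv tK by (simp add: algebra_simps)
        finally show "norm (T1 q) \<le> e1 * Henstock_Kurzweil_Integration.content (snd q)" .
      qed
      also have "\<dots> \<le> (\<Sum>q\<in>p. e1 * Henstock_Kurzweil_Integration.content (snd q))"
        using finp e1 by (intro sum_mono2) auto
      also have "\<dots> = e1 * (b - a)"
        using additive_content_tagged_division[of p a b] ptag \<open>a \<le> b\<close>
        by (simp add: sum_distrib_left[symmetric] case_prod_unfold)
      finally have A: "norm (\<Sum>q\<in>p - p1. T1 q) < e / 2" using e1' by linarith
      have finp1: "finite p1" using finp by (simp add: p1_def)
      obtain f where f: "bij_betw f {0..<card p1} p1" using ex_bij_betw_nat_finite[OF finp1] by blast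
      define n where "n = card p1"
      have f: "bij_betw f {..<n} p1" using f by (simp add: n_def atLeast0LessThan)
      define u where "u = (\<lambda>i. Inf (snd (f i)))"
      define v where "v = (\<lambda>i. Sup (snd (f i)))"
      have fi: "f i \<in> p" "fst (f i) \<in> N'" if "i < n" for i
        using f that by (auto simp: bij_betw_def p1_def)
      have uv: "snd (f i) = {u i..v i}" "a \<le> u i" "u i \<le> v i" "v i \<le> b" "{u i..v i} \<subseteq> U"
        if "i < n" for i
      proof -
        have *: "(fst (f i), snd (f i)) \<in> p" using fi[OF that] by simp
        from K[OF *] d(2)[OF fi(2)[OF that]]
        show "snd (f i) = {u i..v i}" "a \<le> u i" "u i \<le> v i" "v i \<le> b" "{u i..v i} \<subseteq> U"
          unfolding u_def v_def by (metis, metis, fastforce, metis, metis subset_trans)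
      qed
      have disj: "disjoint_family_on (\<lambda>i. {u i<..<v i}) {..<n}"
        unfolding disjoint_family_on_def
      proof (intro ballI impI)
        fix i j assume ij: "i \<in> {..<n}" "j \<in> {..<n}" "i \<noteq> j"
        then have "f i \<noteq> f j" using f by (auto simp: bij_betw_def inj_on_def)
        then have "interior (snd (f i)) \<inter> interior (snd (f j)) = {}"
          using tagged_division_ofD(5)[OF ptag, of "fst (f i)" "snd (f i)" "fst (f j)" "snd (f j)"]
            fi[of i] fi[of j] ij by simp
        then show "{u i<..<v i} \<inter> {u j<..<v j} = {}" using uv[of i] uv[of j] ij by simp
      qed
      have "(\<Sum>i<n. ennreal (v i - u i)) = (\<Sum>i<n. emeasure lborel {u i<..<v i})"
        using uv by (intro sum.cong) auto
      also have "\<dots> = emeasure lborel (\<Union>i<n. {u i<..<v i})"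
        using disj by (intro sum_emeasure) auto
      also have "\<dots> \<le> emeasure lborel U"
        using U uv(5) by (intro emeasure_mono) (auto simp: subset_iff)
      finally have "(\<Sum>i<n. ennreal (v i - u i)) < ennreal \<delta>" using mU by simp
      moreover have "(\<Sum>i<n. ennreal (v i - u i)) = ennreal (\<Sum>i<n. v i - u i)"
        using uv(3) by (intro sum_ennreal) auto
      moreover have "0 \<le> (\<Sum>i<n. v i - u i)" using uv(3) by (intro sum_nonneg) auto
      ultimately have "(\<Sum>i<n. v i - u i) < \<delta>" by (simp add: ennreal_less_iff)
      then have "(\<Sum>i<n. norm (x (v i) - x (u i))) < e / 2"
        using uv disj by (intro acD) auto
      moreover have "(\<Sum>q\<in>p1. norm (T1 q)) = (\<Sum>i<n. norm (T1 (f i)))"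
        using sum.reindex_bij_betw[OF f, of "\<lambda>q. norm (T1 q)"] by simp
      moreover have "norm (T1 (f i)) = norm (x (v i) - x (u i))" if "i < n" for i
        using fi[OF that] by (simp add: T1_def case_prod_unfold g_def u_def v_def norm_minus_commute)
      ultimately have "(\<Sum>q\<in>p1. norm (T1 q)) < e / 2" by simp
      then have "norm (\<Sum>q\<in>p1. T1 q) < e / 2" using norm_sum[of T1 p1] by linarith
      with A eq show "norm ((\<Sum>(t, K)\<in>p. Henstock_Kurzweil_Integration.content K *\<^sub>R g t) - (x b - x a)) < e"
        using norm_triangle_ineq[of "\<Sum>q\<in>p1. T1 q" "\<Sum>q\<in>p - p1. T1 q"] by simp
    qed
  qed
  then show ?thesis
    by (rule has_integral_spike[OF neg, rotated]) (auto simp: g_def)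
qed

lemma lipschitz_abs_continuous:
  fixes x :: "real \<Rightarrow> 'b::euclidean_space"
  assumes C: "0 \<le> C" and lip: "\<And>r t. a \<le> r \<Longrightarrow> r \<le> t \<Longrightarrow> t \<le> b \<Longrightarrow> norm (x t - x r) \<le> C * (t - r)"
  shows "abs_continuous_on_Icc a b x"
  unfolding abs_continuous_on_Icc_def
proof (intro allI impI)
  fix e :: real assume e: "0 < e"
  show "\<exists>\<delta>>0. \<forall>(n::nat) u v. (\<forall>i<n. a \<le> u i \<and> u i \<le> v i \<and> v i \<le> b) \<longrightarrow>
        disjoint_family_on (\<lambda>i. {u i<..<v i}) {..<n} \<longrightarrow>
        (\<Sum>i<n. v i - u i) < \<delta> \<longrightarrow> (\<Sum>i<n. norm (x (v i) - x (u i))) < e"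
  proof (intro exI[of _ "e / (C + 1)"] conjI allI impI)
    show "0 < e / (C + 1)" using e C by simp
    fix n :: nat and u v
    assume uv: "\<forall>i<n. a \<le> u i \<and> u i \<le> v i \<and> v i \<le> b" and s: "(\<Sum>i<n. v i - u i) < e / (C + 1)"
    have "(\<Sum>i<n. norm (x (v i) - x (u i))) \<le> (\<Sum>i<n. C * (v i - u i))"
      using uv by (intro sum_mono lip) auto
    also have "\<dots> = C * (\<Sum>i<n. v i - u i)" by (simp add: sum_distrib_left)
    also have "\<dots> \<le> C * (e / (C + 1))" using s C by (intro mult_left_mono) auto
    also have "\<dots> < e" using e C by (simp add: field_simps)
    finally show "(\<Sum>i<n. norm (x (v i) - x (u i))) < e" .
  qed
qed

text \<open>
  Adding \<open>(C + 1) t\<close> makes a Lipschitz function strictly increasing and bi-Lipschitz. The Stieltjes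
  measure of the result is the image of Lebesgue measure under its inverse; it is absolutely
  continuous, because Lipschitz maps send null sets to null sets, and its Radon-Nikodym density has
  the function as an indefinite integral.
\<close>

lemma lipschitz_real_ae_differentiable:
  fixes F :: "real \<Rightarrow> real"
  assumes lip: "\<And>r t. r \<le> t \<Longrightarrow> \<bar>F t - F r\<bar> \<le> C * (t - r)"
  obtains N where "negligible N" "\<And>t. t \<in> {a<..<b} - N \<Longrightarrow> F differentiable (at t)"
proof (cases "a < b")
  case False
  then show ?thesis by (intro that[of "{}"]) auto
next
  case ab: True
  define G where "G = (\<lambda>t. F t + (C + 1) * t)"
  have G: "t - r \<le> G t - G r" "G t - G r \<le> (2 * C + 1) * (t - r)" if "r \<le> t" for r t
    using lip[OF that] by (auto simp: G_def algebra_simps abs_le_iff)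
  have mono: "strict_mono G"
  proof (rule strict_monoI)
    fix r t :: real assume "r < t"
    then show "G r < G t" using G(1)[of r t] by simp
  qed
  have C: "0 \<le> C" using lip[of 0 1] by simp
  have Glip: "norm (G t - G r) \<le> (2 * C + 1) * norm (t - r)" for r t
  proof (cases "r \<le> t")
    case True
    then show ?thesis using G[of r t] by simp
  next
    case False
    then show ?thesis using G[of t r] by (simp add: algebra_simps)
  qed
  have contG: "continuous_on UNIV G"
    using Glip by (intro lipschitz_on_continuous_on[of "2 * C + 1"] lipschitz_onI) (auto simp: dist_norm C)
  have "surj G"
  proof -
    have "\<exists>t. G t = y" for y
    proof -
      let ?r = "- \<bar>y - G 0\<bar>" let ?t = "\<bar>y - G 0\<bar>"
      have "G ?r \<le> y" "y \<le> G ?t" using G(1)[of ?r 0] G(1)[of 0 ?t] by auto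
      then show ?thesis using IVT'[of G ?r y ?t] contG continuous_on_subset by (metis abs_ge_zero le_minus_iff minus_zero order_trans subset_UNIV neg_le_0_iff_le)
    qed
    then show ?thesis by (metis surj_def)
  qed
  then have bij: "bij G" using mono strict_mono_imp_inj_on by (auto simp: bij_def)
  define Gi where "Gi = inv G"
  have GGi: "G (Gi y) = y" and GiG: "Gi (G t) = t" for y t
    using bij by (auto simp: Gi_def bij_is_surj surj_f_inv_f bij_is_inj)
  have "mono Gi"
  proof (rule monoI)
    fix u v :: real assume "u \<le> v"
    then show "Gi u \<le> Gi v" using strict_mono_less_eq[OF mono, of "Gi u" "Gi v"] GGi by simp
  qed
  then have Gim: "Gi \<in> borel_measurable borel" by (rule borel_measurable_mono)
  define \<nu> where "\<nu> = distr lborel borel Gi"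
  have vim: "Gi -` A = G ` A" for A using GGi GiG by (auto simp: image_iff) (metis)
  have "absolutely_continuous lborel \<nu>"
    unfolding absolutely_continuous_def
  proof
    fix A :: "real set" assume A: "A \<in> null_sets lborel"
    then have "negligible A" by (simp add: negligible_iff_null_sets null_sets_completionI)
    then have "negligible (G ` A)"
      by (rule negligible_locally_Lipschitz_image[rotated]) (use Glip in \<open>auto intro!: exI[of _ UNIV]\<close>)
    then have "emeasure lebesgue (Gi -` A) = 0"
      unfolding vim negligible_iff_null_sets by (rule null_setsD1)
    moreover have "Gi -` A \<in> sets borel" using measurable_sets[OF Gim, of A] A by auto
    ultimately have "emeasure lborel (Gi -` A) = 0" by simp
    then show "A \<in> null_sets \<nu>" using A Gim by (auto simp: null_sets_def \<nu>_def emeasure_distr)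
  qed
  then obtain f where fm: "f \<in> borel_measurable lborel" and f: "density lborel f = \<nu>"
    using sigma_finite_measure.Radon_Nikodym[OF sigma_finite_lborel, of \<nu>] by (auto simp: \<nu>_def)
  have em: "(\<integral>\<^sup>+x. f x * indicator {s..t} x \<partial>lborel) = ennreal (G t - G s)" if "s \<le> t" for s t
  proof -
    have "G ` {s..t} = {G s..G t}"
    proof (intro equalityI subsetI)
      fix y assume "y \<in> G ` {s..t}"
      then show "y \<in> {G s..G t}" using strict_mono_less_eq[OF mono] by auto
    next
      fix y assume "y \<in> {G s..G t}"
      then have "s \<le> Gi y" "Gi y \<le> t"
        using strict_mono_less_eq[OF mono, of s "Gi y"] strict_mono_less_eq[OF mono, of "Gi y" t] GGi by auto
      then show "y \<in> G ` {s..t}" using GGi by (intro image_eqI[of _ _ "Gi y"]) auto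
    qed
    then have "emeasure \<nu> {s..t} = ennreal (G t - G s)"
      using Gim vim strict_mono_less_eq[OF mono, of s t] that by (simp add: \<nu>_def emeasure_distr)
    then show ?thesis using fm by (simp add: f[symmetric] emeasure_density)
  qed
  have fin: "AE x in lborel. f x * indicator {a..b} x \<noteq> \<infinity>"
    using em[of a b] ab fm by (intro nn_integral_noteq_infinite) auto
  define g where "g = (\<lambda>x. enn2real (f x * indicator {a..b} x))"
  have hi: "(g has_integral (G t - G s)) {s..t}" if "a \<le> s" "s \<le> t" "t \<le> b" for s t
  proof -
    have "((\<lambda>x. g x * indicator {s..t} x) has_integral (G t - G s)) UNIV"
    proof (rule nn_integral_has_integral)
      show "(\<lambda>x. g x * indicator {s..t} x) \<in> borel_measurable borel"
        using fm unfolding g_def by measurable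
      show "0 \<le> g x * indicator {s..t} x" for x by (simp add: g_def)
      have "(\<integral>\<^sup>+x. ennreal (g x * indicator {s..t} x) \<partial>lborel) = (\<integral>\<^sup>+x. f x * indicator {s..t} x \<partial>lborel)"
      proof (rule nn_integral_cong_AE)
        show "AE x in lborel. ennreal (g x * indicator {s..t} x) = f x * indicator {s..t} x"
          using fin
        proof eventually_elim
          case (elim x)
          then show ?case using that by (cases "x \<in> {s..t}") (auto simp: g_def top.not_eq_extremum)
        qed
      qed
      then show "(\<integral>\<^sup>+x. ennreal (g x * indicator {s..t} x) \<partial>lborel) = ennreal (G t - G s)"
        using em that by simp
      show "0 \<le> G t - G s" using G(1)[of s t] that by simp
    qed
    then have "((\<lambda>x. if x \<in> {s..t} then g x else 0) has_integral (G t - G s)) UNIV"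
      by (rule has_integral_eq[rotated]) (auto simp: indicator_def)
    then show ?thesis by (simp only: has_integral_restrict_UNIV)
  qed
  have "g integrable_on {a..b}" using hi[of a b] ab by (auto simp: integrable_on_def)
  then obtain N where N: "negligible N" and der: "\<And>t. t \<in> {a<..<b} - N \<Longrightarrow>
      ((\<lambda>u. integral {a..u} g) has_vector_derivative g t) (at t)"
    using indefinite_integral_ae_derivative by blast
  show thesis
  proof (rule that[OF N])
    fix t assume t: "t \<in> {a<..<b} - N"
    have "(\<lambda>u. G a + integral {a..u} g - (C + 1) * u) differentiable (at t)"
      using der[OF t] by (intro derivative_intros) (auto simp: differentiable_def has_vector_derivative_def)
    then obtain D where D: "((\<lambda>u. G a + integral {a..u} g - (C + 1) * u) has_derivative D) (at t)"
      by (auto simp: differentiable_def)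
    have "(F has_derivative D) (at t)"
    proof (rule has_derivative_transform_within_open[OF D, of "{a<..<b}"])
      fix u assume "u \<in> {a<..<b}"
      then show "G a + integral {a..u} g - (C + 1) * u = F u"
        using integral_unique[OF hi[of a u]] by (simp add: G_def)
    qed (use t in auto)
    then show "F differentiable (at t)" by (auto simp: differentiable_def)
  qed
qed

text \<open>
  The coordinates are extended to the line by constants, through the clamp \<open>c\<close>, so that the
  one-dimensional result applies.
\<close>

lemma lipschitz_ae_differentiable:
  fixes x :: "real \<Rightarrow> 'b::euclidean_space"
  assumes lip: "\<And>r t. a \<le> r \<Longrightarrow> r \<le> t \<Longrightarrow> t \<le> b \<Longrightarrow> norm (x t - x r) \<le> C * (t - r)" and C: "0 \<le> C"
  obtains N where "negligible N" "\<And>t. t \<in> {a<..<b} - N \<Longrightarrow> x differentiable (at t)"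
proof (cases "a < b")
  case False
  then show ?thesis by (intro that[of "{}"]) auto
next
  case ab: True
  define c where "c = (\<lambda>t. max a (min b t))"
  have "\<exists>N. negligible N \<and> (\<forall>t\<in>{a<..<b} - N. (\<lambda>t. x t \<bullet> i) differentiable (at t))" if i: "i \<in> Basis" for i
  proof -
    have "\<bar>x (c t) \<bullet> i - x (c r) \<bullet> i\<bar> \<le> C * (t - r)" if "r \<le> t" for r t
    proof -
      have "\<bar>x (c t) \<bullet> i - x (c r) \<bullet> i\<bar> \<le> norm (x (c t) - x (c r))"
        using Basis_le_norm[OF i, of "x (c t) - x (c r)"] by (simp add: inner_diff_left)
      also have "\<dots> \<le> C * (c t - c r)" using that ab by (intro lip) (auto simp: c_def)
      also have "\<dots> \<le> C * (t - r)" using that ab C by (intro mult_left_mono) (auto simp: c_def)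
      finally show ?thesis .
    qed
    from lipschitz_real_ae_differentiable[of "\<lambda>t. x (c t) \<bullet> i", OF this, of a b]
    obtain N where N: "negligible N" "\<And>t. t \<in> {a<..<b} - N \<Longrightarrow> (\<lambda>t. x (c t) \<bullet> i) differentiable (at t)"
      by auto
    have "(\<lambda>t. x t \<bullet> i) differentiable (at t)" if t: "t \<in> {a<..<b} - N" for t
    proof -
      obtain D where D: "((\<lambda>t. x (c t) \<bullet> i) has_derivative D) (at t)"
        using N(2)[OF t] by (auto simp: differentiable_def)
      have "((\<lambda>t. x t \<bullet> i) has_derivative D) (at t)"
        by (rule has_derivative_transform_within_open[OF D, of "{a<..<b}"]) (use t in \<open>auto simp: c_def\<close>)
      then show ?thesis by (auto simp: differentiable_def)
    qed
    with N show ?thesis by blast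
  qed
  then obtain N where N: "\<And>i. i \<in> Basis \<Longrightarrow> negligible (N i)"
      "\<And>i t. i \<in> Basis \<Longrightarrow> t \<in> {a<..<b} - N i \<Longrightarrow> (\<lambda>t. x t \<bullet> i) differentiable (at t)"
    by metis
  show thesis
  proof (rule that[of "\<Union>i\<in>Basis. N i"])
    show "negligible (\<Union>i\<in>Basis. N i)" using N(1) by (intro negligible_Union) auto
    fix t assume "t \<in> {a<..<b} - (\<Union>i\<in>Basis. N i)"
    then have "(\<lambda>t. x t \<bullet> i) differentiable (at t)" if "i \<in> Basis" for i using that by (intro N(2)) auto
    then show "x differentiable (at t)" by (subst differentiable_componentwise_within) auto
  qed
qed

section \<open>Integral equations and inequalities with memory\<close>

text \<open>
  Gronwall's lemma for integrands with memory: the rate \<open>G r\<close> is compared with the running supremum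
  of \<open>d\<close> on \<open>[s,r]\<close>, which need not be measurable. It is therefore enclosed in an exponential: with
  \<open>S\<close> the supremum of \<open>d t / exp (2 b (t - s))\<close>, integrating the rate costs only \<open>S / 2\<close>, and the
  resulting inequality \<open>S \<le> c + S / 2\<close> is solved for \<open>S\<close>.
\<close>

lemma gronwall_sup:
  fixes d :: "real \<Rightarrow> real"
  assumes b: "0 < b" and c: "0 \<le> c" and N: "negligible N"
    and bdd: "\<And>t. t \<in> {s..T} \<Longrightarrow> d t \<le> B"
    and G: "\<And>t. t \<in> {s..T} \<Longrightarrow> G integrable_on {s..t}"
    and le: "\<And>t. t \<in> {s..T} \<Longrightarrow> d t \<le> c + integral {s..t} G"
    and rate: "\<And>r C. r \<in> {s<..<T} - N \<Longrightarrow> 0 \<le> C \<Longrightarrow> (\<And>\<rho>. \<rho> \<in> {s..r} \<Longrightarrow> d \<rho> \<le> C) \<Longrightarrow> G r \<le> b * C"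
    and t: "t \<in> {s..T}"
  shows "d t \<le> 2 * c * exp (2 * b * (t - s))"
proof -
  define E where "E = (\<lambda>r. exp (2 * b * (r - s)))"
  have Epos: "E r > 0" for r by (simp add: E_def)
  have E1: "1 \<le> E r" if "s \<le> r" for r using that b by (simp add: E_def)
  have Emono: "E r \<le> E q" if "r \<le> q" for r q using that b by (simp add: E_def)
  define S where "S = max 0 (SUP r\<in>{s..T}. d r / E r)"
  have S0: "0 \<le> S" by (simp add: S_def)
  have bdd_above: "bdd_above ((\<lambda>r. d r / E r) ` {s..T})"
  proof (rule bdd_aboveI2)
    fix r assume r: "r \<in> {s..T}"
    have "d r \<le> max B 0" using bdd[OF r] by simp
    also have "\<dots> \<le> max B 0 * E r" using E1[of r] r mult_left_mono[of 1 "E r" "max B 0"] by simp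
    finally show "d r / E r \<le> max B 0" using Epos[of r] by (simp add: field_simps)
  qed
  have dS: "d r \<le> S * E r" if "r \<in> {s..T}" for r
  proof -
    have "d r / E r \<le> (SUP r\<in>{s..T}. d r / E r)" using bdd_above that by (rule cSUP_upper[rotated])
    then have "d r / E r \<le> S" by (simp add: S_def)
    then show ?thesis using Epos[of r] by (simp add: field_simps)
  qed
  have key: "d r / E r \<le> c + S / 2" if r: "r \<in> {s..T}" for r
  proof -
    have "((\<lambda>q. S / 2 * E q) has_vector_derivative b * (S * E q)) (at q within {s..r})" for q
      unfolding E_def has_real_derivative_iff_has_vector_derivative[symmetric]
      by (auto intro!: derivative_eq_intros)
    then have I: "((\<lambda>q. b * (S * E q)) has_integral (S / 2 * E r - S / 2 * E s)) {s..r}"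
      using r by (intro fundamental_theorem_of_calculus) auto
    have "integral {s..r} G \<le> integral {s..r} (\<lambda>q. b * (S * E q))"
    proof (rule integral_le_ae[OF G[OF r] _ N])
      show "(\<lambda>q. b * (S * E q)) integrable_on {s..r}" using I by blast
      fix q assume q: "q \<in> {s<..<r} - N"
      show "G q \<le> b * (S * E q)"
      proof (rule rate)
        show "q \<in> {s<..<T} - N" using q r by auto
        show "0 \<le> S * E q" using S0 Epos[of q] by simp
        fix \<rho> assume \<rho>: "\<rho> \<in> {s..q}"
        then have "d \<rho> \<le> S * E \<rho>" using q r by (intro dS) auto
        also have "\<dots> \<le> S * E q" using S0 Emono \<rho> by (intro mult_left_mono) auto
        finally show "d \<rho> \<le> S * E q" .
      qed
    qed
    also have "\<dots> \<le> S / 2 * E r" using integral_unique[OF I] S0 Epos[of s] by simp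
    finally have "d r \<le> c + S / 2 * E r" using le[OF r] by simp
    also have "\<dots> \<le> (c + S / 2) * E r"
      using E1[of r] r c mult_left_mono[of 1 "E r" c] by (simp add: algebra_simps)
    finally show ?thesis using Epos[of r] by (simp add: field_simps)
  qed
  have "(SUP r\<in>{s..T}. d r / E r) \<le> c + S / 2" using t key by (intro cSUP_least) auto
  then have "S \<le> 2 * c" using c S0 by (auto simp: S_def max_def split: if_splits)
  then have "S * E t \<le> 2 * c * E t" using Epos[of t] by (intro mult_right_mono) auto
  with dS[OF t] have "d t \<le> 2 * c * E t" by linarith
  then show ?thesis by (simp add: E_def)
qed

text \<open>
  An inequality that is only known as long as \<open>e \<ge> 0\<close> is good enough to estimate \<open>e s\<close> from
  above: one runs up to the first time at which \<open>e\<close> is nonpositive, or to \<open>T\<close> if there is none. It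
  is used for equations with a nonnegative rate, whose linear term has a favourable sign exactly
  where \<open>e \<ge> 0\<close>.
\<close>

lemma first_zero_bound:
  fixes e :: "real \<Rightarrow> real"
  assumes "s \<le> T" and cont: "continuous_on {s..T} e" and eT: "e T \<le> c" and "0 \<le> c" "0 \<le> \<eta>"
    and step: "\<And>t. s \<le> t \<Longrightarrow> t \<le> T \<Longrightarrow> (\<And>r. r \<in> {s..t} \<Longrightarrow> 0 \<le> e r) \<Longrightarrow> e s \<le> e t + \<eta>"
  shows "e s \<le> c + \<eta>"
proof (cases "\<exists>r\<in>{s..T}. e r \<le> 0")
  case False
  then have "0 \<le> e r" if "r \<in> {s..T}" for r using that by (meson linear)
  then have "e s \<le> e T + \<eta>" using \<open>s \<le> T\<close> by (intro step) auto
  then show ?thesis using eT by simp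
next
  case True
  show ?thesis
  proof (cases "e s \<le> 0")
    case False
    let ?Z = "{s..T} \<inter> e -` {..0}"
    have "closed ?Z" using cont by (intro continuous_closed_preimage) auto
    then have "compact ({s..T} \<inter> ?Z)" by (intro compact_Int_closed) auto
    then have "compact ?Z" by (simp only: Int_left_absorb)
    moreover have "?Z \<noteq> {}" using True by auto
    ultimately have "\<exists>t\<in>?Z. \<forall>r\<in>?Z. t \<le> r" by (rule compact_attains_inf)
    then obtain t where t1: "t \<in> ?Z" and t': "\<forall>r\<in>?Z. t \<le> r" by (rule bexE)
    note t = t1 t'[THEN bspec]
    have pos: "e r > 0" if "r \<in> {s..<t}" for r using t(2)[of r] t(1) that by force
    have c: "continuous_on {s..t} e" by (rule continuous_on_subset[OF cont]) (use t(1) in auto)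
    have "e t \<le> 0" "0 \<le> e s" "s \<le> t" using t(1) False by simp_all
    from IVT2'[OF this c] obtain z where z: "s \<le> z" "z \<le> t" "e z = 0" by blast
    have "z = t"
    proof (rule ccontr)
      assume "z \<noteq> t"
      then have "e z > 0" using z by (intro pos) simp
      then show False using z(3) by simp
    qed
    then have "0 \<le> e r" if "r \<in> {s..t}" for r using pos[of r] z that by (cases "r = t") auto
    then have "e s \<le> e t + \<eta>" using t(1) by (intro step) auto
    then show ?thesis using z \<open>z = t\<close> \<open>0 \<le> c\<close> by simp
  qed (use assms in simp)
qed

text \<open>
  The counterpart forward in time: if \<open>e\<close> were positive somewhere, the estimate would apply from the
  last preceding zero on, and Gronwall's lemma for the positive part of \<open>e\<close> gives a contradiction.
\<close>

lemma forward_nonpos: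
  fixes e :: "real \<Rightarrow> real"
  assumes cont: "continuous_on {s..T} e" and es: "e s \<le> 0" and b: "0 < b"
    and step: "\<And>p q. s \<le> p \<Longrightarrow> p \<le> q \<Longrightarrow> q \<le> T \<Longrightarrow> (\<And>r. r \<in> {p..q} \<Longrightarrow> 0 \<le> e r) \<Longrightarrow>
        e q - e p \<le> b * integral {p..q} e"
    and t: "t \<in> {s..T}"
  shows "e t \<le> 0"
proof -
  have bd: "bounded (e ` {s..T})" using cont by (intro compact_imp_bounded compact_continuous_image) auto
  then obtain B where B: "\<And>r. r \<in> {s..T} \<Longrightarrow> \<bar>e r\<bar> \<le> B"
    unfolding bounded_iff by fastforce
  have dcont: "continuous_on {u..v} (\<lambda>r. b * max 0 (e r))" if "s \<le> u" "v \<le> T" for u v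
    using that by (intro continuous_intros continuous_on_subset[OF cont]) auto
  have I: "(\<lambda>r. b * max 0 (e r)) integrable_on {u..v}" if "s \<le> u" "v \<le> T" for u v
    using dcont that by (intro integrable_continuous_real) auto
  have "max 0 (e t) \<le> 2 * 0 * exp (2 * b * (t - s))"
  proof (rule gronwall_sup[where N="{}" and B=B and T=T and G="\<lambda>r. b * max 0 (e r)"])
    fix q assume q: "q \<in> {s..T}"
    then show "max 0 (e q) \<le> B" using B[OF q] by auto
    show "(\<lambda>r. b * max 0 (e r)) integrable_on {s..q}" using I[of s q] q by simp
    have "max 0 (e q) \<le> integral {s..q} (\<lambda>r. b * max 0 (e r))"
    proof (cases "e q \<le> 0")
      case True
      moreover have "0 \<le> integral {s..q} (\<lambda>r. b * max 0 (e r))"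
        using b I[of s q] q by (intro Henstock_Kurzweil_Integration.integral_nonneg) auto
      ultimately show ?thesis by simp
    next
      case False
      let ?Z = "{s..q} \<inter> e -` {..0}"
      have contq: "continuous_on {s..q} e" using cont q by (auto intro: continuous_on_subset)
      have "closed ?Z" using contq by (intro continuous_closed_preimage) auto
      then have "compact ({s..q} \<inter> ?Z)" by (intro compact_Int_closed) auto
      then have "compact ?Z" by (simp only: Int_left_absorb)
      moreover have "?Z \<noteq> {}" using es q by auto
      ultimately have "\<exists>p\<in>?Z. \<forall>r\<in>?Z. r \<le> p" by (rule compact_attains_sup)
      then obtain p where p1: "p \<in> ?Z" and p': "\<forall>r\<in>?Z. r \<le> p" by (rule bexE)
      note p = p1 p'[THEN bspec]
      have pos: "e r > 0" if "r \<in> {p<..q}" for r using p(2)[of r] p(1) that by force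
      have c: "continuous_on {p..q} e" by (rule continuous_on_subset[OF contq]) (use p(1) in auto)
      have "e p \<le> 0" "0 \<le> e q" "p \<le> q" using p(1) False by simp_all
      from IVT'[OF this c] obtain z where z: "p \<le> z" "z \<le> q" "e z = 0" by blast
      have "z = p"
      proof (rule ccontr)
        assume "z \<noteq> p"
        then have "e z > 0" using z by (intro pos) simp
        then show False using z(3) by simp
      qed
      then have nn: "0 \<le> e r" if "r \<in> {p..q}" for r using pos[of r] z that by (cases "r = p") auto
      then have "e q - e p \<le> b * integral {p..q} e" using p(1) q by (intro step) auto
      also have "\<dots> = integral {p..q} (\<lambda>r. b * max 0 (e r))"
        unfolding integral_mult_right[symmetric] using nn by (intro integral_cong) auto
      also have "\<dots> \<le> integral {s..q} (\<lambda>r. b * max 0 (e r))"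
        using p q b I by (intro integral_subset_le) auto
      finally show ?thesis using z \<open>z = p\<close> False by simp
    qed
    then show "max 0 (e q) \<le> 0 + integral {s..q} (\<lambda>r. b * max 0 (e r))" by simp
  next
    fix r C assume "r \<in> {s<..<T} - {}" and C: "\<And>\<rho>. \<rho> \<in> {s..r} \<Longrightarrow> max 0 (e \<rho>) \<le> C"
    then show "b * max 0 (e r) \<le> b * C" using b by (intro mult_left_mono C) auto
  qed (use b t in auto)
  then show ?thesis by simp
qed

text \<open>
  Banach's fixed point theorem for right-hand sides with memory. In the weighted variable
  \<open>exp (- \<beta> t) q t\<close> with \<open>\<beta> > 2 L\<close> the Picard operator halves the supremum distance,
  which gives a solution on the whole interval at once.
\<close>

lemma picard:
  fixes F :: "real \<Rightarrow> (real \<Rightarrow> 'b::euclidean_space) \<Rightarrow> 'b"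
  assumes sT: "s \<le> T" and L: "0 \<le> L" and N: "negligible N"
    and int: "\<And>q. continuous_on {s..T} q \<Longrightarrow> (\<lambda>t. F t q) integrable_on {s..T}"
    and lip: "\<And>q q' t C. continuous_on {s..T} q \<Longrightarrow> continuous_on {s..T} q' \<Longrightarrow> t \<in> {s<..<T} - N \<Longrightarrow>
        (\<And>r. r \<in> {s..t} \<Longrightarrow> norm (q r - q' r) \<le> C) \<Longrightarrow> norm (F t q - F t q') \<le> L * C"
  obtains q where "continuous_on {s..T} q" "\<And>t. t \<in> {s..T} \<Longrightarrow> q t = q0 + integral {s..t} (\<lambda>r. F r q)"
proof -
  \<comment> \<open>bounded continuous functions live on the whole line; the clamp extends a function on \<open>[s,T]\<close>\<close>
  define c where "c = (\<lambda>t. max s (min T t))"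
  have c: "c t \<in> {s..T}" "continuous_on UNIV c" for t
    using sT by (auto simp: c_def intro!: continuous_intros)
  have cid: "c t = t" if "t \<in> {s..T}" for t using that by (simp add: c_def)
  define \<beta> where "\<beta> = 2 * L + 1"
  have \<beta>: "\<beta> > 0" "L \<le> \<beta> / 2" using L by (auto simp: \<beta>_def)
  define E where "E = (\<lambda>(p :: real \<Rightarrow>\<^sub>C 'b) t. exp (\<beta> * t) *\<^sub>R apply_bcontfun p t)"
  have Ec: "continuous_on S (E p)" for p S by (auto simp: E_def intro!: continuous_intros)
  define R where "R = (\<lambda>p t. exp (- \<beta> * t) *\<^sub>R (q0 + integral {s..t} (\<lambda>r. F r (E p))))"
  have Rc: "continuous_on {s..T} (R p)" for p
    unfolding R_def by (intro continuous_intros indefinite_integral_continuous_1 int Ec)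
  have Rb: "(\<lambda>t. R p (c t)) \<in> bcontfun" for p
  proof -
    have "continuous_on UNIV (R p \<circ> c)"
      using c by (intro continuous_on_compose continuous_on_subset[OF Rc]) auto
    moreover have "bounded (R p ` {s..T})"
      using Rc by (intro compact_imp_bounded compact_continuous_image) auto
    then have "bounded (range (R p \<circ> c))" by (rule bounded_subset) (use c in auto)
    ultimately show ?thesis by (simp add: bcontfun_def comp_def)
  qed
  define \<Psi> where "\<Psi> = (\<lambda>p. Bcontfun (\<lambda>t. R p (c t)))"
  have \<Psi>: "apply_bcontfun (\<Psi> p) t = R p (c t)" for p t
    unfolding \<Psi>_def using Rb by (simp add: Bcontfun_inverse)
  have contr: "dist (\<Psi> p) (\<Psi> p') \<le> 1 / 2 * dist p p'" for p p'
  proof (rule dist_bound)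
    fix t0 define t where "t = c t0"
    have t: "t \<in> {s..T}" using c by (simp add: t_def)
    let ?D = "dist p p'"
    have int': "(\<lambda>r. F r (E p)) integrable_on {s..t}" for p
      using integrable_on_subinterval[OF int[OF Ec]] t by auto
    have "((\<lambda>q. L * ?D / \<beta> * exp (\<beta> * q)) has_vector_derivative L * (exp (\<beta> * q) * ?D)) (at q within {s..t})" for q
      unfolding has_real_derivative_iff_has_vector_derivative[symmetric]
      using \<beta> by (auto intro!: derivative_eq_intros)
    then have I: "((\<lambda>q. L * (exp (\<beta> * q) * ?D)) has_integral (L * ?D / \<beta> * exp (\<beta> * t) - L * ?D / \<beta> * exp (\<beta> * s))) {s..t}"
      using t by (intro fundamental_theorem_of_calculus) auto
    have "norm (integral {s..t} (\<lambda>r. F r (E p)) - integral {s..t} (\<lambda>r. F r (E p')))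
        = norm (integral {s..t} (\<lambda>r. F r (E p) - F r (E p')))"
      using int' by (simp add: Henstock_Kurzweil_Integration.integral_diff)
    also have "\<dots> \<le> integral {s..t} (\<lambda>q. L * (exp (\<beta> * q) * ?D))"
    proof (rule norm_integral_le_ae[OF _ _ N])
      show "(\<lambda>r. F r (E p) - F r (E p')) integrable_on {s..t}"
        using int' by (intro Henstock_Kurzweil_Integration.integrable_diff)
      show "(\<lambda>q. L * (exp (\<beta> * q) * ?D)) integrable_on {s..t}" using I by blast
      fix q assume q: "q \<in> {s<..<t} - N"
      show "norm (F q (E p) - F q (E p')) \<le> L * (exp (\<beta> * q) * ?D)"
      proof (rule lip[OF Ec Ec])
        show "q \<in> {s<..<T} - N" using q t by auto
        fix r assume r: "r \<in> {s..q}"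
        have "norm (E p r - E p' r) = exp (\<beta> * r) * dist (apply_bcontfun p r) (apply_bcontfun p' r)"
          by (simp add: E_def dist_norm flip: scaleR_diff_right)
        also have "\<dots> \<le> exp (\<beta> * q) * ?D"
          using r \<beta> dist_bounded by (intro mult_mono) auto
        finally show "norm (E p r - E p' r) \<le> exp (\<beta> * q) * ?D" .
      qed
    qed
    also have "\<dots> = L * ?D / \<beta> * exp (\<beta> * t) - L * ?D / \<beta> * exp (\<beta> * s)" using I by (rule integral_unique)
    also have "\<dots> \<le> L * ?D / \<beta> * exp (\<beta> * t)" using L \<beta> by simp
    finally have *: "norm (integral {s..t} (\<lambda>r. F r (E p)) - integral {s..t} (\<lambda>r. F r (E p'))) \<le> \<dots>" .
    have "dist (apply_bcontfun (\<Psi> p) t0) (apply_bcontfun (\<Psi> p') t0)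
        = exp (- \<beta> * t) * norm (integral {s..t} (\<lambda>r. F r (E p)) - integral {s..t} (\<lambda>r. F r (E p')))"
      by (simp add: \<Psi> R_def t_def[symmetric] dist_norm flip: scaleR_diff_right)
    also have "\<dots> \<le> exp (- \<beta> * t) * (L * ?D / \<beta> * exp (\<beta> * t))"
      using * by (intro mult_left_mono) auto
    also have "\<dots> = L / \<beta> * ?D" by (simp add: exp_minus)
    also have "\<dots> \<le> 1 / 2 * ?D" using \<beta> by (intro mult_right_mono) (auto simp: field_simps)
    finally show "dist (apply_bcontfun (\<Psi> p) t0) (apply_bcontfun (\<Psi> p') t0) \<le> 1 / 2 * ?D" .
  qed
  obtain p where p: "\<Psi> p = p" using banach_fix_type[of "1/2" \<Psi>] contr by auto
  show thesis
  proof (rule that[OF Ec])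
    fix t assume t: "t \<in> {s..T}"
    have "apply_bcontfun p t = R p t" using \<Psi>[of p t] p cid[OF t] by simp
    then show "E p t = q0 + integral {s..t} (\<lambda>r. F r (E p))"
      by (simp add: E_def[of ] R_def exp_minus)
  qed
qed

lemma exp_lipschitz:
  fixes x y M :: real
  assumes "\<bar>x\<bar> \<le> M" "\<bar>y\<bar> \<le> M"
  shows "\<bar>exp x - exp y\<bar> \<le> exp M * \<bar>x - y\<bar>"
proof -
  have *: "exp x - exp y \<le> exp M * \<bar>x - y\<bar>" if "\<bar>x\<bar> \<le> M" for x y :: real
  proof -
    have "exp x * (1 + (y - x)) \<le> exp x * exp (y - x)" by (intro mult_left_mono exp_ge_add_one_self) auto
    then have "exp x - exp y \<le> exp x * (x - y)" by (simp add: exp_diff algebra_simps)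
    also have "\<dots> \<le> exp x * \<bar>x - y\<bar>" by (intro mult_left_mono) auto
    also have "\<dots> \<le> exp M * \<bar>x - y\<bar>" using that by (intro mult_right_mono) auto
    finally show ?thesis .
  qed
  show ?thesis using *[of x y] *[of y x] assms by (simp add: abs_le_iff abs_minus_commute)
qed

text \<open>
  With \<open>\<Lambda>\<close> a primitive of \<open>lam\<close>, the discounted payoff is \<open>exp (\<Lambda> t)\<close> times an
  indefinite integral, hence Lipschitz, and the product rule holds almost everywhere.
\<close>

lemma discounted_payoff_ode:
  fixes lam l :: "real \<Rightarrow> real" and c :: real
  assumes lam: "lam absolutely_integrable_on {s..T}" and l: "l absolutely_integrable_on {s..T}"
    and N: "negligible N" and "0 \<le> Cm" "0 \<le> Cl"
    and bnd: "\<And>t. t \<in> {s<..<T} - N \<Longrightarrow> \<bar>lam t\<bar> \<le> Cm" "\<And>t. t \<in> {s<..<T} - N \<Longrightarrow> \<bar>l t\<bar> \<le> Cl"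
  defines "p \<equiv> (\<lambda>t. integral {t..T} (\<lambda>r. exp (- integral {t..r} lam) * l r) + exp (- integral {t..T} lam) * c)"
  shows "continuous_on {s..T} p"
    and "\<And>t1 t2. s \<le> t1 \<Longrightarrow> t1 \<le> t2 \<Longrightarrow> t2 \<le> T \<Longrightarrow>
           p t2 - p t1 = integral {t1..t2} (\<lambda>r. lam r * p r - l r)"
proof -
  have lam_int: "lam integrable_on {u..v}" if "s \<le> u" "v \<le> T" for u v
    using lam that integrable_on_subinterval set_lebesgue_integral_eq_integral(1) by (metis atLeastatMost_subset_iff)
  define \<Lambda> where "\<Lambda> = (\<lambda>t. integral {s..t} lam)"
  have \<Lambda>diff: "integral {u..v} lam = \<Lambda> v - \<Lambda> u" if "s \<le> u" "u \<le> v" "v \<le> T" for u v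
    using Henstock_Kurzweil_Integration.integral_combine[of s u v lam] lam_int that
    by (auto simp: \<Lambda>_def algebra_simps)
  have \<Lambda>lip: "\<bar>\<Lambda> v - \<Lambda> u\<bar> \<le> Cm * (v - u)" if "s \<le> u" "u \<le> v" "v \<le> T" for u v
    using norm_integral_le_const_ae[OF lam_int N, of u v Cm] that bnd(1) \<Lambda>diff[OF that] by auto
  have \<Lambda>c: "continuous_on {s..T} \<Lambda>" unfolding \<Lambda>_def by (intro indefinite_integral_continuous_1 lam_int) auto
  define E where "E = (\<lambda>t. exp (- \<Lambda> t))"
  have Ec: "continuous_on {s..T} E" unfolding E_def by (intro continuous_intros \<Lambda>c)
  define F where "F = (\<lambda>r. E r * l r)"
  have Fabs: "F absolutely_integrable_on {s..T}"
    unfolding F_def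
  proof (rule absolutely_integrable_bounded_measurable_product_real[OF _ _ _ l])
    show "E \<in> borel_measurable (lebesgue_on {s..T})"
      by (rule continuous_imp_measurable_on_sets_lebesgue[OF Ec]) auto
    show "bounded (E ` {s..T})" using Ec by (intro compact_imp_bounded compact_continuous_image) auto
  qed auto
  have F_int: "F integrable_on {u..v}" if "s \<le> u" "v \<le> T" for u v
    using Fabs that integrable_on_subinterval set_lebesgue_integral_eq_integral(1) by (metis atLeastatMost_subset_iff)
  define I where "I = (\<lambda>t. integral {s..t} F)"
  have Idiff: "integral {u..v} F = I v - I u" if "s \<le> u" "u \<le> v" "v \<le> T" for u v
    using Henstock_Kurzweil_Integration.integral_combine[of s u v F] F_int that
    by (auto simp: I_def algebra_simps)
  have Ic: "continuous_on {s..T} I" unfolding I_def by (intro indefinite_integral_continuous_1 F_int) auto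
  define P where "P = (\<lambda>t. I T - I t + E T * c)"
  define pt where "pt = (\<lambda>t. exp (\<Lambda> t) * P t)"
  have ptc: "continuous_on {s..T} pt" unfolding pt_def P_def by (intro continuous_intros \<Lambda>c Ic)
  have ppt: "p t = pt t" if t: "t \<in> {s..T}" for t
  proof -
    have "integral {t..T} (\<lambda>r. exp (- integral {t..r} lam) * l r) = integral {t..T} (\<lambda>r. exp (\<Lambda> t) * F r)"
    proof (rule integral_cong)
      fix r assume r: "r \<in> {t..T}"
      then have "integral {t..r} lam = \<Lambda> r - \<Lambda> t" using t by (intro \<Lambda>diff) auto
      then show "exp (- integral {t..r} lam) * l r = exp (\<Lambda> t) * F r"
        by (simp only:) (simp add: F_def E_def exp_minus exp_diff field_simps)
    qed
    also have "\<dots> = exp (\<Lambda> t) * (I T - I t)" using Idiff[of t T] t by simp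
    finally have *: "integral {t..T} (\<lambda>r. exp (- integral {t..r} lam) * l r) = exp (\<Lambda> t) * (I T - I t)" .
    have "integral {t..T} lam = \<Lambda> T - \<Lambda> t" using t by (intro \<Lambda>diff) auto
    then show ?thesis unfolding p_def *
      by (simp only:) (simp add: pt_def P_def E_def exp_minus exp_diff field_simps)
  qed
  show pc: "continuous_on {s..T} p" using ptc ppt continuous_on_cong[of "{s..T}" "{s..T}" p pt] by blast
  fix t1 t2 assume t12: "s \<le> t1" "t1 \<le> t2" "t2 \<le> T"
  define M where "M = exp (Cm * (T - s))"
  have \<Lambda>b: "\<bar>\<Lambda> t\<bar> \<le> Cm * (T - s)" if "t \<in> {s..T}" for t
  proof -
    have "\<bar>\<Lambda> t - \<Lambda> s\<bar> \<le> Cm * (t - s)" using \<Lambda>lip[of s t] that by auto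
    also have "\<dots> \<le> Cm * (T - s)" using that \<open>0 \<le> Cm\<close> by (intro mult_left_mono) auto
    finally show ?thesis by (simp add: \<Lambda>_def)
  qed
  have Eb: "E t \<le> M" "exp (\<Lambda> t) \<le> M" if "t \<in> {s..T}" for t
    using \<Lambda>b[OF that] by (auto simp: E_def M_def abs_le_iff)
  have "bounded (P ` {s..T})"
    unfolding P_def using Ic by (intro compact_imp_bounded compact_continuous_image continuous_intros) auto
  then obtain K where K: "\<And>t. t \<in> {s..T} \<Longrightarrow> \<bar>P t\<bar> \<le> K"
    unfolding bounded_iff by fastforce
  have K0: "0 \<le> K" using K[of t1] t12 by force
  have ptlip: "norm (pt v - pt u) \<le> (M * Cm * K + M * (M * Cl)) * (v - u)" if uv: "t1 \<le> u" "u \<le> v" "v \<le> t2" for u v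
  proof -
    have u: "u \<in> {s..T}" and v: "v \<in> {s..T}" using uv t12 by auto
    have "\<bar>I v - I u\<bar> \<le> (M * Cl) * (v - u)"
    proof -
      have "norm (F t) \<le> M * Cl" if "t \<in> {u<..<v} - N" for t
        unfolding F_def using that u v bnd(2)[of t] Eb(1)[of t]
        by (auto simp: abs_mult E_def M_def intro!: mult_mono)
      then show ?thesis using norm_integral_le_const_ae[OF F_int N, of u v "M * Cl"] Idiff[of u v] uv u v by auto
    qed
    moreover have "\<bar>exp (\<Lambda> v) - exp (\<Lambda> u)\<bar> \<le> M * (Cm * (v - u))"
      unfolding M_def using exp_lipschitz[OF \<Lambda>b[OF v] \<Lambda>b[OF u]] \<Lambda>lip[of u v] u v uv
      by (smt (verit, ccfv_SIG) atLeastAtMost_iff exp_gt_zero mult_left_mono)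
    ultimately have "\<bar>exp (\<Lambda> v) - exp (\<Lambda> u)\<bar> * \<bar>P v\<bar> + exp (\<Lambda> u) * \<bar>I v - I u\<bar>
        \<le> (M * (Cm * (v - u))) * K + M * ((M * Cl) * (v - u))"
      using K[OF v] Eb(2)[OF u] \<open>0 \<le> Cm\<close> K0 uv by (intro add_mono mult_mono) (auto simp: M_def)
    moreover have "pt v - pt u = (exp (\<Lambda> v) - exp (\<Lambda> u)) * P v - exp (\<Lambda> u) * (I v - I u)"
      by (simp add: pt_def P_def algebra_simps)
    then have "\<bar>pt v - pt u\<bar> \<le> \<bar>exp (\<Lambda> v) - exp (\<Lambda> u)\<bar> * \<bar>P v\<bar> + exp (\<Lambda> u) * \<bar>I v - I u\<bar>"
      by (metis abs_exp_cancel abs_mult abs_triangle_ineq4)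
    ultimately show ?thesis by (simp add: algebra_simps)
  qed
  obtain N1 where N1: "negligible N1" "\<And>t. t \<in> {s<..<T} - N1 \<Longrightarrow> (\<Lambda> has_vector_derivative lam t) (at t)"
    using indefinite_integral_ae_derivative[OF lam_int[of s T]] unfolding \<Lambda>_def by auto
  obtain N2 where N2: "negligible N2" "\<And>t. t \<in> {s<..<T} - N2 \<Longrightarrow> (I has_vector_derivative F t) (at t)"
    using indefinite_integral_ae_derivative[OF F_int[of s T]] unfolding I_def by auto
  have "((\<lambda>r. lam r * pt r - l r) has_integral (pt t2 - pt t1)) {t1..t2}"
  proof (rule abs_continuous_has_integral_derivative[where N="N1 \<union> N2"])
    show "abs_continuous_on_Icc t1 t2 pt"
      by (rule lipschitz_abs_continuous[OF _ ptlip]) (use \<open>0 \<le> Cm\<close> \<open>0 \<le> Cl\<close> K0 in \<open>auto simp: M_def\<close>)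
    show "negligible (N1 \<union> N2)" using N1 N2 by auto
    fix t assume t: "t \<in> {t1<..<t2} - (N1 \<union> N2)"
    then have dA: "(\<Lambda> has_real_derivative lam t) (at t)" and dI: "(I has_real_derivative F t) (at t)"
      unfolding has_real_derivative_iff_has_vector_derivative using N1(2)[of t] N2(2)[of t] t12 by auto
    have "(pt has_real_derivative (exp (\<Lambda> t) * lam t * P t + exp (\<Lambda> t) * (- F t))) (at t)"
      unfolding pt_def P_def by (rule derivative_eq_intros dA dI refl | simp add: P_def)+
    moreover have "exp (\<Lambda> t) * lam t * P t + exp (\<Lambda> t) * (- F t) = lam t * pt t - l t"
      by (simp add: pt_def F_def E_def exp_minus field_simps)
    ultimately show "(pt has_vector_derivative lam t * pt t - l t) (at t)"
      by (simp add: has_real_derivative_iff_has_vector_derivative)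
  qed (use t12 in auto)
  then have "integral {t1..t2} (\<lambda>r. lam r * pt r - l r) = pt t2 - pt t1" by (rule integral_unique)
  moreover have "integral {t1..t2} (\<lambda>r. lam r * pt r - l r) = integral {t1..t2} (\<lambda>r. lam r * p r - l r)"
    using t12 by (intro integral_cong) (auto simp: ppt)
  ultimately show "p t2 - p t1 = integral {t1..t2} (\<lambda>r. lam r * p r - l r)"
    using ppt[of t1] ppt[of t2] t12 by auto
qed

section \<open>Constructions and estimates along a mesh\<close>

lemma mesh_exists:
  fixes a b \<delta> :: real
  assumes "a < b" "0 < \<delta>"
  obtains n d where "0 < n" "0 < d" "d \<le> \<delta>" "a + real n * d = b"
proof -
  obtain n :: nat where n: "real n * \<delta> > b - a" using reals_Archimedean3[OF assms(2)] by blast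
  then have "0 < n" using assms(1) by (cases n) auto
  then show thesis using n assms(1)
    by (intro that[of n "(b - a) / real n"]) (auto simp: pos_divide_le_eq mult.commute)
qed

text \<open>
  A construction in \<open>n\<close> steps in which step \<open>k\<close> leaves everything before the \<open>k\<close>-th mesh point
  unchanged: \<open>agree k\<close> says that two stages coincide there, and the properties \<open>Q j\<close> of earlier
  cells are inherited.
\<close>

lemma mesh_induction:
  assumes "P st0"
    and step: "\<And>k st. k < n \<Longrightarrow> P st \<Longrightarrow> \<exists>st'. P st' \<and> agree k st st' \<and> Q k st'"
    and keep: "\<And>j k st st'. j < k \<Longrightarrow> k < n \<Longrightarrow> agree k st st' \<Longrightarrow> Q j st \<Longrightarrow> Q j st'"
  shows "\<exists>st. P st \<and> (\<forall>k<(n::nat). Q k st)"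
proof -
  have "\<exists>st. P st \<and> (\<forall>k<m. Q k st)" if "m \<le> n" for m
    using that
  proof (induction m)
    case 0
    then show ?case using assms(1) by blast
  next
    case (Suc m)
    then obtain st where st: "P st" "\<And>k. k < m \<Longrightarrow> Q k st" by auto
    obtain st' where st': "P st'" "agree m st st'" "Q m st'" using step[of m st] st Suc.prems by auto
    have "Q k st'" if "k < Suc m" for k
      using keep[of k m st st'] st st' that Suc.prems by (cases "k = m") auto
    then show ?case using st' by blast
  qed
  then show ?thesis by blast
qed

lemma mesh_cell:
  fixes a h \<tau> :: real
  assumes "0 < h" "0 < n" "a \<le> \<tau>" "\<tau> \<le> a + real n * h"
  obtains k where "k < n" "a + real k * h \<le> \<tau>" "\<tau> \<le> a + real (Suc k) * h"
proof -
  have "\<exists>k<n. a + real k * h \<le> \<tau> \<and> \<tau> \<le> a + real (Suc k) * h"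
    using assms(2,4)
  proof (induction n)
    case (Suc n)
    show ?case
    proof (cases "n = 0 \<or> a + real n * h \<le> \<tau>")
      case True
      then show ?thesis using Suc.prems assms(3) by (intro exI[of _ n]) auto
    next
      case False
      then show ?thesis using Suc.IH by (auto intro: less_SucI)
    qed
  qed simp
  then show thesis using that by blast
qed

lemma mono_from_cells:
  fixes V :: "real \<Rightarrow> real"
  assumes h: "0 \<le> h" and cell: "\<And>k p q. k < n \<Longrightarrow> a + real k * h \<le> p \<Longrightarrow> p \<le> q \<Longrightarrow> q \<le> a + real (Suc k) * h \<Longrightarrow> V p \<le> V q"
    and "a \<le> p" "p \<le> q" "q \<le> a + real n * h"
  shows "V p \<le> V q"
  using assms(2-)
proof (induction n arbitrary: p q)
  case 0
  then have "p = q" by simp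
  then show ?case by simp
next
  case (Suc n)
  let ?m = "a + real n * h"
  have IH: "V u \<le> V v" if "a \<le> u" "u \<le> v" "v \<le> ?m" for u v
    by (rule Suc.IH[OF Suc.prems(1) that]) auto
  have cell: "V u \<le> V v" if "?m \<le> u" "u \<le> v" "v \<le> a + real (Suc n) * h" for u v
    by (rule Suc.prems(1)[OF lessI that])
  have "a \<le> ?m" "?m \<le> a + real (Suc n) * h" using h by (auto simp: algebra_simps)
  consider "q \<le> ?m" | "?m \<le> p" | "p \<le> ?m" "?m \<le> q" by linarith
  then show ?case
  proof cases
    case 3
    have "V p \<le> V ?m" by (rule IH) (use 3 Suc.prems(2-) in auto)
    also have "V ?m \<le> V q" by (rule cell) (use 3 Suc.prems(2-) in auto)
    finally show ?thesis .
  next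
    case 1
    show ?thesis by (rule IH) (use 1 Suc.prems(2-) in auto)
  next
    case 2
    show ?thesis by (rule cell) (use 2 Suc.prems(2-) in auto)
  qed
qed

lemma base_from_cells:
  fixes V :: "real \<Rightarrow> real"
  assumes h: "0 \<le> h" and cell: "\<And>k q. k < n \<Longrightarrow> a + real k * h \<le> q \<Longrightarrow> q \<le> a + real (Suc k) * h \<Longrightarrow> V (a + real k * h) \<le> V q"
    and "a \<le> q" "q \<le> a + real n * h"
  shows "V a \<le> V q"
  using assms(2-)
proof (induction n arbitrary: q)
  case 0
  then have "a = q" by simp
  then show ?case by simp
next
  case (Suc n)
  let ?m = "a + real n * h"
  have IH: "V a \<le> V v" if "a \<le> v" "v \<le> ?m" for v
    using that Suc.prems(1) by (intro Suc.IH) auto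
  have cell: "V ?m \<le> V v" if "?m \<le> v" "v \<le> a + real (Suc n) * h" for v
    using that Suc.prems(1)[of n] by auto
  have "a \<le> ?m" using h by (auto simp: algebra_simps)
  show ?case
  proof (cases "q \<le> ?m")
    case False
    then have "V a \<le> V ?m" "V ?m \<le> V q" using Suc.prems(2-) \<open>a \<le> ?m\<close> by (auto intro!: IH cell)
    then show ?thesis by simp
  qed (use Suc.prems(2-) in \<open>auto intro!: IH\<close>)
qed

text \<open>
  Monotonicity along the mesh points together with a small oscillation inside the cells.
\<close>

lemma almost_mono_from_mesh:
  fixes V :: "real \<Rightarrow> real"
  assumes h: "0 < h" and n: "0 < n"
    and mesh: "\<And>k. k < n \<Longrightarrow> V (a + real k * h) \<le> V (a + real (Suc k) * h)"
    and osc: "\<And>k q. k < n \<Longrightarrow> a + real k * h \<le> q \<Longrightarrow> q \<le> a + real (Suc k) * h \<Longrightarrow> \<bar>V q - V (a + real k * h)\<bar> \<le> m"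
    and pq: "a \<le> p" "p \<le> q" "q \<le> a + real n * h"
  shows "V p \<le> V q + 2 * m"
proof -
  obtain i where i: "i < n" "a + real i * h \<le> p" "p \<le> a + real (Suc i) * h"
    using mesh_cell[OF h n, of a p] pq by auto
  obtain j where j: "j < n" "a + real j * h \<le> q" "q \<le> a + real (Suc j) * h"
    using mesh_cell[OF h n, of a q] pq by auto
  have m: "0 \<le> m" using osc[OF i] by linarith
  show ?thesis
  proof (cases "i \<le> j")
    case True
    have "V (a + real i * h) \<le> V (a + real j * h)"
      using True j(1)
    proof (induction j rule: dec_induct)
      case (step k)
      then show ?case using mesh[of k] by auto
    qed simp
    then show ?thesis using osc[OF i] osc[OF j] by linarith
  next
    case False
    then have "real (Suc j) * h \<le> real i * h" using h by (intro mult_right_mono) auto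
    then have "p = q" using i j pq by linarith
    then show ?thesis using m by simp
  qed
qed

section \<open>Paths of bounded relative speed\<close>

lemma ae_lebesgue_iff_negligible:
  "(AE t\<in>S in lebesgue. P t) \<longleftrightarrow> (\<exists>N. negligible N \<and> (\<forall>t\<in>S - N. P t))"
proof
  assume "AE t\<in>S in lebesgue. P t"
  then obtain N where "N \<in> null_sets lebesgue" "{t \<in> space lebesgue. \<not> (t \<in> S \<longrightarrow> P t)} \<subseteq> N"
    unfolding eventually_ae_filter by auto
  then show "\<exists>N. negligible N \<and> (\<forall>t\<in>S - N. P t)"
    by (intro exI[of _ N]) (auto simp: negligible_iff_null_sets)
next
  assume "\<exists>N. negligible N \<and> (\<forall>t\<in>S - N. P t)"
  then obtain N where N: "negligible N" "\<forall>t\<in>S - N. P t" by blast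
  show "AE t\<in>S in lebesgue. P t"
    by (rule AE_I'[of N]) (use N in \<open>auto simp: negligible_iff_null_sets\<close>)
qed

lemma sup_norm_upto_le:
  assumes "0 \<le> t" "\<And>r. r \<in> {0..t} \<Longrightarrow> norm (x r) \<le> c"
  shows "sup_norm_upto t x \<le> c"
  unfolding sup_norm_upto_def using assms by (intro cSUP_least) auto

lemma norm_le_sup_norm_upto:
  assumes "x \<in> cadlag_paths T" "r \<in> {0..t}" "t \<le> T"
  shows "norm (x r) \<le> sup_norm_upto t x"
proof -
  obtain B where "\<forall>s\<in>{0..T}. norm (x s) \<le> B"
    using cadlag_paths_bounded[OF assms(1)] unfolding bounded_iff by auto
  then have "bdd_above ((\<lambda>s. norm (x s)) ` {0..t})"
    using assms(3) by (intro bdd_aboveI2[of _ _ B]) auto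
  then show ?thesis unfolding sup_norm_upto_def using assms(2) by (intro cSUP_upper)
qed

lemma sup_norm_upto_mono:
  assumes "x \<in> cadlag_paths T" "0 \<le> s" "s \<le> t" "t \<le> T"
  shows "sup_norm_upto s x \<le> sup_norm_upto t x"
  using assms by (intro sup_norm_upto_le norm_le_sup_norm_upto[of x T]) auto

lemma sup_norm_upto_nonneg:
  assumes "x \<in> cadlag_paths T" "0 \<le> t" "t \<le> T"
  shows "0 \<le> sup_norm_upto t x"
  using norm_le_sup_norm_upto[of x T 0 t] norm_ge_zero[of "x 0"] assms by (auto simp del: norm_ge_zero)

lemma sup_dist_le:
  assumes "0 \<le> t" "\<And>r. r \<in> {0..t} \<Longrightarrow> norm (x r - x' r) \<le> c"
  shows "sup_dist t x x' \<le> c"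
  unfolding sup_dist_def using assms by (intro cSUP_least) auto

text \<open>
  The restriction to \<open>[0,T]\<close> gives the result the value \<open>undefined\<close> elsewhere, so that equality of
  paths is equality on \<open>[0,T]\<close>.
\<close>

definition glue :: "real \<Rightarrow> real \<Rightarrow> (real \<Rightarrow> 'd) \<Rightarrow> (real \<Rightarrow> 'd) \<Rightarrow> real \<Rightarrow> 'd" where
  "glue T s x q = restrict (\<lambda>t. if t \<le> s then x t else q t) {0..T}"

lemma glue_before: "t \<in> {0..s} \<Longrightarrow> s \<le> T \<Longrightarrow> glue T s x q t = x t"
  by (simp add: glue_def)

lemma glue_after: "q s = x s \<Longrightarrow> t \<in> {s..T} \<Longrightarrow> 0 \<le> s \<Longrightarrow> glue T s x q t = q t"
  by (auto simp: glue_def)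

lemma glue_cadlag:
  fixes x q :: "real \<Rightarrow> 'd::euclidean_space"
  assumes x: "x \<in> cadlag_paths T" and s: "0 \<le> s" "s \<le> T"
    and q: "continuous_on {s..T} q" and qs: "q s = x s"
  shows "glue T s x q \<in> cadlag_paths T"
  unfolding cadlag_paths_def
proof (intro CollectI conjI ballI)
  let ?g = "glue T s x q"
  show "?g \<in> extensional {0..T}" by (simp add: glue_def)
  fix t
  assume t: "t \<in> {0..<T}"
  show "(?g \<longlongrightarrow> ?g t) (at_right t)"
  proof (cases "t < s")
    case True
    have "(x \<longlongrightarrow> x t) (at_right t)" using x t by (auto simp: cadlag_paths_def)
    moreover have "eventually (\<lambda>u. x u = ?g u) (at_right t)"
      unfolding eventually_at_right_field using True t s by (intro exI[of _ s]) (auto simp: glue_def)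
    ultimately have "(?g \<longlongrightarrow> x t) (at_right t)" by (rule Lim_transform_eventually)
    then show ?thesis using True t s by (simp add: glue_def)
  next
    case False
    have "continuous_on {t..T} q" by (rule continuous_on_subset[OF q]) (use False in auto)
    then have "(q \<longlongrightarrow> q t) (at_right t)" using t by (intro continuous_on_Icc_at_rightD) auto
    moreover have "eventually (\<lambda>u. q u = ?g u) (at_right t)"
      unfolding eventually_at_right_field using False t s by (intro exI[of _ T]) (auto simp: glue_def)
    ultimately have "(?g \<longlongrightarrow> q t) (at_right t)" by (rule Lim_transform_eventually)
    then show ?thesis using False t s qs by (auto simp: glue_def)
  qed
next
  let ?g = "glue T s x q"
  fix t assume t: "t \<in> {0<..T}"
  show "\<exists>l. (?g \<longlongrightarrow> l) (at_left t)"
  proof (cases "t \<le> s")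
    case True
    have "\<exists>l. (x \<longlongrightarrow> l) (at_left t)" using x t by (simp add: cadlag_paths_def)
    then obtain l where "(x \<longlongrightarrow> l) (at_left t)" by blast
    moreover have "eventually (\<lambda>u. x u = ?g u) (at_left t)"
      unfolding eventually_at_left_field using True t s by (intro exI[of _ 0]) (auto simp: glue_def)
    ultimately have "(?g \<longlongrightarrow> l) (at_left t)" by (rule Lim_transform_eventually)
    then show ?thesis by blast
  next
    case False
    have "continuous_on {s..t} q" by (rule continuous_on_subset[OF q]) (use t in auto)
    then have "(q \<longlongrightarrow> q t) (at_left t)" using False by (intro continuous_on_Icc_at_leftD) auto
    moreover have "eventually (\<lambda>u. q u = ?g u) (at_left t)"
      unfolding eventually_at_left_field using False t s by (intro exI[of _ s]) (auto simp: glue_def)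
    ultimately have "(?g \<longlongrightarrow> q t) (at_left t)" by (rule Lim_transform_eventually)
    then show ?thesis by blast
  qed
qed

lemma glue_self:
  assumes "x \<in> extensional {0..T}" "\<And>t. t \<in> {0..s} \<Longrightarrow> x t = x0 t" "0 \<le> s"
  shows "glue T s x0 x = x"
  using assms by (auto simp: glue_def restrict_def extensional_def fun_eq_iff)

lemma abs_continuous_on_Icc_subset:
  "abs_continuous_on_Icc a b x \<Longrightarrow> a \<le> c \<Longrightarrow> d \<le> b \<Longrightarrow> abs_continuous_on_Icc c d x"
  unfolding abs_continuous_on_Icc_def by (meson order_trans)

lemma X_pathsD:
  assumes "x \<in> X_paths T L s x0"
  shows "x \<in> cadlag_paths T" "\<And>t. t \<in> {0..s} \<Longrightarrow> x t = x0 t"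
  using assms by (auto simp: X_paths_def)

lemma X_paths_derivative:
  assumes x: "x \<in> X_paths T L s x0"
  obtains N where "negligible N"
    "\<And>t. t \<in> {s<..<T} - N \<Longrightarrow> norm (vector_derivative x (at t)) \<le> L * (1 + sup_norm_upto t x)"
    "\<And>r t. s \<le> r \<Longrightarrow> r \<le> t \<Longrightarrow> t \<le> T \<Longrightarrow> ((\<lambda>q. vector_derivative x (at q)) has_integral (x t - x r)) {r..t}"
proof -
  from x have ac: "abs_continuous_on_Icc s T x" by (simp add: X_paths_def)
  from x have "\<exists>N. negligible N \<and> (\<forall>t\<in>{s<..<T} - N. x differentiable (at t) \<and>
      norm (vector_derivative x (at t)) \<le> L * (1 + sup_norm_upto t x))"
    unfolding X_paths_def ae_lebesgue_iff_negligible[symmetric] by simp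
  then obtain N where N: "negligible N" "\<forall>t\<in>{s<..<T} - N. x differentiable (at t) \<and>
      norm (vector_derivative x (at t)) \<le> L * (1 + sup_norm_upto t x)" by blast
  show thesis
  proof (rule that[OF N(1)])
    fix r t assume rt: "s \<le> r" "r \<le> t" "t \<le> T"
    show "((\<lambda>q. vector_derivative x (at q)) has_integral (x t - x r)) {r..t}"
    proof (rule abs_continuous_has_integral_derivative[OF rt(2) _ N(1)])
      show "abs_continuous_on_Icc r t x" using abs_continuous_on_Icc_subset[OF ac] rt by simp
      fix q assume "q \<in> {r<..<t} - N"
      then show "(x has_vector_derivative vector_derivative x (at q)) (at q)"
        using N(2) rt by (simp add: vector_derivative_works)
    qed
  qed (use N in auto)
qed

text \<open>
  Together with \<open>X_pathsI\<close> this describes the path set by increments. In this form membership passes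
  to uniform limits and to concatenations, with no derivative in sight.
\<close>

lemma X_paths_increment:
  assumes x: "x \<in> X_paths T L s x0" and L: "0 \<le> L" and s: "0 \<le> s" and rt: "s \<le> r" "r \<le> t" "t \<le> T"
  shows "norm (x t - x r) \<le> L * (1 + sup_norm_upto t x) * (t - r)"
proof -
  obtain N where N: "negligible N"
    "\<And>t. t \<in> {s<..<T} - N \<Longrightarrow> norm (vector_derivative x (at t)) \<le> L * (1 + sup_norm_upto t x)"
    "\<And>r t. s \<le> r \<Longrightarrow> r \<le> t \<Longrightarrow> t \<le> T \<Longrightarrow> ((\<lambda>q. vector_derivative x (at q)) has_integral (x t - x r)) {r..t}"
    using X_paths_derivative[OF x] by blast
  note I = N(3)[OF rt]
  have "norm (integral {r..t} (\<lambda>q. vector_derivative x (at q))) \<le> L * (1 + sup_norm_upto t x) * (t - r)"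
  proof (rule norm_integral_le_const_ae[OF _ N(1) rt(2)])
    show "(\<lambda>q. vector_derivative x (at q)) integrable_on {r..t}" using I by (auto simp: integrable_on_def)
    fix q assume q: "q \<in> {r<..<t} - N"
    then have "norm (vector_derivative x (at q)) \<le> L * (1 + sup_norm_upto q x)" using rt by (intro N(2)) auto
    also have "\<dots> \<le> L * (1 + sup_norm_upto t x)"
      using sup_norm_upto_mono[OF X_pathsD(1)[OF x], of q t] q rt s L by (intro mult_left_mono) auto
    finally show "norm (vector_derivative x (at q)) \<le> L * (1 + sup_norm_upto t x)" .
  qed
  then show ?thesis using integral_unique[OF I] by simp
qed

text \<open>
  A difference quotient at \<open>t\<close> is taken from the left, so that the bound on the increment involves
  the past of \<open>t\<close> only.
\<close>

lemma X_pathsI: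
  fixes x :: "real \<Rightarrow> 'd::euclidean_space"
  assumes x: "x \<in> cadlag_paths T" and L: "0 \<le> L" and s: "0 \<le> s"
    and x0: "\<And>t. t \<in> {0..s} \<Longrightarrow> x t = x0 t"
    and inc: "\<And>r t. s \<le> r \<Longrightarrow> r \<le> t \<Longrightarrow> t \<le> T \<Longrightarrow> norm (x t - x r) \<le> L * (1 + sup_norm_upto t x) * (t - r)"
  shows "x \<in> X_paths T L s x0"
proof (cases "s < T")
  case False
  have "abs_continuous_on_Icc s T x"
  proof (rule lipschitz_abs_continuous[of 0])
    fix r t assume "s \<le> r" "r \<le> t" "t \<le> T"
    then have "r = t" using False by linarith
    then show "norm (x t - x r) \<le> 0 * (t - r)" by simp
  qed simp
  then show ?thesis using x x0 False by (auto simp: X_paths_def)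
next
  case True
  define K where "K = L * (1 + sup_norm_upto T x)"
  have K0: "0 \<le> K" using L sup_norm_upto_nonneg[OF x, of T] s True by (simp add: K_def)
  have lip: "norm (x t - x r) \<le> K * (t - r)" if "s \<le> r" "r \<le> t" "t \<le> T" for r t
  proof -
    have "L * (1 + sup_norm_upto t x) * (t - r) \<le> K * (t - r)"
      unfolding K_def using sup_norm_upto_mono[OF x, of t T] that s L by (intro mult_right_mono mult_left_mono) auto
    then show ?thesis using inc[OF that] by linarith
  qed
  obtain N where N: "negligible N" "\<And>t. t \<in> {s<..<T} - N \<Longrightarrow> x differentiable (at t)"
    using lipschitz_ae_differentiable[OF lip K0] by blast
  have der: "norm (vector_derivative x (at t)) \<le> L * (1 + sup_norm_upto t x)" if t: "t \<in> {s<..<T} - N" for t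
  proof -
    let ?D = "vector_derivative x (at t)"
    have "(x has_vector_derivative ?D) (at t)" using N(2)[OF t] by (simp add: vector_derivative_works)
    then have alt: "\<And>e. 0 < e \<Longrightarrow> \<exists>d>0. \<forall>u. norm (u - t) < d \<longrightarrow> norm (x u - x t - (u - t) *\<^sub>R ?D) \<le> e * norm (u - t)"
      unfolding has_vector_derivative_def has_derivative_within_alt by auto
    show ?thesis
    proof (rule field_le_epsilon)
      fix e :: real assume "0 < e"
      then obtain d where d: "d > 0" "\<And>u. norm (u - t) < d \<Longrightarrow> norm (x u - x t - (u - t) *\<^sub>R ?D) \<le> e * norm (u - t)"
        using alt by blast
      define u where "u = max ((s + t) / 2) (t - d / 2)"
      have "u \<ge> t - d / 2" "u \<ge> (s + t) / 2" "u < t" using t d(1) by (simp_all add: u_def)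
      then have u: "s < u" "u < t" "t - u < d" using t d(1) by auto
      have "(t - u) * norm ?D = norm ((x u - x t - (u - t) *\<^sub>R ?D) - (x u - x t))" using u by simp
      also have "\<dots> \<le> norm (x u - x t - (u - t) *\<^sub>R ?D) + norm (x t - x u)"
        using norm_triangle_ineq4 by (metis norm_minus_commute)
      also have "\<dots> \<le> e * (t - u) + L * (1 + sup_norm_upto t x) * (t - u)"
        using d(2)[of u] inc[of u t] u t by auto
      also have "\<dots> = (t - u) * (L * (1 + sup_norm_upto t x) + e)" by (simp add: algebra_simps)
      finally show "norm ?D \<le> L * (1 + sup_norm_upto t x) + e" using u by simp
    qed
  qed
  have "AE t\<in>{s<..<T} in lebesgue. x differentiable (at t) \<and> norm (vector_derivative x (at t)) \<le> L * (1 + sup_norm_upto t x)"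
    unfolding ae_lebesgue_iff_negligible using N der by blast
  moreover have "abs_continuous_on_Icc s T x" by (rule lipschitz_abs_continuous[OF K0 lip])
  ultimately show ?thesis using x x0 by (auto simp: X_paths_def)
qed

text \<open>
  The bound that Gronwall's lemma yields for \<open>1 + R + norm (x t)\<close> when \<open>R\<close> bounds the initial
  segment; the summand \<open>R\<close> makes this quantity dominate the running supremum over the initial
  segment too.
\<close>

definition path_bound :: "real \<Rightarrow> real \<Rightarrow> real \<Rightarrow> real" where
  "path_bound T L R = 2 * (1 + 2 * R) * exp (2 * (L + 1) * T)"

lemma path_bound_nonneg: "0 \<le> R \<Longrightarrow> 0 \<le> path_bound T L R"
  by (simp add: path_bound_def)

lemma X_paths_bound:
  fixes x :: "real \<Rightarrow> 'd::euclidean_space"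
  assumes x: "x \<in> X_paths T L s x0" and L: "0 \<le> L" and s: "0 \<le> s" "s \<le> T"
    and R: "\<And>r. r \<in> {0..s} \<Longrightarrow> norm (x0 r) \<le> R" and t: "t \<in> {0..T}"
  shows "norm (x t) \<le> path_bound T L R"
proof -
  have R0: "0 \<le> R" using R[of 0] s by (auto intro: order_trans[OF norm_ge_zero])
  have T0: "0 \<le> T" using s by simp
  have E1: "1 \<le> exp (2 * (L + 1) * T)" using L T0 by simp
  have xR: "norm (x r) \<le> R" if "r \<in> {0..s}" for r using R[OF that] X_pathsD(2)[OF x that] by simp
  show ?thesis
  proof (cases "t \<le> s")
    case True
    then have "norm (x t) \<le> R" using xR t by auto
    also have "\<dots> \<le> 2 * (1 + 2 * R) * 1" using R0 by simp
    also have "\<dots> \<le> path_bound T L R" unfolding path_bound_def using E1 R0 by (intro mult_left_mono) auto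
    finally show ?thesis .
  next
    case False
    obtain B where B: "\<forall>s\<in>{0..T}. norm (x s) \<le> B"
      using cadlag_paths_bounded[OF X_pathsD(1)[OF x]] unfolding bounded_iff by auto
    obtain N where N: "negligible N"
      "\<And>t. t \<in> {s<..<T} - N \<Longrightarrow> norm (vector_derivative x (at t)) \<le> L * (1 + sup_norm_upto t x)"
      "\<And>r t. s \<le> r \<Longrightarrow> r \<le> t \<Longrightarrow> t \<le> T \<Longrightarrow> ((\<lambda>q. vector_derivative x (at q)) has_integral (x t - x r)) {r..t}"
      using X_paths_derivative[OF x] by blast
    let ?v = "\<lambda>q. vector_derivative x (at q)"
    have I: "(?v has_integral (x q - x s)) {s..q}" if "q \<in> {s..T}" for q using that by (intro N(3)) auto
    have "?v absolutely_integrable_on {s..T}"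
    proof (rule ae_bounded_absolutely_integrable[OF integrable_imp_measurable N(1)])
      show "?v integrable_on {s..T}" using I[of T] s by (auto simp: integrable_on_def)
      fix r assume r: "r \<in> {s<..<T} - N"
      then have "norm (?v r) \<le> L * (1 + sup_norm_upto r x)" by (rule N(2))
      also have "\<dots> \<le> L * (1 + B)" using r B s L by (intro mult_left_mono add_left_mono sup_norm_upto_le) auto
      finally show "norm (?v r) \<le> L * (1 + B)" .
    qed
    then have In: "(\<lambda>r. norm (?v r)) integrable_on {s..q}" if "q \<in> {s..T}" for q
      using integrable_on_subinterval[of "\<lambda>r. norm (?v r)" "{s..T}" s q] that by (auto simp: absolutely_integrable_on_def)
    have "1 + R + norm (x t) \<le> 2 * (1 + 2 * R) * exp (2 * (L + 1) * (t - s))"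
    proof (rule gronwall_sup[where T=T and B="1 + R + B" and N=N and G="\<lambda>r. norm (?v r)"])
      fix q assume q: "q \<in> {s..T}"
      then show "1 + R + norm (x q) \<le> 1 + R + B" using B s by auto
      show "(\<lambda>r. norm (?v r)) integrable_on {s..q}" by (rule In[OF q])
      have "norm (x q - x s) \<le> integral {s..q} (\<lambda>r. norm (?v r))"
        using Henstock_Kurzweil_Integration.integral_norm_bound_integral[of ?v "{s..q}" "\<lambda>r. norm (?v r)"]
          In[OF q] I[OF q] integral_unique[OF I[OF q]] by (auto simp: integrable_on_def)
      then show "1 + R + norm (x q) \<le> 1 + 2 * R + integral {s..q} (\<lambda>r. norm (?v r))"
        using xR[of s] s norm_triangle_sub[of "x q" "x s"] by auto
    next
      fix r C assume r: "r \<in> {s<..<T} - N" and C: "0 \<le> C" "\<And>\<rho>. \<rho> \<in> {s..r} \<Longrightarrow> 1 + R + norm (x \<rho>) \<le> C"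
      have "norm (x \<rho>) \<le> C - 1" if "\<rho> \<in> {0..r}" for \<rho>
      proof (cases "\<rho> \<le> s")
        case True
        then have "norm (x \<rho>) \<le> R" using xR that by auto
        moreover have "1 + R + norm (x s) \<le> C" using C(2)[of s] r by auto
        ultimately show ?thesis using norm_ge_zero[of "x s"] by linarith
      next
        case False
        then show ?thesis using C(2)[of \<rho>] that R0 by simp
      qed
      then have le: "sup_norm_upto r x \<le> C - 1" using r s by (intro sup_norm_upto_le) auto
      have "norm (?v r) \<le> L * (1 + sup_norm_upto r x)" by (rule N(2)[OF r])
      also have "\<dots> \<le> L * C" using le L by (intro mult_left_mono) auto
      also have "\<dots> \<le> (L + 1) * C" using C by (intro mult_right_mono) auto
      finally show "norm (?v r) \<le> (L + 1) * C" .
    qed (use False t R0 L N in auto)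
    also have "\<dots> \<le> path_bound T L R"
      unfolding path_bound_def using R0 L t s by (intro mult_left_mono) (auto intro!: mult_left_mono)
    finally show ?thesis using R0 by simp
  qed
qed

lemma cadlag_bound:
  assumes "x \<in> cadlag_paths T"
  obtains R where "0 \<le> R" "\<And>r. r \<in> {0..T} \<Longrightarrow> norm (x r) \<le> R"
proof -
  obtain B where "\<forall>s\<in>{0..T}. norm (x s) \<le> B"
    using cadlag_paths_bounded[OF assms] unfolding bounded_iff by auto
  then show thesis by (intro that[of "max B 0"]) (auto simp: le_max_iff_disj)
qed

lemma X_paths_derivative_abs_integrable:
  fixes x :: "real \<Rightarrow> 'd::euclidean_space"
  assumes x: "x \<in> X_paths T L s x0" and L: "0 \<le> L" and s: "0 \<le> s" "s \<le> T"
  shows "(\<lambda>q. vector_derivative x (at q) \<bullet> z) absolutely_integrable_on {s..T}"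
    and "\<And>p q. s \<le> p \<Longrightarrow> p \<le> q \<Longrightarrow> q \<le> T \<Longrightarrow>
      ((\<lambda>r. vector_derivative x (at r) \<bullet> z) has_integral ((x q - x p) \<bullet> z)) {p..q}"
proof -
  let ?v = "\<lambda>q. vector_derivative x (at q)"
  obtain M where M: "negligible M"
    "\<And>t. t \<in> {s<..<T} - M \<Longrightarrow> norm (vector_derivative x (at t)) \<le> L * (1 + sup_norm_upto t x)"
    "\<And>r t. s \<le> r \<Longrightarrow> r \<le> t \<Longrightarrow> t \<le> T \<Longrightarrow> ((\<lambda>q. vector_derivative x (at q)) has_integral (x t - x r)) {r..t}"
    using X_paths_derivative[OF x] by blast
  show I: "((\<lambda>r. ?v r \<bullet> z) has_integral ((x q - x p) \<bullet> z)) {p..q}" if "s \<le> p" "p \<le> q" "q \<le> T" for p q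
    using has_integral_linear[OF M(3)[OF that] bounded_linear_inner_left[of z]] by (simp add: comp_def)
  obtain B where B: "0 \<le> B" "\<And>r. r \<in> {0..T} \<Longrightarrow> norm (x r) \<le> B" using cadlag_bound[OF X_pathsD(1)[OF x]] by blast
  show "(\<lambda>q. ?v q \<bullet> z) absolutely_integrable_on {s..T}"
  proof (rule ae_bounded_absolutely_integrable[OF integrable_imp_measurable M(1)])
    show "(\<lambda>q. ?v q \<bullet> z) integrable_on {s..T}" using I[of s T] s by (auto simp: integrable_on_def)
    fix t assume t: "t \<in> {s<..<T} - M"
    have "norm (?v t \<bullet> z) \<le> norm (?v t) * norm z" by (simp add: Cauchy_Schwarz_ineq2)
    also have "norm (?v t) \<le> L * (1 + sup_norm_upto t x)" by (rule M(2)[OF t])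
    also have "\<dots> \<le> L * (1 + B)" using t s L B by (intro mult_left_mono add_left_mono sup_norm_upto_le) auto
    finally show "norm (?v t \<bullet> z) \<le> L * (1 + B) * norm z" by (simp add: mult_right_mono)
  qed
qed

text \<open>
  One constant serves as a common bound and as a common Lipschitz constant after time \<open>s\<close>. The
  initial segment is merely right-continuous with left limits.
\<close>

definition equi_lipschitz :: "real \<Rightarrow> real \<Rightarrow> real \<Rightarrow> (real \<Rightarrow> 'd::euclidean_space) \<Rightarrow> real \<Rightarrow> bool" where
  "equi_lipschitz T L s x0 K \<longleftrightarrow> 0 \<le> K \<and> (\<forall>x\<in>X_paths T L s x0. (\<forall>t\<in>{0..T}. norm (x t) \<le> K) \<and>
     (\<forall>r\<in>{s..T}. \<forall>t\<in>{s..T}. norm (x t - x r) \<le> K * \<bar>t - r\<bar>))"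

lemma equi_lipschitzD:
  assumes "equi_lipschitz T L s x0 K"
  shows "0 \<le> K" "\<And>x t. x \<in> X_paths T L s x0 \<Longrightarrow> t \<in> {0..T} \<Longrightarrow> norm (x t) \<le> K"
    "\<And>x r t. x \<in> X_paths T L s x0 \<Longrightarrow> r \<in> {s..T} \<Longrightarrow> t \<in> {s..T} \<Longrightarrow> norm (x t - x r) \<le> K * \<bar>t - r\<bar>"
  using assms by (auto simp: equi_lipschitz_def)

lemma X_paths_uniform:
  fixes x0 :: "real \<Rightarrow> 'd::euclidean_space"
  assumes x0: "x0 \<in> cadlag_paths T" and L: "0 \<le> L" and s: "0 \<le> s" "s \<le> T"
  obtains K where "equi_lipschitz T L s x0 K"
proof -
  obtain R where R: "0 \<le> R" "\<And>r. r \<in> {0..T} \<Longrightarrow> norm (x0 r) \<le> R" using cadlag_bound[OF x0] by blast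
  define B where "B = path_bound T L R"
  have B0: "0 \<le> B" using R by (simp add: B_def path_bound_nonneg)
  have b: "norm (x t) \<le> B" if "x \<in> X_paths T L s x0" "t \<in> {0..T}" for x t
    unfolding B_def by (rule X_paths_bound[OF that(1) L s _ that(2)]) (use R s in auto)
  define K where "K = max B (L * (1 + B))"
  have l: "norm (x t - x r) \<le> K * (t - r)" if "x \<in> X_paths T L s x0" "s \<le> r" "r \<le> t" "t \<le> T" for x r t
  proof -
    have "norm (x t - x r) \<le> L * (1 + sup_norm_upto t x) * (t - r)" by (rule X_paths_increment) (use that L s in auto)
    also have "\<dots> \<le> K * (t - r)"
    proof (rule mult_right_mono)
      have "sup_norm_upto t x \<le> B" using b[OF that(1)] that s by (intro sup_norm_upto_le) auto
      then have "L * (1 + sup_norm_upto t x) \<le> L * (1 + B)" using L by (intro mult_left_mono) auto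
      then show "L * (1 + sup_norm_upto t x) \<le> K" by (simp add: K_def)
    qed (use that in auto)
    finally show ?thesis .
  qed
  have "norm (x t - x r) \<le> K * \<bar>t - r\<bar>" if "x \<in> X_paths T L s x0" "r \<in> {s..T}" "t \<in> {s..T}" for x r t
    using l[OF that(1), of r t] l[OF that(1), of t r] that(2,3) by (cases "r \<le> t") (auto simp: norm_minus_commute)
  moreover have "0 \<le> K" using B0 by (simp add: K_def)
  moreover have "norm (x t) \<le> K" if "x \<in> X_paths T L s x0" "t \<in> {0..T}" for x t
    using b[OF that] by (simp add: K_def)
  ultimately show thesis using that[of K] by (simp add: equi_lipschitz_def)
qed

lemma X_paths_trans:
  assumes x: "x \<in> X_paths T L s0 x0" and x': "x' \<in> X_paths T L s x" and L: "0 \<le> L"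
    and s: "0 \<le> s0" "s0 \<le> s" "s \<le> T"
  shows "x' \<in> X_paths T L s0 x0"
proof (rule X_pathsI[OF X_pathsD(1)[OF x'] L s(1)])
  note c = X_pathsD(1)[OF x']
  fix t assume "t \<in> {0..s0}"
  then show "x' t = x0 t" using X_pathsD(2)[OF x', of t] X_pathsD(2)[OF x, of t] s by auto
next
  note c = X_pathsD(1)[OF x']
  fix r t assume rt: "s0 \<le> r" "r \<le> t" "t \<le> T"
  have after: "norm (x' t - x' r) \<le> L * (1 + sup_norm_upto t x') * (t - r)" if "s \<le> r" "r \<le> t" "t \<le> T" for r t
    by (rule X_paths_increment) (use that L s x' in auto)
  have before: "norm (x' t - x' r) \<le> L * (1 + sup_norm_upto t x') * (t - r)" if "s0 \<le> r" "r \<le> t" "t \<le> s" for r t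
  proof -
    have eq: "x' q = x q" if "q \<in> {0..s}" for q using X_pathsD(2)[OF x' that] .
    have "sup_norm_upto t x' = sup_norm_upto t x"
      unfolding sup_norm_upto_def using that eq by (intro arg_cong[where f=Sup] image_cong) auto
    then show ?thesis using X_paths_increment[OF x L, of r t] that s eq by auto
  qed
  consider "s \<le> r" | "t \<le> s" | "r \<le> s" "s \<le> t" by linarith
  then show "norm (x' t - x' r) \<le> L * (1 + sup_norm_upto t x') * (t - r)"
  proof cases
    case 3
    have "norm (x' t - x' r) \<le> norm (x' t - x' s) + norm (x' s - x' r)"
      using norm_triangle_ineq[of "x' t - x' s" "x' s - x' r"] by simp
    also have "\<dots> \<le> L * (1 + sup_norm_upto t x') * (t - s) + L * (1 + sup_norm_upto s x') * (s - r)"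
      using 3 rt s by (intro add_mono after before) auto
    also have "L * (1 + sup_norm_upto s x') * (s - r) \<le> L * (1 + sup_norm_upto t x') * (s - r)"
      using sup_norm_upto_mono[OF c, of s t] 3 rt s L by (intro mult_right_mono mult_left_mono) auto
    finally show ?thesis by (simp add: algebra_simps)
  qed (use rt in \<open>auto intro: after before\<close>)
qed

lemma X_paths_closed:
  fixes x :: "real \<Rightarrow> 'd::euclidean_space"
  assumes x0: "x0 \<in> cadlag_paths T" and L: "0 \<le> L" and s: "0 \<le> s" "s \<le> T"
    and ext: "x \<in> extensional {0..T}"
    and lim: "\<And>e. 0 < e \<Longrightarrow> \<exists>x'\<in>X_paths T L s x0. \<forall>t\<in>{0..T}. norm (x' t - x t) \<le> e"
  shows "x \<in> X_paths T L s x0"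
proof -
  obtain K where "equi_lipschitz T L s x0 K" using X_paths_uniform[OF x0 L s] by blast
  note K = equi_lipschitzD[OF this]
  have eq: "x t = x0 t" if t: "t \<in> {0..s}" for t
  proof -
    have "norm (x0 t - x t) \<le> 0 + e" if "0 < e" for e
      using lim[OF that] t s X_pathsD(2)[of _ T L s x0 t] by force
    then have "norm (x0 t - x t) \<le> 0" by (rule field_le_epsilon)
    then show ?thesis by simp
  qed
  have lip: "norm (x t - x r) \<le> K * \<bar>t - r\<bar>" if rt: "r \<in> {s..T}" "t \<in> {s..T}" for r t
  proof (rule field_le_epsilon)
    fix e :: real assume "0 < e"
    then obtain x' where x': "x' \<in> X_paths T L s x0" "\<forall>t\<in>{0..T}. norm (x' t - x t) \<le> e / 2"
      using lim[of "e/2"] by auto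
    have "norm (x t - x r) \<le> norm (x t - x' t) + norm (x' t - x' r) + norm (x' r - x r)"
      using norm_triangle_ineq[of "x t - x' t" "x' t - x' r"] norm_triangle_ineq[of "x t - x' r" "x' r - x r"] by simp
    also have "\<dots> \<le> e / 2 + K * \<bar>t - r\<bar> + e / 2"
      using x'(2) K(3)[OF x'(1) rt] rt s by (intro add_mono) (auto simp: norm_minus_commute)
    finally show "norm (x t - x r) \<le> K * \<bar>t - r\<bar> + e" by simp
  qed
  have "continuous_on {s..T} x"
    by (rule lipschitz_on_continuous_on[of K], rule lipschitz_onI) (use lip K in \<open>auto simp: dist_norm\<close>)
  then have "glue T s x0 x \<in> cadlag_paths T"
    using eq s by (intro glue_cadlag x0) auto
  then have c: "x \<in> cadlag_paths T" using glue_self[OF ext eq] s by simp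
  show ?thesis
  proof (rule X_pathsI[OF c L s(1) eq])
    fix r t assume rt: "s \<le> r" "r \<le> t" "t \<le> T"
    show "norm (x t - x r) \<le> L * (1 + sup_norm_upto t x) * (t - r)"
    proof (rule field_le_epsilon)
      fix e :: real assume e: "0 < e"
      define e' where "e' = e / (2 + L * (t - r))"
      have den: "2 + L * (t - r) > 0" using L rt by (intro add_pos_nonneg) auto
      have e': "e' > 0" "e' * (2 + L * (t - r)) = e" using e den by (auto simp: e'_def)
      obtain x' where x': "x' \<in> X_paths T L s x0" "\<forall>t\<in>{0..T}. norm (x' t - x t) \<le> e'"
        using lim[OF e'(1)] by auto
      have "norm (x' q) \<le> sup_norm_upto t x + e'" if "q \<in> {0..t}" for q
      proof -
        have "norm (x' q) \<le> norm (x q) + norm (x' q - x q)" using norm_triangle_sub[of "x' q" "x q"] by simp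
        then show ?thesis using norm_le_sup_norm_upto[OF c that] x'(2) that rt by force
      qed
      then have "sup_norm_upto t x' \<le> sup_norm_upto t x + e'" using rt s by (intro sup_norm_upto_le) auto
      then have "L * (1 + sup_norm_upto t x') * (t - r) \<le> L * (1 + (sup_norm_upto t x + e')) * (t - r)"
        using L rt by (intro mult_right_mono mult_left_mono) auto
      moreover have "norm (x t - x r) \<le> norm (x t - x' t) + norm (x' t - x' r) + norm (x' r - x r)"
        using norm_triangle_ineq[of "x t - x' t" "x' t - x' r"] norm_triangle_ineq[of "x t - x' r" "x' r - x r"] by simp
      moreover have "norm (x t - x' t) \<le> e'" "norm (x' r - x r) \<le> e'"
        using x'(2) rt s by (auto simp: norm_minus_commute)
      moreover have "norm (x' t - x' r) \<le> L * (1 + sup_norm_upto t x') * (t - r)"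
        by (rule X_paths_increment[OF x'(1) L s(1) rt])
      ultimately have "norm (x t - x r) \<le> 2 * e' + L * (1 + (sup_norm_upto t x + e')) * (t - r)" by linarith
      also have "\<dots> = L * (1 + sup_norm_upto t x) * (t - r) + e' * (2 + L * (t - r))" by (simp add: algebra_simps)
      finally show "norm (x t - x r) \<le> L * (1 + sup_norm_upto t x) * (t - r) + e" using e' by simp
    qed
  qed
qed

lemma X_paths_self:
  assumes "x \<in> cadlag_paths T" "0 \<le> L" "0 \<le> s" "s \<le> T"
  shows "glue T s x (\<lambda>_. x s) \<in> X_paths T L s x"
proof (rule X_pathsI)
  show "glue T s x (\<lambda>_. x s) \<in> cadlag_paths T" by (rule glue_cadlag) (use assms in auto)
  fix r t assume "s \<le> r" "r \<le> t" "t \<le> T"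
  moreover from this have "0 \<le> sup_norm_upto t (glue T s x (\<lambda>_. x s))"
    using assms by (intro sup_norm_upto_nonneg[of _ T] glue_cadlag) auto
  ultimately show "norm (glue T s x (\<lambda>_. x s) t - glue T s x (\<lambda>_. x s) r) \<le>
      L * (1 + sup_norm_upto t (glue T s x (\<lambda>_. x s))) * (t - r)"
    using assms by (simp add: glue_after)
qed (use assms in \<open>auto simp: glue_before\<close>)

text \<open>
  On \<open>[s,T]\<close> the paths are uniformly bounded and equi-Lipschitz, and on \<open>[0,s]\<close> they coincide; so
  the Arzela-Ascoli theorem applies, and the limit is in the path set by its description through
  increments.
\<close>

lemma X_paths_compact:
  fixes x0 :: "real \<Rightarrow> 'd::euclidean_space"
  assumes x0: "x0 \<in> cadlag_paths T" and L: "0 \<le> L" and s: "0 \<le> s" "s \<le> T"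
    and xs: "\<And>n::nat. xs n \<in> X_paths T L s x0"
  obtains k x where "strict_mono (k::nat \<Rightarrow> nat)" "x \<in> X_paths T L s x0"
    "\<And>e. 0 < e \<Longrightarrow> \<exists>M. \<forall>n\<ge>M. \<forall>t\<in>{0..T}. norm (xs (k n) t - x t) < e"
proof -
  obtain K where "equi_lipschitz T L s x0 K" using X_paths_uniform[OF x0 L s] by blast
  note K = equi_lipschitzD[OF this]
  obtain g k where gk: "continuous_on {s..T} g" "strict_mono (k :: nat \<Rightarrow> nat)"
    "\<And>e. 0 < e \<Longrightarrow> \<exists>N. \<forall>n t. n \<ge> N \<and> t \<in> {s..T} \<longrightarrow> norm (xs (k n) t - g t) < e"
  proof (rule Arzela_Ascoli[of "{s..T}" xs K])
    show "norm (xs n t) \<le> K" if "t \<in> {s..T}" for n t using K(2)[OF xs] that s by auto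
    fix t e :: real assume t: "t \<in> {s..T}" and e: "0 < e"
    show "\<exists>d>0. \<forall>n y. y \<in> {s..T} \<and> norm (t - y) < d \<longrightarrow> norm (xs n t - xs n y) < e"
    proof (intro exI[of _ "e / (K + 1)"] conjI allI impI)
      show "0 < e / (K + 1)" using e K by simp
      fix n y assume y: "y \<in> {s..T} \<and> norm (t - y) < e / (K + 1)"
      then have "norm (xs n t - xs n y) \<le> K * \<bar>t - y\<bar>" using K(3)[OF xs, of y t n] t by auto
      also have "\<dots> \<le> K * (e / (K + 1))" using y K by (intro mult_left_mono) auto
      also have "\<dots> < e" using e K by (simp add: field_simps)
      finally show "norm (xs n t - xs n y) < e" .
    qed
  qed auto
  have gs: "g s = x0 s"
  proof -
    have "norm (x0 s - g s) \<le> 0 + e" if e: "0 < e" for e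
    proof -
      obtain N where "\<forall>n t. n \<ge> N \<and> t \<in> {s..T} \<longrightarrow> norm (xs (k n) t - g t) < e" using gk(3)[OF e] by blast
      then have "norm (xs (k N) s - g s) < e" using s by auto
      then show ?thesis using X_pathsD(2)[OF xs, of s "k N"] s by simp
    qed
    then have "norm (x0 s - g s) \<le> 0" by (rule field_le_epsilon)
    then show ?thesis by simp
  qed
  define x where "x = glue T s x0 g"
  have conv: "\<exists>M. \<forall>n\<ge>M. \<forall>t\<in>{0..T}. norm (xs (k n) t - x t) < e" if e: "0 < e" for e
  proof -
    obtain N where N: "\<forall>n t. n \<ge> N \<and> t \<in> {s..T} \<longrightarrow> norm (xs (k n) t - g t) < e" using gk(3)[OF e] by blast
    have "norm (xs (k n) t - x t) < e" if "n \<ge> N" "t \<in> {0..T}" for n t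
    proof (cases "t \<le> s")
      case True
      then show ?thesis using X_pathsD(2)[OF xs, of t "k n"] that e s by (simp add: x_def glue_before)
    next
      case False
      then show ?thesis using N that s gs by (simp add: x_def glue_after)
    qed
    then show ?thesis by blast
  qed
  have "x \<in> X_paths T L s x0"
  proof (rule X_paths_closed[OF x0 L s])
    show "x \<in> extensional {0..T}" by (simp add: x_def glue_def)
    fix e :: real assume "0 < e"
    then obtain M where "\<forall>n\<ge>M. \<forall>t\<in>{0..T}. norm (xs (k n) t - x t) < e" using conv by blast
    then show "\<exists>x'\<in>X_paths T L s x0. \<forall>t\<in>{0..T}. norm (x' t - x t) \<le> e"
      using xs[of "k M"] by (intro bexI[of _ "xs (k M)"]) (auto intro: less_imp_le)
  qed
  then show thesis using that gk(2) conv by blast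
qed

section \<open>Continuous functionals of stopped paths\<close>

lemma stopped_dist_le:
  assumes "0 \<le> T" "\<And>r. r \<in> {0..T} \<Longrightarrow> norm (x (min r t) - x' (min r t')) \<le> c"
  shows "stopped_dist T (t, x) (t', x') \<le> \<bar>t - t'\<bar> + c"
  unfolding stopped_dist_def using assms by (auto intro!: cSUP_least)

lemma stopped_dist_ge:
  fixes x x' :: "real \<Rightarrow> 'd::euclidean_space"
  assumes x: "x \<in> cadlag_paths T" "x' \<in> cadlag_paths T" and t: "t \<in> {0..T}" "t' \<in> {0..T}" and r: "r \<in> {0..T}"
  shows "\<bar>t - t'\<bar> + norm (x (min r t) - x' (min r t')) \<le> stopped_dist T (t, x) (t', x')"
proof -
  obtain B where B: "\<And>r. r \<in> {0..T} \<Longrightarrow> norm (x r) \<le> B" using cadlag_bound[OF x(1)] by blast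
  obtain B' where B': "\<And>r. r \<in> {0..T} \<Longrightarrow> norm (x' r) \<le> B'" using cadlag_bound[OF x(2)] by blast
  have "bdd_above ((\<lambda>r. norm (x (min r t) - x' (min r t'))) ` {0..T})"
  proof (rule bdd_aboveI2)
    fix r assume "r \<in> {0..T}"
    then have "norm (x (min r t)) \<le> B" "norm (x' (min r t')) \<le> B'" using t by (auto intro!: B B' simp: min_def)
    then show "norm (x (min r t) - x' (min r t')) \<le> B + B'"
      using norm_triangle_ineq4[of "x (min r t)" "x' (min r t')"] by linarith
  qed
  then show ?thesis using r unfolding stopped_dist_def by (auto intro!: cSUP_upper)
qed

lemma stopped_dist_triangle:
  fixes x x' x'' :: "real \<Rightarrow> 'd::euclidean_space"
  assumes "x \<in> cadlag_paths T" "x' \<in> cadlag_paths T" "x'' \<in> cadlag_paths T"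
    and "t \<in> {0..T}" "t' \<in> {0..T}" "t'' \<in> {0..T}"
  shows "stopped_dist T (t, x) (t'', x'') \<le> stopped_dist T (t, x) (t', x') + stopped_dist T (t', x') (t'', x'')"
proof -
  let ?c = "stopped_dist T (t, x) (t', x') - \<bar>t - t'\<bar> + (stopped_dist T (t', x') (t'', x'') - \<bar>t' - t''\<bar>)"
  have "stopped_dist T (t, x) (t'', x'') \<le> \<bar>t - t''\<bar> + ?c"
  proof (rule stopped_dist_le)
    fix r assume r: "r \<in> {0..T}"
    have "norm (x (min r t) - x'' (min r t'')) \<le> norm (x (min r t) - x' (min r t')) + norm (x' (min r t') - x'' (min r t''))"
      using norm_triangle_ineq[of "x (min r t) - x' (min r t')" "x' (min r t') - x'' (min r t'')"] by simp
    then show "norm (x (min r t) - x'' (min r t'')) \<le> ?c"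
      using stopped_dist_ge[OF assms(1,2,4,5) r] stopped_dist_ge[OF assms(2,3,5,6) r] by linarith
  qed (use assms in auto)
  then show ?thesis by linarith
qed

lemma stopped_dist_agree:
  assumes "t \<in> {0..T}" "\<And>r. r \<in> {0..t} \<Longrightarrow> x r = x' r"
  shows "stopped_dist T (t, x) (t, x') \<le> 0"
  using stopped_dist_le[of T x t x' t 0] assms by (auto simp: min_def)

definition continuous_paths :: "real \<Rightarrow> (real \<Rightarrow> (real \<Rightarrow> 'd::euclidean_space) \<Rightarrow> real) \<Rightarrow> bool" where
  "continuous_paths T u \<longleftrightarrow> lsc_paths T u \<and> usc_paths T u"

lemma continuous_pathsD:
  assumes "continuous_paths T u" "t \<in> {0..T}" "x \<in> cadlag_paths T" "0 < \<epsilon>"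
  obtains \<delta> where "0 < \<delta>" "\<And>s x'. s \<in> {0..T} \<Longrightarrow> x' \<in> cadlag_paths T \<Longrightarrow>
    stopped_dist T (t, x) (s, x') < \<delta> \<Longrightarrow> \<bar>u s x' - u t x\<bar> < \<epsilon>"
proof -
  obtain \<delta>1 where 1: "0 < \<delta>1" "\<And>s x'. s \<in> {0..T} \<Longrightarrow> x' \<in> cadlag_paths T \<Longrightarrow>
    stopped_dist T (t, x) (s, x') < \<delta>1 \<Longrightarrow> u s x' > u t x - \<epsilon>"
    using assms unfolding continuous_paths_def lsc_paths_def by meson
  obtain \<delta>2 where 2: "0 < \<delta>2" "\<And>s x'. s \<in> {0..T} \<Longrightarrow> x' \<in> cadlag_paths T \<Longrightarrow>
    stopped_dist T (t, x) (s, x') < \<delta>2 \<Longrightarrow> u s x' < u t x + \<epsilon>"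
    using assms unfolding continuous_paths_def usc_paths_def by meson
  show thesis
  proof (rule that[of "min \<delta>1 \<delta>2"])
    show "0 < min \<delta>1 \<delta>2" using 1 2 by simp
    fix s x' assume "s \<in> {0..T}" "x' \<in> cadlag_paths T" "stopped_dist T (t, x) (s, x') < min \<delta>1 \<delta>2"
    then have "u s x' > u t x - \<epsilon>" "u s x' < u t x + \<epsilon>" using 1(2)[of s x'] 2(2)[of s x'] by auto
    then show "\<bar>u s x' - u t x\<bar> < \<epsilon>" by linarith
  qed
qed

lemma continuous_pathsI:
  fixes u :: "real \<Rightarrow> (real \<Rightarrow> 'd::euclidean_space) \<Rightarrow> real"
  assumes "\<And>t x \<epsilon>. t \<in> {0..T} \<Longrightarrow> x \<in> cadlag_paths T \<Longrightarrow> 0 < \<epsilon> \<Longrightarrow> \<exists>\<delta>>0. \<forall>s\<in>{0..T}. \<forall>x'\<in>cadlag_paths T.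
    stopped_dist T (t, x) (s, x') < \<delta> \<longrightarrow> \<bar>u s x' - u t x\<bar> < \<epsilon>"
  shows "continuous_paths T u"
  unfolding continuous_paths_def lsc_paths_def usc_paths_def
proof (intro conjI ballI allI impI)
  fix t \<epsilon> :: real and x :: "real \<Rightarrow> 'd" assume *: "t \<in> {0..T}" "x \<in> cadlag_paths T" "0 < \<epsilon>"
  obtain \<delta> where \<delta>: "\<delta> > 0" "\<forall>s\<in>{0..T}. \<forall>x'\<in>cadlag_paths T. stopped_dist T (t, x) (s, x') < \<delta> \<longrightarrow> \<bar>u s x' - u t x\<bar> < \<epsilon>"
    using assms[OF *] by blast
  show "\<exists>\<delta>>0. \<forall>s\<in>{0..T}. \<forall>x'\<in>cadlag_paths T. stopped_dist T (t, x) (s, x') < \<delta> \<longrightarrow> u s x' > u t x - \<epsilon>"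
    using \<delta> by (intro exI[of _ \<delta>]) (auto simp: abs_less_iff algebra_simps)
  show "\<exists>\<delta>>0. \<forall>s\<in>{0..T}. \<forall>x'\<in>cadlag_paths T. stopped_dist T (t, x) (s, x') < \<delta> \<longrightarrow> u s x' < u t x + \<epsilon>"
    using \<delta> by (intro exI[of _ \<delta>]) (auto simp: abs_less_iff algebra_simps)
qed

text \<open>
  The stopped distance of two paths that agree up to \<open>t\<close> is zero.
\<close>

lemma continuous_paths_nonanticipative:
  assumes u: "continuous_paths T u" and t: "t \<in> {0..T}" and x: "x \<in> cadlag_paths T" "x' \<in> cadlag_paths T"
    and eq: "\<And>r. r \<in> {0..t} \<Longrightarrow> x r = x' r"
  shows "u t x = u t x'"
proof -
  have "\<bar>u t x' - u t x\<bar> \<le> 0 + e" if e: "0 < e" for e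
  proof -
    obtain \<delta> where "0 < \<delta>" "\<And>s x'. s \<in> {0..T} \<Longrightarrow> x' \<in> cadlag_paths T \<Longrightarrow>
      stopped_dist T (t, x) (s, x') < \<delta> \<Longrightarrow> \<bar>u s x' - u t x\<bar> < e"
      using continuous_pathsD[OF u t x(1) e] by blast
    then show ?thesis using stopped_dist_agree[OF t eq] t x by force
  qed
  then have "\<bar>u t x' - u t x\<bar> \<le> 0" by (rule field_le_epsilon)
  then show ?thesis by simp
qed

text \<open>
  For paths that are Lipschitz after \<open>s\<close>, freezing them at two times \<open>t\<close> and \<open>t'\<close> costs at most
  \<open>K \<bar>t - t'\<bar>\<close> beyond their distance up to the smaller time.
\<close>

lemma stopped_dist_X_le:
  assumes K: "0 \<le> K" and s: "0 \<le> s" and t: "t \<in> {s..T}" "t' \<in> {s..T}"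
    and lip: "\<And>r q. r \<in> {s..T} \<Longrightarrow> q \<in> {s..T} \<Longrightarrow> norm (x r - x q) \<le> K * \<bar>r - q\<bar>"
      "\<And>r q. r \<in> {s..T} \<Longrightarrow> q \<in> {s..T} \<Longrightarrow> norm (x' r - x' q) \<le> K * \<bar>r - q\<bar>"
    and c: "\<And>r. r \<in> {0..min t t'} \<Longrightarrow> norm (x r - x' r) \<le> c"
  shows "stopped_dist T (t, x) (t', x') \<le> (1 + K) * \<bar>t - t'\<bar> + c"
proof -
  have "stopped_dist T (t, x) (t', x') \<le> \<bar>t - t'\<bar> + (K * \<bar>t - t'\<bar> + c)"
  proof (rule stopped_dist_le)
    fix r assume r: "r \<in> {0..T}"
    let ?m = "min r (min t t')"
    have c': "norm (x ?m - x' ?m) \<le> c" using r t s by (intro c) auto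
    show "norm (x (min r t) - x' (min r t')) \<le> K * \<bar>t - t'\<bar> + c"
    proof (cases "t \<le> t'")
      case True
      have "norm (x' ?m - x' (min r t')) \<le> K * \<bar>t - t'\<bar>"
      proof (cases "r \<le> t")
        case True
        then have "?m = min r t'" using \<open>t \<le> t'\<close> by auto
        then show ?thesis using K by simp
      next
        case False
        then have "norm (x' ?m - x' (min r t')) \<le> K * \<bar>?m - min r t'\<bar>" using t True by (intro lip) auto
        also have "\<dots> \<le> K * \<bar>t - t'\<bar>" using True False K by (intro mult_left_mono) auto
        finally show ?thesis .
      qed
      moreover have "x (min r t) = x ?m" using True by (simp add: min_def)
      ultimately show ?thesis using c' norm_triangle_ineq[of "x ?m - x' ?m" "x' ?m - x' (min r t')"] by simp
    next
      case F: False
      have "norm (x (min r t) - x ?m) \<le> K * \<bar>t - t'\<bar>"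
      proof (cases "r \<le> t'")
        case True
        then have "?m = min r t" using F by auto
        then show ?thesis using K by simp
      next
        case False
        then have "norm (x (min r t) - x ?m) \<le> K * \<bar>min r t - ?m\<bar>" using t F by (intro lip) auto
        also have "\<dots> \<le> K * \<bar>t - t'\<bar>" using F False K by (intro mult_left_mono) auto
        finally show ?thesis .
      qed
      moreover have "x' (min r t') = x' ?m" using F by (simp add: min_def)
      ultimately show ?thesis using c' norm_triangle_ineq[of "x (min r t) - x ?m" "x ?m - x' ?m"] by simp
    qed
  qed (use t s in auto)
  then show ?thesis by (simp add: algebra_simps)
qed

lemma X_paths_seq_compact:
  fixes x0 :: "real \<Rightarrow> 'd::euclidean_space"
  assumes x0: "x0 \<in> cadlag_paths T" and L: "0 \<le> L" and s: "0 \<le> s" "s \<le> T"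
    and xs: "\<And>n::nat. xs n \<in> X_paths T L s x0" and ts: "\<And>n. ts n \<in> {s..T}"
  obtains k t x where "strict_mono (k::nat \<Rightarrow> nat)" "t \<in> {s..T}" "x \<in> X_paths T L s x0"
    "\<And>e. 0 < e \<Longrightarrow> \<exists>M. \<forall>n\<ge>M. stopped_dist T (t, x) (ts (k n), xs (k n)) < e"
proof -
  obtain K where "equi_lipschitz T L s x0 K" using X_paths_uniform[OF x0 L s] by blast
  note K = equi_lipschitzD[OF this]
  obtain k1 x where k1: "strict_mono (k1::nat \<Rightarrow> nat)" "x \<in> X_paths T L s x0"
    "\<And>e. 0 < e \<Longrightarrow> \<exists>M. \<forall>n\<ge>M. \<forall>t\<in>{0..T}. norm (xs (k1 n) t - x t) < e"
    using X_paths_compact[of x0 T L s xs, OF x0 L s xs] by blast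
  have "seq_compact {s..T}" using compact_imp_seq_compact by blast
  then obtain t k2 where k2: "t \<in> {s..T}" "strict_mono (k2::nat \<Rightarrow> nat)" "((ts \<circ> k1) \<circ> k2) \<longlonglongrightarrow> t"
    using ts seq_compactE[of "{s..T}" "ts \<circ> k1"] by (metis comp_apply)
  show thesis
  proof (rule that[of "k1 \<circ> k2" t x])
    show "strict_mono (k1 \<circ> k2)" using k1 k2 by (intro strict_mono_o)
    fix e :: real assume e: "0 < e"
    have "0 < e / (2 * (1 + K))" using e K by simp
    then obtain M1 where M1: "\<And>n. n \<ge> M1 \<Longrightarrow> \<bar>ts (k1 (k2 n)) - t\<bar> < e / (2 * (1 + K))"
      using k2(3) unfolding lim_sequentially by (force simp: dist_real_def)
    obtain M2 where M2: "\<And>n t. n \<ge> M2 \<Longrightarrow> t \<in> {0..T} \<Longrightarrow> norm (xs (k1 n) t - x t) < e / 2"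
      using k1(3)[OF half_gt_zero[OF e]] by blast
    have "stopped_dist T (t, x) (ts ((k1 \<circ> k2) n), xs ((k1 \<circ> k2) n)) < e" if n: "n \<ge> max M1 M2" for n
    proof -
      let ?t = "ts (k1 (k2 n))" let ?x = "xs (k1 (k2 n))"
      have "k2 n \<ge> M2" using n seq_suble[OF k2(2), of n] by linarith
      have "stopped_dist T (t, x) (?t, ?x) \<le> (1 + K) * \<bar>t - ?t\<bar> + e / 2"
      proof (rule stopped_dist_X_le[OF K(1) s(1) k2(1) ts])
        fix r assume "r \<in> {0..min t ?t}"
        then show "norm (x r - ?x r) \<le> e / 2"
          using M2[OF \<open>k2 n \<ge> M2\<close>, of r] k2(1) by (auto simp: norm_minus_commute)
      next
        show "norm (x r - x q) \<le> K * \<bar>r - q\<bar>" if "r \<in> {s..T}" "q \<in> {s..T}" for r q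
          by (rule K(3)[OF k1(2) that(2,1)])
        show "norm (?x r - ?x q) \<le> K * \<bar>r - q\<bar>" if "r \<in> {s..T}" "q \<in> {s..T}" for r q
          by (rule K(3)[OF xs that(2,1)])
      qed
      also have "(1 + K) * \<bar>t - ?t\<bar> < (1 + K) * (e / (2 * (1 + K)))"
        using M1[of n] n K by (intro mult_strict_left_mono) (auto simp: abs_minus_commute)
      also have "\<dots> = e / 2" using K by (simp add: field_simps)
      finally show ?thesis by simp
    qed
    then show "\<exists>M. \<forall>n\<ge>M. stopped_dist T (t, x) (ts ((k1 \<circ> k2) n), xs ((k1 \<circ> k2) n)) < e" by blast
  qed (use k1 k2 in auto)
qed

text \<open>
  A radius \<open>\<rho>\<close> that works for the tolerance \<open>\<eta>\<close> uniformly over all times and all paths of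
  the path set.
\<close>

definition path_modulus ::
  "real \<Rightarrow> real \<Rightarrow> real \<Rightarrow> (real \<Rightarrow> 'd::euclidean_space) \<Rightarrow> (real \<Rightarrow> (real \<Rightarrow> 'd) \<Rightarrow> real) \<Rightarrow> real \<Rightarrow> real \<Rightarrow> bool" where
  "path_modulus T L s x0 u \<eta> \<rho> \<longleftrightarrow> 0 < \<rho> \<and> (\<forall>t\<in>{s..T}. \<forall>t'\<in>{s..T}. \<forall>x\<in>X_paths T L s x0. \<forall>x'\<in>X_paths T L s x0.
     \<bar>t - t'\<bar> \<le> \<rho> \<longrightarrow> (\<forall>r\<in>{0..min t t'}. norm (x r - x' r) \<le> \<rho>) \<longrightarrow> \<bar>u t x - u t' x'\<bar> \<le> \<eta>)"

lemma path_modulusD: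
  assumes "path_modulus T L s x0 u \<eta> \<rho>"
  shows "0 < \<rho>" "\<And>t t' x x'. t \<in> {s..T} \<Longrightarrow> t' \<in> {s..T} \<Longrightarrow> x \<in> X_paths T L s x0 \<Longrightarrow> x' \<in> X_paths T L s x0 \<Longrightarrow>
     \<bar>t - t'\<bar> \<le> \<rho> \<Longrightarrow> (\<And>r. r \<in> {0..min t t'} \<Longrightarrow> norm (x r - x' r) \<le> \<rho>) \<Longrightarrow> \<bar>u t x - u t' x'\<bar> \<le> \<eta>"
  using assms unfolding path_modulus_def by blast+

text \<open>
  Uniform continuity on a compact set, by contradiction along a convergent subsequence. The distance
  of the paths is measured up to \<open>min t t'\<close> only, since the functional does not see more.
\<close>

lemma continuous_paths_uniform:
  fixes x0 :: "real \<Rightarrow> 'd::euclidean_space"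
  assumes u: "continuous_paths T u" and x0: "x0 \<in> cadlag_paths T" and L: "0 \<le> L" and s: "0 \<le> s" "s \<le> T"
    and \<eta>: "0 < \<eta>"
  obtains \<rho> where "path_modulus T L s x0 u \<eta> \<rho>"
proof (rule ccontr)
  assume neg: "\<not> thesis"
  have "\<exists>t t' x x'. t \<in> {s..T} \<and> t' \<in> {s..T} \<and> x \<in> X_paths T L s x0 \<and> x' \<in> X_paths T L s x0 \<and>
     \<bar>t - t'\<bar> \<le> 1 / real (Suc n) \<and> (\<forall>r\<in>{0..min t t'}. norm (x r - x' r) \<le> 1 / real (Suc n)) \<and> \<bar>u t x - u t' x'\<bar> > \<eta>" for n
  proof (rule ccontr)
    assume "\<nexists>t t' x x'. t \<in> {s..T} \<and> t' \<in> {s..T} \<and> x \<in> X_paths T L s x0 \<and> x' \<in> X_paths T L s x0 \<and>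
     \<bar>t - t'\<bar> \<le> 1 / real (Suc n) \<and> (\<forall>r\<in>{0..min t t'}. norm (x r - x' r) \<le> 1 / real (Suc n)) \<and> \<bar>u t x - u t' x'\<bar> > \<eta>"
    then have "path_modulus T L s x0 u \<eta> (1 / real (Suc n))"
      unfolding path_modulus_def by (force simp: not_less)
    then have "thesis" by (rule that)
    with neg show False by simp
  qed
  then obtain ts ts' xs xs' where seq: "\<And>n. ts n \<in> {s..T}" "\<And>n. ts' n \<in> {s..T}" "\<And>n. xs n \<in> X_paths T L s x0"
    "\<And>n. xs' n \<in> X_paths T L s x0" "\<And>n. \<bar>ts n - ts' n\<bar> \<le> 1 / real (Suc n)"
    "\<And>n r. r \<in> {0..min (ts n) (ts' n)} \<Longrightarrow> norm (xs n r - xs' n r) \<le> 1 / real (Suc n)"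
    "\<And>n. \<bar>u (ts n) (xs n) - u (ts' n) (xs' n)\<bar> > \<eta>"
    by metis
  obtain K where "equi_lipschitz T L s x0 K" using X_paths_uniform[OF x0 L s] by blast
  note K = equi_lipschitzD[OF this]
  obtain k t x where k: "strict_mono (k::nat \<Rightarrow> nat)" "t \<in> {s..T}" "x \<in> X_paths T L s x0"
    "\<And>e. 0 < e \<Longrightarrow> \<exists>M. \<forall>n\<ge>M. stopped_dist T (t, x) (ts (k n), xs (k n)) < e"
    using X_paths_seq_compact[of x0 T L s xs ts, OF x0 L s seq(3) seq(1)] by blast
  have t: "t \<in> {0..T}" using k(2) s by auto
  have ts: "ts n \<in> {0..T}" "ts' n \<in> {0..T}" for n using seq(1,2)[of n] s by auto
  have cad: "x \<in> cadlag_paths T" "xs n \<in> cadlag_paths T" "xs' n \<in> cadlag_paths T" for n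
    using X_pathsD(1) k(3) seq(3,4) by blast+
  have "\<eta> / 2 > 0" using \<eta> by simp
  from continuous_pathsD[OF u t cad(1) this]
  obtain \<delta> where \<delta>: "0 < \<delta>" "\<And>s x'. s \<in> {0..T} \<Longrightarrow> x' \<in> cadlag_paths T \<Longrightarrow>
    stopped_dist T (t, x) (s, x') < \<delta> \<Longrightarrow> \<bar>u s x' - u t x\<bar> < \<eta> / 2" by blast
  obtain M1 where M1: "\<And>n. n \<ge> M1 \<Longrightarrow> stopped_dist T (t, x) (ts (k n), xs (k n)) < \<delta> / 2"
    using k(4)[of "\<delta> / 2"] \<delta> by auto
  obtain M2 :: nat where M2: "real M2 > (2 + K) / (\<delta> / 2)" using reals_Archimedean2 by blast
  define n where "n = max M1 M2"
  have kn: "real (Suc (k n)) > (2 + K) / (\<delta> / 2)"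
  proof -
    have "real M2 \<le> real (Suc (k n))" using seq_suble[OF k(1), of n] by (simp add: n_def)
    then show ?thesis using M2 by linarith
  qed
  have small: "(2 + K) * (1 / real (Suc (k n))) < \<delta> / 2"
    using kn \<delta>(1) K by (simp add: field_simps)
  have 1: "stopped_dist T (t, x) (ts (k n), xs (k n)) < \<delta> / 2" using M1[of n] by (simp add: n_def)
  have "stopped_dist T (ts (k n), xs (k n)) (ts' (k n), xs' (k n)) \<le> (1 + K) * \<bar>ts (k n) - ts' (k n)\<bar> + 1 / real (Suc (k n))"
  proof (rule stopped_dist_X_le[OF K(1) s(1) seq(1,2)])
    show "norm (xs (k n) r - xs (k n) q) \<le> K * \<bar>r - q\<bar>" if "r \<in> {s..T}" "q \<in> {s..T}" for r q
      by (rule K(3)[OF seq(3) that(2,1)])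
    show "norm (xs' (k n) r - xs' (k n) q) \<le> K * \<bar>r - q\<bar>" if "r \<in> {s..T}" "q \<in> {s..T}" for r q
      by (rule K(3)[OF seq(4) that(2,1)])
  qed (rule seq(6))
  also have "\<dots> \<le> (1 + K) * (1 / real (Suc (k n))) + 1 / real (Suc (k n))"
    using seq(5)[of "k n"] K by (intro add_right_mono mult_left_mono) auto
  also have "\<dots> = (2 + K) * (1 / real (Suc (k n)))" by (simp add: add_divide_distrib[symmetric])
  finally have 2: "stopped_dist T (t, x) (ts' (k n), xs' (k n)) < \<delta>"
    using stopped_dist_triangle[OF cad(1) cad(2) cad(3) t ts(1) ts(2), of "k n" "k n" "k n" "k n"] 1 small by linarith
  have "\<bar>u (ts (k n)) (xs (k n)) - u t x\<bar> < \<eta> / 2" using \<delta>(2)[OF ts(1) cad(2)] 1 \<delta>(1) by force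
  moreover have "\<bar>u (ts' (k n)) (xs' (k n)) - u t x\<bar> < \<eta> / 2" using \<delta>(2)[OF ts(2) cad(3) 2] .
  ultimately show False using seq(7)[of "k n"] by linarith
qed

lemma continuous_paths_bounded:
  fixes x0 :: "real \<Rightarrow> 'd::euclidean_space"
  assumes u: "continuous_paths T u" and x0: "x0 \<in> cadlag_paths T" and L: "0 \<le> L" and s: "0 \<le> s" "s \<le> T"
  obtains B where "0 \<le> B" "\<And>t x. t \<in> {s..T} \<Longrightarrow> x \<in> X_paths T L s x0 \<Longrightarrow> \<bar>u t x\<bar> \<le> B"
proof (rule ccontr)
  assume neg: "\<not> thesis"
  have "\<exists>t x. t \<in> {s..T} \<and> x \<in> X_paths T L s x0 \<and> \<bar>u t x\<bar> > real n" for n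
  proof (rule ccontr)
    assume "\<nexists>t x. t \<in> {s..T} \<and> x \<in> X_paths T L s x0 \<and> \<bar>u t x\<bar> > real n"
    then have thesis by (intro that[of "real n"]) (force simp: not_less)+
    with neg show False by simp
  qed
  then obtain ts xs where seq: "\<And>n. ts n \<in> {s..T}" "\<And>n. xs n \<in> X_paths T L s x0" "\<And>n. \<bar>u (ts n) (xs n)\<bar> > real n"
    by metis
  obtain k t x where k: "strict_mono (k::nat \<Rightarrow> nat)" "t \<in> {s..T}" "x \<in> X_paths T L s x0"
    "\<And>e. 0 < e \<Longrightarrow> \<exists>M. \<forall>n\<ge>M. stopped_dist T (t, x) (ts (k n), xs (k n)) < e"
    using X_paths_seq_compact[of x0 T L s xs ts, OF x0 L s seq(2) seq(1)] by blast
  have t: "t \<in> {0..T}" using k(2) s by auto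
  obtain \<delta> where \<delta>: "0 < \<delta>" "\<And>s x'. s \<in> {0..T} \<Longrightarrow> x' \<in> cadlag_paths T \<Longrightarrow>
    stopped_dist T (t, x) (s, x') < \<delta> \<Longrightarrow> \<bar>u s x' - u t x\<bar> < 1"
    using continuous_pathsD[OF u t X_pathsD(1)[OF k(3)] zero_less_one] by blast
  obtain M1 where M1: "\<And>n. n \<ge> M1 \<Longrightarrow> stopped_dist T (t, x) (ts (k n), xs (k n)) < \<delta>"
    using k(4)[OF \<delta>(1)] by auto
  obtain M2 :: nat where M2: "real M2 > \<bar>u t x\<bar> + 1" using reals_Archimedean2 by blast
  define n where "n = max M1 M2"
  have "real M2 \<le> real (k n)" using seq_suble[OF k(1), of n] by (simp add: n_def)
  moreover have "\<bar>u (ts (k n)) (xs (k n)) - u t x\<bar> < 1"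
    using \<delta>(2)[of "ts (k n)" "xs (k n)"] M1[of n] seq(1)[of "k n"] X_pathsD(1)[OF seq(2)] s by (auto simp: n_def)
  ultimately show False using seq(3)[of "k n"] M2 by linarith
qed

lemma X_paths_functional_continuous:
  fixes x :: "real \<Rightarrow> 'd::euclidean_space"
  assumes u: "continuous_paths T u" and x0: "x0 \<in> cadlag_paths T" and L: "0 \<le> L" and s: "0 \<le> s" "s \<le> T"
    and x: "x \<in> X_paths T L s x0"
  shows "continuous_on {s..T} (\<lambda>t. u t x)"
  unfolding continuous_on_iff
proof (intro ballI allI impI)
  fix t e :: real assume t: "t \<in> {s..T}" and e: "0 < e"
  obtain \<rho> where "path_modulus T L s x0 u (e / 2) \<rho>"
    using continuous_paths_uniform[OF u x0 L s half_gt_zero[OF e]] by blast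
  note \<rho> = path_modulusD[OF this]
  show "\<exists>d>0. \<forall>t'\<in>{s..T}. dist t' t < d \<longrightarrow> dist (u t' x) (u t x) < e"
  proof (intro exI[of _ \<rho>] conjI ballI impI \<rho>(1))
    fix t' assume t': "t' \<in> {s..T}" "dist t' t < \<rho>"
    have "\<bar>u t' x - u t x\<bar> \<le> e / 2"
      by (rule \<rho>(2)[OF t'(1) t x x]) (use t'(2) \<rho>(1) in \<open>auto simp: dist_real_def\<close>)
    then show "dist (u t' x) (u t x) < e" using e by (simp add: dist_real_def)
  qed
qed

section \<open>Controls and the Hamiltonian\<close>

text \<open>
  Along a control, the data are measurable in time only after a change on a null set, namely that of
  the times at which they are not continuous in the control variable.
\<close>

lemma lebesgue_on_measurable_spike:
  fixes F G :: "real \<Rightarrow> 'b::euclidean_space"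
  assumes F: "F \<in> borel_measurable (lebesgue_on {a..b})" and N: "negligible N"
    and eq: "\<And>t. t \<in> {a<..<b} - N \<Longrightarrow> G t = F t"
  shows "G \<in> borel_measurable (lebesgue_on {a..b})"
proof -
  have S: "{a..b} \<in> sets lebesgue" by simp
  let ?N = "N \<union> {a, b}"
  have "negligible ?N" using N by auto
  then have null: "?N \<in> null_sets lebesgue" by (simp add: negligible_iff_null_sets)
  have "(\<lambda>t. if t \<in> {a..b} then F t else 0) \<in> borel_measurable lebesgue"
    using F by (rule borel_measurable_if_I) simp
  moreover have "AE t in lebesgue. (if t \<in> {a..b} then F t else 0) = (if t \<in> {a..b} then G t else 0)"
  proof (rule AE_I'[OF null], rule subsetI, rule ccontr)
    fix t assume "t \<in> {t \<in> space lebesgue. (if t \<in> {a..b} then F t else 0) \<noteq> (if t \<in> {a..b} then G t else 0)}"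
      and n: "t \<notin> ?N"
    then have "t \<in> {a..b}" "F t \<noteq> G t" by (auto split: if_splits)
    then show False using eq[of t] n by auto
  qed
  ultimately have "(\<lambda>t. if t \<in> {a..b} then G t else 0) \<in> borel_measurable lebesgue"
    by (rule borel_measurable_AE)
  then show ?thesis by (rule borel_measurable_if_D)
qed

lemma borel_on_imp_lebesgue_on:
  fixes F :: "real \<Rightarrow> 'b::euclidean_space"
  assumes "F \<in> borel_measurable (restrict_space borel {a..b})"
  shows "F \<in> borel_measurable (lebesgue_on {a..b})"
proof -
  have "(\<lambda>x. indicator {a..b} x *\<^sub>R F x) \<in> borel_measurable borel"
    using assms by (subst (asm) borel_measurable_restrict_space_iff) auto
  then have "(\<lambda>x. indicator {a..b} x *\<^sub>R F x) \<in> borel_measurable lebesgue"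
    by (intro measurable_completion) simp
  then show ?thesis by (subst borel_measurable_restrict_space_iff) auto
qed

lemma absolutely_integrable_mult_continuous:
  fixes F w :: "real \<Rightarrow> real"
  assumes F: "F absolutely_integrable_on {a..b}" and w: "continuous_on {a..b} w"
  shows "(\<lambda>t. F t * w t) absolutely_integrable_on {a..b}"
proof -
  have "(\<lambda>t. w t * F t) absolutely_integrable_on {a..b}"
  proof (rule absolutely_integrable_bounded_measurable_product_real[OF _ _ _ F])
    show "w \<in> borel_measurable (lebesgue_on {a..b})"
      by (rule continuous_imp_measurable_on_sets_lebesgue[OF w]) auto
    show "bounded (w ` {a..b})" using w by (intro compact_imp_bounded compact_continuous_image) auto
  qed auto
  then show ?thesis by (simp add: mult.commute)
qed

lemma INF_diff_le:
  fixes g g' :: "'a \<Rightarrow> real"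
  assumes "S \<noteq> {}" and bdd: "bdd_below (g ` S)" "bdd_below (g' ` S)"
    and le: "\<And>a. a \<in> S \<Longrightarrow> \<bar>g a - g' a\<bar> \<le> c"
  shows "\<bar>(INF a\<in>S. g a) - (INF a\<in>S. g' a)\<bar> \<le> c"
proof -
  have "(INF a\<in>S. g a) - c \<le> (INF a\<in>S. g' a)"
  proof (rule cINF_greatest[OF assms(1)])
    fix a assume a: "a \<in> S"
    show "(INF a\<in>S. g a) - c \<le> g' a" using cINF_lower[OF bdd(1) a] le[OF a] by linarith
  qed
  moreover have "(INF a\<in>S. g' a) - c \<le> (INF a\<in>S. g a)"
  proof (rule cINF_greatest[OF assms(1)])
    fix a assume a: "a \<in> S"
    show "(INF a\<in>S. g' a) - c \<le> g a" using cINF_lower[OF bdd(2) a] le[OF a] by linarith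
  qed
  ultimately show ?thesis by linarith
qed

text \<open>
  The standing assumptions with one common null set \<open>N\<close> for all almost-everywhere clauses.
  Continuity is recorded in the control variable alone, for a fixed path; continuity in the path is
  contained in the Lipschitz bound.
\<close>

locale control_data =
  fixes T Cf Clam Lf :: real and A :: "'p::polish_space set"
    and f :: "real \<Rightarrow> (real \<Rightarrow> 'd::euclidean_space) \<Rightarrow> 'p \<Rightarrow> 'd"
    and lam l :: "real \<Rightarrow> (real \<Rightarrow> 'd) \<Rightarrow> 'p \<Rightarrow> real"
    and h :: "(real \<Rightarrow> 'd) \<Rightarrow> real" and N :: "real set"
  assumes T_pos: "0 < T" and A_nonempty: "A \<noteq> {}" and N: "negligible N"
    and Cf: "0 \<le> Cf" and Clam: "0 \<le> Clam" and Lf: "0 \<le> Lf"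
    and lam_nonneg: "t \<in> {0..T} \<Longrightarrow> x \<in> cadlag_paths T \<Longrightarrow> a \<in> A \<Longrightarrow> 0 \<le> lam t x a"
    and data_continuous: "t \<in> {0<..<T} - N \<Longrightarrow> x \<in> cadlag_paths T \<Longrightarrow> continuous_on A (f t x)"
      "t \<in> {0<..<T} - N \<Longrightarrow> x \<in> cadlag_paths T \<Longrightarrow> continuous_on A (lam t x)"
      "t \<in> {0<..<T} - N \<Longrightarrow> x \<in> cadlag_paths T \<Longrightarrow> continuous_on A (l t x)"
    and data_measurable:
      "x \<in> cadlag_paths T \<Longrightarrow> a \<in> A \<Longrightarrow> (\<lambda>t. f t x a) \<in> borel_measurable (restrict_space borel {0..T})"
      "x \<in> cadlag_paths T \<Longrightarrow> a \<in> A \<Longrightarrow> (\<lambda>t. lam t x a) \<in> borel_measurable (restrict_space borel {0..T})"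
      "x \<in> cadlag_paths T \<Longrightarrow> a \<in> A \<Longrightarrow> (\<lambda>t. l t x a) \<in> borel_measurable (restrict_space borel {0..T})"
    and growth: "t \<in> {0<..<T} - N \<Longrightarrow> x \<in> cadlag_paths T \<Longrightarrow> a \<in> A \<Longrightarrow>
        norm (f t x a) + \<bar>l t x a\<bar> \<le> Cf * (1 + sup_norm_upto t x)"
    and lam_le: "t \<in> {0<..<T} - N \<Longrightarrow> x \<in> cadlag_paths T \<Longrightarrow> a \<in> A \<Longrightarrow> \<bar>lam t x a\<bar> \<le> Clam"
    and lipschitz: "t \<in> {0<..<T} - N \<Longrightarrow> x \<in> cadlag_paths T \<Longrightarrow> x' \<in> cadlag_paths T \<Longrightarrow> a \<in> A \<Longrightarrow>
        norm (f t x a - f t x' a) + \<bar>l t x a - l t x' a\<bar> + \<bar>lam t x a - lam t x' a\<bar> \<le> Lf * sup_dist t x x'"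
    and h_lipschitz: "x \<in> cadlag_paths T \<Longrightarrow> x' \<in> cadlag_paths T \<Longrightarrow> \<bar>h x - h x'\<bar> \<le> Lf * sup_dist T x x'"
begin

abbreviation "\<Omega> \<equiv> cadlag_paths T :: (real \<Rightarrow> 'd) set"
abbreviation "ham \<equiv> hamiltonian A f lam l"

text \<open>
  The expression under the infimum in the Hamiltonian.
\<close>

definition preham :: "real \<Rightarrow> (real \<Rightarrow> 'd) \<Rightarrow> 'p \<Rightarrow> real \<Rightarrow> 'd \<Rightarrow> real" where
  "preham t x a y z = l t x a + f t x a \<bullet> z - lam t x a * y"

lemma data_bound:
  assumes t: "t \<in> {0<..<T} - N" and x: "x \<in> \<Omega>" and a: "a \<in> A" and R: "\<And>r. r \<in> {0..t} \<Longrightarrow> norm (x r) \<le> R"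
  shows "norm (f t x a) \<le> Cf * (1 + R)" "\<bar>l t x a\<bar> \<le> Cf * (1 + R)" "\<bar>lam t x a\<bar> \<le> Clam" "0 \<le> lam t x a"
proof -
  have "Cf * (1 + sup_norm_upto t x) \<le> Cf * (1 + R)"
    using t R Cf by (intro mult_left_mono add_left_mono sup_norm_upto_le) auto
  then have "norm (f t x a) + \<bar>l t x a\<bar> \<le> Cf * (1 + R)" using growth[OF t x a] by linarith
  then show "norm (f t x a) \<le> Cf * (1 + R)" "\<bar>l t x a\<bar> \<le> Cf * (1 + R)"
    using norm_ge_zero[of "f t x a"] by linarith+
  show "\<bar>lam t x a\<bar> \<le> Clam" by (rule lam_le[OF t x a])
  show "0 \<le> lam t x a" using t by (intro lam_nonneg x a) auto
qed

lemma data_lipschitz: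
  assumes t: "t \<in> {0<..<T} - N" and x: "x \<in> \<Omega>" "x' \<in> \<Omega>" and a: "a \<in> A"
    and c: "\<And>r. r \<in> {0..t} \<Longrightarrow> norm (x r - x' r) \<le> c"
  shows "norm (f t x a - f t x' a) \<le> Lf * c" "\<bar>l t x a - l t x' a\<bar> \<le> Lf * c" "\<bar>lam t x a - lam t x' a\<bar> \<le> Lf * c"
proof -
  have "Lf * sup_dist t x x' \<le> Lf * c"
    using t c Lf by (intro mult_left_mono sup_dist_le) auto
  then have "norm (f t x a - f t x' a) + \<bar>l t x a - l t x' a\<bar> + \<bar>lam t x a - lam t x' a\<bar> \<le> Lf * c"
    using lipschitz[OF t x a] by linarith
  then show "norm (f t x a - f t x' a) \<le> Lf * c" "\<bar>l t x a - l t x' a\<bar> \<le> Lf * c" "\<bar>lam t x a - lam t x' a\<bar> \<le> Lf * c"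
    using norm_ge_zero[of "f t x a - f t x' a"] by linarith+
qed

text \<open>
  The Lipschitz bound at time \<open>t\<close> involves the paths up to time \<open>t\<close> only, so the data depend on the
  past.
\<close>

lemma data_nonanticipative:
  assumes t: "t \<in> {0<..<T} - N" and x: "x \<in> \<Omega>" "x' \<in> \<Omega>" and a: "a \<in> A"
    and c: "\<And>r. r \<in> {0..t} \<Longrightarrow> x r = x' r"
  shows "f t x a = f t x' a" "l t x a = l t x' a" "lam t x a = lam t x' a"
  using data_lipschitz[OF t x a, of 0] c by auto

lemma h_le:
  assumes "x \<in> \<Omega>" "x' \<in> \<Omega>" "\<And>r. r \<in> {0..T} \<Longrightarrow> norm (x r - x' r) \<le> c"
  shows "\<bar>h x - h x'\<bar> \<le> Lf * c"
  using h_lipschitz[OF assms(1,2)] mult_left_mono[OF sup_dist_le[of T x x' c] Lf] assms(3) T_pos by force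

lemma preham_bound:
  assumes t: "t \<in> {0<..<T} - N" and x: "x \<in> \<Omega>" and a: "a \<in> A" and R: "\<And>r. r \<in> {0..t} \<Longrightarrow> norm (x r) \<le> R"
  shows "\<bar>preham t x a y z\<bar> \<le> Cf * (1 + R) * (1 + norm z) + Clam * \<bar>y\<bar>"
proof -
  note b = data_bound[OF assms]
  have "\<bar>f t x a \<bullet> z\<bar> \<le> Cf * (1 + R) * norm z"
    using Cauchy_Schwarz_ineq2[of "f t x a" z] mult_right_mono[OF b(1), of "norm z"] by simp
  moreover have "\<bar>lam t x a * y\<bar> \<le> Clam * \<bar>y\<bar>" using b(3) by (simp add: abs_mult mult_right_mono)
  ultimately show ?thesis using b(2) unfolding preham_def by (simp add: algebra_simps abs_le_iff)
qed

lemma preham_lipschitz: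
  assumes t: "t \<in> {0<..<T} - N" and x: "x \<in> \<Omega>" "x' \<in> \<Omega>" and a: "a \<in> A"
    and c: "\<And>r. r \<in> {0..t} \<Longrightarrow> norm (x r - x' r) \<le> c"
  shows "\<bar>preham t x a y z - preham t x' a y' z\<bar> \<le> Lf * (1 + norm z + \<bar>y\<bar>) * c + Clam * \<bar>y - y'\<bar>"
proof -
  note b = data_lipschitz[OF assms]
  have "\<bar>(f t x a - f t x' a) \<bullet> z\<bar> \<le> Lf * c * norm z"
    using Cauchy_Schwarz_ineq2[of "f t x a - f t x' a" z] mult_right_mono[OF b(1), of "norm z"] by simp
  moreover have "\<bar>(lam t x a - lam t x' a) * y\<bar> \<le> Lf * c * \<bar>y\<bar>" using b(3) by (simp add: abs_mult mult_right_mono)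
  moreover have "\<bar>lam t x' a * (y - y')\<bar> \<le> Clam * \<bar>y - y'\<bar>"
    using lam_le[OF t x(2) a] by (simp add: abs_mult mult_right_mono)
  moreover have "preham t x a y z - preham t x' a y' z
      = (l t x a - l t x' a) + (f t x a - f t x' a) \<bullet> z - (lam t x a - lam t x' a) * y - lam t x' a * (y - y')"
    by (simp add: preham_def algebra_simps)
  ultimately have "\<bar>preham t x a y z - preham t x' a y' z\<bar>
      \<le> Lf * c + Lf * c * norm z + Lf * c * \<bar>y\<bar> + Clam * \<bar>y - y'\<bar>" using b(2) by linarith
  then show ?thesis by (simp add: algebra_simps)
qed

lemma ham_eq: "ham t x y z = (INF a\<in>A. preham t x a y z)"
  by (simp add: hamiltonian_def preham_def)

lemma preham_bdd_below:
  assumes t: "t \<in> {0<..<T} - N" and x: "x \<in> \<Omega>"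
  shows "bdd_below ((\<lambda>a. preham t x a y z) ` A)"
proof -
  obtain R where R: "\<And>r. r \<in> {0..T} \<Longrightarrow> norm (x r) \<le> R" using cadlag_bound[OF x] by blast
  show ?thesis
  proof (rule bdd_belowI2)
    fix a assume "a \<in> A"
    then show "- (Cf * (1 + R) * (1 + norm z) + Clam * \<bar>y\<bar>) \<le> preham t x a y z"
      using preham_bound[OF t x, of a R y z] R t by auto
  qed
qed

lemma ham_le:
  assumes "t \<in> {0<..<T} - N" "x \<in> \<Omega>" "a \<in> A"
  shows "ham t x y z \<le> preham t x a y z"
  unfolding ham_eq using preham_bdd_below[OF assms(1,2)] assms(3) by (rule cINF_lower)

lemma ham_bound:
  assumes t: "t \<in> {0<..<T} - N" and x: "x \<in> \<Omega>" and R: "\<And>r. r \<in> {0..t} \<Longrightarrow> norm (x r) \<le> R"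
  shows "\<bar>ham t x y z\<bar> \<le> Cf * (1 + R) * (1 + norm z) + Clam * \<bar>y\<bar>"
proof -
  obtain a where a: "a \<in> A" using A_nonempty by blast
  have "ham t x y z \<le> preham t x a y z" by (rule ham_le[OF t x a])
  moreover have "- (Cf * (1 + R) * (1 + norm z) + Clam * \<bar>y\<bar>) \<le> ham t x y z"
    unfolding ham_eq
  proof (rule cINF_greatest[OF A_nonempty])
    fix a assume "a \<in> A"
    from preham_bound[OF t x this R, of y z]
    show "- (Cf * (1 + R) * (1 + norm z) + Clam * \<bar>y\<bar>) \<le> preham t x a y z" by linarith
  qed
  ultimately show ?thesis using preham_bound[OF t x a R, of y z] by linarith
qed

lemma ham_lipschitz:
  assumes t: "t \<in> {0<..<T} - N" and x: "x \<in> \<Omega>" "x' \<in> \<Omega>"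
    and c: "\<And>r. r \<in> {0..t} \<Longrightarrow> norm (x r - x' r) \<le> c"
  shows "\<bar>ham t x y z - ham t x' y' z\<bar> \<le> Lf * (1 + norm z + \<bar>y\<bar>) * c + Clam * \<bar>y - y'\<bar>"
  unfolding ham_eq using A_nonempty
  by (intro INF_diff_le preham_bdd_below[OF t] x preham_lipschitz[OF t] c)

text \<open>
  A countable dense set of control values replaces the infimum over \<open>A\<close> by a countable one, makes
  the Hamiltonian measurable in time and allows measurable selection by least indices.
\<close>

lemma dense_sequence:
  obtains d :: "nat \<Rightarrow> 'p" where "\<And>n. d n \<in> A"
    "\<And>(g :: 'p \<Rightarrow> real) a e. continuous_on A g \<Longrightarrow> a \<in> A \<Longrightarrow> 0 < e \<Longrightarrow> \<exists>n. \<bar>g (d n) - g a\<bar> < e"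
    "\<And>a e. a \<in> A \<Longrightarrow> 0 < e \<Longrightarrow> \<exists>n. dist (d n) a < e"
proof -
  obtain D where D: "countable D" "D \<subseteq> A" "A \<subseteq> closure D" using separable[of A] by blast
  have "D \<noteq> {}" using D(3) A_nonempty by auto
  define d where "d = from_nat_into D"
  have r: "range d = D" unfolding d_def using D(1) \<open>D \<noteq> {}\<close> by (rule range_from_nat_into[rotated])
  have dA: "d n \<in> A" for n using r D(2) by auto
  have near: "\<exists>n. dist (d n) a < e" if "a \<in> A" "0 < e" for a e
  proof -
    have "a \<in> closure D" using that D(3) by blast
    then obtain b where "b \<in> D" "dist b a < e" using \<open>0 < e\<close> closure_approachable by metis
    then show ?thesis using r by (metis rangeE)
  qed
  show thesis
  proof (rule that[OF dA _ near])
    fix g :: "'p \<Rightarrow> real" and a and e :: real assume g: "continuous_on A g" and a: "a \<in> A" and e: "0 < e"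
    obtain \<delta> where \<delta>: "\<delta> > 0" "\<And>b. b \<in> A \<Longrightarrow> dist b a < \<delta> \<Longrightarrow> dist (g b) (g a) < e"
      using g a e unfolding continuous_on_iff by meson
    obtain n where "dist (d n) a < \<delta>" using near[OF a \<delta>(1)] by blast
    then show "\<exists>n. \<bar>g (d n) - g a\<bar> < e" using \<delta>(2)[OF dA] by (auto simp: dist_real_def)
  qed
qed

lemma control_in: "a \<in> controls T A \<Longrightarrow> t \<in> {0..T} \<Longrightarrow> a t \<in> A"
  unfolding controls_def using measurable_space[of a "restrict_space borel {0..T}" "restrict_space borel A" t]
  by (simp add: space_restrict_space)

lemma control_borel:
  assumes "a \<in> controls T A" shows "a \<in> borel_measurable (restrict_space borel {0..T})"
  using assms unfolding controls_def by (simp add: measurable_restrict_space2_iff)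

lemma controlI:
  assumes "a \<in> borel_measurable (restrict_space borel {0..T})" "\<And>t. t \<in> {0..T} \<Longrightarrow> a t \<in> A"
  shows "a \<in> controls T A"
  unfolding controls_def using assms by (auto simp: measurable_restrict_space2_iff space_restrict_space)

lemma control_concat:
  assumes "a \<in> controls T A" "a' \<in> controls T A"
  shows "(\<lambda>r. if r \<le> t then a r else a' r) \<in> controls T A"
proof (rule controlI)
  have "(\<lambda>r. r) \<in> borel_measurable (restrict_space borel {0..T})" by (intro measurable_restrict_space1) simp
  then have "Measurable.pred (restrict_space borel {0..T}) (\<lambda>r. r \<le> t)" by measurable
  then show "(\<lambda>r. if r \<le> t then a r else a' r) \<in> borel_measurable (restrict_space borel {0..T})"
    unfolding pred_def by (rule measurable_If[OF control_borel[OF assms(1)] control_borel[OF assms(2)]])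
qed (use assms control_in in auto)

lemma controls_nonempty: "controls T A \<noteq> {}"
proof -
  obtain a where "a \<in> A" using A_nonempty by blast
  then have "(\<lambda>_. a) \<in> controls T A" by (intro controlI) auto
  then show ?thesis by blast
qed

text \<open>
  The control is approximated by controls \<open>d (k n t)\<close> with countably many values: \<open>k n t\<close> is the
  first index whose point is within \<open>1 / (n + 1)\<close> of \<open>a t\<close>. Continuity in the control passes to the
  limit.
\<close>

lemma measurable_along_control:
  fixes g :: "real \<Rightarrow> 'p \<Rightarrow> 'b::euclidean_space"
  assumes a: "a \<in> controls T A"
    and gm: "\<And>b. b \<in> A \<Longrightarrow> (\<lambda>t. g t b) \<in> borel_measurable (restrict_space borel {0..T})"
    and gc: "\<And>t. t \<in> {0<..<T} - N \<Longrightarrow> continuous_on A (g t)"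
  shows "(\<lambda>t. g t (a t)) \<in> borel_measurable (lebesgue_on {0..T})"
proof -
  obtain d :: "nat \<Rightarrow> 'p" where d: "\<And>n. d n \<in> A" "\<And>a e. a \<in> A \<Longrightarrow> 0 < e \<Longrightarrow> \<exists>n. dist (d n) a < e"
    using dense_sequence by metis
  define k where "k = (\<lambda>n t. LEAST j. dist (d j) (a t) < 1 / real (Suc n))"
  have dk: "dist (d (k n t)) (a t) < 1 / real (Suc n)" if "t \<in> {0..T}" for n t
    unfolding k_def by (rule LeastI_ex, rule d(2)) (use control_in[OF a that] in auto)
  let ?B = "restrict_space borel {0..T} :: real measure"
  note am = control_borel[OF a]
  have km: "k n \<in> measurable ?B (count_space UNIV)" for n
    unfolding k_def using am by measurable
  have gk: "(\<lambda>t. g t (d (k n t))) \<in> borel_measurable ?B" for n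
    by (rule measurable_compose_countable[OF _ km]) (rule gm[OF d(1)])
  define N' where "N' = N \<union> {0, T}"
  have N': "negligible N'" using N by (auto simp: N'_def)
  define g' where "g' = (\<lambda>n t. if t \<in> N' then 0 else g t (d (k n t)))"
  have g'm: "g' n \<in> borel_measurable (lebesgue_on {0..T})" for n
    by (rule lebesgue_on_measurable_spike[OF borel_on_imp_lebesgue_on[OF gk] N']) (auto simp: g'_def)
  have lim: "(\<lambda>n. g' n t) \<longlonglongrightarrow> (if t \<in> N' then 0 else g t (a t))" if t: "t \<in> {0..T}" for t
  proof (cases "t \<in> N'")
    case False
    then have "t \<in> {0<..<T} - N" using t by (auto simp: N'_def)
    then have c: "continuous_on A (g t)" by (rule gc)
    have "(\<lambda>n. d (k n t)) \<longlonglongrightarrow> a t"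
    proof (rule metric_LIMSEQ_I)
      fix e :: real assume "0 < e"
      then obtain m where m: "1 / real (Suc m) < e" using nat_approx_posE by blast
      have "dist (d (k n t)) (a t) < e" if "n \<ge> m" for n
      proof -
        have "1 / real (Suc n) \<le> 1 / real (Suc m)" using that by (intro divide_left_mono) auto
        then show ?thesis using dk[OF t, of n] m by linarith
      qed
      then show "\<exists>m. \<forall>n\<ge>m. dist (d (k n t)) (a t) < e" by blast
    qed
    then have "(\<lambda>n. g t (d (k n t))) \<longlonglongrightarrow> g t (a t)"
      by (rule continuous_on_tendsto_compose[OF c]) (use control_in[OF a t] d(1) in auto)
    then show ?thesis using False by (simp add: g'_def)
  qed (simp add: g'_def)
  have "(\<lambda>t. if t \<in> N' then 0 else g t (a t)) \<in> borel_measurable (lebesgue_on {0..T})"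
    by (rule borel_measurable_LIMSEQ_metric[of g', OF g'm]) (use lim in \<open>simp add: space_restrict_space\<close>)
  then show ?thesis by (rule lebesgue_on_measurable_spike[OF _ N']) simp
qed

lemma along_measurable:
  assumes "x \<in> \<Omega>" "a \<in> controls T A"
  shows "(\<lambda>t. f t x (a t)) \<in> borel_measurable (lebesgue_on {0..T})"
    "(\<lambda>t. lam t x (a t)) \<in> borel_measurable (lebesgue_on {0..T})"
    "(\<lambda>t. l t x (a t)) \<in> borel_measurable (lebesgue_on {0..T})"
  by (rule measurable_along_control[OF assms(2)]; use assms data_measurable data_continuous in blast)+

lemma along_abs_integrable:
  assumes x: "x \<in> \<Omega>" and a: "a \<in> controls T A" and st: "0 \<le> s" "t \<le> T"
  shows "(\<lambda>r. f r x (a r)) absolutely_integrable_on {s..t}"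
    "(\<lambda>r. lam r x (a r)) absolutely_integrable_on {s..t}"
    "(\<lambda>r. l r x (a r)) absolutely_integrable_on {s..t}"
proof -
  obtain R where R: "\<And>r. r \<in> {0..T} \<Longrightarrow> norm (x r) \<le> R" using cadlag_bound[OF x] by blast
  have sub: "{s..t} \<subseteq> {0..T}" using st by auto
  note b = data_bound[OF _ x control_in[OF a]]
  show "(\<lambda>r. f r x (a r)) absolutely_integrable_on {s..t}"
    by (rule absolutely_integrable_on_subinterval[OF ae_bounded_absolutely_integrable[OF along_measurable(1)[OF x a] N b(1)[where R=R]] sub])
      (use R in auto)
  show "(\<lambda>r. lam r x (a r)) absolutely_integrable_on {s..t}"
    by (rule absolutely_integrable_on_subinterval[OF ae_bounded_absolutely_integrable[OF along_measurable(2)[OF x a] N, of Clam] sub])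
      (use b(3)[where R=R] R in auto)
  show "(\<lambda>r. l r x (a r)) absolutely_integrable_on {s..t}"
    by (rule absolutely_integrable_on_subinterval[OF ae_bounded_absolutely_integrable[OF along_measurable(3)[OF x a] N, of "Cf * (1 + R)"] sub])
      (use b(2)[where R=R] R in auto)
qed

lemma along_integrable:
  assumes x: "x \<in> \<Omega>" and a: "a \<in> controls T A" and st: "0 \<le> s" "t \<le> T"
  shows "(\<lambda>r. f r x (a r)) integrable_on {s..t}"
    "(\<lambda>r. lam r x (a r)) integrable_on {s..t}"
    "(\<lambda>r. l r x (a r)) integrable_on {s..t}"
  using along_abs_integrable[OF assms] set_lebesgue_integral_eq_integral(1) by blast+

lemma running_integrable:
  assumes x: "x \<in> \<Omega>" and a: "a \<in> controls T A" and st: "0 \<le> s" "t \<le> T" and w: "continuous_on {s..t} w"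
  shows "(\<lambda>r. lam r x (a r) * w r - l r x (a r)) integrable_on {s..t}"
    "(\<lambda>r. lam r x (a r) * w r) integrable_on {s..t}"
  using along_abs_integrable[OF x a st] absolutely_integrable_mult_continuous[OF _ w] set_lebesgue_integral_eq_integral(1)
  by (blast intro: Henstock_Kurzweil_Integration.integrable_diff)+

text \<open>
  At almost every time the infimum over \<open>A\<close> is the infimum over the dense sequence.
\<close>

lemma ham_measurable:
  assumes x: "x \<in> \<Omega>" and s: "0 \<le> s" and w: "w \<in> borel_measurable (lebesgue_on {s..T})"
  shows "(\<lambda>t. ham t x (w t) z) \<in> borel_measurable (lebesgue_on {s..T})"
proof -
  obtain d :: "nat \<Rightarrow> 'p" where d: "\<And>n. d n \<in> A"
    "\<And>(g :: 'p \<Rightarrow> real) a e. continuous_on A g \<Longrightarrow> a \<in> A \<Longrightarrow> 0 < e \<Longrightarrow> \<exists>n. \<bar>g (d n) - g a\<bar> < e"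
    using dense_sequence by metis
  define N' where "N' = N \<union> {0, T}"
  have N': "negligible N'" using N by (auto simp: N'_def)
  define g where "g = (\<lambda>n t. if t \<in> N' then 0 else preham t x (d n) (w t) z)"
  have sub: "{s..T} \<subseteq> {0..T}" using s by auto
  have m: "(\<lambda>t. f t x (d n)) \<in> borel_measurable (lebesgue_on {s..T})"
    "(\<lambda>t. lam t x (d n)) \<in> borel_measurable (lebesgue_on {s..T})"
    "(\<lambda>t. l t x (d n)) \<in> borel_measurable (lebesgue_on {s..T})" for n
    using data_measurable[OF x d(1)] by (auto intro!: measurable_restrict_mono[OF _ sub] borel_on_imp_lebesgue_on)
  have gm: "g n \<in> borel_measurable (lebesgue_on {s..T})" for n
  proof (rule lebesgue_on_measurable_spike[OF _ N'])
    show "(\<lambda>t. preham t x (d n) (w t) z) \<in> borel_measurable (lebesgue_on {s..T})"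
      unfolding preham_def using m[of n] w by measurable
  qed (simp add: g_def)
  have "(\<lambda>t. INF n. g n t) \<in> borel_measurable (lebesgue_on {s..T})"
  proof (rule borel_measurable_cINF)
    fix t assume "t \<in> space (lebesgue_on {s..T})"
    then have t: "t \<in> {s..T}" by (simp add: space_restrict_space)
    show "bdd_below ((\<lambda>n. g n t) ` UNIV)"
    proof (cases "t \<in> N'")
      case False
      then have "t \<in> {0<..<T} - N" using t s by (auto simp: N'_def)
      from preham_bdd_below[OF this x, of "w t" z]
      have "bdd_below ((\<lambda>a. preham t x a (w t) z) ` d ` UNIV)" by (rule bdd_below_mono) (use d in auto)
      then show ?thesis using False by (simp add: g_def image_image)
    qed (simp add: g_def)
  qed (use gm in auto)
  then show ?thesis
  proof (rule lebesgue_on_measurable_spike[OF _ N'])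
    fix t assume "t \<in> {s<..<T} - N'"
    then have t: "t \<in> {0<..<T} - N" and t': "t \<notin> N'" using s by (auto simp: N'_def)
    let ?g = "\<lambda>a. preham t x a (w t) z"
    have c: "continuous_on A ?g"
      unfolding preham_def by (intro continuous_intros data_continuous[OF t x])
    have "bdd_below (?g ` d ` UNIV)" by (rule bdd_below_mono[OF preham_bdd_below[OF t x]]) (use d in auto)
    then have bd: "bdd_below (range (\<lambda>n. ?g (d n)))" by (simp add: image_image)
    have "(INF a\<in>A. ?g a) = (INF n. ?g (d n))"
    proof (rule antisym)
      show "(INF a\<in>A. ?g a) \<le> (INF n. ?g (d n))"
        using d(1) by (intro cINF_greatest cINF_lower preham_bdd_below[OF t x]) auto
      show "(INF n. ?g (d n)) \<le> (INF a\<in>A. ?g a)"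
      proof (rule cINF_greatest[OF A_nonempty], rule field_le_epsilon)
        fix a and e :: real assume "a \<in> A" "0 < e"
        then obtain n where "\<bar>?g (d n) - ?g a\<bar> < e" using d(2)[OF c] by blast
        then show "(INF n. ?g (d n)) \<le> ?g a + e" using cINF_lower[OF bd UNIV_I, of n] by linarith
      qed
    qed
    then show "ham t x (w t) z = (INF n. g n t)" using t' by (simp add: ham_eq g_def)
  qed
qed

lemma ham_abs_integrable:
  assumes x: "x \<in> \<Omega>" and s: "0 \<le> s" and w: "continuous_on {s..T} w"
  shows "(\<lambda>t. ham t x (w t) z) absolutely_integrable_on {s..T}"
proof -
  obtain R where R: "\<And>r. r \<in> {0..T} \<Longrightarrow> norm (x r) \<le> R" using cadlag_bound[OF x] by blast
  have "bounded (w ` {s..T})" using w by (intro compact_imp_bounded compact_continuous_image) auto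
  then obtain B where B: "\<And>t. t \<in> {s..T} \<Longrightarrow> \<bar>w t\<bar> \<le> B" unfolding bounded_iff by fastforce
  show ?thesis
  proof (rule ae_bounded_absolutely_integrable[OF ham_measurable[OF x s] N])
    show "w \<in> borel_measurable (lebesgue_on {s..T})"
      by (rule continuous_imp_measurable_on_sets_lebesgue[OF w]) auto
    fix t assume t: "t \<in> {s<..<T} - N"
    then have "\<bar>ham t x (w t) z\<bar> \<le> Cf * (1 + R) * (1 + norm z) + Clam * \<bar>w t\<bar>"
      using s R by (intro ham_bound x) auto
    also have "\<dots> \<le> Cf * (1 + R) * (1 + norm z) + Clam * B"
      using B[of t] t Clam by (intro add_left_mono mult_left_mono) auto
    finally show "norm (ham t x (w t) z) \<le> Cf * (1 + R) * (1 + norm z) + Clam * B" by simp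
  qed
qed

lemma ham_integrable:
  assumes x: "x \<in> \<Omega>" and s: "0 \<le> s" "s \<le> r" "t \<le> T" and w: "continuous_on {s..T} w"
  shows "(\<lambda>q. ham q x (w q) z) integrable_on {r..t}"
proof -
  have "(\<lambda>t. ham t x (w t) z) integrable_on {s..T}"
    using ham_abs_integrable[OF x s(1) w] set_lebesgue_integral_eq_integral(1) by blast
  then show ?thesis by (rule integrable_on_subinterval) (use s in auto)
qed

text \<open>
  Measurable selection without an optimal control: the least index of the dense sequence that is
  such that the value at its point exceeds no other by more than \<open>\<eta> / 2\<close>. The path and the
  value \<open>c\<close> are frozen, so the selection depends on time alone and is an open-loop control.
\<close>

lemma almost_optimal_selection:
  assumes x: "x \<in> \<Omega>" and \<eta>: "0 < \<eta>"
  obtains a where "a \<in> controls T A" "\<And>t. t \<in> {0<..<T} - N \<Longrightarrow> preham t x (a t) c z \<le> ham t x c z + \<eta>"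
proof -
  obtain d :: "nat \<Rightarrow> 'p" where d: "\<And>n. d n \<in> A"
    "\<And>(g :: 'p \<Rightarrow> real) a e. continuous_on A g \<Longrightarrow> a \<in> A \<Longrightarrow> 0 < e \<Longrightarrow> \<exists>n. \<bar>g (d n) - g a\<bar> < e"
    using dense_sequence by metis
  let ?g = "\<lambda>t n. preham t x (d n) c z"
  \<comment> \<open>comparing with every \<open>j\<close> instead of with the infimum keeps the defining property measurable by
    countable operations; no such \<open>n\<close> need exist on the null set \<open>N\<close>, where \<open>LEAST\<close> returns some
    number\<close>
  define k where "k = (\<lambda>t. LEAST n. \<forall>j. ?g t n \<le> ?g t j + \<eta> / 2)"
  let ?B = "restrict_space borel {0..T} :: real measure"
  have gm: "(\<lambda>t. ?g t n) \<in> borel_measurable ?B" for n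
    unfolding preham_def using data_measurable[OF x d(1)[of n]] by measurable
  have km: "k \<in> measurable ?B (count_space UNIV)"
    unfolding k_def using gm by measurable
  define a where "a = (\<lambda>t. d (k t))"
  have "a \<in> controls T A"
  proof (rule controlI)
    show "a \<in> borel_measurable ?B"
      unfolding a_def by (rule measurable_compose[OF km]) simp
  qed (simp add: a_def d(1))
  moreover have "preham t x (a t) c z \<le> ham t x c z + \<eta>" if t: "t \<in> {0<..<T} - N" for t
  proof -
    have bd: "bdd_below (range (?g t))"
      by (rule bdd_below_mono[OF preham_bdd_below[OF t x, of c z]]) (use d(1) in auto)
    have "(INF n. ?g t n) < (INF n. ?g t n) + \<eta> / 2" using \<eta> by simp
    then obtain n where n: "?g t n < (INF n. ?g t n) + \<eta> / 2" using cINF_less_iff[OF UNIV_not_empty bd] by blast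
    have "\<exists>n. \<forall>j. ?g t n \<le> ?g t j + \<eta> / 2"
    proof (intro exI allI)
      fix j show "?g t n \<le> ?g t j + \<eta> / 2" using n cINF_lower[OF bd UNIV_I, of j] by linarith
    qed
    then have kk: "\<forall>j. ?g t (k t) \<le> ?g t j + \<eta> / 2" unfolding k_def by (rule LeastI_ex)
    have "?g t (k t) - \<eta> \<le> ham t x c z"
      unfolding ham_eq
    proof (rule cINF_greatest[OF A_nonempty])
      fix b assume b: "b \<in> A"
      have "continuous_on A (\<lambda>a. preham t x a c z)"
        unfolding preham_def by (intro continuous_intros data_continuous[OF t x])
      from d(2)[OF this b, of "\<eta> / 2"] \<eta> obtain j where "\<bar>?g t j - preham t x b c z\<bar> < \<eta> / 2" by auto
      moreover have "?g t (k t) \<le> ?g t j + \<eta> / 2" using kk by blast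
      ultimately show "?g t (k t) - \<eta> \<le> preham t x b c z" by linarith
    qed
    then show ?thesis by (simp add: a_def)
  qed
  ultimately show thesis by (rule that)
qed

section \<open>Controlled trajectories\<close>

abbreviation "traj \<equiv> trajectory T f"

text \<open>
  The integral form of the state equation, equivalent to the differential form by \<open>trajectory_iff\<close>
  and better suited to existence, uniqueness and concatenation.
\<close>

definition is_traj :: "real \<Rightarrow> (real \<Rightarrow> 'd) \<Rightarrow> (real \<Rightarrow> 'p) \<Rightarrow> (real \<Rightarrow> 'd) \<Rightarrow> bool" where
  "is_traj s x a \<phi> \<longleftrightarrow> \<phi> \<in> \<Omega> \<and> (\<forall>t\<in>{0..s}. \<phi> t = x t) \<and>
     (\<forall>t\<in>{s..T}. \<phi> t = x s + integral {s..t} (\<lambda>r. f r \<phi> (a r)))"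

lemma is_trajD:
  assumes "is_traj s x a \<phi>"
  shows "\<phi> \<in> \<Omega>" "\<And>t. t \<in> {0..s} \<Longrightarrow> \<phi> t = x t"
    "\<And>t. t \<in> {s..T} \<Longrightarrow> \<phi> t = x s + integral {s..t} (\<lambda>r. f r \<phi> (a r))"
  using assms by (auto simp: is_traj_def)

lemma is_traj_increment:
  assumes "is_traj s x a \<phi>" "a \<in> controls T A" "0 \<le> s" "s \<le> r" "r \<le> t" "t \<le> T"
  shows "\<phi> t - \<phi> r = integral {r..t} (\<lambda>r. f r \<phi> (a r))"
  using is_trajD(3)[OF assms(1), of t] is_trajD(3)[OF assms(1), of r] assms
    Henstock_Kurzweil_Integration.integral_combine[of s r t "\<lambda>r. f r \<phi> (a r)"]
    along_integrable(1)[OF is_trajD(1)[OF assms(1)] assms(2), of s t]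
  by (auto simp: algebra_simps)

lemma is_traj_X_paths:
  assumes \<phi>: "is_traj s x a \<phi>" and a: "a \<in> controls T A" and s: "0 \<le> s"
  shows "\<phi> \<in> X_paths T Cf s x"
proof (rule X_pathsI[OF is_trajD(1)[OF \<phi>] Cf s is_trajD(2)[OF \<phi>]])
  note c = is_trajD(1)[OF \<phi>]
  fix r t assume rt: "s \<le> r" "r \<le> t" "t \<le> T"
  have "norm (integral {r..t} (\<lambda>r. f r \<phi> (a r))) \<le> Cf * (1 + sup_norm_upto t \<phi>) * (t - r)"
  proof (rule norm_integral_le_const_ae[OF along_integrable(1)[OF c a] N rt(2)])
    fix q assume q: "q \<in> {r<..<t} - N"
    then have q': "q \<in> {0<..<T} - N" "a q \<in> A" using rt s control_in[OF a, of q] by auto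
    show "norm (f q \<phi> (a q)) \<le> Cf * (1 + sup_norm_upto t \<phi>)"
      using rt q by (intro data_bound(1)[OF q'(1) c q'(2)] norm_le_sup_norm_upto[OF c]) auto
  qed (use rt s in auto)
  then show "norm (\<phi> t - \<phi> r) \<le> Cf * (1 + sup_norm_upto t \<phi>) * (t - r)"
    using is_traj_increment[OF \<phi> a s rt] by simp
qed

lemma is_traj_unique:
  assumes \<phi>: "is_traj s x a \<phi>" and \<phi>': "is_traj s x a \<phi>'" and a: "a \<in> controls T A" and s: "0 \<le> s" "s \<le> T"
  shows "\<phi> = \<phi>'"
proof -
  note c = is_trajD(1)[OF \<phi>] and c' = is_trajD(1)[OF \<phi>']
  obtain R where R: "\<And>r. r \<in> {0..T} \<Longrightarrow> norm (\<phi> r) \<le> R" using cadlag_bound[OF c] by blast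
  obtain R' where R': "\<And>r. r \<in> {0..T} \<Longrightarrow> norm (\<phi>' r) \<le> R'" using cadlag_bound[OF c'] by blast
  let ?D = "\<lambda>r. f r \<phi> (a r) - f r \<phi>' (a r)"
  have after: "norm (\<phi> t - \<phi>' t) \<le> 2 * 0 * exp (2 * (Lf + 1) * (t - s))" if t: "t \<in> {s..T}" for t
  proof (rule gronwall_sup[where N=N and B="R + R'" and T=T and G="\<lambda>r. norm (?D r)"])
    fix t assume t: "t \<in> {s..T}"
    show "norm (\<phi> t - \<phi>' t) \<le> R + R'"
      using R[of t] R'[of t] t s norm_triangle_ineq4[of "\<phi> t" "\<phi>' t"] by auto
    have "?D absolutely_integrable_on {s..t}"
      using t s by (intro set_integral_diff along_abs_integrable c c' a) auto
    then have Di: "?D integrable_on {s..t}" "(\<lambda>r. norm (?D r)) integrable_on {s..t}"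
      by (auto simp: absolutely_integrable_on_def)
    then show "(\<lambda>r. norm (?D r)) integrable_on {s..t}" by simp
    have "\<phi> t - \<phi>' t = integral {s..t} ?D"
      using is_trajD(3)[OF \<phi> t] is_trajD(3)[OF \<phi>' t] along_integrable(1)[OF c a, of s t] along_integrable(1)[OF c' a, of s t] t s
      by (simp add: Henstock_Kurzweil_Integration.integral_diff)
    then show "norm (\<phi> t - \<phi>' t) \<le> 0 + integral {s..t} (\<lambda>r. norm (?D r))"
      using Henstock_Kurzweil_Integration.integral_norm_bound_integral[OF Di] by simp
  next
    fix r C assume r: "r \<in> {s<..<T} - N" and C: "0 \<le> C" "\<And>\<rho>. \<rho> \<in> {s..r} \<Longrightarrow> norm (\<phi> \<rho> - \<phi>' \<rho>) \<le> C"
    have r': "r \<in> {0<..<T} - N" "a r \<in> A" using r s control_in[OF a, of r] by auto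
    have "norm (?D r) \<le> Lf * C"
    proof (rule data_lipschitz(1)[OF r'(1) c c' r'(2)])
      fix \<rho> assume "\<rho> \<in> {0..r}"
      then show "norm (\<phi> \<rho> - \<phi>' \<rho>) \<le> C"
        using C is_trajD(2)[OF \<phi>, of \<rho>] is_trajD(2)[OF \<phi>', of \<rho>] by (cases "\<rho> \<le> s") auto
    qed
    also have "\<dots> \<le> (Lf + 1) * C" using C by (intro mult_right_mono) auto
    finally show "norm (?D r) \<le> (Lf + 1) * C" .
  qed (use t Lf N in auto)
  show ?thesis
  proof (rule extensionalityI[of _ "{0..T}"])
    show "\<phi> \<in> extensional {0..T}" "\<phi>' \<in> extensional {0..T}" using c c' by (auto simp: cadlag_paths_def)
    fix t assume t: "t \<in> {0..T}"
    show "\<phi> t = \<phi>' t"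
    proof (cases "t \<le> s")
      case True
      then show ?thesis using is_trajD(2)[OF \<phi>, of t] is_trajD(2)[OF \<phi>', of t] t by auto
    next
      case False
      then show ?thesis using after[of t] t by auto
    qed
  qed
qed

text \<open>
  Continuous functions \<open>q\<close> on \<open>[s,T]\<close> are turned into paths by shifting them so that they start at
  \<open>x s\<close> and attaching the initial segment. The shift makes every continuous \<open>q\<close> admissible for the
  fixed point theorem and costs a factor 2 in the Lipschitz constant; at the fixed point it
  vanishes.
\<close>

lemma is_traj_exists:
  assumes x: "x \<in> \<Omega>" and a: "a \<in> controls T A" and s: "0 \<le> s" "s \<le> T"
  obtains \<phi> where "is_traj s x a \<phi>"
proof -
  define P where "P = (\<lambda>q. glue T s x (\<lambda>r. q r + (x s - q s)))"
  have P: "P q \<in> \<Omega>" if "continuous_on {s..T} q" for q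
    unfolding P_def using that s x by (intro glue_cadlag continuous_intros) auto
  obtain q where q: "continuous_on {s..T} q"
    "\<And>t. t \<in> {s..T} \<Longrightarrow> q t = x s + integral {s..t} (\<lambda>r. f r (P q) (a r))"
  proof (rule picard[where F="\<lambda>t q. f t (P q) (a t)" and s=s and T=T and N=N and L="2 * Lf" and ?q0.0="x s"])
    show "(\<lambda>t. f t (P q) (a t)) integrable_on {s..T}" if "continuous_on {s..T} q" for q
      using along_integrable(1)[OF P[OF that] a] s by simp
    fix q q' :: "real \<Rightarrow> 'd" and t C
    assume q: "continuous_on {s..T} q" "continuous_on {s..T} q'" and t: "t \<in> {s<..<T} - N"
      and C: "\<And>r. r \<in> {s..t} \<Longrightarrow> norm (q r - q' r) \<le> C"
    have t': "t \<in> {0<..<T} - N" "a t \<in> A" using t s control_in[OF a, of t] by auto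
    have "norm (f t (P q) (a t) - f t (P q') (a t)) \<le> Lf * (2 * C)"
    proof (rule data_lipschitz(1)[OF t'(1) P P t'(2)])
      fix r assume r: "r \<in> {0..t}"
      have C0: "0 \<le> C" using C[of s] t by (auto intro: order_trans[OF norm_ge_zero])
      show "norm (P q r - P q' r) \<le> 2 * C"
      proof (cases "r \<le> s")
        case True
        then show ?thesis using r s C0 by (simp add: P_def glue_before)
      next
        case False
        have "norm ((q r - q' r) - (q s - q' s)) \<le> norm (q r - q' r) + norm (q s - q' s)"
          by (rule norm_triangle_ineq4)
        also have "\<dots> \<le> 2 * C" using C[of r] C[of s] False r t by auto
        finally show ?thesis using False r s t by (simp add: P_def glue_after algebra_simps)
      qed
    qed (use q in auto)
    then show "norm (f t (P q) (a t) - f t (P q') (a t)) \<le> 2 * Lf * C" by (simp add: algebra_simps)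
  qed (use s Lf N in auto)
  have qs: "q s = x s" using q(2)[of s] s by simp
  have "is_traj s x a (P q)"
    unfolding is_traj_def
  proof (intro conjI ballI)
    fix t assume t: "t \<in> {s..T}"
    then have "P q t = q t" using s qs by (simp add: P_def glue_after)
    also have "\<dots> = x s + integral {s..t} (\<lambda>r. f r (P q) (a r))" by (rule q(2)[OF t])
    finally show "P q t = x s + integral {s..t} (\<lambda>r. f r (P q) (a r))" .
  next
    fix t assume "t \<in> {0..s}"
    then show "P q t = x t" using s by (simp add: P_def glue_before)
  qed (rule P[OF q(1)])
  then show thesis by (rule that)
qed

lemma trajectory_iff:
  assumes x: "x \<in> \<Omega>" and a: "a \<in> controls T A" and s: "0 \<le> s" "s \<le> T"
  shows "(\<phi> \<in> cadlag_paths T \<and> abs_continuous_on_Icc s T \<phi> \<and> (\<forall>t\<in>{0..s}. \<phi> t = x t) \<and>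
        (AE t\<in>{s<..<T} in lebesgue. (\<phi> has_vector_derivative f t \<phi> (a t)) (at t))) \<longleftrightarrow> is_traj s x a \<phi>"
    (is "?P \<longleftrightarrow> _")
proof
  assume P: ?P
  then obtain M where M: "negligible M" "\<forall>t\<in>{s<..<T} - M. (\<phi> has_vector_derivative f t \<phi> (a t)) (at t)"
    unfolding ae_lebesgue_iff_negligible by blast
  have "\<phi> t = x s + integral {s..t} (\<lambda>r. f r \<phi> (a r))" if t: "t \<in> {s..T}" for t
  proof -
    have "((\<lambda>r. f r \<phi> (a r)) has_integral (\<phi> t - \<phi> s)) {s..t}"
    proof (rule abs_continuous_has_integral_derivative[OF _ _ M(1)])
      show "abs_continuous_on_Icc s t \<phi>" using P t abs_continuous_on_Icc_subset[of s T \<phi> s t] by auto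
    qed (use M t in auto)
    moreover have "\<phi> s = x s" using P s by auto
    ultimately show ?thesis by (simp add: integral_unique)
  qed
  then show "is_traj s x a \<phi>" using P by (auto simp: is_traj_def)
next
  assume \<phi>: "is_traj s x a \<phi>"
  note c = is_trajD(1)[OF \<phi>]
  have ac: "abs_continuous_on_Icc s T \<phi>" using is_traj_X_paths[OF \<phi> a s(1)] by (simp add: X_paths_def)
  obtain M where M: "negligible M" "\<And>t. t \<in> {s<..<T} - M \<Longrightarrow>
      ((\<lambda>u. integral {s..u} (\<lambda>r. f r \<phi> (a r))) has_vector_derivative f t \<phi> (a t)) (at t)"
    using indefinite_integral_ae_derivative[OF along_integrable(1)[OF c a s(1) order_refl]] by blast
  have "(\<phi> has_vector_derivative f t \<phi> (a t)) (at t)" if t: "t \<in> {s<..<T} - M" for t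
  proof (rule has_vector_derivative_transform_within_open[of _ _ _ "{s<..<T}"])
    show "((\<lambda>u. x s + integral {s..u} (\<lambda>r. f r \<phi> (a r))) has_vector_derivative f t \<phi> (a t)) (at t)"
      using has_vector_derivative_add[OF has_vector_derivative_const M(2)[OF t]] by simp
    show "x s + integral {s..u} (\<lambda>r. f r \<phi> (a r)) = \<phi> u" if "u \<in> {s<..<T}" for u
      using is_trajD(3)[OF \<phi>, of u] that by auto
  qed (use t in auto)
  then show ?P using c ac is_trajD(2)[OF \<phi>] M(1) unfolding ae_lebesgue_iff_negligible by blast
qed

lemma traj_is_traj:
  assumes x: "x \<in> \<Omega>" and a: "a \<in> controls T A" and s: "0 \<le> s" "s \<le> T"
  shows "is_traj s x a (traj s x a)"
proof -
  obtain \<phi> where \<phi>: "is_traj s x a \<phi>" using is_traj_exists[OF assms] .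
  show ?thesis
    unfolding trajectory_def trajectory_iff[OF assms]
    by (rule theI[of "is_traj s x a", OF \<phi>]) (rule is_traj_unique[OF _ \<phi> a s])
qed

lemma traj_eqI:
  assumes x: "x \<in> \<Omega>" and a: "a \<in> controls T A" and s: "0 \<le> s" "s \<le> T" and \<phi>: "is_traj s x a \<phi>"
  shows "traj s x a = \<phi>"
  using is_traj_unique[OF traj_is_traj[OF x a s] \<phi> a s] .

lemma traj_path:
  assumes x: "x \<in> \<Omega>" and a: "a \<in> controls T A" and s: "0 \<le> s" "s \<le> T"
  shows "traj s x a \<in> \<Omega>" "traj s x a \<in> X_paths T Cf s x" "\<And>t. t \<in> {0..s} \<Longrightarrow> traj s x a t = x t"
  using traj_is_traj[OF assms] is_trajD is_traj_X_paths[OF _ a s(1)] by blast+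

text \<open>
  Restarting a trajectory from itself at a later time with the same control continues it.
\<close>

lemma traj_flow:
  assumes x: "x \<in> \<Omega>" and a: "a \<in> controls T A" and s: "0 \<le> s" "s \<le> t" "t \<le> T"
  shows "traj t (traj s x a) a = traj s x a"
proof (rule traj_eqI)
  let ?\<phi> = "traj s x a"
  have "s \<le> T" using s by simp
  note \<phi> = traj_is_traj[OF x a s(1) this]
  show "?\<phi> \<in> \<Omega>" using \<phi> by (rule is_trajD)
  show "is_traj t ?\<phi> a ?\<phi>"
    unfolding is_traj_def
  proof (intro conjI ballI)
    fix r assume "r \<in> {t..T}"
    then show "?\<phi> r = ?\<phi> t + integral {t..r} (\<lambda>r. f r ?\<phi> (a r))"
      using is_traj_increment[OF \<phi> a s(1), of t r] s by (auto simp: algebra_simps)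
  qed (use is_trajD(1)[OF \<phi>] in auto)
qed (use a s in auto)

lemma traj_cong:
  assumes x: "x \<in> \<Omega>" "x' \<in> \<Omega>" and a: "a \<in> controls T A" "a' \<in> controls T A" and s: "0 \<le> s" "s \<le> T"
    and xx: "\<And>r. r \<in> {0..s} \<Longrightarrow> x r = x' r" and aa: "\<And>r. r \<in> {s<..<T} \<Longrightarrow> a r = a' r"
  shows "traj s x a = traj s x' a'"
proof (rule traj_eqI[OF x(1) a(1) s])
  let ?\<phi> = "traj s x' a'"
  note \<phi> = traj_is_traj[OF x(2) a(2) s]
  show "is_traj s x a ?\<phi>"
    unfolding is_traj_def
  proof (intro conjI ballI)
    fix t assume t: "t \<in> {s..T}"
    have "integral {s..t} (\<lambda>r. f r ?\<phi> (a' r)) = integral {s..t} (\<lambda>r. f r ?\<phi> (a r))"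
      by (rule integral_eq_ae[of "{}"]) (use t aa in auto)
    then show "?\<phi> t = x s + integral {s..t} (\<lambda>r. f r ?\<phi> (a r))"
      using is_trajD(3)[OF \<phi> t] xx[of s] s by simp
  qed (use is_trajD[OF \<phi>] xx in auto)
qed

lemma traj_concat:
  assumes x: "x \<in> \<Omega>" and a: "a \<in> controls T A" "a' \<in> controls T A" and s: "0 \<le> s" "s \<le> t" "t \<le> T"
    and aa: "\<And>r. r \<in> {s<..<t} \<Longrightarrow> a' r = a r"
  shows "traj s x a' = traj t (traj s x a) a'"
proof (rule traj_eqI[OF x a(2) s(1)])
  have sT: "s \<le> T" and t0: "0 \<le> t" using s by auto
  let ?\<phi> = "traj s x a"
  note \<phi> = traj_is_traj[OF x a(1) s(1) sT]
  let ?\<psi> = "traj t ?\<phi> a'"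
  note \<psi> = traj_is_traj[OF is_trajD(1)[OF \<phi>] a(2) t0 s(3)]
  have eq: "?\<psi> r = ?\<phi> r" if "r \<in> {0..t}" for r using is_trajD(2)[OF \<psi> that] .
  have before: "?\<psi> r = x s + integral {s..r} (\<lambda>r. f r ?\<psi> (a' r))" if r: "r \<in> {s..t}" for r
  proof -
    have "integral {s..r} (\<lambda>r. f r ?\<phi> (a r)) = integral {s..r} (\<lambda>r. f r ?\<psi> (a' r))"
    proof (rule integral_eq_ae[OF N])
      fix q assume q: "q \<in> {s<..<r} - N"
      have "f q ?\<phi> (a q) = f q ?\<psi> (a q)"
        using q r s by (intro data_nonanticipative(1) is_trajD(1)[OF \<phi>] is_trajD(1)[OF \<psi>] control_in a eq[symmetric]) auto
      then show "f q ?\<phi> (a q) = f q ?\<psi> (a' q)" using aa[of q] q r by auto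
    qed
    then show ?thesis using is_trajD(3)[OF \<phi>, of r] eq[of r] r s by auto
  qed
  show "is_traj s x a' ?\<psi>"
    unfolding is_traj_def
  proof (intro conjI ballI)
    fix r assume r: "r \<in> {0..s}"
    then show "?\<psi> r = x r" using eq[of r] is_trajD(2)[OF \<phi>, of r] s by auto
  next
    fix r assume r: "r \<in> {s..T}"
    show "?\<psi> r = x s + integral {s..r} (\<lambda>r. f r ?\<psi> (a' r))"
    proof (cases "r \<le> t")
      case True
      then show ?thesis using before r by auto
    next
      case False
      have "integral {s..t} (\<lambda>r. f r ?\<psi> (a' r)) + integral {t..r} (\<lambda>r. f r ?\<psi> (a' r)) = integral {s..r} (\<lambda>r. f r ?\<psi> (a' r))"
        by (rule Henstock_Kurzweil_Integration.integral_combine)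
          (use False r s along_integrable(1)[OF is_trajD(1)[OF \<psi>] a(2)] in auto)
      then show ?thesis
        using is_trajD(3)[OF \<psi>, of r] before[of t] eq[of t] False r s by (auto simp: algebra_simps)
    qed
  qed (rule is_trajD(1)[OF \<psi>])
qed (use s in auto)

section \<open>The discounted payoff along a trajectory\<close>

text \<open>
  The payoff from time \<open>t\<close> on, as a functional of an arbitrary path \<open>\<phi>\<close>; along the trajectory
  of \<open>a\<close> from \<open>s\<close> it is the payoff of restarting at \<open>t\<close>, which makes it a function of \<open>t\<close> on one
  fixed path.
\<close>

definition payoff :: "real \<Rightarrow> (real \<Rightarrow> 'd) \<Rightarrow> (real \<Rightarrow> 'p) \<Rightarrow> real" where
  "payoff t \<phi> a = integral {t..T} (\<lambda>r. exp (- integral {t..r} (\<lambda>q. lam q \<phi> (a q))) * l r \<phi> (a r))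
     + exp (- integral {t..T} (\<lambda>q. lam q \<phi> (a q))) * h \<phi>"

abbreviation "val \<equiv> value_function T A f lam l h"

lemma value_eq_payoff:
  assumes x: "x \<in> \<Omega>" and s: "0 \<le> s" "s \<le> T"
  shows "val s x = (INF a\<in>controls T A. payoff s (traj s x a) a)"
  unfolding value_function_def
proof (rule INF_cong[OF refl])
  fix a assume a: "a \<in> controls T A"
  let ?\<phi> = "traj s x a"
  note c = traj_path(1)[OF x a s]
  have d: "discount T f lam s x a t = exp (- integral {s..t} (\<lambda>q. lam q ?\<phi> (a q)))" if "t \<in> {s..T}" for t
    unfolding discount_def
    using set_lebesgue_integral_eq_integral(2)[OF along_abs_integrable(2)[OF c a s(1), of t]] that by simp
  have "(LINT t:{s..T}|lebesgue. discount T f lam s x a t * l t ?\<phi> (a t))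
      = (LINT t:{s..T}|lebesgue. l t ?\<phi> (a t) * exp (- integral {s..t} (\<lambda>q. lam q ?\<phi> (a q))))"
  proof (rule set_lebesgue_integral_cong, simp, intro allI impI)
    fix t assume "t \<in> {s..T}"
    then show "discount T f lam s x a t * l t ?\<phi> (a t) = l t ?\<phi> (a t) * exp (- integral {s..t} (\<lambda>q. lam q ?\<phi> (a q)))"
      by (simp only: d mult.commute)
  qed
  also have "\<dots> = integral {s..T} (\<lambda>t. l t ?\<phi> (a t) * exp (- integral {s..t} (\<lambda>q. lam q ?\<phi> (a q))))"
    by (intro set_lebesgue_integral_eq_integral(2) absolutely_integrable_mult_continuous
        along_abs_integrable c a s continuous_intros indefinite_integral_continuous_1 along_integrable) auto
  also have "\<dots> = integral {s..T} (\<lambda>t. exp (- integral {s..t} (\<lambda>q. lam q ?\<phi> (a q))) * l t ?\<phi> (a t))"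
    by (rule integral_cong) (rule mult.commute)
  finally have 1: "(LINT t:{s..T}|lebesgue. discount T f lam s x a t * l t ?\<phi> (a t)) = \<dots>" .
  have "T \<in> {s..T}" using s by simp
  then show "(LINT t:{s..T}|lebesgue. discount T f lam s x a t * l t ?\<phi> (a t)) + discount T f lam s x a T * h ?\<phi>
      = payoff s ?\<phi> a"
    unfolding 1 payoff_def by (simp only: d)
qed

text \<open>
  In this form payoffs are compared with one another and with other functionals without
  exponentials: the linear term has the rate \<open>lam \<ge> 0\<close>, which only helps backward in time.
\<close>

lemma payoff_ode:
  assumes \<phi>: "\<phi> \<in> \<Omega>" and a: "a \<in> controls T A" and s: "0 \<le> s"
  shows "continuous_on {s..T} (\<lambda>t. payoff t \<phi> a)"
    and "\<And>t1 t2. s \<le> t1 \<Longrightarrow> t1 \<le> t2 \<Longrightarrow> t2 \<le> T \<Longrightarrow> payoff t2 \<phi> a - payoff t1 \<phi> a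
      = integral {t1..t2} (\<lambda>r. lam r \<phi> (a r) * payoff r \<phi> a - l r \<phi> (a r))"
    and "payoff T \<phi> a = h \<phi>"
proof -
  obtain R where R: "0 \<le> R" "\<And>r. r \<in> {0..T} \<Longrightarrow> norm (\<phi> r) \<le> R" using cadlag_bound[OF \<phi>] by blast
  have b: "\<bar>lam t \<phi> (a t)\<bar> \<le> Clam" "\<bar>l t \<phi> (a t)\<bar> \<le> Cf * (1 + R)" if t: "t \<in> {s<..<T} - N" for t
  proof -
    have t': "t \<in> {0<..<T} - N" "a t \<in> A" using t s control_in[OF a, of t] by auto
    show "\<bar>lam t \<phi> (a t)\<bar> \<le> Clam" "\<bar>l t \<phi> (a t)\<bar> \<le> Cf * (1 + R)"
      using data_bound(2,3)[OF t'(1) \<phi> t'(2), of R] R t' by auto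
  qed
  have CR: "0 \<le> Cf * (1 + R)" using Cf R by simp
  note ode = discounted_payoff_ode[where c="h \<phi>", OF along_abs_integrable(2,3)[OF \<phi> a s order_refl] N Clam CR b]
  show "continuous_on {s..T} (\<lambda>t. payoff t \<phi> a)"
    unfolding payoff_def using ode(1) by simp
  show "payoff t2 \<phi> a - payoff t1 \<phi> a = integral {t1..t2} (\<lambda>r. lam r \<phi> (a r) * payoff r \<phi> a - l r \<phi> (a r))"
    if "s \<le> t1" "t1 \<le> t2" "t2 \<le> T" for t1 t2
    unfolding payoff_def by (rule ode(2)) (use that in auto)
  show "payoff T \<phi> a = h \<phi>" by (simp add: payoff_def)
qed

lemma payoff_cong:
  assumes "\<And>r. r \<in> {t<..<T} \<Longrightarrow> a r = a' r"
  shows "payoff t \<phi> a = payoff t \<phi> a'"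
proof -
  have 1: "integral {t..r} (\<lambda>q. lam q \<phi> (a q)) = integral {t..r} (\<lambda>q. lam q \<phi> (a' q))" if "r \<le> T" for r
    by (rule integral_eq_ae[of "{}"]) (use assms that in auto)
  have "integral {t..T} (\<lambda>r. exp (- integral {t..r} (\<lambda>q. lam q \<phi> (a q))) * l r \<phi> (a r))
      = integral {t..T} (\<lambda>r. exp (- integral {t..r} (\<lambda>q. lam q \<phi> (a' q))) * l r \<phi> (a' r))"
    by (rule integral_eq_ae[of "{}"]) (use assms 1 in auto)
  then show ?thesis unfolding payoff_def using 1[of T] by simp
qed

text \<open>
  Since \<open>lam \<ge> 0\<close>, a payoff is bounded by its terminal value plus the integral of the running
  cost; \<open>h\<close> is compared with its value at the zero path.
\<close>

definition payoff_bound :: "real \<Rightarrow> real" where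
  "payoff_bound R = \<bar>h (restrict (\<lambda>_. 0) {0..T})\<bar> + Lf * R + Cf * (1 + R) * T"

lemma zero_path: "restrict (\<lambda>_. 0) {0..T} \<in> \<Omega>"
  unfolding cadlag_paths_def
proof (intro CollectI conjI ballI)
    let ?z = "restrict (\<lambda>_. 0 :: 'd) {0..T}"
    fix t assume t: "t \<in> {0..<T}"
    have "eventually (\<lambda>u. 0 = ?z u) (at_right t)"
      unfolding eventually_at_right_field using t by (intro exI[of _ T]) auto
    then have "(?z \<longlongrightarrow> 0) (at_right t)" by (rule Lim_transform_eventually[OF tendsto_const])
    then show "(?z \<longlongrightarrow> ?z t) (at_right t)" using t by simp
  next
    let ?z = "restrict (\<lambda>_. 0 :: 'd) {0..T}"
    fix t assume t: "t \<in> {0<..T}"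
    have "eventually (\<lambda>u. 0 = ?z u) (at_left t)"
      unfolding eventually_at_left_field using t by (intro exI[of _ 0]) auto
    then have "(?z \<longlongrightarrow> 0) (at_left t)" by (rule Lim_transform_eventually[OF tendsto_const])
    then show "\<exists>c. (?z \<longlongrightarrow> c) (at_left t)" by blast
qed simp

text \<open>
  Both signs of the payoff are estimated from the linear equation up to the first time they vanish.
\<close>

lemma payoff_bound:
  assumes \<phi>: "\<phi> \<in> \<Omega>" and a: "a \<in> controls T A" and s: "0 \<le> s" "s \<le> T"
    and R: "\<And>r. r \<in> {0..T} \<Longrightarrow> norm (\<phi> r) \<le> R"
  shows "\<bar>payoff s \<phi> a\<bar> \<le> payoff_bound R"
proof -
  note ode = payoff_ode[OF \<phi> a s(1)]
  have R0: "0 \<le> R" using R[of 0] T_pos by (auto intro: order_trans[OF norm_ge_zero])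
  have CR: "0 \<le> Cf * (1 + R)" using Cf R0 by simp
  have hb: "\<bar>h \<phi>\<bar> \<le> \<bar>h (restrict (\<lambda>_. 0) {0..T})\<bar> + Lf * R"
    using h_le[OF \<phi> zero_path, of R] R by auto
  have key: "\<sigma> * payoff s \<phi> a \<le> (\<bar>h (restrict (\<lambda>_. 0) {0..T})\<bar> + Lf * R) + Cf * (1 + R) * T"
    if \<sigma>: "\<bar>\<sigma>\<bar> = 1" for \<sigma> :: real
  proof (rule first_zero_bound[OF s(2)])
    show "continuous_on {s..T} (\<lambda>t. \<sigma> * payoff t \<phi> a)" by (intro continuous_intros ode)
    have "\<bar>\<sigma> * payoff T \<phi> a\<bar> = \<bar>h \<phi>\<bar>" using \<sigma> ode(3) by (simp add: abs_mult)
    then show "\<sigma> * payoff T \<phi> a \<le> \<bar>h (restrict (\<lambda>_. 0) {0..T})\<bar> + Lf * R" using hb by linarith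
    show "0 \<le> \<bar>h (restrict (\<lambda>_. 0) {0..T})\<bar> + Lf * R" using Lf R0 by simp
    show "0 \<le> Cf * (1 + R) * T" using CR T_pos by simp
    fix t assume t: "s \<le> t" "t \<le> T" and pos: "\<And>r. r \<in> {s..t} \<Longrightarrow> 0 \<le> \<sigma> * payoff r \<phi> a"
    let ?g = "\<lambda>r. lam r \<phi> (a r) * payoff r \<phi> a - l r \<phi> (a r)"
    have gi: "?g integrable_on {s..t}"
      by (rule running_integrable) (use t s \<phi> a in \<open>auto intro: continuous_on_subset[OF ode(1)]\<close>)
    have "integral {s..t} (\<lambda>_. - (Cf * (1 + R))) \<le> integral {s..t} (\<lambda>r. \<sigma> * ?g r)"
    proof (rule integral_le_ae[OF _ _ N])
      show "(\<lambda>r. \<sigma> * ?g r) integrable_on {s..t}" by (rule integrable_on_mult_right[OF gi])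
      fix r assume r: "r \<in> {s<..<t} - N"
      have r': "r \<in> {0<..<T} - N" "a r \<in> A" using r t s control_in[OF a, of r] by auto
      have "\<bar>l r \<phi> (a r)\<bar> \<le> Cf * (1 + R)" "0 \<le> lam r \<phi> (a r)"
        using data_bound(2,4)[OF r'(1) \<phi> r'(2), of R] R r' by auto
      moreover have "\<bar>\<sigma> * l r \<phi> (a r)\<bar> = \<bar>l r \<phi> (a r)\<bar>" using \<sigma> by (simp add: abs_mult)
      moreover have "0 \<le> lam r \<phi> (a r) * (\<sigma> * payoff r \<phi> a)"
        using r by (intro mult_nonneg_nonneg[OF calculation(2) pos]) auto
      ultimately have "- (Cf * (1 + R)) \<le> lam r \<phi> (a r) * (\<sigma> * payoff r \<phi> a) - \<sigma> * l r \<phi> (a r)" by linarith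
      then show "- (Cf * (1 + R)) \<le> \<sigma> * ?g r" by (simp add: algebra_simps)
    qed (rule integrable_const_ivl)
    also have "integral {s..t} (\<lambda>r. \<sigma> * ?g r) = \<sigma> * payoff t \<phi> a - \<sigma> * payoff s \<phi> a"
      using ode(2)[of s t] t by (simp add: right_diff_distrib[symmetric])
    finally have "\<sigma> * payoff s \<phi> a \<le> \<sigma> * payoff t \<phi> a + Cf * (1 + R) * (t - s)" using t by (simp add: algebra_simps)
    also have "\<dots> \<le> \<sigma> * payoff t \<phi> a + Cf * (1 + R) * T" using CR t s by (intro add_left_mono mult_left_mono) auto
    finally show "\<sigma> * payoff s \<phi> a \<le> \<sigma> * payoff t \<phi> a + Cf * (1 + R) * T" .
  qed
  show ?thesis using key[of 1] key[of "-1"] by (simp add: payoff_bound_def abs_le_iff)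
qed

text \<open>
  The difference of two payoffs solves a linear equation with rate \<open>lam\<close> along the first path and a
  source bounded by the distance of the paths; again \<open>lam \<ge> 0\<close> makes the rate harmless.
\<close>

lemma payoff_lipschitz:
  assumes \<phi>: "\<phi> \<in> \<Omega>" "\<phi>' \<in> \<Omega>" and a: "a \<in> controls T A" and s: "0 \<le> s" "s \<le> T"
    and R: "\<And>r. r \<in> {0..T} \<Longrightarrow> norm (\<phi> r) \<le> R" "\<And>r. r \<in> {0..T} \<Longrightarrow> norm (\<phi>' r) \<le> R"
    and c: "\<And>r. r \<in> {0..T} \<Longrightarrow> norm (\<phi> r - \<phi>' r) \<le> c"
  shows "\<bar>payoff s \<phi> a - payoff s \<phi>' a\<bar> \<le> Lf * (1 + (1 + payoff_bound R) * T) * c"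
proof -
  have c0: "0 \<le> c" using c[of 0] T_pos by (auto intro: order_trans[OF norm_ge_zero])
  have half: "payoff s \<phi> a - payoff s \<phi>' a \<le> Lf * c + Lf * c * (1 + payoff_bound R) * T"
    if \<phi>: "\<phi> \<in> \<Omega>" "\<phi>' \<in> \<Omega>" and R: "\<And>r. r \<in> {0..T} \<Longrightarrow> norm (\<phi> r) \<le> R" "\<And>r. r \<in> {0..T} \<Longrightarrow> norm (\<phi>' r) \<le> R"
      and c: "\<And>r. r \<in> {0..T} \<Longrightarrow> norm (\<phi> r - \<phi>' r) \<le> c" for \<phi> \<phi>'
  proof (rule first_zero_bound[OF s(2)])
    note ode = payoff_ode[OF \<phi>(1) a s(1)] and ode' = payoff_ode[OF \<phi>(2) a s(1)]
    have PB: "0 \<le> payoff_bound R" using payoff_bound[OF \<phi>(1) a s R(1)] by linarith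
    then have Q: "0 \<le> Lf * c * (1 + payoff_bound R)" using c0 Lf by simp
    show "continuous_on {s..T} (\<lambda>t. payoff t \<phi> a - payoff t \<phi>' a)" by (intro continuous_intros ode ode')
    show "payoff T \<phi> a - payoff T \<phi>' a \<le> Lf * c"
      using h_le[OF \<phi> c] ode(3) ode'(3) by simp
    show "0 \<le> Lf * c" using Lf c0 by simp
    show "0 \<le> Lf * c * (1 + payoff_bound R) * T" using Q T_pos by simp
    fix t assume t: "s \<le> t" "t \<le> T" and pos: "\<And>r. r \<in> {s..t} \<Longrightarrow> 0 \<le> payoff r \<phi> a - payoff r \<phi>' a"
    let ?g = "\<lambda>r. lam r \<phi> (a r) * payoff r \<phi> a - l r \<phi> (a r)"
    let ?g' = "\<lambda>r. lam r \<phi>' (a r) * payoff r \<phi>' a - l r \<phi>' (a r)"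
    have gi: "?g integrable_on {s..t}" "?g' integrable_on {s..t}"
      by (rule running_integrable; use t s \<phi> a in \<open>auto intro: continuous_on_subset[OF ode(1)] continuous_on_subset[OF ode'(1)]\<close>)+
    have "integral {s..t} (\<lambda>_. - (Lf * c * (1 + payoff_bound R))) \<le> integral {s..t} (\<lambda>r. ?g r - ?g' r)"
    proof (rule integral_le_ae[OF _ _ N])
      show "(\<lambda>r. ?g r - ?g' r) integrable_on {s..t}" by (rule Henstock_Kurzweil_Integration.integrable_diff[OF gi])
      fix r assume r: "r \<in> {s<..<t} - N"
      have r': "r \<in> {0<..<T} - N" "a r \<in> A" using r t s control_in[OF a, of r] by auto
      note lip = data_lipschitz[OF r'(1) \<phi> r'(2), of c]
      have "\<bar>l r \<phi> (a r) - l r \<phi>' (a r)\<bar> \<le> Lf * c" "\<bar>lam r \<phi> (a r) - lam r \<phi>' (a r)\<bar> \<le> Lf * c"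
        using lip(2,3) c r' by auto
      moreover have "\<bar>payoff r \<phi>' a\<bar> \<le> payoff_bound R" using r t s by (intro payoff_bound \<phi> a R) auto
      ultimately have "\<bar>(lam r \<phi> (a r) - lam r \<phi>' (a r)) * payoff r \<phi>' a\<bar> \<le> Lf * c * payoff_bound R"
        using Lf c0 unfolding abs_mult by (intro mult_mono) auto
      moreover have "0 \<le> lam r \<phi> (a r) * (payoff r \<phi> a - payoff r \<phi>' a)"
        using data_bound(4)[OF r'(1) \<phi>(1) r'(2), of R] R r' pos[of r] r by (intro mult_nonneg_nonneg) auto
      moreover have "?g r - ?g' r = lam r \<phi> (a r) * (payoff r \<phi> a - payoff r \<phi>' a)
          + (lam r \<phi> (a r) - lam r \<phi>' (a r)) * payoff r \<phi>' a - (l r \<phi> (a r) - l r \<phi>' (a r))"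
        by (simp add: algebra_simps)
      moreover have "Lf * c * (1 + payoff_bound R) = Lf * c + Lf * c * payoff_bound R" by (simp add: algebra_simps)
      ultimately show "- (Lf * c * (1 + payoff_bound R)) \<le> ?g r - ?g' r"
        using \<open>\<bar>l r \<phi> (a r) - l r \<phi>' (a r)\<bar> \<le> Lf * c\<close> by linarith
    qed (rule integrable_const_ivl)
    also have "integral {s..t} (\<lambda>r. ?g r - ?g' r) = (payoff t \<phi> a - payoff s \<phi> a) - (payoff t \<phi>' a - payoff s \<phi>' a)"
      using ode(2)[of s t] ode'(2)[of s t] t gi by (simp add: Henstock_Kurzweil_Integration.integral_diff)
    finally have "payoff s \<phi> a - payoff s \<phi>' a \<le> payoff t \<phi> a - payoff t \<phi>' a + Lf * c * (1 + payoff_bound R) * (t - s)"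
      using t by (simp add: algebra_simps)
    also have "\<dots> \<le> payoff t \<phi> a - payoff t \<phi>' a + Lf * c * (1 + payoff_bound R) * T"
      using Q t s by (intro add_left_mono mult_left_mono) auto
    finally show "payoff s \<phi> a - payoff s \<phi>' a \<le> payoff t \<phi> a - payoff t \<phi>' a + Lf * c * (1 + payoff_bound R) * T" .
  qed
  have "payoff s \<phi> a - payoff s \<phi>' a \<le> Lf * c + Lf * c * (1 + payoff_bound R) * T"
    by (rule half[OF \<phi> R c])
  moreover have "payoff s \<phi>' a - payoff s \<phi> a \<le> Lf * c + Lf * c * (1 + payoff_bound R) * T"
    by (rule half[OF \<phi>(2,1) R(2,1)]) (use c in \<open>auto simp: norm_minus_commute\<close>)
  ultimately show ?thesis by (simp add: algebra_simps abs_le_iff)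
qed

section \<open>Continuity and dynamic programming for the value function\<close>

lemma val_bdd:
  assumes x: "x \<in> \<Omega>" and s: "0 \<le> s" "s \<le> T"
  shows "bdd_below ((\<lambda>a. payoff s (traj s x a) a) ` controls T A)"
proof -
  obtain R where R: "\<And>r. r \<in> {0..T} \<Longrightarrow> norm (x r) \<le> R" using cadlag_bound[OF x] by blast
  show ?thesis
  proof (rule bdd_belowI2)
    fix a assume a: "a \<in> controls T A"
    have "\<bar>payoff s (traj s x a) a\<bar> \<le> payoff_bound (path_bound T Cf R)"
      by (rule payoff_bound[OF traj_path(1)[OF x a s] a s], rule X_paths_bound[OF traj_path(2)[OF x a s] Cf s])
        (use R s in auto)
    then show "- payoff_bound (path_bound T Cf R) \<le> payoff s (traj s x a) a" by linarith
  qed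
qed

lemma val_le:
  assumes "x \<in> \<Omega>" "a \<in> controls T A" "0 \<le> s" "s \<le> T"
  shows "val s x \<le> payoff s (traj s x a) a"
  unfolding value_eq_payoff[OF assms(1,3,4)] using val_bdd[OF assms(1,3,4)] assms(2) by (rule cINF_lower)

lemma val_near:
  assumes x: "x \<in> \<Omega>" and s: "0 \<le> s" "s \<le> T" and e: "0 < e"
  obtains a where "a \<in> controls T A" "payoff s (traj s x a) a < val s x + e"
proof -
  have "(INF a\<in>controls T A. payoff s (traj s x a) a) < val s x + e"
    using e value_eq_payoff[OF x s] by simp
  then show thesis using that cINF_less_iff[OF controls_nonempty val_bdd[OF x s]] by blast
qed

lemma traj_terminal:
  assumes "x \<in> \<Omega>" "a \<in> controls T A"
  shows "traj T x a = x"
proof (rule traj_eqI)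
  show "is_traj T x a x" using assms by (auto simp: is_traj_def)
qed (use assms T_pos in auto)

lemma val_terminal:
  assumes x: "x \<in> \<Omega>" shows "val T x = h x"
proof -
  have "val T x = (INF a\<in>controls T A. payoff T (traj T x a) a)"
    using T_pos by (intro value_eq_payoff x) auto
  also have "\<dots> = (INF a\<in>controls T A. h x)"
    using traj_terminal[OF x] by (intro INF_cong) (auto simp: payoff_def)
  also have "\<dots> = h x" using controls_nonempty by simp
  finally show ?thesis .
qed

lemma val_nonanticipative:
  assumes x: "x \<in> \<Omega>" "x' \<in> \<Omega>" and s: "0 \<le> s" "s \<le> T" and eq: "\<And>r. r \<in> {0..s} \<Longrightarrow> x r = x' r"
  shows "val s x = val s x'"
  unfolding value_eq_payoff[OF x(1) s] value_eq_payoff[OF x(2) s]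
  by (rule INF_cong[OF refl]) (use traj_cong[OF x _ _ s eq] in auto)

text \<open>
  The two trajectories start at different times. Between \<open>s\<close> and \<open>s'\<close> the first one moves at bounded
  speed while the second one is still prescribed; from \<open>s'\<close> on, Gronwall's lemma applies. Adding the
  constant \<open>c1\<close> to the distance turns its running supremum after \<open>s'\<close> into a bound for the distance
  on the whole past.
\<close>

lemma traj_dist:
  assumes x: "x \<in> \<Omega>" "x' \<in> \<Omega>" and a: "a \<in> controls T A" and s: "0 \<le> s" "s \<le> s'" "s' \<le> T"
    and R: "\<And>r. r \<in> {0..s} \<Longrightarrow> norm (x r) \<le> R"
    and c: "0 \<le> c" "\<And>r. r \<in> {0..s} \<Longrightarrow> norm (x r - x' r) \<le> c" "\<And>r. r \<in> {s..s'} \<Longrightarrow> norm (x s - x' r) \<le> c"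
    and t: "t \<in> {0..T}"
  shows "norm (traj s x a t - traj s' x' a t)
    \<le> 4 * (c + Cf * (1 + path_bound T Cf R) * (s' - s)) * exp (2 * (Lf + 1) * T)"
proof -
  have sT: "s \<le> T" and s'0: "0 \<le> s'" using s by auto
  let ?\<phi> = "traj s x a" and ?\<phi>' = "traj s' x' a"
  note \<phi> = traj_is_traj[OF x(1) a s(1) sT] and \<phi>' = traj_is_traj[OF x(2) a s'0 s(3)]
  note X = traj_path(2)[OF x(1) a s(1) sT]
  note cad = is_trajD(1)[OF \<phi>] and cad' = is_trajD(1)[OF \<phi>']
  define R1 where "R1 = path_bound T Cf R"
  have R1: "norm (?\<phi> r) \<le> R1" if "r \<in> {0..T}" for r
    unfolding R1_def by (rule X_paths_bound[OF X Cf s(1) sT R that])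
  have R0: "0 \<le> R1" using R1[of 0] T_pos by (auto intro: order_trans[OF norm_ge_zero])
  define c1 where "c1 = c + Cf * (1 + R1) * (s' - s)"
  have K: "0 \<le> Cf * (1 + R1) * (s' - s)" using Cf R0 s by simp
  have c1: "0 \<le> c1" "c \<le> c1" using K c(1) by (auto simp: c1_def)
  have E: "1 \<le> exp (2 * (Lf + 1) * T)" using Lf T_pos by simp
  have before: "norm (?\<phi> r - ?\<phi>' r) \<le> c1" if r: "r \<in> {0..s'}" for r
  proof (cases "r \<le> s")
    case True
    then show ?thesis using c(2)[of r] c1 is_trajD(2)[OF \<phi>, of r] is_trajD(2)[OF \<phi>', of r] r by auto
  next
    case False
    have "norm (?\<phi> r - ?\<phi> s) \<le> Cf * (1 + sup_norm_upto r ?\<phi>) * (r - s)"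
      by (rule X_paths_increment[OF X Cf s(1)]) (use False r s in auto)
    also have "\<dots> \<le> Cf * (1 + R1) * (s' - s)"
      using False r s Cf R0 by (intro mult_mono mult_left_mono add_left_mono sup_norm_upto_le R1) (auto intro!: mult_nonneg_nonneg)
    finally have "norm (?\<phi> r - x s) \<le> Cf * (1 + R1) * (s' - s)" using is_trajD(2)[OF \<phi>, of s] s by simp
    moreover have "norm (x s - ?\<phi>' r) \<le> c" using c(3)[of r] False r is_trajD(2)[OF \<phi>', of r] s by auto
    ultimately show ?thesis using norm_triangle_ineq[of "?\<phi> r - x s" "x s - ?\<phi>' r"] by (simp add: c1_def)
  qed
  show ?thesis
  proof (cases "t \<le> s'")
    case True
    then have "norm (?\<phi> t - ?\<phi>' t) \<le> c1" using before t by auto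
    also have "\<dots> \<le> 4 * c1 * 1" using c1 by simp
    also have "\<dots> \<le> 4 * c1 * exp (2 * (Lf + 1) * T)" using c1 E by (intro mult_left_mono) auto
    finally show ?thesis by (simp add: c1_def R1_def)
  next
    case False
    obtain R2 where R2: "\<And>r. r \<in> {0..T} \<Longrightarrow> norm (?\<phi>' r) \<le> R2" using cadlag_bound[OF cad'] by blast
    let ?D = "\<lambda>r. f r ?\<phi> (a r) - f r ?\<phi>' (a r)"
    have "c1 + norm (?\<phi> t - ?\<phi>' t) \<le> 2 * (2 * c1) * exp (2 * (Lf + 1) * (t - s'))"
    proof (rule gronwall_sup[where N=N and T=T and B="c1 + (R1 + R2)" and G="\<lambda>r. norm (?D r)"])
      fix q assume q: "q \<in> {s'..T}"
      show "c1 + norm (?\<phi> q - ?\<phi>' q) \<le> c1 + (R1 + R2)"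
        using R1[of q] R2[of q] q s norm_triangle_ineq4[of "?\<phi> q" "?\<phi>' q"] by auto
      have "?D absolutely_integrable_on {s'..q}"
        using q s by (intro set_integral_diff along_abs_integrable cad cad' a) auto
      then have Di: "?D integrable_on {s'..q}" "(\<lambda>r. norm (?D r)) integrable_on {s'..q}"
        by (auto simp: absolutely_integrable_on_def)
      then show "(\<lambda>r. norm (?D r)) integrable_on {s'..q}" by simp
      have fi: "(\<lambda>r. f r ?\<phi> (a r)) integrable_on {s'..q}" "(\<lambda>r. f r ?\<phi>' (a r)) integrable_on {s'..q}"
        using q s by (auto intro!: along_integrable cad cad' a)
      have "(?\<phi> q - ?\<phi>' q) - (?\<phi> s' - ?\<phi>' s') = integral {s'..q} ?D"
        using is_traj_increment[OF \<phi> a s(1), of s' q] is_traj_increment[OF \<phi>' a s'0, of s' q] q s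
        by (simp add: Henstock_Kurzweil_Integration.integral_diff[OF fi] algebra_simps)
      then have "norm ((?\<phi> q - ?\<phi>' q) - (?\<phi> s' - ?\<phi>' s')) \<le> integral {s'..q} (\<lambda>r. norm (?D r))"
        using Henstock_Kurzweil_Integration.integral_norm_bound_integral[OF Di] by simp
      moreover have "norm (?\<phi> s' - ?\<phi>' s') \<le> c1" using before[of s'] s by auto
      ultimately show "c1 + norm (?\<phi> q - ?\<phi>' q) \<le> 2 * c1 + integral {s'..q} (\<lambda>r. norm (?D r))"
        using norm_triangle_sub[of "?\<phi> q - ?\<phi>' q" "?\<phi> s' - ?\<phi>' s'"] by linarith
    next
      fix r C assume r: "r \<in> {s'<..<T} - N" and C: "0 \<le> C" "\<And>\<rho>. \<rho> \<in> {s'..r} \<Longrightarrow> c1 + norm (?\<phi> \<rho> - ?\<phi>' \<rho>) \<le> C"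
      have r': "r \<in> {0<..<T} - N" "a r \<in> A" using r s control_in[OF a, of r] by auto
      have "c1 + norm (?\<phi> s' - ?\<phi>' s') \<le> C" using C(2)[of s'] r by auto
      then have c1C: "c1 \<le> C" using norm_ge_zero[of "?\<phi> s' - ?\<phi>' s'"] by linarith
      have "norm (?D r) \<le> Lf * C"
      proof (rule data_lipschitz(1)[OF r'(1) cad cad' r'(2)])
        fix \<rho> assume \<rho>: "\<rho> \<in> {0..r}"
        show "norm (?\<phi> \<rho> - ?\<phi>' \<rho>) \<le> C"
        proof (cases "\<rho> \<le> s'")
          case True
          then show ?thesis using before[of \<rho>] c1C \<rho> by auto
        next
          case False
          then have "c1 + norm (?\<phi> \<rho> - ?\<phi>' \<rho>) \<le> C" using \<rho> by (intro C(2)) auto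
          then show ?thesis using c1 by linarith
        qed
      qed
      also have "\<dots> \<le> (Lf + 1) * C" using C by (intro mult_right_mono) auto
      finally show "norm (?D r) \<le> (Lf + 1) * C" .
    qed (use False t Lf N c1 in auto)
    also have "\<dots> \<le> 2 * (2 * c1) * exp (2 * (Lf + 1) * T)"
      using c1 Lf t s by (intro mult_left_mono) (auto intro!: mult_left_mono)
    finally show ?thesis using c1 by (simp add: c1_def R1_def)
  qed
qed

text \<open>
  An estimate for a fixed control, uniform in the control, passes to the infimum. The right-hand
  side is what the stopped distance controls: \<open>c\<close> bounds the distance up to \<open>s\<close>, and between \<open>s\<close> and
  \<open>s'\<close> the distance of the second path from the frozen first one.
\<close>

lemma val_modulus:
  assumes R0: "0 \<le> R"
  obtains K where "0 \<le> K"
    "\<And>s s' x x' c. 0 \<le> s \<Longrightarrow> s \<le> s' \<Longrightarrow> s' \<le> T \<Longrightarrow> x \<in> \<Omega> \<Longrightarrow> x' \<in> \<Omega> \<Longrightarrow>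
      (\<And>r. r \<in> {0..s} \<Longrightarrow> norm (x r) \<le> R) \<Longrightarrow> (\<And>r. r \<in> {0..s'} \<Longrightarrow> norm (x' r) \<le> R) \<Longrightarrow>
      0 \<le> c \<Longrightarrow> (\<And>r. r \<in> {0..s} \<Longrightarrow> norm (x r - x' r) \<le> c) \<Longrightarrow> (\<And>r. r \<in> {s..s'} \<Longrightarrow> norm (x s - x' r) \<le> c) \<Longrightarrow>
      \<bar>val s x - val s' x'\<bar> \<le> K * (c + (s' - s))"
proof -
  define R1 where "R1 = path_bound T Cf R"
  have R1: "0 \<le> R1" using R0 by (simp add: R1_def path_bound_nonneg)
  define P where "P = payoff_bound R1"
  have P: "0 \<le> P" unfolding P_def payoff_bound_def using Lf Cf R1 T_pos by simp
  define K1 where "K1 = Cf * (1 + R1)"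
  have K1: "0 \<le> K1" using Cf R1 by (simp add: K1_def)
  define E where "E = exp (2 * (Lf + 1) * T)"
  define M where "M = Lf * (1 + (1 + P) * T)"
  have M: "0 \<le> M" using Lf P T_pos by (simp add: M_def)
  define K where "K = (Clam * P + K1) + M * (4 * (1 + K1) * E)"
  have K: "0 \<le> K" using Clam P K1 M by (simp add: K_def E_def)
  show thesis
  proof (rule that[OF K])
    fix s s' x x' c
    assume s: "0 \<le> s" "s \<le> s'" "s' \<le> T" and x: "x \<in> \<Omega>" "x' \<in> \<Omega>"
      and xR: "\<And>r. r \<in> {0..s} \<Longrightarrow> norm (x r) \<le> R" "\<And>r. r \<in> {0..s'} \<Longrightarrow> norm (x' r) \<le> R"
      and c: "0 \<le> c" "\<And>r. r \<in> {0..s} \<Longrightarrow> norm (x r - x' r) \<le> c" "\<And>r. r \<in> {s..s'} \<Longrightarrow> norm (x s - x' r) \<le> c"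
    have sT: "s \<le> T" and s'0: "0 \<le> s'" using s by auto
    have main: "\<bar>payoff s (traj s x a) a - payoff s' (traj s' x' a) a\<bar> \<le> K * (c + (s' - s))"
      if a: "a \<in> controls T A" for a
    proof -
      let ?\<phi> = "traj s x a" and ?\<phi>' = "traj s' x' a"
      note cad = traj_path(1)[OF x(1) a s(1) sT] and cad' = traj_path(1)[OF x(2) a s'0 s(3)]
      have b: "norm (?\<phi> r) \<le> R1" "norm (?\<phi>' r) \<le> R1" if "r \<in> {0..T}" for r
        unfolding R1_def
        using X_paths_bound[OF traj_path(2)[OF x(1) a s(1) sT] Cf s(1) sT xR(1) that]
          X_paths_bound[OF traj_path(2)[OF x(2) a s'0 s(3)] Cf s'0 s(3) xR(2) that] by auto
      note ode = payoff_ode[OF cad a s(1)]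
      have "\<bar>payoff s' ?\<phi> a - payoff s ?\<phi> a\<bar> \<le> (Clam * P + K1) * (s' - s)"
      proof -
        have "norm (integral {s..s'} (\<lambda>r. lam r ?\<phi> (a r) * payoff r ?\<phi> a - l r ?\<phi> (a r))) \<le> (Clam * P + K1) * (s' - s)"
        proof (rule norm_integral_le_const_ae[OF _ N s(2)])
          show "(\<lambda>r. lam r ?\<phi> (a r) * payoff r ?\<phi> a - l r ?\<phi> (a r)) integrable_on {s..s'}"
            by (rule running_integrable) (use s cad a in \<open>auto intro: continuous_on_subset[OF ode(1)]\<close>)
          fix r assume r: "r \<in> {s<..<s'} - N"
          have r': "r \<in> {0<..<T} - N" "a r \<in> A" using r s control_in[OF a, of r] by auto
          have 1: "\<bar>l r ?\<phi> (a r)\<bar> \<le> K1" "\<bar>lam r ?\<phi> (a r)\<bar> \<le> Clam"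
            unfolding K1_def using data_bound(2,3)[OF r'(1) cad r'(2), of R1] b(1) r' by auto
          have "\<bar>payoff r ?\<phi> a\<bar> \<le> P" unfolding P_def using r s by (intro payoff_bound cad a b) auto
          then have "\<bar>lam r ?\<phi> (a r) * payoff r ?\<phi> a\<bar> \<le> Clam * P"
            unfolding abs_mult using 1(2) Clam by (intro mult_mono) auto
          then show "norm (lam r ?\<phi> (a r) * payoff r ?\<phi> a - l r ?\<phi> (a r)) \<le> Clam * P + K1"
            using 1(1) by simp
        qed
        then show ?thesis using ode(2)[of s s'] s by simp
      qed
      moreover have "\<bar>payoff s' ?\<phi> a - payoff s' ?\<phi>' a\<bar> \<le> M * (4 * (c + K1 * (s' - s)) * E)"
        unfolding M_def P_def E_def K1_def R1_def
        by (rule payoff_lipschitz[OF cad cad' a s'0 s(3)])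
          (use b traj_dist[OF x a s xR(1) c] in \<open>auto simp: R1_def\<close>)
      moreover have "M * (4 * (c + K1 * (s' - s)) * E) \<le> M * (4 * ((1 + K1) * (c + (s' - s))) * E)"
      proof -
        have "c + K1 * (s' - s) \<le> (1 + K1) * (c + (s' - s))" using c(1) s mult_nonneg_nonneg[OF K1 c(1)] by (simp add: algebra_simps)
        then show ?thesis using M by (intro mult_left_mono mult_right_mono) (auto simp: E_def)
      qed
      moreover have "(Clam * P + K1) * (s' - s) \<le> (Clam * P + K1) * (c + (s' - s))"
        using c(1) Clam P K1 by (intro mult_left_mono) auto
      moreover have "K * (c + (s' - s)) = (Clam * P + K1) * (c + (s' - s)) + M * (4 * ((1 + K1) * (c + (s' - s))) * E)"
        by (simp add: K_def algebra_simps)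
      ultimately show ?thesis by linarith
    qed
    show "\<bar>val s x - val s' x'\<bar> \<le> K * (c + (s' - s))"
      unfolding value_eq_payoff[OF x(1) s(1) sT] value_eq_payoff[OF x(2) s'0 s(3)]
      by (rule INF_diff_le[OF controls_nonempty val_bdd[OF x(1) s(1) sT] val_bdd[OF x(2) s'0 s(3)] main])
  qed
qed

lemma val_continuous: "continuous_paths T val"
proof (rule continuous_pathsI)
  fix t x and \<epsilon> :: real assume t: "t \<in> {0..T}" and x: "x \<in> \<Omega>" and \<epsilon>: "0 < \<epsilon>"
  obtain R where R: "0 \<le> R" "\<And>r. r \<in> {0..T} \<Longrightarrow> norm (x r) \<le> R" using cadlag_bound[OF x] by blast
  have "0 \<le> R + 1" using R by simp
  from val_modulus[OF this] obtain K where K: "0 \<le> K"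
    "\<And>s s' x x' c. 0 \<le> s \<Longrightarrow> s \<le> s' \<Longrightarrow> s' \<le> T \<Longrightarrow> x \<in> \<Omega> \<Longrightarrow> x' \<in> \<Omega> \<Longrightarrow>
      (\<And>r. r \<in> {0..s} \<Longrightarrow> norm (x r) \<le> R + 1) \<Longrightarrow> (\<And>r. r \<in> {0..s'} \<Longrightarrow> norm (x' r) \<le> R + 1) \<Longrightarrow>
      0 \<le> c \<Longrightarrow> (\<And>r. r \<in> {0..s} \<Longrightarrow> norm (x r - x' r) \<le> c) \<Longrightarrow> (\<And>r. r \<in> {s..s'} \<Longrightarrow> norm (x s - x' r) \<le> c) \<Longrightarrow>
      \<bar>val s x - val s' x'\<bar> \<le> K * (c + (s' - s))" by blast
  define \<delta> where "\<delta> = min 1 (\<epsilon> / (2 * (K + 1)))"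
  have \<delta>: "0 < \<delta>" "\<delta> \<le> 1" "K * (2 * \<delta>) < \<epsilon>"
  proof -
    show "0 < \<delta>" "\<delta> \<le> 1" using \<epsilon> K by (auto simp: \<delta>_def)
    have "K * (2 * \<delta>) \<le> K * (2 * (\<epsilon> / (2 * (K + 1))))" using K by (intro mult_left_mono) (auto simp: \<delta>_def)
    also have "\<dots> < \<epsilon>" using K \<epsilon> by (simp add: field_simps)
    finally show "K * (2 * \<delta>) < \<epsilon>" .
  qed
  show "\<exists>\<delta>>0. \<forall>s\<in>{0..T}. \<forall>x'\<in>\<Omega>. stopped_dist T (t, x) (s, x') < \<delta> \<longrightarrow> \<bar>val s x' - val t x\<bar> < \<epsilon>"
  proof (intro exI[of _ \<delta>] conjI ballI impI \<delta>(1))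
    fix s x' assume s: "s \<in> {0..T}" and x': "x' \<in> \<Omega>" and d: "stopped_dist T (t, x) (s, x') < \<delta>"
    have D: "\<bar>t - s\<bar> + norm (x (min r t) - x' (min r s)) < \<delta>" if "r \<in> {0..T}" for r
      using stopped_dist_ge[OF x x' t s that] d by linarith
    have near: "norm (x (min r t) - x' (min r s)) \<le> \<delta>" if "r \<in> {0..T}" for r using D[OF that] by linarith
    have ts: "\<bar>t - s\<bar> \<le> \<delta>" using D[of 0] T_pos norm_ge_zero[of "x (min 0 t) - x' (min 0 s)"] by (simp del: norm_ge_zero)
    have xb: "norm (x r) \<le> R + 1" if "r \<in> {0..t}" for r using R(2)[of r] that t by auto
    have x'b: "norm (x' r) \<le> R + 1" if "r \<in> {0..s}" for r
    proof -
      have r: "r \<in> {0..T}" "min r s = r" using that s by auto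
      have "norm (x' r) \<le> norm (x (min r t)) + norm (x (min r t) - x' r)"
        using norm_triangle_ineq4[of "x (min r t)" "x (min r t) - x' r"] by simp
      moreover have "norm (x (min r t)) \<le> R" using r t by (intro R(2)) auto
      moreover have "norm (x (min r t) - x' r) \<le> \<delta>" using near[OF r(1)] r(2) by simp
      ultimately show ?thesis using \<delta>(2) by linarith
    qed
    have "\<bar>val s x' - val t x\<bar> \<le> K * (\<delta> + \<delta>)"
    proof (cases "t \<le> s")
      case True
      have "\<bar>val t x - val s x'\<bar> \<le> K * (\<delta> + (s - t))"
      proof (rule K(2))
        fix r assume r: "r \<in> {0..t}"
        then have "r \<in> {0..T}" "min r t = r" "min r s = r" using t True by auto
        then show "norm (x r - x' r) \<le> \<delta>" using near by metis
      next
        fix r assume r: "r \<in> {t..s}"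
        then have "r \<in> {0..T}" "min r t = t" "min r s = r" using t s True by auto
        then show "norm (x t - x' r) \<le> \<delta>" using near by metis
      qed (use t s True x x' xb x'b \<delta> in auto)
      also have "\<dots> \<le> K * (\<delta> + \<delta>)" using ts K by (intro mult_left_mono) auto
      finally show ?thesis by (simp add: abs_minus_commute)
    next
      case False
      have "\<bar>val s x' - val t x\<bar> \<le> K * (\<delta> + (t - s))"
      proof (rule K(2))
        fix r assume r: "r \<in> {0..s}"
        then have "r \<in> {0..T}" "min r t = r" "min r s = r" using t s False by auto
        then show "norm (x' r - x r) \<le> \<delta>" using near norm_minus_commute by metis
      next
        fix r assume r: "r \<in> {s..t}"
        then have "r \<in> {0..T}" "min r t = r" "min r s = s" using t s False by auto
        then show "norm (x' s - x r) \<le> \<delta>" using near norm_minus_commute by metis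
      qed (use t s False x x' xb x'b \<delta> in auto)
      also have "\<dots> \<le> K * (\<delta> + \<delta>)" using ts K by (intro mult_left_mono) auto
      finally show ?thesis .
    qed
    then show "\<bar>val s x' - val t x\<bar> < \<epsilon>" using \<delta>(3) by simp
  qed
qed

lemma val_along_continuous:
  assumes "x0 \<in> \<Omega>" "0 \<le> s" "s \<le> T" "x \<in> X_paths T Cf s x0"
  shows "continuous_on {s..T} (\<lambda>t. val t x)"
  by (rule X_paths_functional_continuous[OF val_continuous assms(1) Cf assms(2-)])

text \<open>
  An arbitrary control \<open>a\<close> up to \<open>q\<close> is completed by a nearly optimal one from \<open>q\<close> on. The payoff of
  the result is at least \<open>val\<close> on \<open>[p,q]\<close> and almost equal to it at \<open>q\<close>. Its linear equation has the
  monotone right-hand side \<open>lam J - l\<close>, so \<open>J\<close> may be replaced by the smaller \<open>val\<close> under the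
  integral.
\<close>

lemma dynamic_programming:
  assumes x: "x \<in> \<Omega>" and a: "a \<in> controls T A" and s: "0 \<le> s" "s \<le> p" "p \<le> q" "q \<le> T"
  shows "integral {p..q} (\<lambda>r. lam r (traj s x a) (a r) * val r (traj s x a) - l r (traj s x a) (a r))
    \<le> val q (traj s x a) - val p (traj s x a)"
proof -
  let ?\<phi> = "traj s x a"
  have sT: "s \<le> T" and p0: "0 \<le> p" "p \<le> T" and q0: "0 \<le> q" using s by auto
  note cad = traj_path(1)[OF x a s(1) sT] and X = traj_path(2)[OF x a s(1) sT]
  have wc: "continuous_on {p..q} (\<lambda>r. val r ?\<phi>)"
    by (rule continuous_on_subset[OF val_along_continuous[OF x s(1) sT X]]) (use s in auto)
  let ?I = "integral {p..q} (\<lambda>r. lam r ?\<phi> (a r) * val r ?\<phi> - l r ?\<phi> (a r))"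
  have "?I \<le> val q ?\<phi> - val p ?\<phi> + \<eta>" if \<eta>: "0 < \<eta>" for \<eta>
  proof -
    obtain a' where a': "a' \<in> controls T A" "payoff q (traj q ?\<phi> a') a' < val q ?\<phi> + \<eta>"
      using val_near[OF cad q0 s(4) \<eta>] by blast
    define b where "b = (\<lambda>r. if r \<le> q then a r else a' r)"
    have b: "b \<in> controls T A" unfolding b_def by (rule control_concat[OF a a'(1)])
    let ?\<psi> = "traj p ?\<phi> b"
    have \<psi>eq: "?\<psi> = traj q ?\<phi> a'"
    proof -
      have "?\<psi> = traj q (traj p ?\<phi> a) b"
        by (rule traj_concat[OF cad a b p0(1) s(3,4)]) (auto simp: b_def)
      also have "traj p ?\<phi> a = ?\<phi>" by (rule traj_flow[OF x a s(1,2) p0(2)])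
      also have "traj q ?\<phi> b = traj q ?\<phi> a'"
        by (rule traj_cong[OF cad cad b a'(1) q0 s(4)]) (auto simp: b_def)
      finally show ?thesis .
    qed
    note c\<psi> = traj_path(1)[OF cad b p0]
    have agree: "?\<psi> r = ?\<phi> r" if "r \<in> {0..q}" for r
      unfolding \<psi>eq by (rule traj_path(3)[OF cad a'(1) q0 s(4) that])
    note ode = payoff_ode[OF c\<psi> b p0(1)]
    have up: "val r ?\<phi> \<le> payoff r ?\<psi> b" if r: "r \<in> {p..q}" for r
    proof -
      have r0: "0 \<le> r" "r \<le> T" using r s by auto
      have "val r ?\<phi> = val r ?\<psi>" by (rule val_nonanticipative[OF cad c\<psi> r0]) (use agree r in auto)
      also have "\<dots> \<le> payoff r (traj r ?\<psi> b) b" by (rule val_le[OF c\<psi> b r0])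
      also have "traj r ?\<psi> b = ?\<psi>" by (rule traj_flow[OF cad b]) (use r s in auto)
      finally show ?thesis .
    qed
    have pq: "payoff q ?\<psi> b < val q ?\<phi> + \<eta>"
      using a'(2) payoff_cong[of q b a' ?\<psi>] unfolding \<psi>eq by (auto simp: b_def)
    have "?I \<le> integral {p..q} (\<lambda>r. lam r ?\<psi> (b r) * payoff r ?\<psi> b - l r ?\<psi> (b r))"
    proof (rule integral_le_ae[OF _ _ N])
      show "(\<lambda>r. lam r ?\<phi> (a r) * val r ?\<phi> - l r ?\<phi> (a r)) integrable_on {p..q}"
        by (rule running_integrable[OF cad a p0(1) s(4) wc])
      show "(\<lambda>r. lam r ?\<psi> (b r) * payoff r ?\<psi> b - l r ?\<psi> (b r)) integrable_on {p..q}"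
        by (rule running_integrable[OF c\<psi> b p0(1) s(4)]) (use s in \<open>auto intro: continuous_on_subset[OF ode(1)]\<close>)
      fix r assume r: "r \<in> {p<..<q} - N"
      have r': "r \<in> {0<..<T} - N" "a r \<in> A" using r s control_in[OF a, of r] by auto
      have br: "b r = a r" using r by (auto simp: b_def)
      have eq: "l r ?\<psi> (a r) = l r ?\<phi> (a r)" "lam r ?\<psi> (a r) = lam r ?\<phi> (a r)"
        by (rule data_nonanticipative(2,3)[OF r'(1) c\<psi> cad r'(2)]; use agree r in auto)+
      have "lam r ?\<phi> (a r) * val r ?\<phi> \<le> lam r ?\<phi> (a r) * payoff r ?\<psi> b"
        using r r' lam_nonneg[of r ?\<phi> "a r"] cad by (intro mult_left_mono up) auto
      then show "lam r ?\<phi> (a r) * val r ?\<phi> - l r ?\<phi> (a r) \<le> lam r ?\<psi> (b r) * payoff r ?\<psi> b - l r ?\<psi> (b r)"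
        unfolding br eq by simp
    qed
    also have "\<dots> = payoff q ?\<psi> b - payoff p ?\<psi> b" using ode(2)[of p q] s by simp
    also have "\<dots> \<le> val q ?\<phi> + \<eta> - val p ?\<phi>" using pq up[of p] s by auto
    finally show ?thesis by simp
  qed
  then show ?thesis by (rule field_le_epsilon)
qed

section \<open>The value function is a minimax solution\<close>

lemma ham_nonanticipative:
  assumes "t \<in> {0<..<T} - N" "x \<in> \<Omega>" "x' \<in> \<Omega>" "\<And>r. r \<in> {0..t} \<Longrightarrow> x r = x' r"
  shows "ham t x y z = ham t x' y z"
  using ham_lipschitz[OF assms(1-3), of 0 y z y] assms(4) by simp

lemma inner_running_integral:
  assumes x: "x \<in> \<Omega>" and a: "a \<in> controls T A" and s: "0 \<le> s" "s \<le> p" "p \<le> q" "q \<le> T"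
  shows "(\<lambda>r. f r (traj s x a) (a r) \<bullet> z) integrable_on {p..q}"
    and "integral {p..q} (\<lambda>r. f r (traj s x a) (a r) \<bullet> z) = (traj s x a q - traj s x a p) \<bullet> z"
proof -
  have sT: "s \<le> T" and p0: "0 \<le> p" using s by auto
  let ?\<phi> = "traj s x a"
  note \<phi> = traj_is_traj[OF x a s(1) sT]
  have I: "((\<lambda>r. f r ?\<phi> (a r)) has_integral (?\<phi> q - ?\<phi> p)) {p..q}"
    using along_integrable(1)[OF is_trajD(1)[OF \<phi>] a p0 s(4)] is_traj_increment[OF \<phi> a s]
    by (simp add: has_integral_integrable_integral)
  have "((\<lambda>r. f r ?\<phi> (a r) \<bullet> z) has_integral ((?\<phi> q - ?\<phi> p) \<bullet> z)) {p..q}"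
    using has_integral_linear[OF I bounded_linear_inner_left[of z]] by (simp add: comp_def)
  then show "(\<lambda>r. f r ?\<phi> (a r) \<bullet> z) integrable_on {p..q}"
    "integral {p..q} (\<lambda>r. f r ?\<phi> (a r) \<bullet> z) = (?\<phi> q - ?\<phi> p) \<bullet> z"
    by (auto simp: has_integral_integrable_integral)
qed

text \<open>
  The increment of \<open>y\<close> over \<open>[p,q]\<close> in the definition of a characteristic pair, with \<open>u\<close> in place of
  \<open>y\<close>. It involves no derivative of the path, and so is continuous under uniform convergence of
  paths.
\<close>

definition charac_drift :: "(real \<Rightarrow> (real \<Rightarrow> 'd) \<Rightarrow> real) \<Rightarrow> (real \<Rightarrow> 'd) \<Rightarrow> 'd \<Rightarrow> real \<Rightarrow> real \<Rightarrow> real" where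
  "charac_drift u x z p q = (x q - x p) \<bullet> z - integral {p..q} (\<lambda>r. ham r x (u r x) z)"

text \<open>
  Approximate drift inequalities along paths of the compact path set pass to a limit path.
\<close>

lemma charac_drift_limit:
  assumes u: "continuous_paths T u" and x0: "x0 \<in> \<Omega>" and s: "0 \<le> s0" "s0 \<le> T" and \<sigma>: "\<bar>\<sigma>\<bar> = 1"
    and approx: "\<And>\<eta>. 0 < \<eta> \<Longrightarrow> \<exists>\<phi>\<in>X_paths T Cf s0 x0. \<forall>p q. s0 \<le> p \<longrightarrow> p \<le> q \<longrightarrow> q \<le> T \<longrightarrow>
      \<sigma> * charac_drift u \<phi> z p q - \<eta> \<le> \<sigma> * (u q \<phi> - u p \<phi>)"
  obtains x where "x \<in> X_paths T Cf s0 x0"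
    "\<And>p q. s0 \<le> p \<Longrightarrow> p \<le> q \<Longrightarrow> q \<le> T \<Longrightarrow> \<sigma> * charac_drift u x z p q \<le> \<sigma> * (u q x - u p x)"
proof -
  have "\<exists>\<phi>. \<phi> \<in> X_paths T Cf s0 x0 \<and> (\<forall>p q. s0 \<le> p \<longrightarrow> p \<le> q \<longrightarrow> q \<le> T \<longrightarrow>
      \<sigma> * charac_drift u \<phi> z p q - 1 / real (Suc n) \<le> \<sigma> * (u q \<phi> - u p \<phi>))" for n
    using approx[of "1 / real (Suc n)"] by auto
  then obtain \<phi> where \<phi>: "\<And>n. \<phi> n \<in> X_paths T Cf s0 x0"
    "\<And>n p q. s0 \<le> p \<Longrightarrow> p \<le> q \<Longrightarrow> q \<le> T \<Longrightarrow>
      \<sigma> * charac_drift u (\<phi> n) z p q - 1 / real (Suc n) \<le> \<sigma> * (u q (\<phi> n) - u p (\<phi> n))" by metis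
  obtain k x where k: "strict_mono (k::nat \<Rightarrow> nat)" "x \<in> X_paths T Cf s0 x0"
    "\<And>e. 0 < e \<Longrightarrow> \<exists>M. \<forall>n\<ge>M. \<forall>t\<in>{0..T}. norm (\<phi> (k n) t - x t) < e"
    using X_paths_compact[of x0 T Cf s0 \<phi>, OF x0 Cf s \<phi>(1)] by blast
  obtain B where B: "0 \<le> B" "\<And>t x. t \<in> {s0..T} \<Longrightarrow> x \<in> X_paths T Cf s0 x0 \<Longrightarrow> \<bar>u t x\<bar> \<le> B"
    using continuous_paths_bounded[OF u x0 Cf s] by blast
  note cx = X_pathsD(1)[OF k(2)]
  note wx = X_paths_functional_continuous[OF u x0 Cf s k(2)]
  show thesis
  proof (rule that[OF k(2)], rule field_le_epsilon)
    fix p q e :: real assume pq: "s0 \<le> p" "p \<le> q" "q \<le> T" and e: "0 < e"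
    define Q where "Q = Lf * (1 + norm z + B) + Clam"
    have Q: "0 \<le> Q" using Lf Clam B by (simp add: Q_def)
    define C where "C = 3 + 2 * norm z + Q * T"
    have C: "0 < C" using Q T_pos by (auto simp: C_def intro!: add_pos_nonneg)
    define e' where "e' = e / C"
    have e': "0 < e'" "C * e' = e" using e C by (auto simp: e'_def)
    obtain \<rho> where "path_modulus T Cf s0 x0 u e' \<rho>"
      using continuous_paths_uniform[OF u x0 Cf s e'(1)] by blast
    note \<rho> = path_modulusD[OF this]
    define \<rho>' where "\<rho>' = min \<rho> e'"
    have \<rho>': "0 < \<rho>'" "\<rho>' \<le> \<rho>" "\<rho>' \<le> e'" using \<rho> e' by (auto simp: \<rho>'_def)
    obtain M1 where M1: "\<And>n t. n \<ge> M1 \<Longrightarrow> t \<in> {0..T} \<Longrightarrow> norm (\<phi> (k n) t - x t) < \<rho>'" using k(3)[OF \<rho>'(1)] by blast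
    obtain M2 where M2: "1 / real (Suc M2) < e'" using nat_approx_posE[OF e'(1)] by blast
    define n where "n = max M1 M2"
    let ?y = "\<phi> (k n)"
    have near: "norm (?y t - x t) \<le> \<rho>'" if "t \<in> {0..T}" for t using M1[of n t] that by (simp add: n_def less_imp_le)
    note cy = X_pathsD(1)[OF \<phi>(1)[of "k n"]]
    note wy = X_paths_functional_continuous[OF u x0 Cf s \<phi>(1)[of "k n"]]
    have "1 / real (Suc (k n)) \<le> 1 / real (Suc M2)"
      using seq_suble[OF k(1), of n] by (intro divide_left_mono) (auto simp: n_def)
    then have small: "1 / real (Suc (k n)) < e'" using M2 by linarith
    have ud: "\<bar>u t ?y - u t x\<bar> \<le> e'" if "t \<in> {s0..T}" for t
      by (rule \<rho>(2)[OF that that \<phi>(1) k(2)]) (use that near \<rho>(1) \<rho>'(2) in \<open>force+\<close>)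
    have "\<bar>integral {p..q} (\<lambda>r. ham r ?y (u r ?y) z) - integral {p..q} (\<lambda>r. ham r x (u r x) z)\<bar> \<le> Q * e' * (q - p)"
    proof -
      have i: "(\<lambda>r. ham r ?y (u r ?y) z) integrable_on {p..q}" "(\<lambda>r. ham r x (u r x) z) integrable_on {p..q}"
        by (rule ham_integrable[OF cy s(1) pq(1,3) wy], rule ham_integrable[OF cx s(1) pq(1,3) wx])
      have "norm (integral {p..q} (\<lambda>r. ham r ?y (u r ?y) z - ham r x (u r x) z)) \<le> Q * e' * (q - p)"
      proof (rule norm_integral_le_const_ae[OF Henstock_Kurzweil_Integration.integrable_diff[OF i] N pq(2)])
        fix r assume r: "r \<in> {p<..<q} - N"
        then have r': "r \<in> {0<..<T} - N" "r \<in> {s0..T}" using pq s by auto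
        have "\<bar>ham r ?y (u r ?y) z - ham r x (u r x) z\<bar> \<le> Lf * (1 + norm z + \<bar>u r ?y\<bar>) * \<rho>' + Clam * \<bar>u r ?y - u r x\<bar>"
          by (rule ham_lipschitz[OF r'(1) cy cx]) (use near r' in auto)
        also have "\<dots> \<le> Lf * (1 + norm z + B) * e' + Clam * e'"
          using B(2)[OF r'(2) \<phi>(1)] ud[OF r'(2)] \<rho>' Lf Clam B(1)
          by (intro add_mono mult_mono mult_left_mono) auto
        also have "\<dots> = Q * e'" by (simp add: Q_def algebra_simps)
        finally show "norm (ham r ?y (u r ?y) z - ham r x (u r x) z) \<le> Q * e'" by simp
      qed
      then show ?thesis by (simp add: Henstock_Kurzweil_Integration.integral_diff[OF i])
    qed
    also have "\<dots> \<le> Q * e' * T" using pq s Q e' by (intro mult_left_mono) auto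
    finally have H: "\<bar>integral {p..q} (\<lambda>r. ham r ?y (u r ?y) z) - integral {p..q} (\<lambda>r. ham r x (u r x) z)\<bar> \<le> Q * e' * T" .
    have "\<bar>((?y q - x q) - (?y p - x p)) \<bullet> z\<bar> \<le> (e' + e') * norm z"
    proof -
      have "norm ((?y q - x q) - (?y p - x p)) \<le> norm (?y q - x q) + norm (?y p - x p)" by (rule norm_triangle_ineq4)
      also have "\<dots> \<le> e' + e'" using near[of q] near[of p] pq s \<rho>' by (intro add_mono) auto
      finally show ?thesis
        using Cauchy_Schwarz_ineq2[of "(?y q - x q) - (?y p - x p)" z] mult_right_mono[of _ "e' + e'" "norm z"]
        by (meson norm_ge_zero order_trans)
    qed
    moreover have "((?y q - x q) - (?y p - x p)) \<bullet> z = (?y q - ?y p) \<bullet> z - (x q - x p) \<bullet> z"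
      by (simp add: algebra_simps)
    ultimately have D: "\<bar>charac_drift u ?y z p q - charac_drift u x z p q\<bar> \<le> (e' + e') * norm z + Q * e' * T"
      using H unfolding charac_drift_def by linarith
    have sg: "\<sigma> * (a - b) \<le> \<bar>a - b\<bar>" for a b
      using abs_ge_self[of "\<sigma> * (a - b)"] \<sigma> by (simp add: abs_mult)
    have "\<sigma> * charac_drift u x z p q \<le> \<sigma> * charac_drift u ?y z p q + ((e' + e') * norm z + Q * e' * T)"
      using sg[of "charac_drift u x z p q" "charac_drift u ?y z p q"] D by (simp add: algebra_simps abs_minus_commute)
    also have "\<sigma> * charac_drift u ?y z p q \<le> \<sigma> * (u q ?y - u p ?y) + e'"
      using \<phi>(2)[OF pq, of "k n"] small by linarith
    also have "\<sigma> * (u q ?y - u p ?y) \<le> \<sigma> * (u q x - u p x) + 2 * e'"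
      using sg[of "u q ?y - u p ?y" "u q x - u p x"] ud[of q] ud[of p] pq by (simp add: algebra_simps)
    finally have "\<sigma> * charac_drift u x z p q \<le> \<sigma> * (u q x - u p x) + C * e'" by (simp add: C_def algebra_simps)
    then show "\<sigma> * charac_drift u x z p q \<le> \<sigma> * (u q x - u p x) + e" using e' by simp
  qed
qed

text \<open>
  For a fixed path the equation for \<open>y\<close> is an ordinary one with a Lipschitz right-hand side. Where
  \<open>y\<close> is on the wrong side of \<open>u\<close>, the drift inequality and the Lipschitz bound give
  \<open>e' \<le> (Clam + 1) e\<close> for \<open>e = \<sigma> (y - u)\<close>, so \<open>e\<close> cannot become positive.
\<close>

lemma characteristic_exists:
  assumes u: "continuous_paths T u" and x0: "x0 \<in> \<Omega>" and s: "0 \<le> s0" "s0 \<le> T" and \<sigma>: "\<bar>\<sigma>\<bar> = 1"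
    and x: "x \<in> X_paths T Cf s0 x0"
    and drift: "\<And>p q. s0 \<le> p \<Longrightarrow> p \<le> q \<Longrightarrow> q \<le> T \<Longrightarrow> \<sigma> * charac_drift u x z p q \<le> \<sigma> * (u q x - u p x)"
    and y0: "\<sigma> * (y0 - u s0 x0) \<le> 0"
  obtains y where "(x, y) \<in> Y_paths T ham Cf s0 x0 y0 z" "\<And>t. t \<in> {s0..T} \<Longrightarrow> \<sigma> * (y t - u t x) \<le> 0"
proof -
  note cx = X_pathsD(1)[OF x]
  note wx = X_paths_functional_continuous[OF u x0 Cf s x]
  note v = X_paths_derivative_abs_integrable[where z=z, OF x Cf s]
  let ?F = "\<lambda>t y. vector_derivative x (at t) \<bullet> z - ham t x (y t) z"
  have Fabs: "(\<lambda>t. ?F t y) absolutely_integrable_on {s0..T}" if "continuous_on {s0..T} y" for y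
    by (intro set_integral_diff v(1) ham_abs_integrable[OF cx s(1) that])
  obtain y where y: "continuous_on {s0..T} y" "\<And>t. t \<in> {s0..T} \<Longrightarrow> y t = y0 + integral {s0..t} (\<lambda>r. ?F r y)"
  proof (rule picard[where F="?F" and s=s0 and T=T and N=N and L=Clam and ?q0.0=y0])
    show "(\<lambda>t. ?F t y) integrable_on {s0..T}" if "continuous_on {s0..T} y" for y
      using Fabs[OF that] set_lebesgue_integral_eq_integral(1) by blast
    fix y y' :: "real \<Rightarrow> real" and t C
    assume "continuous_on {s0..T} y" "continuous_on {s0..T} y'" and t: "t \<in> {s0<..<T} - N"
      and C: "\<And>r. r \<in> {s0..t} \<Longrightarrow> norm (y r - y' r) \<le> C"
    have t': "t \<in> {0<..<T} - N" using t s by auto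
    have "\<bar>ham t x (y t) z - ham t x (y' t) z\<bar> \<le> Lf * (1 + norm z + \<bar>y t\<bar>) * 0 + Clam * \<bar>y t - y' t\<bar>"
      by (rule ham_lipschitz[OF t' cx cx]) auto
    also have "\<dots> \<le> Clam * C" using C[of t] t Clam by (auto intro!: mult_left_mono)
    finally show "norm (?F t y - ?F t y') \<le> Clam * C" by (simp add: abs_minus_commute)
  qed (use s Clam N in auto)
  have ydiff: "y q - y p = (x q - x p) \<bullet> z - integral {p..q} (\<lambda>r. ham r x (y r) z)" if pq: "s0 \<le> p" "p \<le> q" "q \<le> T" for p q
  proof -
    have Fi: "(\<lambda>r. ?F r y) integrable_on {s0..q}"
      using integrable_on_subinterval[of "\<lambda>r. ?F r y" "{s0..T}" s0 q] Fabs[OF y(1)] set_lebesgue_integral_eq_integral(1) pq by fastforce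
    have "y q - y p = integral {p..q} (\<lambda>r. ?F r y)"
      using y(2)[of q] y(2)[of p] Henstock_Kurzweil_Integration.integral_combine[OF pq(1,2) Fi] pq by simp
    also have "\<dots> = integral {p..q} (\<lambda>r. vector_derivative x (at r) \<bullet> z) - integral {p..q} (\<lambda>r. ham r x (y r) z)"
      by (rule Henstock_Kurzweil_Integration.integral_diff)
        (use v(2)[OF pq] ham_integrable[OF cx s(1) pq(1,3) y(1)] in \<open>auto simp: integrable_on_def\<close>)
    finally show ?thesis using integral_unique[OF v(2)[OF pq]] by simp
  qed
  have "(x, y) \<in> Y_paths T ham Cf s0 x0 y0 z"
    unfolding Y_paths_def
  proof (intro CollectI case_prodI conjI ballI x y(1) Fabs)
    fix t assume t: "t \<in> {s0..T}"
    have "(\<lambda>r. ?F r y) absolutely_integrable_on {s0..t}"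
      by (rule absolutely_integrable_on_subinterval[OF Fabs[OF y(1)]]) (use t in auto)
    then show "y t = y0 + (LINT r:{s0..t}|lebesgue. ?F r y)"
      using y(2)[OF t] by (simp add: set_lebesgue_integral_eq_integral(2))
  qed
  moreover have "\<sigma> * (y t - u t x) \<le> 0" if t: "t \<in> {s0..T}" for t
  proof (rule forward_nonpos[where e="\<lambda>t. \<sigma> * (y t - u t x)" and s=s0 and T=T and b="Clam + 1"])
    show "continuous_on {s0..T} (\<lambda>t. \<sigma> * (y t - u t x))" by (intro continuous_intros y wx)
    have "u s0 x = u s0 x0"
      using s by (intro continuous_paths_nonanticipative[OF u _ cx x0] X_pathsD(2)[OF x]) auto
    then show "\<sigma> * (y s0 - u s0 x) \<le> 0" using y0 y(2)[of s0] s by simp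
    fix p q assume pq: "s0 \<le> p" "p \<le> q" "q \<le> T" and pos: "\<And>r. r \<in> {p..q} \<Longrightarrow> 0 \<le> \<sigma> * (y r - u r x)"
    let ?e = "\<lambda>t. \<sigma> * (y t - u t x)"
    have i: "(\<lambda>r. ham r x (u r x) z) integrable_on {p..q}" "(\<lambda>r. ham r x (y r) z) integrable_on {p..q}"
      by (rule ham_integrable[OF cx s(1) pq(1,3) wx], rule ham_integrable[OF cx s(1) pq(1,3) y(1)])
    have ei: "?e integrable_on {p..q}"
      by (intro integrable_continuous_interval continuous_intros continuous_on_subset[OF y(1)] continuous_on_subset[OF wx]) (use pq in auto)
    have "?e q - ?e p = \<sigma> * (y q - y p) - \<sigma> * (u q x - u p x)" by (simp add: algebra_simps)
    also have "\<dots> \<le> \<sigma> * (y q - y p) - \<sigma> * charac_drift u x z p q" using drift[OF pq] by simp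
    also have "\<dots> = integral {p..q} (\<lambda>r. \<sigma> * (ham r x (u r x) z - ham r x (y r) z))"
      unfolding integral_mult_right Henstock_Kurzweil_Integration.integral_diff[OF i] ydiff[OF pq] charac_drift_def
      by (simp add: algebra_simps)
    also have "\<dots> \<le> integral {p..q} (\<lambda>r. (Clam + 1) * ?e r)"
    proof (rule integral_le_ae[OF _ _ N])
      show "(\<lambda>r. \<sigma> * (ham r x (u r x) z - ham r x (y r) z)) integrable_on {p..q}"
        by (intro integrable_on_mult_right Henstock_Kurzweil_Integration.integrable_diff i)
      show "(\<lambda>r. (Clam + 1) * ?e r) integrable_on {p..q}" by (rule integrable_on_mult_right[OF ei])
      fix r assume r: "r \<in> {p<..<q} - N"
      then have r': "r \<in> {0<..<T} - N" using pq s by auto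
      have "\<bar>ham r x (u r x) z - ham r x (y r) z\<bar> \<le> Lf * (1 + norm z + \<bar>u r x\<bar>) * 0 + Clam * \<bar>u r x - y r\<bar>"
        by (rule ham_lipschitz[OF r' cx cx]) auto
      moreover have "\<bar>u r x - y r\<bar> = \<bar>?e r\<bar>" using \<sigma> by (simp add: abs_mult abs_minus_commute)
      moreover have "\<bar>?e r\<bar> = ?e r" using pos[of r] r by simp
      ultimately have "\<bar>ham r x (u r x) z - ham r x (y r) z\<bar> \<le> Clam * ?e r" by simp
      moreover have "\<sigma> * (ham r x (u r x) z - ham r x (y r) z) \<le> \<bar>ham r x (u r x) z - ham r x (y r) z\<bar>"
        using abs_ge_self[of "\<sigma> * (ham r x (u r x) z - ham r x (y r) z)"] \<sigma> by (simp add: abs_mult)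
      moreover have "Clam * ?e r \<le> (Clam + 1) * ?e r" using pos[of r] r by (intro mult_right_mono) auto
      ultimately show "\<sigma> * (ham r x (u r x) z - ham r x (y r) z) \<le> (Clam + 1) * ?e r" by linarith
    qed
    also have "\<dots> = (Clam + 1) * integral {p..q} ?e" by (rule integral_mult_right)
    finally show "?e q - ?e p \<le> (Clam + 1) * integral {p..q} ?e" .
  qed (use Clam t in auto)
  ultimately show thesis by (rule that)
qed

text \<open>
  The gap between the payoff of an \<open>\<epsilon>\<close>-optimal control and \<open>val\<close> starts at most at
  \<open>\<epsilon>\<close>, and by dynamic programming it grows at most at the rate \<open>lam\<close>; so the control
  remains nearly optimal along its own trajectory. Since the Hamiltonian is an infimum, the linear
  equation of the payoff then bounds its increments by the drift.
\<close>

lemma val_super_approx: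
  assumes x0: "x0 \<in> \<Omega>" and s: "0 \<le> s0" "s0 \<le> T" and \<eta>: "0 < \<eta>"
  shows "\<exists>\<phi>\<in>X_paths T Cf s0 x0. \<forall>p q. s0 \<le> p \<longrightarrow> p \<le> q \<longrightarrow> q \<le> T \<longrightarrow>
      - 1 * charac_drift val \<phi> z p q - \<eta> \<le> - 1 * (val q \<phi> - val p \<phi>)"
proof -
  define E where "E = 2 * exp (2 * (Clam + 1) * T) * (1 + Clam * T)"
  have E: "0 < E" using Clam T_pos by (auto simp: E_def intro!: add_pos_nonneg mult_pos_pos)
  define \<epsilon> where "\<epsilon> = \<eta> / E"
  have \<epsilon>: "0 < \<epsilon>" "\<epsilon> * E = \<eta>" using \<eta> E by (auto simp: \<epsilon>_def)
  obtain a where a: "a \<in> controls T A" "payoff s0 (traj s0 x0 a) a < val s0 x0 + \<epsilon>"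
    using val_near[OF x0 s \<epsilon>(1)] by blast
  let ?\<phi> = "traj s0 x0 a"
  note cad = traj_path(1)[OF x0 a(1) s] and X = traj_path(2)[OF x0 a(1) s]
  note ode = payoff_ode[OF cad a(1) s(1)]
  note wc = val_along_continuous[OF x0 s X]
  have up: "val r ?\<phi> \<le> payoff r ?\<phi> a" if r: "r \<in> {s0..T}" for r
  proof -
    have r0: "0 \<le> r" "r \<le> T" using r s by auto
    have "val r ?\<phi> \<le> payoff r (traj r ?\<phi> a) a" by (rule val_le[OF cad a(1) r0])
    also have "traj r ?\<phi> a = ?\<phi>" by (rule traj_flow[OF x0 a(1)]) (use r s in auto)
    finally show ?thesis .
  qed
  define e where "e = (\<lambda>r. payoff r ?\<phi> a - val r ?\<phi>)"
  have ec: "continuous_on {s0..T} e" unfolding e_def by (intro continuous_intros ode wc)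
  have e0: "0 \<le> e r" if "r \<in> {s0..T}" for r using up[OF that] by (simp add: e_def)
  have es: "e s0 \<le> \<epsilon>"
  proof -
    have "val s0 ?\<phi> = val s0 x0" by (rule val_nonanticipative[OF cad x0 s traj_path(3)[OF x0 a(1) s]])
    then show ?thesis using a(2) by (simp add: e_def)
  qed
  define \<epsilon>' where "\<epsilon>' = 2 * \<epsilon> * exp (2 * (Clam + 1) * T)"
  have ee: "e t \<le> \<epsilon>'" if t: "t \<in> {s0..T}" for t
  proof -
    have "bounded (e ` {s0..T})" using ec by (intro compact_imp_bounded compact_continuous_image) auto
    then obtain B where B: "\<And>t. t \<in> {s0..T} \<Longrightarrow> \<bar>e t\<bar> \<le> B" unfolding bounded_iff by fastforce
    let ?G = "\<lambda>r. lam r ?\<phi> (a r) * e r"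
    have "e t \<le> 2 * \<epsilon> * exp (2 * (Clam + 1) * (t - s0))"
    proof (rule gronwall_sup[where N=N and T=T and B=B and G="?G"])
      fix q assume q: "q \<in> {s0..T}"
      show "e q \<le> B" using B[OF q] by simp
      have ri: "(\<lambda>r. lam r ?\<phi> (a r) * payoff r ?\<phi> a - l r ?\<phi> (a r)) integrable_on {s0..q}"
        "(\<lambda>r. lam r ?\<phi> (a r) * val r ?\<phi> - l r ?\<phi> (a r)) integrable_on {s0..q}"
        "?G integrable_on {s0..q}"
        using q s by (auto intro!: running_integrable[OF cad a(1)] intro: continuous_on_subset[OF ode(1)]
            continuous_on_subset[OF wc] continuous_on_subset[OF ec])
      show "?G integrable_on {s0..q}" by (rule ri(3))
      have "e q - e s0 = (payoff q ?\<phi> a - payoff s0 ?\<phi> a) - (val q ?\<phi> - val s0 ?\<phi>)" by (simp add: e_def)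
      also have "\<dots> \<le> integral {s0..q} (\<lambda>r. lam r ?\<phi> (a r) * payoff r ?\<phi> a - l r ?\<phi> (a r))
          - integral {s0..q} (\<lambda>r. lam r ?\<phi> (a r) * val r ?\<phi> - l r ?\<phi> (a r))"
        using ode(2)[of s0 q] dynamic_programming[OF x0 a(1) s(1), of s0 q] q by simp
      also have "\<dots> = integral {s0..q} ?G"
        unfolding Henstock_Kurzweil_Integration.integral_diff[OF ri(1,2), symmetric]
        by (rule integral_cong) (simp add: e_def algebra_simps)
      finally show "e q \<le> \<epsilon> + integral {s0..q} ?G" using es by simp
    next
      fix r C assume r: "r \<in> {s0<..<T} - N" and C: "0 \<le> C" "\<And>\<rho>. \<rho> \<in> {s0..r} \<Longrightarrow> e \<rho> \<le> C"
      have r': "r \<in> {0<..<T} - N" "a r \<in> A" using r s control_in[OF a(1), of r] by auto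
      have "lam r ?\<phi> (a r) \<le> Clam" using lam_le[OF r'(1) cad r'(2)] by simp
      then have "?G r \<le> Clam * C" using C(2)[of r] r e0[of r] Clam by (intro mult_mono) auto
      also have "\<dots> \<le> (Clam + 1) * C" using C by (intro mult_right_mono) auto
      finally show "?G r \<le> (Clam + 1) * C" .
    qed (use \<epsilon> N Clam t in auto)
    also have "\<dots> \<le> \<epsilon>'" unfolding \<epsilon>'_def using \<epsilon> Clam t s by (intro mult_left_mono) (auto intro!: mult_left_mono)
    finally show ?thesis .
  qed
  have \<epsilon>'0: "0 \<le> \<epsilon>'" using \<epsilon> by (simp add: \<epsilon>'_def)
  show ?thesis
  proof (intro bexI[OF _ X] allI impI)
    fix p q assume pq: "s0 \<le> p" "p \<le> q" "q \<le> T"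
    have p0: "0 \<le> p" using pq s by simp
    have pc: "continuous_on {p..q} (\<lambda>r. payoff r ?\<phi> a)" by (rule continuous_on_subset[OF ode(1)]) (use pq in auto)
    have ri: "(\<lambda>r. lam r ?\<phi> (a r) * payoff r ?\<phi> a - l r ?\<phi> (a r)) integrable_on {p..q}"
      by (rule running_integrable[OF cad a(1) p0 pq(3) pc])
    note fz = inner_running_integral[OF x0 a(1) s(1) pq, of z]
    have hi: "(\<lambda>r. ham r ?\<phi> (val r ?\<phi>) z) integrable_on {p..q}" by (rule ham_integrable[OF cad s(1) pq(1,3) wc])
    have "payoff q ?\<phi> a - payoff p ?\<phi> a = integral {p..q} (\<lambda>r. lam r ?\<phi> (a r) * payoff r ?\<phi> a - l r ?\<phi> (a r))"
      by (rule ode(2)[OF pq])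
    also have "\<dots> \<le> integral {p..q} (\<lambda>r. f r ?\<phi> (a r) \<bullet> z - (ham r ?\<phi> (val r ?\<phi>) z + (- Clam * \<epsilon>')))"
    proof (rule integral_le_ae[OF ri _ N])
      show "(\<lambda>r. f r ?\<phi> (a r) \<bullet> z - (ham r ?\<phi> (val r ?\<phi>) z + (- Clam * \<epsilon>'))) integrable_on {p..q}"
        by (intro Henstock_Kurzweil_Integration.integrable_diff Henstock_Kurzweil_Integration.integrable_add fz hi integrable_const_ivl)
      fix r assume r: "r \<in> {p<..<q} - N"
      have r': "r \<in> {0<..<T} - N" "a r \<in> A" "r \<in> {s0..T}" using r pq s control_in[OF a(1), of r] by auto
      have "ham r ?\<phi> (payoff r ?\<phi> a) z \<le> preham r ?\<phi> (a r) (payoff r ?\<phi> a) z" by (rule ham_le[OF r'(1) cad r'(2)])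
      moreover have "\<bar>ham r ?\<phi> (payoff r ?\<phi> a) z - ham r ?\<phi> (val r ?\<phi>) z\<bar>
          \<le> Lf * (1 + norm z + \<bar>payoff r ?\<phi> a\<bar>) * 0 + Clam * \<bar>payoff r ?\<phi> a - val r ?\<phi>\<bar>"
        by (rule ham_lipschitz[OF r'(1) cad cad]) auto
      moreover have "Clam * \<bar>payoff r ?\<phi> a - val r ?\<phi>\<bar> \<le> Clam * \<epsilon>'"
        using ee[OF r'(3)] e0[OF r'(3)] Clam by (intro mult_left_mono) (auto simp: e_def)
      ultimately have "ham r ?\<phi> (val r ?\<phi>) z - Clam * \<epsilon>' \<le> preham r ?\<phi> (a r) (payoff r ?\<phi> a) z" by linarith
      then show "lam r ?\<phi> (a r) * payoff r ?\<phi> a - l r ?\<phi> (a r) \<le> f r ?\<phi> (a r) \<bullet> z - (ham r ?\<phi> (val r ?\<phi>) z + (- Clam * \<epsilon>'))"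
        by (simp add: preham_def)
    qed
    also have "\<dots> = charac_drift val ?\<phi> z p q + Clam * \<epsilon>' * (q - p)"
      unfolding integral_diff_shift[OF fz(1) hi pq(2)] fz(2) by (simp add: charac_drift_def)
    also have "\<dots> \<le> charac_drift val ?\<phi> z p q + Clam * \<epsilon>' * T"
      using pq s Clam \<epsilon>'0 by (intro add_left_mono mult_left_mono) auto
    finally have 1: "payoff q ?\<phi> a - payoff p ?\<phi> a \<le> charac_drift val ?\<phi> z p q + Clam * \<epsilon>' * T" .
    have "val q ?\<phi> - val p ?\<phi> \<le> (payoff q ?\<phi> a - payoff p ?\<phi> a) + \<epsilon>'"
      using up[of q] ee[of p] pq by (simp add: e_def)
    moreover have "\<epsilon>' + Clam * \<epsilon>' * T = \<epsilon> * E" by (simp add: \<epsilon>'_def E_def algebra_simps)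
    ultimately have "val q ?\<phi> - val p ?\<phi> \<le> charac_drift val ?\<phi> z p q + \<eta>"
      using 1 \<epsilon>(2) by linarith
    then show "- 1 * charac_drift val ?\<phi> z p q - \<eta> \<le> - 1 * (val q ?\<phi> - val p ?\<phi>)" by simp
  qed
qed

text \<open>
  On each cell of a fine mesh the control almost attains the Hamiltonian for the path \<open>x\<close> of the
  preceding stage and for the value \<open>c\<close> at the left end. The true trajectory and the true value
  deviate little from these within the cell, and dynamic programming bounds the increments of \<open>val\<close>
  from below.
\<close>

lemma val_sub_approx:
  assumes x0: "x0 \<in> \<Omega>" and s: "0 \<le> s0" "s0 < T" and \<eta>: "0 < \<eta>"
  shows "\<exists>\<phi>\<in>X_paths T Cf s0 x0. \<forall>p q. s0 \<le> p \<longrightarrow> p \<le> q \<longrightarrow> q \<le> T \<longrightarrow>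
      1 * charac_drift val \<phi> z p q - \<eta> \<le> 1 * (val q \<phi> - val p \<phi>)"
proof -
  have sT: "s0 \<le> T" using s by simp
  obtain K where "equi_lipschitz T Cf s0 x0 K" using X_paths_uniform[OF x0 Cf s(1) sT] by blast
  note K = equi_lipschitzD[OF this]
  obtain B where B: "0 \<le> B" "\<And>t x. t \<in> {s0..T} \<Longrightarrow> x \<in> X_paths T Cf s0 x0 \<Longrightarrow> \<bar>val t x\<bar> \<le> B"
    using continuous_paths_bounded[OF val_continuous x0 Cf s(1) sT] by blast
  define Q where "Q = Lf * (1 + norm z + B) * (2 * K) + Clam"
  have Q: "0 \<le> Q" using Lf Clam B K by (simp add: Q_def)
  define C where "C = (2 * Q + 1) * T"
  have C: "0 < C" using Q T_pos by (auto simp: C_def intro!: mult_pos_pos add_nonneg_pos)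
  define e where "e = \<eta> / C"
  have e: "0 < e" "C * e = \<eta>" using \<eta> C by (auto simp: e_def)
  obtain \<rho> where "path_modulus T Cf s0 x0 val e \<rho>"
    using continuous_paths_uniform[OF val_continuous x0 Cf s(1) sT e(1)] by blast
  note \<rho> = path_modulusD[OF this]
  have "0 < min \<rho> e" using \<rho> e by simp
  then obtain n h where "0 < h" "h \<le> min \<rho> e" and hT: "s0 + real n * h = T" using mesh_exists[OF s(2)] by metis
  then have h: "0 < h" "h \<le> \<rho>" "h \<le> e" "s0 + real n * h = T" by auto
  define t where "t = (\<lambda>k. s0 + real k * h)"
  have tk: "t k \<in> {s0..T}" "t (Suc k) \<in> {s0..T}" "t k \<le> t (Suc k)" "t k < T" if "k < n" for k
  proof -
    have "real (Suc k) * h \<le> real n * h" using that h by (intro mult_right_mono) auto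
    moreover have "real k * h < real (Suc k) * h" using h by simp
    ultimately show "t k \<in> {s0..T}" "t (Suc k) \<in> {s0..T}" "t k \<le> t (Suc k)" "t k < T"
      unfolding t_def using h by auto
  qed
  \<comment> \<open>the claim for \<open>[p,q]\<close> says that this function of \<open>q\<close> does not decrease; in this form the cells
    are combined by monotonicity\<close>
  define V where "V = (\<lambda>x q. val q x - x q \<bullet> z + integral {s0..q} (\<lambda>r. ham r x (val r x) z) + (2 * Q + 1) * e * q)"
  have Vdiff: "V x q - V x p = val q x - val p x - charac_drift val x z p q + (2 * Q + 1) * e * (q - p)"
    if x: "x \<in> X_paths T Cf s0 x0" and pq: "s0 \<le> p" "p \<le> q" "q \<le> T" for x p q
    using Henstock_Kurzweil_Integration.integral_combine[OF pq(1,2),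
        OF ham_integrable[OF X_pathsD(1)[OF x] s(1) order_refl pq(3) val_along_continuous[OF x0 s(1) sT x], of z]]
    by (simp add: V_def charac_drift_def algebra_simps)
  have "\<exists>x. x \<in> X_paths T Cf s0 x0 \<and> (\<forall>k<n. \<forall>p q. t k \<le> p \<longrightarrow> p \<le> q \<longrightarrow> q \<le> t (Suc k) \<longrightarrow> V x p \<le> V x q)"
  proof (rule mesh_induction[where agree="\<lambda>k x x'. x \<in> X_paths T Cf s0 x0 \<and> x' \<in> X_paths T Cf s0 x0 \<and> (\<forall>r\<in>{0..t k}. x' r = x r)"
        and Q="\<lambda>k x. \<forall>p q. t k \<le> p \<longrightarrow> p \<le> q \<longrightarrow> q \<le> t (Suc k) \<longrightarrow> V x p \<le> V x q"
        and P="\<lambda>x. x \<in> X_paths T Cf s0 x0"])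
    show "glue T s0 x0 (\<lambda>_. x0 s0) \<in> X_paths T Cf s0 x0" by (rule X_paths_self[OF x0 Cf s(1) sT])
  next
    fix j k x x' assume jk: "j < k" "k < n"
      and agree: "x \<in> X_paths T Cf s0 x0 \<and> x' \<in> X_paths T Cf s0 x0 \<and> (\<forall>r\<in>{0..t k}. x' r = x r)"
      and Q: "\<forall>p q. t j \<le> p \<longrightarrow> p \<le> q \<longrightarrow> q \<le> t (Suc j) \<longrightarrow> V x p \<le> V x q"
    have "real (Suc j) * h \<le> real k * h" using jk h by (intro mult_right_mono) auto
    then have le: "t (Suc j) \<le> t k" by (simp add: t_def)
    have t0: "s0 \<le> t j" using h by (simp add: t_def)
    have eqV: "V x' q = V x q" if q: "s0 \<le> q" "q \<le> t k" for q
    proof -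
      note c = X_pathsD(1)[OF conjunct1[OF agree]] and c' = X_pathsD(1)[OF conjunct1[OF conjunct2[OF agree]]]
      have q': "q \<le> T" using q tk[OF jk(2)] by auto
      have veq: "val r x' = val r x" if "0 \<le> r" "r \<le> q" for r
        by (rule val_nonanticipative[OF c' c]) (use agree q q' that in auto)
      have "integral {s0..q} (\<lambda>r. ham r x' (val r x') z) = integral {s0..q} (\<lambda>r. ham r x (val r x) z)"
      proof (rule integral_eq_ae[OF N])
        fix r assume r: "r \<in> {s0<..<q} - N"
        then have "ham r x' (val r x') z = ham r x (val r x') z"
          using agree q q' s by (intro ham_nonanticipative[OF _ c' c]) auto
        then show "ham r x' (val r x') z = ham r x (val r x) z" using veq[of r] r s by simp
      qed
      then show ?thesis using veq[of q] agree q s by (simp add: V_def)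
    qed
    show "\<forall>p q. t j \<le> p \<longrightarrow> p \<le> q \<longrightarrow> q \<le> t (Suc j) \<longrightarrow> V x' p \<le> V x' q"
    proof (intro allI impI)
      fix p q assume pq: "t j \<le> p" "p \<le> q" "q \<le> t (Suc j)"
      then have "V x' p = V x p" "V x' q = V x q" using le t0 by (auto intro!: eqV)
      then show "V x' p \<le> V x' q" using Q pq by simp
    qed
  next
    fix k x assume k: "k < n" and x: "x \<in> X_paths T Cf s0 x0"
    note tk = tk[OF k]
    have t0: "0 \<le> t k" "t k \<le> T" using tk s by auto
    note cx = X_pathsD(1)[OF x]
    define c where "c = val (t k) x"
    obtain a where a: "a \<in> controls T A" "\<And>r. r \<in> {0<..<T} - N \<Longrightarrow> preham r x (a r) c z \<le> ham r x c z + e"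
      using almost_optimal_selection[OF cx e(1), of c z] by blast
    let ?\<phi> = "traj (t k) x a"
    note c\<phi> = traj_path(1)[OF cx a(1) t0] and eq\<phi> = traj_path(3)[OF cx a(1) t0]
    have X\<phi>: "?\<phi> \<in> X_paths T Cf s0 x0"
      by (rule X_paths_trans[OF x traj_path(2)[OF cx a(1) t0] Cf s(1)]) (use tk in auto)
    have wc: "continuous_on {s0..T} (\<lambda>r. val r ?\<phi>)" by (rule val_along_continuous[OF x0 s(1) sT X\<phi>])
    have near: "norm (?\<phi> \<rho> - x \<rho>) \<le> 2 * K * e" if \<rho>: "\<rho> \<in> {0..t (Suc k)}" for \<rho>
    proof (cases "\<rho> \<le> t k")
      case True
      then show ?thesis using eq\<phi>[of \<rho>] \<rho> K e by auto
    next
      case False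
      have "norm (?\<phi> \<rho> - x \<rho>) \<le> norm (?\<phi> \<rho> - ?\<phi> (t k)) + norm (x \<rho> - x (t k))"
        using eq\<phi>[of "t k"] t0 norm_triangle_ineq4[of "?\<phi> \<rho> - ?\<phi> (t k)" "x \<rho> - x (t k)"] by simp
      also have "\<dots> \<le> K * \<bar>\<rho> - t k\<bar> + K * \<bar>\<rho> - t k\<bar>"
        using False \<rho> tk by (intro add_mono K(3) X\<phi> x) auto
      also have "\<dots> \<le> K * e + K * e"
      proof -
        have "\<bar>\<rho> - t k\<bar> \<le> e" using False \<rho> h by (auto simp: t_def algebra_simps)
        then show ?thesis using K by (intro add_mono mult_left_mono) auto
      qed
      finally show ?thesis by simp
    qed
    have cw: "\<bar>c - val r ?\<phi>\<bar> \<le> e" if r: "r \<in> {t k..t (Suc k)}" for r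
    proof -
      have "\<bar>val (t k) ?\<phi> - val r ?\<phi>\<bar> \<le> e"
      proof (rule \<rho>(2)[OF tk(1) _ X\<phi> X\<phi>])
        show "r \<in> {s0..T}" using r tk by auto
        show "\<bar>t k - r\<bar> \<le> \<rho>" using r h by (auto simp: t_def algebra_simps)
      qed (use \<rho>(1) in simp)
      moreover have "val (t k) ?\<phi> = c" unfolding c_def by (rule val_nonanticipative[OF c\<phi> cx t0 eq\<phi>])
      ultimately show ?thesis by simp
    qed
    have cB: "\<bar>c\<bar> \<le> B" unfolding c_def using tk by (intro B(2) x) auto
    have "V ?\<phi> p \<le> V ?\<phi> q" if pq: "t k \<le> p" "p \<le> q" "q \<le> t (Suc k)" for p q
    proof -
      have pq': "s0 \<le> p" "0 \<le> p" "q \<le> T" using pq tk s by auto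
      note fz = inner_running_integral[OF cx a(1) t0(1) pq(1,2) pq'(3), of z]
      have hi: "(\<lambda>r. ham r ?\<phi> (val r ?\<phi>) z) integrable_on {p..q}" by (rule ham_integrable[OF c\<phi> s(1) pq'(1,3) wc])
      have "integral {p..q} (\<lambda>r. f r ?\<phi> (a r) \<bullet> z - (ham r ?\<phi> (val r ?\<phi>) z + (2 * Q + 1) * e))
          \<le> integral {p..q} (\<lambda>r. lam r ?\<phi> (a r) * val r ?\<phi> - l r ?\<phi> (a r))"
      proof (rule integral_le_ae[OF _ _ N])
        show "(\<lambda>r. f r ?\<phi> (a r) \<bullet> z - (ham r ?\<phi> (val r ?\<phi>) z + (2 * Q + 1) * e)) integrable_on {p..q}"
          by (intro Henstock_Kurzweil_Integration.integrable_diff Henstock_Kurzweil_Integration.integrable_add fz hi integrable_const_ivl)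
        show "(\<lambda>r. lam r ?\<phi> (a r) * val r ?\<phi> - l r ?\<phi> (a r)) integrable_on {p..q}"
          by (rule running_integrable[OF c\<phi> a(1) pq'(2,3)]) (rule continuous_on_subset[OF wc], use pq' in auto)
        fix r assume r: "r \<in> {p<..<q} - N"
        have r': "r \<in> {0<..<T} - N" "a r \<in> A" "r \<in> {t k..t (Suc k)}"
          using r pq pq' control_in[OF a(1), of r] by auto
        have nr: "norm (x \<rho> - ?\<phi> \<rho>) \<le> 2 * K * e" if "\<rho> \<in> {0..r}" for \<rho>
          using near[of \<rho>] that r' by (auto simp: norm_minus_commute)
        have bd: "Lf * (1 + norm z + \<bar>c\<bar>) * (2 * K * e) + Clam * \<bar>c - val r ?\<phi>\<bar> \<le> Q * e"
        proof -
          have "Lf * (1 + norm z + \<bar>c\<bar>) * (2 * K * e) + Clam * \<bar>c - val r ?\<phi>\<bar> \<le> Lf * (1 + norm z + B) * (2 * K * e) + Clam * e"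
            using cB cw[OF r'(3)] Lf Clam K e by (intro add_mono mult_mono mult_left_mono) auto
          then show ?thesis by (simp add: Q_def algebra_simps)
        qed
        have "\<bar>preham r x (a r) c z - preham r ?\<phi> (a r) (val r ?\<phi>) z\<bar> \<le> Q * e"
          using preham_lipschitz[OF r'(1) cx c\<phi> r'(2) nr, of c z "val r ?\<phi>"] bd by linarith
        moreover have "\<bar>ham r x c z - ham r ?\<phi> (val r ?\<phi>) z\<bar> \<le> Q * e"
          using ham_lipschitz[OF r'(1) cx c\<phi> nr, of c z "val r ?\<phi>"] bd by linarith
        moreover have "(2 * Q + 1) * e = Q * e + Q * e + e" by (simp add: algebra_simps)
        ultimately have "preham r ?\<phi> (a r) (val r ?\<phi>) z \<le> ham r ?\<phi> (val r ?\<phi>) z + (2 * Q + 1) * e"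
          using a(2)[OF r'(1)] by linarith
        then show "f r ?\<phi> (a r) \<bullet> z - (ham r ?\<phi> (val r ?\<phi>) z + (2 * Q + 1) * e) \<le> lam r ?\<phi> (a r) * val r ?\<phi> - l r ?\<phi> (a r)"
          by (simp add: preham_def)
      qed
      also have "\<dots> \<le> val q ?\<phi> - val p ?\<phi>" by (rule dynamic_programming[OF cx a(1) t0(1) pq(1,2) pq'(3)])
      also have "integral {p..q} (\<lambda>r. f r ?\<phi> (a r) \<bullet> z - (ham r ?\<phi> (val r ?\<phi>) z + (2 * Q + 1) * e))
          = charac_drift val ?\<phi> z p q - (2 * Q + 1) * e * (q - p)"
        unfolding integral_diff_shift[OF fz(1) hi pq(2)] fz(2) by (simp add: charac_drift_def)
      finally show ?thesis using Vdiff[OF X\<phi> pq'(1) pq(2) pq'(3)] by linarith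
    qed
    then show "\<exists>x'. x' \<in> X_paths T Cf s0 x0 \<and>
        (x \<in> X_paths T Cf s0 x0 \<and> x' \<in> X_paths T Cf s0 x0 \<and> (\<forall>r\<in>{0..t k}. x' r = x r)) \<and>
        (\<forall>p q. t k \<le> p \<longrightarrow> p \<le> q \<longrightarrow> q \<le> t (Suc k) \<longrightarrow> V x' p \<le> V x' q)"
      using X\<phi> x eq\<phi> by (intro exI[of _ ?\<phi>]) auto
  qed
  then obtain x where x: "x \<in> X_paths T Cf s0 x0"
    "\<And>k p q. k < n \<Longrightarrow> t k \<le> p \<Longrightarrow> p \<le> q \<Longrightarrow> q \<le> t (Suc k) \<Longrightarrow> V x p \<le> V x q" by blast
  show ?thesis
  proof (intro bexI[OF _ x(1)] allI impI)
    fix p q assume pq: "s0 \<le> p" "p \<le> q" "q \<le> T"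
    have "V x p \<le> V x q"
      by (rule mono_from_cells[where h=h and n=n and a=s0]) (use x(2) h pq in \<open>auto simp: t_def\<close>)
    moreover have "(2 * Q + 1) * e * (q - p) \<le> (2 * Q + 1) * e * T"
      using pq s Q e by (intro mult_left_mono) auto
    moreover have "(2 * Q + 1) * e * T = \<eta>" using e(2) by (simp add: C_def algebra_simps)
    ultimately have "charac_drift val x z p q - \<eta> \<le> val q x - val p x"
      using Vdiff[OF x(1) pq] by linarith
    then show "1 * charac_drift val x z p q - \<eta> \<le> 1 * (val q x - val p x)" by simp
  qed
qed

lemma val_minimax_solution: "minimax_solution T ham h Cf val"
proof -
  have lsc: "lsc_paths T val" and usc: "usc_paths T val" using val_continuous by (auto simp: continuous_paths_def)
  have main: "\<exists>(x, y)\<in>Y_paths T ham Cf s0 x0 y0 z. \<forall>t\<in>{s0..T}. \<sigma> * (y t - val t x) \<le> 0"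
    if s: "s0 \<in> {0..<T}" and x0: "x0 \<in> \<Omega>" and y0: "\<sigma> * (y0 - val s0 x0) \<le> 0" and \<sigma>: "\<sigma> = 1 \<or> \<sigma> = - 1"
    for s0 x0 z y0 and \<sigma> :: real
  proof -
    have s': "0 \<le> s0" "s0 \<le> T" "s0 < T" and \<sigma>1: "\<bar>\<sigma>\<bar> = 1" using s \<sigma> by auto
    have "\<exists>\<phi>\<in>X_paths T Cf s0 x0. \<forall>p q. s0 \<le> p \<longrightarrow> p \<le> q \<longrightarrow> q \<le> T \<longrightarrow>
        \<sigma> * charac_drift val \<phi> z p q - \<eta> \<le> \<sigma> * (val q \<phi> - val p \<phi>)" if "0 < \<eta>" for \<eta>
      using \<sigma> val_sub_approx[OF x0 s'(1,3) that, of z] val_super_approx[OF x0 s'(1,2) that, of z] by metis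
    then obtain x where x: "x \<in> X_paths T Cf s0 x0"
      "\<And>p q. s0 \<le> p \<Longrightarrow> p \<le> q \<Longrightarrow> q \<le> T \<Longrightarrow> \<sigma> * charac_drift val x z p q \<le> \<sigma> * (val q x - val p x)"
      using charac_drift_limit[OF val_continuous x0 s'(1,2) \<sigma>1, of z] by blast
    obtain y where "(x, y) \<in> Y_paths T ham Cf s0 x0 y0 z" "\<And>t. t \<in> {s0..T} \<Longrightarrow> \<sigma> * (y t - val t x) \<le> 0"
      using characteristic_exists[OF val_continuous x0 s'(1,2) \<sigma>1 x y0] by blast
    then show ?thesis by blast
  qed
  have "minimax_supersolution T ham h Cf val"
    unfolding minimax_supersolution_def
  proof (intro conjI ballI allI impI lsc)
    fix s0 x0 z y0 assume *: "s0 \<in> {0..<T}" "x0 \<in> \<Omega>" "val s0 x0 \<le> y0"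
    show "\<exists>(x, y)\<in>Y_paths T ham Cf s0 x0 y0 z. \<forall>t\<in>{s0..T}. val t x \<le> y t"
      using main[OF *(1,2), of "-1" y0 z] *(3) by fastforce
  qed (simp add: val_terminal)
  moreover have "minimax_subsolution T ham h Cf val"
    unfolding minimax_subsolution_def
  proof (intro conjI ballI allI impI usc)
    fix s0 x0 z y0 assume *: "s0 \<in> {0..<T}" "x0 \<in> \<Omega>" "y0 \<le> val s0 x0"
    show "\<exists>(x, y)\<in>Y_paths T ham Cf s0 x0 y0 z. \<forall>t\<in>{s0..T}. y t \<le> val t x"
      using main[OF *(1,2), of 1 y0 z] *(3) by fastforce
  qed (simp add: val_terminal)
  ultimately show ?thesis by (simp add: minimax_solution_def)
qed

section \<open>Comparison with payoffs by extremal aiming\<close>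

lemma traj_agree:
  assumes x: "x \<in> \<Omega>" and a: "a \<in> controls T A" "a' \<in> controls T A" and s: "0 \<le> s" "s \<le> t" "t \<le> T"
    and aa: "\<And>r. r \<in> {s<..<t} \<Longrightarrow> a' r = a r" and r: "r \<in> {0..t}"
  shows "traj s x a' r = traj s x a r"
proof -
  have "s \<le> T" "0 \<le> t" using s by auto
  then show ?thesis
    using traj_concat[OF x a s aa] traj_path(3)[OF traj_path(1)[OF x a(1) s(1)] a(2) _ s(3) r] by simp
qed

lemma Y_paths_increment:
  assumes Y: "(x, y) \<in> Y_paths T ham Cf s x0 y0 z" and s: "0 \<le> s" "s \<le> p" "p \<le> q" "q \<le> T"
  shows "y q - y p = (x q - x p) \<bullet> z - integral {p..q} (\<lambda>r. ham r x (y r) z)"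
    and "(\<lambda>r. ham r x (y r) z) integrable_on {p..q}"
    and "y s = y0"
proof -
  let ?F = "\<lambda>r. vector_derivative x (at r) \<bullet> z - ham r x (y r) z"
  have X: "x \<in> X_paths T Cf s x0" and yc: "continuous_on {s..T} y" and F: "?F absolutely_integrable_on {s..T}"
    and yI: "\<And>t. t \<in> {s..T} \<Longrightarrow> y t = y0 + (LINT r:{s..t}|lebesgue. ?F r)"
    using Y by (auto simp: Y_paths_def)
  have yI': "y t = y0 + integral {s..t} ?F" if t: "t \<in> {s..T}" for t
  proof -
    have "?F absolutely_integrable_on {s..t}"
      by (rule absolutely_integrable_on_subinterval[OF F]) (use t in auto)
    then show ?thesis using yI[OF t] by (simp add: set_lebesgue_integral_eq_integral(2))
  qed
  have sT: "s \<le> T" using s by simp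
  then show "y s = y0" using yI'[of s] by simp
  show hi: "(\<lambda>r. ham r x (y r) z) integrable_on {p..q}"
    by (rule ham_integrable[OF X_pathsD(1)[OF X] s(1,2,4) yc])
  note v = X_paths_derivative_abs_integrable(2)[where z=z, OF X Cf s(1) sT s(2-4)]
  have Fi: "?F integrable_on {s..q}"
    using integrable_on_subinterval[of ?F "{s..T}" s q] F set_lebesgue_integral_eq_integral(1) s by fastforce
  have "y q - y p = integral {p..q} ?F"
    using yI'[of q] yI'[of p] Henstock_Kurzweil_Integration.integral_combine[OF s(2,3) Fi] s by simp
  also have "\<dots> = integral {p..q} (\<lambda>r. vector_derivative x (at r) \<bullet> z) - integral {p..q} (\<lambda>r. ham r x (y r) z)"
    by (rule Henstock_Kurzweil_Integration.integral_diff) (use v hi in \<open>auto simp: integrable_on_def\<close>)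
  finally show "y q - y p = (x q - x p) \<bullet> z - integral {p..q} (\<lambda>r. ham r x (y r) z)"
    using integral_unique[OF v] by simp
qed

text \<open>
  On a short interval \<open>y\<close> stays near its initial value, uniformly over paths, directions and values
  in a bounded set. So \<open>y\<close> may be replaced by a constant in the Hamiltonian.
\<close>

lemma Y_paths_near_start:
  assumes Y: "(x, y) \<in> Y_paths T ham Cf t x0 c z" and t: "0 \<le> t" "t \<le> r" "r \<le> T"
    and K: "0 \<le> K" "\<And>q. q \<in> {0..T} \<Longrightarrow> norm (x q) \<le> K" "\<And>q. q \<in> {t..T} \<Longrightarrow> norm (x q - x t) \<le> K * (q - t)"
    and z: "norm z \<le> Z" and c: "\<bar>c\<bar> \<le> B"
  shows "\<bar>y r - c\<bar> \<le> 2 * ((K * Z + Cf * (1 + K) * (1 + Z) + Clam * B) * (r - t)) * exp (2 * (Clam + 1) * T)"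
proof -
  have cx: "x \<in> \<Omega>" and yc: "continuous_on {t..T} y" using Y X_pathsD(1) by (auto simp: Y_paths_def)
  define M where "M = K * Z + Cf * (1 + K) * (1 + Z) + Clam * B"
  have Z: "0 \<le> Z" and B: "0 \<le> B" using z c norm_ge_zero[of z] by linarith+
  have M: "0 \<le> M" using K(1) Z Cf Clam B by (simp add: M_def)
  have tT: "t \<le> T" using t by simp
  have yt: "y t = c" by (rule Y_paths_increment(3)[OF Y t(1) order_refl order_refl tT])
  have "bounded ((\<lambda>r. y r - c) ` {t..T})"
    using yc by (intro compact_imp_bounded compact_continuous_image continuous_intros) auto
  then obtain B' where B': "\<And>r. r \<in> {t..T} \<Longrightarrow> \<bar>y r - c\<bar> \<le> B'" unfolding bounded_iff by fastforce
  let ?G = "\<lambda>r. Clam * \<bar>y r - c\<bar>"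
  have "\<bar>y r - c\<bar> \<le> 2 * (M * (r - t)) * exp (2 * (Clam + 1) * (r - t))"
  proof (rule gronwall_sup[where N=N and T=r and B=B' and G="?G"])
    fix q assume q: "q \<in> {t..r}"
    show "\<bar>y q - c\<bar> \<le> B'" using B'[of q] q t by auto
    have tq: "t \<le> q" "q \<le> T" using q t by auto
    note inc = Y_paths_increment[OF Y t(1) order_refl tq]
    show Gi: "?G integrable_on {t..q}"
      by (intro integrable_continuous_interval continuous_intros continuous_on_subset[OF yc]) (use tq in auto)
    have "norm (integral {t..q} (\<lambda>r. ham r x (y r) z)) \<le> integral {t..q} (\<lambda>r. (M - K * Z) + Clam * \<bar>y r - c\<bar>)"
    proof (rule norm_integral_le_ae[OF inc(2) _ N])
      show "(\<lambda>r. (M - K * Z) + Clam * \<bar>y r - c\<bar>) integrable_on {t..q}"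
        by (intro Henstock_Kurzweil_Integration.integrable_add Gi integrable_const_ivl)
      fix r assume r: "r \<in> {t<..<q} - N"
      then have r': "r \<in> {0<..<T} - N" using t tq by auto
      have "\<bar>ham r x (y r) z\<bar> \<le> Cf * (1 + K) * (1 + norm z) + Clam * \<bar>y r\<bar>"
        by (rule ham_bound[OF r' cx]) (use K(2) r' in auto)
      also have "\<dots> \<le> Cf * (1 + K) * (1 + Z) + Clam * (B + \<bar>y r - c\<bar>)"
        using z c Cf K(1) Clam by (intro add_mono mult_left_mono) auto
      finally show "norm (ham r x (y r) z) \<le> (M - K * Z) + Clam * \<bar>y r - c\<bar>" by (simp add: M_def algebra_simps)
    qed
    also have "\<dots> = (M - K * Z) * (q - t) + integral {t..q} (\<lambda>r. Clam * \<bar>y r - c\<bar>)"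
      using tq by (simp add: Henstock_Kurzweil_Integration.integral_add[OF integrable_const_ivl Gi] mult.commute)
    finally have 1: "\<bar>integral {t..q} (\<lambda>r. ham r x (y r) z)\<bar> \<le> \<dots>" by simp
    have "\<bar>(x q - x t) \<bullet> z\<bar> \<le> norm (x q - x t) * norm z" by (rule Cauchy_Schwarz_ineq2)
    also have "\<dots> \<le> (K * (q - t)) * Z"
      using K(3)[of q] tq z Z K(1) by (intro mult_mono) auto
    finally have "\<bar>y q - c\<bar> \<le> M * (q - t) + integral {t..q} (\<lambda>r. Clam * \<bar>y r - c\<bar>)"
      using inc(1) 1 unfolding yt by (simp add: algebra_simps)
    also have "M * (q - t) \<le> M * (r - t)" using M q by (intro mult_left_mono) auto
    finally show "\<bar>y q - c\<bar> \<le> M * (r - t) + integral {t..q} ?G" by simp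
  next
    fix q C assume q: "q \<in> {t<..<r} - N" and C: "0 \<le> C" "\<And>\<rho>. \<rho> \<in> {t..q} \<Longrightarrow> \<bar>y \<rho> - c\<bar> \<le> C"
    show "?G q \<le> (Clam + 1) * C" using C(2)[of q] q C(1) Clam by (intro mult_mono) auto
  qed (use Clam M N t in auto)
  also have "\<dots> \<le> 2 * (M * (r - t)) * exp (2 * (Clam + 1) * T)"
    using M Clam t by (intro mult_left_mono) (auto intro!: mult_left_mono)
  finally show ?thesis by (simp add: M_def)
qed

end

text \<open>
  Both halves of the uniqueness proof at once. For \<open>\<sigma> = 1\<close> the functional \<open>u\<close> is a
  subsolution and \<open>\<C>\<close> consists of a single control: every control is admissible, as the
  Hamiltonian is an infimum. For \<open>\<sigma> = -1\<close> it is a supersolution and \<open>\<C>\<close> is the set of all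
  controls, among which one can be selected that almost attains the infimum. The assumption \<open>select\<close>
  covers both cases; it lets the control be modified after time \<open>t\<close> only.
\<close>

locale extremal_aiming = control_data T Cf Clam Lf A f lam l h N
  for T Cf Clam Lf :: real and A :: "'p::polish_space set"
    and f :: "real \<Rightarrow> (real \<Rightarrow> 'd::euclidean_space) \<Rightarrow> 'p \<Rightarrow> 'd"
    and lam l :: "real \<Rightarrow> (real \<Rightarrow> 'd) \<Rightarrow> 'p \<Rightarrow> real"
    and h :: "(real \<Rightarrow> 'd) \<Rightarrow> real" and N :: "real set" +
  fixes u :: "real \<Rightarrow> (real \<Rightarrow> 'd) \<Rightarrow> real" and \<sigma> :: real and \<C> :: "(real \<Rightarrow> 'p) set"
  assumes u: "continuous_paths T u" and \<sigma>: "\<bar>\<sigma>\<bar> = 1"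
    and characteristic: "\<And>s x z. s \<in> {0..<T} \<Longrightarrow> x \<in> \<Omega> \<Longrightarrow>
      \<exists>(x', y)\<in>Y_paths T ham Cf s x (u s x) z. \<forall>t\<in>{s..T}. \<sigma> * (y t - u t x') \<le> 0"
    and \<C>: "\<C> \<subseteq> controls T A"
    and select: "\<And>a t x c z \<eta>. a \<in> \<C> \<Longrightarrow> t \<in> {0..T} \<Longrightarrow> x \<in> \<Omega> \<Longrightarrow> 0 < \<eta> \<Longrightarrow>
      \<exists>a'\<in>\<C>. (\<forall>r\<le>t. a' r = a r) \<and> (\<forall>r\<in>{t<..<T} - N. - \<eta> \<le> \<sigma> * (preham r x (a' r) c z - ham r x c z))"
begin

text \<open>
  The right-hand side of the linear equation of the payoff, with \<open>u\<close> in place of the payoff.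
\<close>

abbreviation "running x a r \<equiv> lam r x (a r) * u r x - l r x (a r)"

lemma \<sigma>_le: "\<sigma> * b \<le> \<bar>b\<bar>" "- \<bar>b\<bar> \<le> \<sigma> * b"
  using abs_ge_self[of "\<sigma> * b"] abs_ge_minus_self[of "\<sigma> * b"] \<sigma> by (auto simp: abs_mult)

lemma u_along_continuous:
  assumes "x0 \<in> \<Omega>" "0 \<le> s" "s \<le> T" "x \<in> X_paths T Cf s x0"
  shows "continuous_on {s..T} (\<lambda>t. u t x)"
  by (rule X_paths_functional_continuous[OF u assms(1) Cf assms(2-)])

lemma running_u_integrable:
  assumes "x0 \<in> \<Omega>" "0 \<le> s" "x \<in> X_paths T Cf s x0" "a \<in> controls T A" "s \<le> p" "p \<le> q" "q \<le> T"
  shows "(\<lambda>r. running x a r) integrable_on {p..q}"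
proof (rule running_integrable[OF X_pathsD(1)[OF assms(3)] assms(4)])
  have "s \<le> T" using assms by simp
  from u_along_continuous[OF assms(1,2) this assms(3)]
  show "continuous_on {p..q} (\<lambda>r. u r x)" by (rule continuous_on_subset) (use assms in auto)
qed (use assms in auto)

lemma running_agree:
  assumes x: "x \<in> \<Omega>" "x' \<in> \<Omega>" and a: "a \<in> controls T A" "a' \<in> controls T A" and pq: "0 \<le> p" "q \<le> T"
    and eq: "\<And>r. r \<in> {0..q} \<Longrightarrow> x' r = x r" "\<And>r. r \<le> q \<Longrightarrow> a' r = a r"
  shows "integral {p..q} (\<lambda>r. running x' a' r) = integral {p..q} (\<lambda>r. running x a r)"
proof (rule integral_eq_ae[OF N])
  fix r assume r: "r \<in> {p<..<q} - N"
  have r': "r \<in> {0<..<T} - N" "a r \<in> A" using r pq control_in[OF a(1), of r] by auto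
  have "l r x' (a r) = l r x (a r)" "lam r x' (a r) = lam r x (a r)"
    by (rule data_nonanticipative(2,3)[OF r'(1) x(2,1) r'(2)]; use eq r in auto)+
  moreover have "u r x' = u r x"
    by (rule continuous_paths_nonanticipative[OF u _ x(2,1)]) (use eq r pq in auto)
  ultimately show "running x' a' r = running x a r" using eq(2)[of r] r by simp
qed

text \<open>
  The inequality that drives the comparison: up to the rate \<open>\<eta>\<close>, the increment of \<open>\<sigma> u\<close>
  along \<open>x\<close> pays for the increment of the penalty and for the running term. The error in the middle
  comes from the dependence of the data on the past, and \<open>D\<close> bounds the deviation from the
  trajectory on the whole past; the quantification over \<open>D\<close> lets the estimates of consecutive cells
  be added with a common \<open>D\<close>.
\<close>

definition aiming_estimate :: "real \<Rightarrow> real \<Rightarrow> real \<Rightarrow> (real \<Rightarrow> 'd) \<Rightarrow> real \<Rightarrow> real \<Rightarrow> (real \<Rightarrow> 'd) \<Rightarrow> (real \<Rightarrow> 'p) \<Rightarrow> bool" where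
  "aiming_estimate \<epsilon> \<eta> s \<psi> t t' x a \<longleftrightarrow>
     (\<forall>\<tau>\<in>{t..t'}. \<forall>D. (\<forall>\<rho>\<in>{0..\<tau>}. norm (x \<rho> - traj s \<psi> a \<rho>) \<le> D) \<longrightarrow>
        (norm (x \<tau> - traj s \<psi> a \<tau>)^2 - norm (x t - traj s \<psi> a t)^2) / \<epsilon> - 2 * Lf / \<epsilon> * D^2 * (\<tau> - t)
          + \<sigma> * integral {t..\<tau>} (\<lambda>r. running x a r) - \<eta> * (\<tau> - t) \<le> \<sigma> * (u \<tau> x - u t x))"

text \<open>
  The estimate concerns the past of \<open>t'\<close> only, so it is kept when path and control are changed
  later.
\<close>

lemma aiming_estimate_cong:
  assumes \<psi>: "\<psi> \<in> \<Omega>" and x: "x \<in> \<Omega>" "x' \<in> \<Omega>" and a: "a \<in> controls T A" "a' \<in> controls T A"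
    and s: "0 \<le> s" "s \<le> t" "t \<le> t'" "t' \<le> T"
    and eq: "\<And>r. r \<in> {0..t'} \<Longrightarrow> x' r = x r" "\<And>r. r \<le> t' \<Longrightarrow> a' r = a r"
    and est: "aiming_estimate \<epsilon> \<eta> s \<psi> t t' x a"
  shows "aiming_estimate \<epsilon> \<eta> s \<psi> t t' x' a'"
  unfolding aiming_estimate_def
proof (intro ballI allI impI)
  fix \<tau> D assume \<tau>: "\<tau> \<in> {t..t'}" and D: "\<forall>\<rho>\<in>{0..\<tau>}. norm (x' \<rho> - traj s \<psi> a' \<rho>) \<le> D"
  have st': "s \<le> t'" using s by simp
  have teq: "traj s \<psi> a' r = traj s \<psi> a r" if "r \<in> {0..t'}" for r
    by (rule traj_agree[OF \<psi> a s(1) st' s(4) _ that]) (use eq(2) in auto)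
  have ueq: "u r x' = u r x" if "r \<in> {0..t'}" for r
    by (rule continuous_paths_nonanticipative[OF u _ x(2,1)]) (use eq(1) that s in auto)
  have I: "integral {t..\<tau>} (\<lambda>r. running x' a' r) = integral {t..\<tau>} (\<lambda>r. running x a r)"
    by (rule running_agree[OF x a]) (use eq \<tau> s in auto)
  have in': "\<tau> \<in> {0..t'}" "t \<in> {0..t'}" using \<tau> s by auto
  have "norm (x \<rho> - traj s \<psi> a \<rho>) \<le> D" if "\<rho> \<in> {0..\<tau>}" for \<rho>
    using D[rule_format, OF that] eq(1)[of \<rho>] teq[of \<rho>] that \<tau> by simp
  then show "(norm (x' \<tau> - traj s \<psi> a' \<tau>)^2 - norm (x' t - traj s \<psi> a' t)^2) / \<epsilon> - 2 * Lf / \<epsilon> * D^2 * (\<tau> - t)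
      + \<sigma> * integral {t..\<tau>} (\<lambda>r. running x' a' r) - \<eta> * (\<tau> - t) \<le> \<sigma> * (u \<tau> x' - u t x')"
    unfolding I eq(1)[OF in'(1)] eq(1)[OF in'(2)] teq[OF in'(1)] teq[OF in'(2)] ueq[OF in'(1)] ueq[OF in'(2)]
    using est \<tau> unfolding aiming_estimate_def by blast
qed

lemma running_bound:
  assumes x0: "x0 \<in> \<Omega>" and s0: "0 \<le> s0" "s0 \<le> T"
  obtains C where "0 \<le> C" "\<And>x a r. r \<in> {0<..<T} - N \<Longrightarrow> s0 \<le> r \<Longrightarrow> x \<in> X_paths T Cf s0 x0 \<Longrightarrow> a \<in> controls T A \<Longrightarrow>
    \<bar>running x a r\<bar> \<le> C"
proof -
  obtain K where "equi_lipschitz T Cf s0 x0 K" using X_paths_uniform[OF x0 Cf s0] by blast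
  note K = equi_lipschitzD[OF this]
  obtain B where B: "0 \<le> B" "\<And>t x. t \<in> {s0..T} \<Longrightarrow> x \<in> X_paths T Cf s0 x0 \<Longrightarrow> \<bar>u t x\<bar> \<le> B"
    using continuous_paths_bounded[OF u x0 Cf s0] by blast
  show thesis
  proof (rule that)
    show "0 \<le> Clam * B + Cf * (1 + K)" using Clam B Cf K by simp
    fix x a r
    assume r: "r \<in> {0<..<T} - N" "s0 \<le> r" and x: "x \<in> X_paths T Cf s0 x0" and a: "a \<in> controls T A"
    have aA: "a r \<in> A" using r control_in[OF a, of r] by auto
    note b = data_bound(2,3)[OF r(1) X_pathsD(1)[OF x] aA, of K]
    have "\<bar>l r x (a r)\<bar> \<le> Cf * (1 + K)" "\<bar>lam r x (a r)\<bar> \<le> Clam" using b K(2)[OF x] r(1) by auto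
    moreover from this(2) have "\<bar>lam r x (a r) * u r x\<bar> \<le> Clam * B"
      unfolding abs_mult using B(2)[OF _ x, of r] r Clam by (intro mult_mono) auto
    ultimately show "\<bar>running x a r\<bar> \<le> Clam * B + Cf * (1 + K)" by linarith
  qed
qed

text \<open>
  Extremal aiming on one cell. With \<open>w\<close> the deviation at \<open>t\<close> and \<open>z = (2 \<sigma> / \<epsilon>) w\<close>,
  let \<open>x'\<close> be a characteristic for the direction \<open>z\<close> started at \<open>u t x\<close>, and let \<open>a'\<close> be an almost
  extremal control for the frozen value \<open>c = u t x\<close>. Comparing the term
  \<open>(x' \<tau> - x' t) \<bullet> z\<close> of the characteristic with the term \<open>f \<bullet> z\<close> inside the
  Hamiltonian leaves the scalar product of \<open>2 w / \<epsilon>\<close> with the increment of the deviation.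
  This is the increment of the penalty up to a quadratic remainder, which is of second order in the
  length of the cell.
\<close>

lemma aiming_cell:
  assumes x0: "x0 \<in> \<Omega>" and s0: "0 \<le> s0" "s0 \<le> T" and \<epsilon>: "0 < \<epsilon>" and \<eta>: "0 < \<eta>"
  obtains \<delta> where "0 < \<delta>"
    "\<And>s \<psi> a x t t'. s0 \<le> s \<Longrightarrow> s \<le> t \<Longrightarrow> t < t' \<Longrightarrow> t' \<le> T \<Longrightarrow> t' - t \<le> \<delta> \<Longrightarrow> \<psi> \<in> X_paths T Cf s0 x0 \<Longrightarrow>
      x \<in> X_paths T Cf s0 x0 \<Longrightarrow> a \<in> \<C> \<Longrightarrow>
      \<exists>x' a'. x' \<in> X_paths T Cf s0 x0 \<and> a' \<in> \<C> \<and> (\<forall>r\<in>{0..t}. x' r = x r) \<and> (\<forall>r\<le>t. a' r = a r) \<and>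
        aiming_estimate \<epsilon> \<eta> s \<psi> t t' x' a'"
proof -
  obtain K where "equi_lipschitz T Cf s0 x0 K" using X_paths_uniform[OF x0 Cf s0] by blast
  note K = equi_lipschitzD[OF this]
  obtain B where B: "0 \<le> B" "\<And>t x. t \<in> {s0..T} \<Longrightarrow> x \<in> X_paths T Cf s0 x0 \<Longrightarrow> \<bar>u t x\<bar> \<le> B"
    using continuous_paths_bounded[OF u x0 Cf s0] by blast
  define e where "e = \<eta> / (4 * (Clam + 1))"
  have e: "0 < e" "Clam * e \<le> \<eta> / 4" using \<eta> Clam by (auto simp: e_def field_simps)
  obtain \<rho> where "path_modulus T Cf s0 x0 u e \<rho>"
    using continuous_paths_uniform[OF u x0 Cf s0 e(1)] by blast
  note \<rho> = path_modulusD[OF this]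
  define Z where "Z = 4 * K / \<epsilon>"
  have Z: "0 \<le> Z" using K \<epsilon> by (simp add: Z_def)
  define M where "M = K * Z + Cf * (1 + K) * (1 + Z) + Clam * B"
  have M: "0 \<le> M" using K Z Cf Clam B by (simp add: M_def)
  define E where "E = 2 * M * exp (2 * (Clam + 1) * T)"
  have E: "0 \<le> E" using M by (simp add: E_def)
  define X where "X = 4 * K^2 + 1"
  have X: "0 < X" "4 * K^2 \<le> X" unfolding X_def by (auto intro: add_nonneg_pos)
  define \<delta> where "\<delta> = min \<rho> (min (e / (E + 1)) (\<eta> * \<epsilon> / (4 * X)))"
  have \<delta>: "0 < \<delta>" "\<delta> \<le> \<rho>" "E * \<delta> \<le> e" "4 * K^2 / \<epsilon> * \<delta> \<le> \<eta> / 4"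
  proof -
    show "0 < \<delta>" using \<rho> e E \<eta> \<epsilon> X by (auto simp: \<delta>_def)
    show "\<delta> \<le> \<rho>" by (simp add: \<delta>_def)
    have "E * \<delta> \<le> E * (e / (E + 1))" using E by (intro mult_left_mono) (auto simp: \<delta>_def)
    also have "\<dots> \<le> e" using E e by (simp add: field_simps)
    finally show "E * \<delta> \<le> e" .
    have "4 * K^2 / \<epsilon> * \<delta> \<le> X / \<epsilon> * (\<eta> * \<epsilon> / (4 * X))"
      using \<epsilon> X \<eta> \<rho>(1) e(1) E by (intro mult_mono divide_right_mono) (auto simp: \<delta>_def)
    also have "\<dots> = \<eta> / 4" using \<epsilon> X(1) by simp
    finally show "4 * K^2 / \<epsilon> * \<delta> \<le> \<eta> / 4" .
  qed
  show thesis
  proof (rule that[OF \<delta>(1)])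
    fix s \<psi> a x t t'
    assume st: "s0 \<le> s" "s \<le> t" "t < t'" "t' \<le> T" "t' - t \<le> \<delta>" and \<psi>: "\<psi> \<in> X_paths T Cf s0 x0"
      and x: "x \<in> X_paths T Cf s0 x0" and a: "a \<in> \<C>"
    note c\<psi> = X_pathsD(1)[OF \<psi>] and cx = X_pathsD(1)[OF x]
    have s: "0 \<le> s" "s \<le> T" and t0: "0 \<le> t" "t \<le> T" "t < T" "t \<in> {s0..T}" using st s0 by auto
    have aC: "a \<in> controls T A" using a \<C> by blast
    define w where "w = x t - traj s \<psi> a t"
    \<comment> \<open>the gradient of the penalty, with the sign that makes its growth enter on the small side of
      the estimate\<close>
    define z where "z = (2 * \<sigma> / \<epsilon>) *\<^sub>R w"
    define c where "c = u t x"
    obtain x' y where Y: "(x', y) \<in> Y_paths T ham Cf t x c z" and yu: "\<And>r. r \<in> {t..T} \<Longrightarrow> \<sigma> * (y r - u r x') \<le> 0"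
      using characteristic[of t x z] t0 cx unfolding c_def by auto
    have X't: "x' \<in> X_paths T Cf t x" and yc: "continuous_on {t..T} y" using Y by (auto simp: Y_paths_def)
    have X': "x' \<in> X_paths T Cf s0 x0" by (rule X_paths_trans[OF x X't Cf s0(1)]) (use t0 in auto)
    note c' = X_pathsD(1)[OF X'] and eq = X_pathsD(2)[OF X't]
    have "0 < \<eta> / 4" using \<eta> by simp
    then obtain a' where a': "a' \<in> \<C>" "\<And>r. r \<le> t \<Longrightarrow> a' r = a r"
      "\<And>r. r \<in> {t<..<T} - N \<Longrightarrow> - (\<eta> / 4) \<le> \<sigma> * (preham r x' (a' r) c z - ham r x' c z)"
      using select[OF a, of t x' "\<eta> / 4" c z] t0 c' by auto
    have a'C: "a' \<in> controls T A" using a'(1) \<C> by blast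
    let ?\<phi> = "traj s \<psi> a'"
    note c\<phi> = traj_path(1)[OF c\<psi> a'C s]
    have X\<phi>: "?\<phi> \<in> X_paths T Cf s0 x0"
      by (rule X_paths_trans[OF \<psi> traj_path(2)[OF c\<psi> a'C s] Cf s0(1) st(1) s(2)])
    have \<phi>t: "?\<phi> r = traj s \<psi> a r" if "r \<in> {0..t}" for r
      by (rule traj_agree[OF c\<psi> aC a'C s(1) st(2) t0(2) _ that]) (use a'(2) in auto)
    have w: "x' t - ?\<phi> t = w" using eq[of t] \<phi>t[of t] t0 by (simp add: w_def)
    have wK: "norm w \<le> 2 * K"
      using w K(2)[OF X', of t] K(2)[OF X\<phi>, of t] t0 norm_triangle_ineq4[of "x' t" "?\<phi> t"] by auto
    have nz: "norm z = 2 / \<epsilon> * norm w" using \<sigma> \<epsilon> by (simp add: z_def abs_mult)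
    have zZ: "norm z \<le> Z"
      unfolding nz Z_def using wK \<epsilon> by (simp add: field_simps)
    have cB: "\<bar>c\<bar> \<le> B" unfolding c_def by (rule B(2)[OF t0(4) x])
    have yt: "y t = c"
      by (rule Y_paths_increment(3)[OF Y t0(1) order_refl order_refl t0(2)])
    have uc: "\<bar>u r x' - c\<bar> \<le> e" if r: "r \<in> {t..t'}" for r
    proof -
      have "\<bar>u r x' - u t x'\<bar> \<le> e"
      proof (rule \<rho>(2)[OF _ t0(4) X' X'])
        show "r \<in> {s0..T}" using r st t0 by auto
        show "\<bar>r - t\<bar> \<le> \<rho>" using r st \<delta>(2) by auto
      qed (use \<rho>(1) in simp)
      moreover have "u t x' = c" unfolding c_def
        by (rule continuous_paths_nonanticipative[OF u _ c' cx eq]) (use t0 in auto)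
      ultimately show ?thesis by simp
    qed
    have yclose: "\<bar>y r - c\<bar> \<le> e" if r: "r \<in> {t..t'}" for r
    proof -
      have "\<bar>y r - c\<bar> \<le> 2 * (M * (r - t)) * exp (2 * (Clam + 1) * T)"
        unfolding M_def
      proof (rule Y_paths_near_start[OF Y t0(1) _ _ K(1) _ _ zZ cB])
        show "norm (x' q) \<le> K" if "q \<in> {0..T}" for q by (rule K(2)[OF X' that])
        show "norm (x' q - x' t) \<le> K * (q - t)" if "q \<in> {t..T}" for q
          using K(3)[OF X' t0(4), of q] that t0 by auto
      qed (use r st in auto)
      also have "\<dots> \<le> 2 * (M * \<delta>) * exp (2 * (Clam + 1) * T)"
        using M r st by (intro mult_right_mono mult_left_mono) auto
      also have "\<dots> = E * \<delta>" by (simp add: E_def)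
      finally show ?thesis using \<delta>(3) by linarith
    qed
    have main: "(norm (x' \<tau> - ?\<phi> \<tau>)^2 - norm (x' t - ?\<phi> t)^2) / \<epsilon> - 2 * Lf / \<epsilon> * D^2 * (\<tau> - t)
            + \<sigma> * integral {t..\<tau>} (\<lambda>r. running x' a' r) - \<eta> * (\<tau> - t) \<le> \<sigma> * (u \<tau> x' - u t x')"
      if \<tau>: "\<tau> \<in> {t..t'}" and D: "\<forall>\<rho>\<in>{0..\<tau>}. norm (x' \<rho> - ?\<phi> \<rho>) \<le> D" for \<tau> D
    proof -
      have tt: "t \<le> \<tau>" "\<tau> \<le> T" using \<tau> st by auto
      define \<zeta> where "\<zeta> = (2 / \<epsilon>) *\<^sub>R w"
      have \<sigma>2: "\<sigma> * \<sigma> = 1" using \<sigma> by (cases "\<sigma> \<ge> 0") auto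
      have \<sigma>z: "\<sigma> *\<^sub>R z = \<zeta>" by (simp add: z_def \<zeta>_def mult.assoc[symmetric] \<sigma>2 mult.commute)
      have wD: "norm w \<le> D" using D w t0 tt by auto
      have D0: "0 \<le> D" using wD norm_ge_zero[of w] by linarith
      have n\<zeta>: "norm \<zeta> \<le> 2 / \<epsilon> * D" using wD \<epsilon> by (simp add: \<zeta>_def divide_right_mono)
      note inc = Y_paths_increment[OF Y t0(1) order_refl tt]
      note fz = inner_running_integral[OF c\<psi> a'C s(1) st(2) tt, of \<zeta>]
      note ri = running_u_integrable[OF x0 s0(1) X' a'C _ tt]
      have ri: "(\<lambda>r. running x' a' r) integrable_on {t..\<tau>}" by (rule ri) (use t0 in auto)
      \<comment> \<open>four errors, of which three are \<open>\<eta> / 4\<close>: replacing \<open>y\<close> by \<open>c\<close> in the Hamiltonian,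
        replacing \<open>c\<close> by \<open>u\<close> in the rate term, and the selection; the fourth, from evaluating \<open>f\<close>
        along the trajectory instead of along \<open>x'\<close>, is the one with \<open>D\<close>\<close>
      have "integral {t..\<tau>} (\<lambda>r. \<sigma> * running x' a' r - (f r ?\<phi> (a' r) \<bullet> \<zeta> + (2 * Lf / \<epsilon> * D^2 + 3 * \<eta> / 4)))
          \<le> integral {t..\<tau>} (\<lambda>r. - \<sigma> * ham r x' (y r) z)"
      proof (rule integral_le_ae[OF _ _ N])
        show "(\<lambda>r. \<sigma> * running x' a' r - (f r ?\<phi> (a' r) \<bullet> \<zeta> + (2 * Lf / \<epsilon> * D^2 + 3 * \<eta> / 4))) integrable_on {t..\<tau>}"
          by (intro Henstock_Kurzweil_Integration.integrable_diff Henstock_Kurzweil_Integration.integrable_add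
              fz integrable_const_ivl integrable_on_mult_right ri)
        show "(\<lambda>r. - \<sigma> * ham r x' (y r) z) integrable_on {t..\<tau>}" by (rule integrable_on_mult_right[OF inc(2)])
        fix r assume r: "r \<in> {t<..<\<tau>} - N"
        have r': "r \<in> {0<..<T} - N" "r \<in> {t<..<T} - N" "r \<in> {t..t'}" "a' r \<in> A"
          using r t0 tt \<tau> control_in[OF a'C, of r] by auto
        have "\<bar>ham r x' (y r) z - ham r x' c z\<bar> \<le> Lf * (1 + norm z + \<bar>y r\<bar>) * 0 + Clam * \<bar>y r - c\<bar>"
          by (rule ham_lipschitz[OF r'(1) c' c']) auto
        moreover have "Clam * \<bar>y r - c\<bar> \<le> Clam * e" using yclose[OF r'(3)] Clam by (intro mult_left_mono)
        ultimately have "\<bar>ham r x' (y r) z - ham r x' c z\<bar> \<le> \<eta> / 4" using e(2) by linarith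
        then have 1: "\<sigma> * (ham r x' (y r) z - ham r x' c z) \<le> \<eta> / 4" using \<sigma>_le(1) order_trans by blast
        have "\<bar>lam r x' (a' r) * (c - u r x')\<bar> \<le> Clam * e"
          unfolding abs_mult using lam_le[OF r'(1) c' r'(4)] uc[OF r'(3)] Clam by (intro mult_mono) (auto simp: abs_minus_commute)
        then have 2: "- (\<eta> / 4) \<le> \<sigma> * (lam r x' (a' r) * (c - u r x'))"
          using \<sigma>_le(2)[of "lam r x' (a' r) * (c - u r x')"] e(2) by linarith
        have "norm (f r x' (a' r) - f r ?\<phi> (a' r)) \<le> Lf * D"
          by (rule data_lipschitz(1)[OF r'(1) c' c\<phi> r'(4)]) (use D r in auto)
        then have "\<bar>(f r x' (a' r) - f r ?\<phi> (a' r)) \<bullet> \<zeta>\<bar> \<le> (Lf * D) * (2 / \<epsilon> * D)"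
          using Cauchy_Schwarz_ineq2[of "f r x' (a' r) - f r ?\<phi> (a' r)" \<zeta>] n\<zeta> Lf D0
            mult_mono[of "norm (f r x' (a' r) - f r ?\<phi> (a' r))" "Lf * D" "norm \<zeta>" "2 / \<epsilon> * D"] by auto
        then have 3: "f r x' (a' r) \<bullet> \<zeta> \<le> f r ?\<phi> (a' r) \<bullet> \<zeta> + 2 * Lf / \<epsilon> * D^2"
          by (simp add: inner_diff_left power2_eq_square algebra_simps)
        have 4: "- (\<eta> / 4) \<le> \<sigma> * (preham r x' (a' r) c z - ham r x' c z)" by (rule a'(3)[OF r'(2)])
        have "\<sigma> * preham r x' (a' r) c z = \<sigma> * l r x' (a' r) + f r x' (a' r) \<bullet> \<zeta> - \<sigma> * (lam r x' (a' r) * c)"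
          unfolding preham_def \<sigma>z[symmetric] by (simp add: algebra_simps)
        moreover have "\<sigma> * (lam r x' (a' r) * (c - u r x')) = \<sigma> * (lam r x' (a' r) * c) - \<sigma> * (lam r x' (a' r) * u r x')"
          "\<sigma> * (preham r x' (a' r) c z - ham r x' c z) = \<sigma> * preham r x' (a' r) c z - \<sigma> * ham r x' c z"
          "\<sigma> * (ham r x' (y r) z - ham r x' c z) = \<sigma> * ham r x' (y r) z - \<sigma> * ham r x' c z"
          "\<sigma> * running x' a' r = \<sigma> * (lam r x' (a' r) * u r x') - \<sigma> * l r x' (a' r)"
          by (simp_all add: algebra_simps)
        ultimately have "\<sigma> * running x' a' r - (f r ?\<phi> (a' r) \<bullet> \<zeta> + (2 * Lf / \<epsilon> * D^2 + 3 * \<eta> / 4)) \<le> - (\<sigma> * ham r x' (y r) z)"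
          using 1 2 3 4 by linarith
        then show "\<sigma> * running x' a' r - (f r ?\<phi> (a' r) \<bullet> \<zeta> + (2 * Lf / \<epsilon> * D^2 + 3 * \<eta> / 4)) \<le> - \<sigma> * ham r x' (y r) z"
          by simp
      qed
      then have I: "\<sigma> * integral {t..\<tau>} (\<lambda>r. running x' a' r) - (?\<phi> \<tau> - ?\<phi> t) \<bullet> \<zeta> - (2 * Lf / \<epsilon> * D^2 + 3 * \<eta> / 4) * (\<tau> - t)
          \<le> - \<sigma> * integral {t..\<tau>} (\<lambda>r. ham r x' (y r) z)"
        unfolding integral_diff_shift[OF integrable_on_mult_right[OF ri] fz(1) tt(1)] integral_mult_right fz(2) .
      have "\<sigma> * (y \<tau> - c) = \<sigma> * ((x' \<tau> - x' t) \<bullet> z) - \<sigma> * integral {t..\<tau>} (\<lambda>r. ham r x' (y r) z)"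
        using inc(1) unfolding yt by (simp only: right_diff_distrib)
      also have "\<sigma> * ((x' \<tau> - x' t) \<bullet> z) = (x' \<tau> - x' t) \<bullet> \<zeta>" unfolding \<sigma>z[symmetric] by simp
      finally have yy: "\<sigma> * (y \<tau> - c) = (x' \<tau> - x' t) \<bullet> \<zeta> - \<sigma> * integral {t..\<tau>} (\<lambda>r. ham r x' (y r) z)" .
      \<comment> \<open>increment of the deviation over \<open>[t,\<tau>]\<close>; its square is the remainder and takes the last
        \<open>\<eta> / 4\<close>\<close>
      define \<Delta> where "\<Delta> = (x' \<tau> - x' t) - (?\<phi> \<tau> - ?\<phi> t)"
      have w\<tau>: "x' \<tau> - ?\<phi> \<tau> = w + \<Delta>" unfolding \<Delta>_def w[symmetric] by simp
      have "norm \<Delta> \<le> norm (x' \<tau> - x' t) + norm (?\<phi> \<tau> - ?\<phi> t)" unfolding \<Delta>_def by (rule norm_triangle_ineq4)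
      also have "\<dots> \<le> K * \<bar>\<tau> - t\<bar> + K * \<bar>\<tau> - t\<bar>"
        using tt t0 by (intro add_mono K(3) X' X\<phi>) auto
      finally have "norm \<Delta> \<le> 2 * K * (\<tau> - t)" using tt by simp
      then have "(norm \<Delta>)^2 \<le> (2 * K * (\<tau> - t))^2" by (intro power_mono) auto
      also have "\<dots> = 4 * K^2 * (\<tau> - t) * (\<tau> - t)" by (simp add: power2_eq_square)
      also have "\<dots> \<le> 4 * K^2 * \<delta> * (\<tau> - t)" using tt \<tau> st by (intro mult_right_mono mult_left_mono) auto
      finally have "(norm \<Delta>)^2 / \<epsilon> \<le> 4 * K^2 * \<delta> * (\<tau> - t) / \<epsilon>" using \<epsilon> by (intro divide_right_mono) auto
      also have "\<dots> = 4 * K^2 / \<epsilon> * \<delta> * (\<tau> - t)" by simp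
      also have "\<dots> \<le> \<eta> / 4 * (\<tau> - t)" using \<delta>(4) tt by (intro mult_right_mono) auto
      finally have \<Delta>2: "(norm \<Delta>)^2 / \<epsilon> \<le> \<eta> / 4 * (\<tau> - t)" .
      have "(norm (w + \<Delta>))^2 = (norm w)^2 + 2 * (\<Delta> \<bullet> w) + (norm \<Delta>)^2"
        by (simp add: power2_norm_eq_inner inner_add_left inner_add_right inner_commute)
      moreover have "\<Delta> \<bullet> \<zeta> = 2 * (\<Delta> \<bullet> w) / \<epsilon>" by (simp add: \<zeta>_def)
      ultimately have "\<Delta> \<bullet> \<zeta> = ((norm (w + \<Delta>))^2 - (norm w)^2) / \<epsilon> - (norm \<Delta>)^2 / \<epsilon>"
        using \<epsilon> by (simp add: field_simps)
      moreover have "\<Delta> \<bullet> \<zeta> = (x' \<tau> - x' t) \<bullet> \<zeta> - (?\<phi> \<tau> - ?\<phi> t) \<bullet> \<zeta>" by (simp add: \<Delta>_def inner_diff_left)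
      ultimately have "((norm (w + \<Delta>))^2 - (norm w)^2) / \<epsilon> - \<eta> / 4 * (\<tau> - t) + \<sigma> * integral {t..\<tau>} (\<lambda>r. running x' a' r)
          - (2 * Lf / \<epsilon> * D^2 + 3 * \<eta> / 4) * (\<tau> - t) \<le> \<sigma> * (y \<tau> - c)"
        using yy I \<Delta>2 by linarith
      moreover have "\<sigma> * (y \<tau> - c) \<le> \<sigma> * (u \<tau> x' - u t x')"
      proof -
        have "u t x' = c" unfolding c_def
          by (rule continuous_paths_nonanticipative[OF u _ c' cx eq]) (use t0 in auto)
        moreover have "\<sigma> * (y \<tau> - u \<tau> x') \<le> 0" using tt by (intro yu) auto
        ultimately show ?thesis by (simp add: algebra_simps)
      qed
      moreover have "\<eta> / 4 * (\<tau> - t) + (2 * Lf / \<epsilon> * D^2 + 3 * \<eta> / 4) * (\<tau> - t) = 2 * Lf / \<epsilon> * D^2 * (\<tau> - t) + \<eta> * (\<tau> - t)"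
      proof -
        have "\<eta> / 4 * d + (b + 3 * \<eta> / 4) * d = b * d + \<eta> * d" for b d by (simp add: field_simps)
        then show ?thesis .
      qed
      ultimately show ?thesis unfolding w\<tau> w by linarith
    qed
    show "\<exists>x' a'. x' \<in> X_paths T Cf s0 x0 \<and> a' \<in> \<C> \<and> (\<forall>r\<in>{0..t}. x' r = x r) \<and> (\<forall>r\<le>t. a' r = a r) \<and>
        aiming_estimate \<epsilon> \<eta> s \<psi> t t' x' a'"
      using X' a'(1,2) eq main unfolding aiming_estimate_def by (intro exI[of _ x'] exI[of _ a']) blast
  qed
qed

text \<open>
  The estimates of the cells of a fine mesh add up, since the direction is chosen anew from the
  current deviation at each mesh point.
\<close>

lemma aiming_interval:
  assumes x0: "x0 \<in> \<Omega>" and s0: "0 \<le> s0" and \<epsilon>: "0 < \<epsilon>" and \<eta>: "0 < \<eta>"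
    and s: "s0 \<le> s" "s < s'" "s' \<le> T" and \<psi>: "\<psi> \<in> X_paths T Cf s0 x0" and a0: "a0 \<in> \<C>"
  obtains x a where "x \<in> X_paths T Cf s0 x0" "a \<in> \<C>" "\<And>r. r \<in> {0..s} \<Longrightarrow> x r = \<psi> r" "\<And>r. r \<le> s \<Longrightarrow> a r = a0 r"
    "aiming_estimate \<epsilon> \<eta> s \<psi> s s' x a"
proof -
  have sT: "0 \<le> s" "s \<le> T" and s0T: "s0 \<le> T" using s s0 by auto
  note c\<psi> = X_pathsD(1)[OF \<psi>]
  obtain \<delta> where \<delta>: "0 < \<delta>"
    "\<And>s \<psi> a x t t'. s0 \<le> s \<Longrightarrow> s \<le> t \<Longrightarrow> t < t' \<Longrightarrow> t' \<le> T \<Longrightarrow> t' - t \<le> \<delta> \<Longrightarrow> \<psi> \<in> X_paths T Cf s0 x0 \<Longrightarrow>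
      x \<in> X_paths T Cf s0 x0 \<Longrightarrow> a \<in> \<C> \<Longrightarrow>
      \<exists>x' a'. x' \<in> X_paths T Cf s0 x0 \<and> a' \<in> \<C> \<and> (\<forall>r\<in>{0..t}. x' r = x r) \<and> (\<forall>r\<le>t. a' r = a r) \<and>
        aiming_estimate \<epsilon> \<eta> s \<psi> t t' x' a'"
    using aiming_cell[OF x0 s0 s0T \<epsilon> \<eta>] by blast
  obtain n d where d: "0 < d" "d \<le> \<delta>" "s + real n * d = s'"
    using mesh_exists[OF s(2) \<delta>(1)] by metis
  define t where "t = (\<lambda>k. s + real k * d)"
  have tk: "s \<le> t k" "t k < t (Suc k)" "t (Suc k) \<le> s'" "t (Suc k) \<le> T" "t (Suc k) - t k \<le> \<delta>" if "k < n" for k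
  proof -
    have "real (Suc k) * d \<le> real n * d" using that d by (intro mult_right_mono) auto
    then show "t (Suc k) \<le> s'" unfolding t_def using d(3) by linarith
    then show "t (Suc k) \<le> T" using s by simp
    show "s \<le> t k" "t k < t (Suc k)" "t (Suc k) - t k \<le> \<delta>" using d by (auto simp: t_def algebra_simps)
  qed
  define Pst where "Pst = (\<lambda>st. fst st \<in> X_paths T Cf s0 x0 \<and> snd st \<in> \<C> \<and> (\<forall>r\<in>{0..s}. fst st r = \<psi> r) \<and> (\<forall>r\<le>s. snd st r = a0 r))"
  define Qst where "Qst = (\<lambda>k st. aiming_estimate \<epsilon> \<eta> s \<psi> (t k) (t (Suc k)) (fst st) (snd st))"
  have "\<exists>st. Pst st \<and> (\<forall>k<n. Qst k st)"
  proof (rule mesh_induction[where agree="\<lambda>k st st'. Pst st \<and> Pst st' \<and> (\<forall>r\<in>{0..t k}. fst st' r = fst st r) \<and> (\<forall>r\<le>t k. snd st' r = snd st r)"])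
    show "Pst (\<psi>, a0)" using \<psi> a0 by (simp add: Pst_def)
  next
    fix k st assume k: "k < n" and P: "Pst st"
    have Pd: "fst st \<in> X_paths T Cf s0 x0" "snd st \<in> \<C>" using P by (auto simp: Pst_def)
    obtain x' a' where xa: "x' \<in> X_paths T Cf s0 x0" "a' \<in> \<C>" "\<forall>r\<in>{0..t k}. x' r = fst st r" "\<forall>r\<le>t k. a' r = snd st r"
      and q: "aiming_estimate \<epsilon> \<eta> s \<psi> (t k) (t (Suc k)) x' a'"
      using \<delta>(2)[OF s(1) tk(1)[OF k] tk(2)[OF k] tk(4)[OF k] tk(5)[OF k] \<psi> Pd] by blast
    have "Pst (x', a')"
      using xa P tk(1)[OF k] unfolding Pst_def by auto
    moreover have "Qst k (x', a')" using q by (simp add: Qst_def)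
    ultimately show "\<exists>st'. Pst st' \<and> (Pst st \<and> Pst st' \<and> (\<forall>r\<in>{0..t k}. fst st' r = fst st r) \<and> (\<forall>r\<le>t k. snd st' r = snd st r)) \<and> Qst k st'"
      using P xa by (intro exI[of _ "(x', a')"]) simp
  next
    fix j k st st' assume jk: "j < k" "k < n"
      and agree: "Pst st \<and> Pst st' \<and> (\<forall>r\<in>{0..t k}. fst st' r = fst st r) \<and> (\<forall>r\<le>t k. snd st' r = snd st r)"
      and Q: "Qst j st"
    have "real (Suc j) * d \<le> real k * d" using jk d by (intro mult_right_mono) auto
    then have le: "t (Suc j) \<le> t k" by (simp add: t_def)
    have jn: "j < n" using jk by simp
    note j = tk[OF jn]
    have X: "fst st \<in> X_paths T Cf s0 x0" "fst st' \<in> X_paths T Cf s0 x0" and a: "snd st \<in> controls T A" "snd st' \<in> controls T A"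
      using agree \<C> by (auto simp: Pst_def)
    note c = X_pathsD(1)[OF X(1)] X_pathsD(1)[OF X(2)]
    show "Qst j st'"
      unfolding Qst_def
      by (rule aiming_estimate_cong[OF c\<psi> c a sT(1) j(1) _ j(4) _ _ Q[unfolded Qst_def]]) (use agree le j(2) in auto)
  qed
  then obtain st where st: "Pst st" "\<And>k. k < n \<Longrightarrow> Qst k st" by blast
  define x a where "x = fst st" and "a = snd st"
  have X: "x \<in> X_paths T Cf s0 x0" and aC: "a \<in> \<C>" and x\<psi>: "\<And>r. r \<in> {0..s} \<Longrightarrow> x r = \<psi> r" and aa0: "\<And>r. r \<le> s \<Longrightarrow> a r = a0 r"
    using st(1) by (auto simp: Pst_def x_def a_def)
  have ac: "a \<in> controls T A" using aC \<C> by blast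
  let ?\<phi> = "traj s \<psi> a"
  have ri: "(\<lambda>r. running x a r) integrable_on {s..q}" if "s \<le> q" "q \<le> T" for q
    using running_u_integrable[OF x0 s0 X ac s(1) that] .
  show thesis
  proof (rule that[OF X aC x\<psi> aa0])
    show "aiming_estimate \<epsilon> \<eta> s \<psi> s s' x a"
      unfolding aiming_estimate_def
    proof (intro ballI allI impI)
      fix \<tau> D assume \<tau>: "\<tau> \<in> {s..s'}" and D: "\<forall>\<rho>\<in>{0..\<tau>}. norm (x \<rho> - ?\<phi> \<rho>) \<le> D"
      define \<kappa> where "\<kappa> = 2 * Lf / \<epsilon> * D^2"
      define V where "V = (\<lambda>q. \<sigma> * u q x - norm (x q - ?\<phi> q)^2 / \<epsilon> + (\<kappa> + \<eta>) * q - \<sigma> * integral {s..q} (\<lambda>r. running x a r))"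
      have cell: "V (t k) \<le> V q" if k: "k < n" and q: "q \<in> {t k..t (Suc k)}" "q \<le> \<tau>" for k q
      proof -
        have qT: "q \<le> T" "s \<le> t k" "t k \<le> q" "s \<le> q" using q \<tau> tk[OF k] by auto
        have "\<forall>\<rho>\<in>{0..q}. norm (x \<rho> - ?\<phi> \<rho>) \<le> D" using D q by simp
        then have "(norm (x q - ?\<phi> q)^2 - norm (x (t k) - ?\<phi> (t k))^2) / \<epsilon>
            - \<kappa> * (q - t k) + \<sigma> * integral {t k..q} (\<lambda>r. running x a r) - \<eta> * (q - t k)
          \<le> \<sigma> * (u q x - u (t k) x)"
          using st(2)[OF k, unfolded Qst_def aiming_estimate_def x_def[symmetric] a_def[symmetric], rule_format, OF q(1), of D]
          unfolding \<kappa>_def by blast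
        moreover have "\<sigma> * integral {s..q} (\<lambda>r. running x a r) = \<sigma> * integral {s..t k} (\<lambda>r. running x a r) + \<sigma> * integral {t k..q} (\<lambda>r. running x a r)"
          using Henstock_Kurzweil_Integration.integral_combine[OF qT(2,3) ri[OF qT(4,1)]] by (simp only: distrib_left[symmetric])
        ultimately show ?thesis
          unfolding V_def diff_divide_distrib by (simp add: algebra_simps)
      qed
      \<comment> \<open>stopping \<open>V\<close> at \<open>\<tau>\<close> makes the cells after \<open>\<tau>\<close> trivial\<close>
      have "V (min s \<tau>) \<le> V (min \<tau> \<tau>)"
      proof (rule base_from_cells[where V="\<lambda>q. V (min q \<tau>)" and h=d and n=n and a=s])
        fix k q assume k: "k < n" and q: "s + real k * d \<le> q" "q \<le> s + real (Suc k) * d"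
        then show "V (min (s + real k * d) \<tau>) \<le> V (min q \<tau>)"
          using cell[OF k, of "min q \<tau>"] unfolding t_def by (cases "s + real k * d \<le> \<tau>") (auto simp: min_def)
      qed (use d \<tau> in auto)
      then have "V s \<le> V \<tau>" using \<tau> by (simp add: min_def)
      then show "(norm (x \<tau> - ?\<phi> \<tau>)^2 - norm (x s - ?\<phi> s)^2) / \<epsilon> - 2 * Lf / \<epsilon> * D^2 * (\<tau> - s)
          + \<sigma> * integral {s..\<tau>} (\<lambda>r. running x a r) - \<eta> * (\<tau> - s) \<le> \<sigma> * (u \<tau> x - u s x)"
        unfolding \<kappa>_def[symmetric] by (simp add: V_def diff_divide_distrib algebra_simps)
    qed
  qed
qed

text \<open>
  The path starts at time \<open>s\<close> on the trajectory itself, so the penalty is zero there. At the time of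
  largest deviation \<open>D\<close>, the aiming estimate reads
  \<open>D^2 / \<epsilon> - (2 Lf h) (D^2 / \<epsilon>) \<le> 3 e\<close>, where the right-hand side bounds the
  oscillation of \<open>u\<close>, the running term and the error; with \<open>Lf h \<le> 1/4\<close> this gives
  \<open>D^2 / \<epsilon> \<le> 6 e\<close>. The bound \<open>h0\<close> does not depend on \<open>\<epsilon>\<close>, so \<open>\<epsilon>\<close> may
  be chosen after \<open>h\<close> and so small that \<open>D\<close> is below the modulus of continuity of \<open>u\<close> for the
  tolerance \<open>e h\<close>. Then \<open>u\<close> and the running term are transferred from the path to the trajectory,
  and every loss is proportional to \<open>h\<close>.
\<close>

lemma aiming_step:
  assumes x0: "x0 \<in> \<Omega>" and s0: "0 \<le> s0" "s0 \<le> T" and \<eta>: "0 < \<eta>"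
  obtains h0 where "0 < h0"
    "\<And>h s \<psi> a. 0 < h \<Longrightarrow> h \<le> h0 \<Longrightarrow> s0 \<le> s \<Longrightarrow> s + h \<le> T \<Longrightarrow> \<psi> \<in> X_paths T Cf s0 x0 \<Longrightarrow> a \<in> \<C> \<Longrightarrow>
      \<exists>a'\<in>\<C>. (\<forall>r\<le>s. a' r = a r) \<and>
        \<sigma> * integral {s..s + h} (\<lambda>r. running (traj s \<psi> a') a' r) - \<eta> * h
          \<le> \<sigma> * (u (s + h) (traj s \<psi> a') - u s (traj s \<psi> a'))"
proof -
  obtain K where "equi_lipschitz T Cf s0 x0 K" using X_paths_uniform[OF x0 Cf s0] by blast
  note K = equi_lipschitzD[OF this]
  obtain B where B: "0 \<le> B" "\<And>t x. t \<in> {s0..T} \<Longrightarrow> x \<in> X_paths T Cf s0 x0 \<Longrightarrow> \<bar>u t x\<bar> \<le> B"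
    using continuous_paths_bounded[OF u x0 Cf s0] by blast
  obtain C1 where C1: "0 \<le> C1" and running_bound: "\<And>x a r. r \<in> {0<..<T} - N \<Longrightarrow> s0 \<le> r \<Longrightarrow>
      x \<in> X_paths T Cf s0 x0 \<Longrightarrow> a \<in> controls T A \<Longrightarrow> \<bar>running x a r\<bar> \<le> C1"
    using running_bound[OF x0 s0] by blast
  \<comment> \<open>the losses collected at the end are \<open>12 Lf e h\<close> from the aiming error and \<open>(3 + Clam) e h\<close> from
    the remaining terms\<close>
  define e where "e = \<eta> / (12 * Lf + 4 + Clam)"
  have den: "0 < 12 * Lf + 4 + Clam" using Lf Clam by simp
  have e: "0 < e" "e * (12 * Lf + 4 + Clam) = \<eta>" using \<eta> den by (auto simp: e_def)
  obtain \<rho>1 where "path_modulus T Cf s0 x0 u e \<rho>1"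
    using continuous_paths_uniform[OF u x0 Cf s0 e(1)] by blast
  note \<rho>1 = path_modulusD[OF this]
  define h0 where "h0 = min (min 1 \<rho>1) (min (e / (C1 + 1)) (1 / (4 * (Lf + 1))))"
  have h0: "0 < h0" "h0 \<le> 1" "h0 \<le> \<rho>1" "C1 * h0 \<le> e" "Lf * h0 \<le> 1 / 4"
  proof -
    show "0 < h0" using \<rho>1 e C1 Lf by (auto simp: h0_def)
    show "h0 \<le> 1" "h0 \<le> \<rho>1" by (auto simp: h0_def)
    have "C1 * h0 \<le> C1 * (e / (C1 + 1))" using C1 by (intro mult_left_mono) (auto simp: h0_def)
    also have "\<dots> \<le> e" using C1 e by (simp add: field_simps)
    finally show "C1 * h0 \<le> e" .
    have "Lf * h0 \<le> Lf * (1 / (4 * (Lf + 1)))" using Lf by (intro mult_left_mono) (auto simp: h0_def)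
    also have "\<dots> \<le> 1 / 4" using Lf by (simp add: field_simps)
    finally show "Lf * h0 \<le> 1 / 4" .
  qed
  show thesis
  proof (rule that[OF h0(1)])
    fix h s \<psi> a0
    assume h: "0 < h" "h \<le> h0" and s: "s0 \<le> s" "s + h \<le> T" and \<psi>: "\<psi> \<in> X_paths T Cf s0 x0" and a0: "a0 \<in> \<C>"
    have C1h: "C1 * h \<le> e" using mult_left_mono[OF h(2) C1] h0(4) by linarith
    have Lfh: "Lf * h \<le> 1 / 4" using mult_left_mono[OF h(2) Lf] h0(5) by linarith
    have sT: "0 \<le> s" "s \<le> T" "s \<in> {s0..T}" "s + h \<in> {s0..T}" using s h s0 by auto
    note c\<psi> = X_pathsD(1)[OF \<psi>]
    have eh: "0 < e * h" using e h by simp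
    obtain \<rho>3 where "path_modulus T Cf s0 x0 u (e * h) \<rho>3"
      using continuous_paths_uniform[OF u x0 Cf s0 eh] by blast
    note \<rho>3 = path_modulusD[OF this]
    \<comment> \<open>largest deviation that is tolerated: it is small for \<open>u\<close> and for the data\<close>
    define \<rho>' where "\<rho>' = min \<rho>3 (e / (Lf * (1 + B) + 1))"
    have LB: "0 \<le> Lf * (1 + B)" using Lf B by simp
    have \<rho>': "0 < \<rho>'" "\<rho>' \<le> \<rho>3" "Lf * (1 + B) * \<rho>' \<le> e"
    proof -
      show "0 < \<rho>'" using \<rho>3 e LB by (auto simp: \<rho>'_def)
      show "\<rho>' \<le> \<rho>3" by (simp add: \<rho>'_def)
      have "Lf * (1 + B) * \<rho>' \<le> Lf * (1 + B) * (e / (Lf * (1 + B) + 1))"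
        using LB by (intro mult_left_mono) (auto simp: \<rho>'_def)
      also have "\<dots> \<le> e"
      proof -
        have "Lf * (1 + B) * e \<le> e * (Lf * (1 + B) + 1)" using e(1) by (simp add: algebra_simps)
        then show ?thesis using LB by (simp add: divide_le_eq)
      qed
      finally show "Lf * (1 + B) * \<rho>' \<le> e" .
    qed
    \<comment> \<open>turns the bound \<open>D^2 / \<epsilon> \<le> 6 e\<close> into \<open>D \<le> \<rho>'\<close>\<close>
    define \<epsilon> where "\<epsilon> = \<rho>'^2 / (6 * e)"
    have \<epsilon>: "0 < \<epsilon>" "6 * e * \<epsilon> = \<rho>'^2" using \<rho>'(1) e by (auto simp: \<epsilon>_def)
    have sh: "s < s + h" using h by simp
    obtain x a where X: "x \<in> X_paths T Cf s0 x0" and aC: "a \<in> \<C>" and x\<psi>: "\<And>r. r \<in> {0..s} \<Longrightarrow> x r = \<psi> r"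
      and aa0: "\<And>r. r \<le> s \<Longrightarrow> a r = a0 r" and est: "aiming_estimate \<epsilon> e s \<psi> s (s + h) x a"
      using aiming_interval[OF x0 s0(1) \<epsilon>(1) e(1) s(1) sh s(2) \<psi> a0] by metis
    have ac: "a \<in> controls T A" using aC \<C> by blast
    let ?\<phi> = "traj s \<psi> a"
    note cx = X_pathsD(1)[OF X] and c\<phi> = traj_path(1)[OF c\<psi> ac sT(1,2)]
    have X\<phi>: "?\<phi> \<in> X_paths T Cf s0 x0"
      by (rule X_paths_trans[OF \<psi> traj_path(2)[OF c\<psi> ac sT(1,2)] Cf s0(1) s(1) sT(2)])
    have xs: "x r = ?\<phi> r" if "r \<in> {0..s}" for r
      using x\<psi>[OF that] traj_path(3)[OF c\<psi> ac sT(1,2) that] by simp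
    have ri: "(\<lambda>r. running x a r) integrable_on {p..q}" "(\<lambda>r. running ?\<phi> a r) integrable_on {p..q}"
      if "s \<le> p" "p \<le> q" "q \<le> T" for p q
      by (rule running_u_integrable[OF x0 s0(1) X ac], use s that in simp_all)
        (rule running_u_integrable[OF x0 s0(1) X\<phi> ac], use s that in simp_all)
    have agg: "norm (x \<tau> - ?\<phi> \<tau>)^2 / \<epsilon> - 2 * Lf / \<epsilon> * D^2 * (\<tau> - s) + \<sigma> * integral {s..\<tau>} (\<lambda>r. running x a r) - e * (\<tau> - s)
        \<le> \<sigma> * (u \<tau> x - u s x)"
      if \<tau>: "\<tau> \<in> {s..s + h}" and D: "\<And>\<rho>. \<rho> \<in> {0..s + h} \<Longrightarrow> norm (x \<rho> - ?\<phi> \<rho>) \<le> D" for \<tau> D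
    proof -
      have "\<forall>\<rho>\<in>{0..\<tau>}. norm (x \<rho> - ?\<phi> \<rho>) \<le> D" using D \<tau> by simp
      from est[unfolded aiming_estimate_def, rule_format, OF \<tau>, of D] this
      show ?thesis using xs[of s] sT by auto
    qed
    obtain D \<tau>' where D: "\<And>\<rho>. \<rho> \<in> {0..s + h} \<Longrightarrow> norm (x \<rho> - ?\<phi> \<rho>) \<le> D" and \<tau>': "\<tau>' \<in> {s..s + h}" "D = norm (x \<tau>' - ?\<phi> \<tau>')"
    proof -
      have lipc: "continuous_on {s..s + h} y" if "y \<in> X_paths T Cf s0 x0" for y
        by (rule lipschitz_on_continuous_on[of K], rule lipschitz_onI)
          (use K(3)[OF that] K(1) s sT in \<open>auto simp: dist_norm dist_real_def\<close>)
      have "continuous_on {s..s + h} (\<lambda>r. norm (x r - ?\<phi> r))" by (intro continuous_intros lipc X X\<phi>)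
      then obtain \<tau>' where \<tau>': "\<tau>' \<in> {s..s + h}" "\<forall>r\<in>{s..s + h}. norm (x r - ?\<phi> r) \<le> norm (x \<tau>' - ?\<phi> \<tau>')"
        using continuous_attains_sup[of "{s..s + h}" "\<lambda>r. norm (x r - ?\<phi> r)"] h by fastforce
      show thesis
      proof (rule that[OF _ \<tau>'(1) refl])
        fix \<rho> assume \<rho>: "\<rho> \<in> {0..s + h}"
        show "norm (x \<rho> - ?\<phi> \<rho>) \<le> norm (x \<tau>' - ?\<phi> \<tau>')"
        proof (cases "\<rho> \<le> s")
          case True
          then show ?thesis using xs[of \<rho>] \<rho> by simp
        next
          case False
          then show ?thesis using \<tau>'(2) \<rho> by simp
        qed
      qed
    qed
    have D0: "0 \<le> D" using \<tau>' by simp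
    define m where "m = D^2 / \<epsilon>"
    have m0: "0 \<le> m" using \<epsilon> by (simp add: m_def)
    have run: "\<bar>\<sigma> * integral {s..\<tau>} (\<lambda>r. running x a r)\<bar> \<le> C1 * h" if \<tau>: "\<tau> \<in> {s..s + h}" for \<tau>
    proof -
      have "norm (integral {s..\<tau>} (\<lambda>r. running x a r)) \<le> C1 * (\<tau> - s)"
        by (rule norm_integral_le_const_ae[OF ri(1) N]) (use \<tau> s sT in \<open>auto intro!: running_bound X ac\<close>)
      also have "\<dots> \<le> C1 * h" using \<tau> C1 by (intro mult_left_mono) auto
      finally show ?thesis using \<sigma> by (simp add: abs_mult)
    qed
    have "m \<le> 6 * e"
    proof -
      have "\<bar>u \<tau>' x - u s x\<bar> \<le> e"
      proof (rule \<rho>1(2)[OF _ sT(3) X X])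
        show "\<tau>' \<in> {s0..T}" using \<tau>' s by auto
        show "\<bar>\<tau>' - s\<bar> \<le> \<rho>1" using \<tau>' h h0 by auto
      qed (use \<rho>1(1) in simp)
      then have "\<sigma> * (u \<tau>' x - u s x) \<le> e" by (rule order_trans[OF \<sigma>_le(1)])
      moreover have "2 * Lf / \<epsilon> * D^2 * (\<tau>' - s) \<le> m / 2"
      proof -
        have "2 * Lf / \<epsilon> * D^2 * (\<tau>' - s) = 2 * m * (Lf * (\<tau>' - s))" by (simp add: m_def)
        also have "Lf * (\<tau>' - s) \<le> 1 / 4" using Lfh \<tau>' mult_left_mono[of "\<tau>' - s" h Lf] Lf by auto
        finally show ?thesis using m0 by (simp add: mult_left_mono)
      qed
      moreover have "e * (\<tau>' - s) \<le> e" using \<tau>' h h0 e mult_left_mono[of "\<tau>' - s" 1 e] by auto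
      moreover have "m - 2 * Lf / \<epsilon> * D^2 * (\<tau>' - s) + \<sigma> * integral {s..\<tau>'} (\<lambda>r. running x a r) - e * (\<tau>' - s) \<le> \<sigma> * (u \<tau>' x - u s x)"
        using agg[OF \<tau>'(1) D] unfolding m_def \<tau>'(2) .
      ultimately show ?thesis using run[OF \<tau>'(1)] C1h by linarith
    qed
    have "D^2 \<le> \<rho>'^2"
    proof -
      have "D^2 = m * \<epsilon>" using \<epsilon> by (simp add: m_def)
      also have "\<dots> \<le> 6 * e * \<epsilon>" using \<open>m \<le> 6 * e\<close> \<epsilon> by (intro mult_right_mono) auto
      finally show ?thesis using \<epsilon>(2) by simp
    qed
    then have D\<rho>: "D \<le> \<rho>'" by (rule power2_le_imp_le) (rule less_imp_le[OF \<rho>'(1)])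
    have close: "\<bar>u r x - u r ?\<phi>\<bar> \<le> e * h" if r: "r \<in> {s..s + h}" for r
    proof (rule \<rho>3(2)[OF _ _ X X\<phi>])
      show "r \<in> {s0..T}" "r \<in> {s0..T}" using r s by auto
      fix q assume "q \<in> {0..min r r}"
      then have "norm (x q - ?\<phi> q) \<le> D" using D[of q] r by auto
      then show "norm (x q - ?\<phi> q) \<le> \<rho>3" using D\<rho> \<rho>'(2) by simp
    qed (use \<rho>3(1) in simp)
    have shI: "s + h \<in> {s..s + h}" using h by simp
    have int_close: "\<bar>integral {s..s + h} (\<lambda>r. running x a r) - integral {s..s + h} (\<lambda>r. running ?\<phi> a r)\<bar> \<le> (e + Clam * e) * h"
    proof -
      have "s \<le> s + h" using h by simp
      note r1 = ri(1)[OF order_refl this s(2)] and r2 = ri(2)[OF order_refl this s(2)]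
      have "norm (integral {s..s + h} (\<lambda>r. running x a r - running ?\<phi> a r)) \<le> (e + Clam * e) * (s + h - s)"
      proof (rule norm_integral_le_const_ae[OF Henstock_Kurzweil_Integration.integrable_diff[OF r1 r2] N])
        fix r assume r: "r \<in> {s<..<s + h} - N"
        have r': "r \<in> {0<..<T} - N" "a r \<in> A" "r \<in> {s..s + h}" "r \<in> {s0..T}" using r s sT control_in[OF ac, of r] by auto
        have nr: "norm (x q - ?\<phi> q) \<le> \<rho>'" if "q \<in> {0..r}" for q using D[of q] D\<rho> that r by auto
        note lip = data_lipschitz(2,3)[OF r'(1) cx c\<phi> r'(2) nr]
        have "\<bar>(lam r x (a r) - lam r ?\<phi> (a r)) * u r x\<bar> \<le> Lf * \<rho>' * B"
          unfolding abs_mult using lip(2) B(2)[OF r'(4) X] Lf \<rho>'(1) by (intro mult_mono) auto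
        moreover have "\<bar>lam r ?\<phi> (a r) * (u r x - u r ?\<phi>)\<bar> \<le> Clam * (e * h)"
          unfolding abs_mult using lam_le[OF r'(1) c\<phi> r'(2)] close[OF r'(3)] Clam by (intro mult_mono) auto
        moreover have "Clam * (e * h) \<le> Clam * e" using Clam e h h0 mult_left_mono[of h 1 e] by (intro mult_left_mono) auto
        moreover have "running x a r - running ?\<phi> a r = (lam r x (a r) - lam r ?\<phi> (a r)) * u r x
            + lam r ?\<phi> (a r) * (u r x - u r ?\<phi>) - (l r x (a r) - l r ?\<phi> (a r))" by (simp add: algebra_simps)
        moreover have "Lf * \<rho>' + Lf * \<rho>' * B \<le> e" using \<rho>'(3) by (simp add: algebra_simps)
        ultimately have "\<bar>running x a r - running ?\<phi> a r\<bar> \<le> e + Clam * e" using lip(1) by linarith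
        then show "norm (running x a r - running ?\<phi> a r) \<le> e + Clam * e" by simp
      qed (use h in auto)
      then show ?thesis by (simp add: Henstock_Kurzweil_Integration.integral_diff[OF r1 r2])
    qed
    have "- 2 * m * (Lf * h) + \<sigma> * integral {s..s + h} (\<lambda>r. running x a r) - e * h \<le> \<sigma> * (u (s + h) x - u s x)"
    proof -
      have "0 \<le> norm (x (s + h) - ?\<phi> (s + h))^2 / \<epsilon>" using \<epsilon> by simp
      moreover have "2 * Lf / \<epsilon> * D^2 * (s + h - s) = 2 * m * (Lf * h)" by (simp add: m_def)
      ultimately show ?thesis using agg[OF shI D] by simp
    qed
    moreover have "2 * m * (Lf * h) \<le> 12 * e * Lf * h"
      using \<open>m \<le> 6 * e\<close> Lf h mult_right_mono[of "2 * m" "12 * e" "Lf * h"] by (simp add: mult.assoc)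
    moreover have "\<sigma> * (u (s + h) x - u s x) \<le> \<sigma> * (u (s + h) ?\<phi> - u s ?\<phi>) + e * h"
    proof -
      have "u s x = u s ?\<phi>" by (rule continuous_paths_nonanticipative[OF u _ cx c\<phi> xs]) (use sT in auto)
      then have "\<sigma> * (u (s + h) x - u s x) - \<sigma> * (u (s + h) ?\<phi> - u s ?\<phi>) = \<sigma> * (u (s + h) x - u (s + h) ?\<phi>)"
        by (simp add: algebra_simps)
      also have "\<dots> \<le> e * h" by (rule order_trans[OF \<sigma>_le(1) close[OF shI]])
      finally show ?thesis by simp
    qed
    moreover have "\<sigma> * integral {s..s + h} (\<lambda>r. running ?\<phi> a r) - (e + Clam * e) * h \<le> \<sigma> * integral {s..s + h} (\<lambda>r. running x a r)"
    proof -
      have "\<sigma> * (integral {s..s + h} (\<lambda>r. running ?\<phi> a r) - integral {s..s + h} (\<lambda>r. running x a r)) \<le> (e + Clam * e) * h"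
        by (rule order_trans[OF \<sigma>_le(1)], subst abs_minus_commute) (rule int_close)
      then show ?thesis unfolding right_diff_distrib by linarith
    qed
    moreover have "12 * e * Lf * h + (e * h + e * h + (e + Clam * e) * h) \<le> \<eta> * h"
    proof -
      have "12 * e * Lf * h + (e * h + e * h + (e + Clam * e) * h) = (e * (12 * Lf + 3 + Clam)) * h"
        by (simp add: algebra_simps)
      also have "\<dots> \<le> (e * (12 * Lf + 4 + Clam)) * h" using e h by (intro mult_right_mono mult_left_mono) auto
      finally show ?thesis using e(2) by simp
    qed
    ultimately have "\<sigma> * integral {s..s + h} (\<lambda>r. running ?\<phi> a r) - \<eta> * h \<le> \<sigma> * (u (s + h) ?\<phi> - u s ?\<phi>)"
      by linarith
    then show "\<exists>a'\<in>\<C>. (\<forall>r\<le>s. a' r = a0 r) \<and>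
        \<sigma> * integral {s..s + h} (\<lambda>r. running (traj s \<psi> a') a' r) - \<eta> * h
          \<le> \<sigma> * (u (s + h) (traj s \<psi> a') - u s (traj s \<psi> a'))"
      using aC aa0 by blast
  qed
qed

text \<open>
  The short intervals are chained: on each of them the control is modified, and the trajectory
  continues. The losses \<open>\<eta>' h\<close> add up to at most \<open>\<eta> / 2\<close>, and inside an interval the
  compared quantity \<open>V\<close> varies by at most \<open>\<eta> / 4\<close>.
\<close>

lemma aiming_trajectory:
  assumes x0: "x0 \<in> \<Omega>" and s0: "0 \<le> s0" "s0 < T" and a0: "a0 \<in> \<C>" and \<eta>: "0 < \<eta>"
  obtains a where "a \<in> \<C>"
    "\<And>p q. s0 \<le> p \<Longrightarrow> p \<le> q \<Longrightarrow> q \<le> T \<Longrightarrow>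
      \<sigma> * integral {p..q} (\<lambda>r. running (traj s0 x0 a) a r) - \<eta> \<le> \<sigma> * (u q (traj s0 x0 a) - u p (traj s0 x0 a))"
proof -
  have sT: "s0 \<le> T" using s0 by simp
  obtain C1 where C1: "0 \<le> C1" and running_bound: "\<And>x a r. r \<in> {0<..<T} - N \<Longrightarrow> s0 \<le> r \<Longrightarrow>
      x \<in> X_paths T Cf s0 x0 \<Longrightarrow> a \<in> controls T A \<Longrightarrow> \<bar>running x a r\<bar> \<le> C1"
    using running_bound[OF x0 s0(1) sT] by blast
  define \<eta>' where "\<eta>' = \<eta> / (2 * T)"
  have \<eta>': "0 < \<eta>'" "\<eta>' * T = \<eta> / 2" using \<eta> T_pos by (auto simp: \<eta>'_def)
  obtain h0 where h0: "0 < h0"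
    "\<And>h s \<psi> a. 0 < h \<Longrightarrow> h \<le> h0 \<Longrightarrow> s0 \<le> s \<Longrightarrow> s + h \<le> T \<Longrightarrow> \<psi> \<in> X_paths T Cf s0 x0 \<Longrightarrow> a \<in> \<C> \<Longrightarrow>
      \<exists>a'\<in>\<C>. (\<forall>r\<le>s. a' r = a r) \<and>
        \<sigma> * integral {s..s + h} (\<lambda>r. running (traj s \<psi> a') a' r) - \<eta>' * h
          \<le> \<sigma> * (u (s + h) (traj s \<psi> a') - u s (traj s \<psi> a'))"
    using aiming_step[OF x0 s0(1) sT \<eta>'(1)] by blast
  have "0 < \<eta> / 8" using \<eta> by simp
  then obtain \<rho> where "path_modulus T Cf s0 x0 u (\<eta> / 8) \<rho>"
    using continuous_paths_uniform[OF u x0 Cf s0(1) sT] by blast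
  note \<rho> = path_modulusD[OF this]
  define \<delta> where "\<delta> = min h0 (min \<rho> (\<eta> / (8 * (C1 + \<eta>' + 1))))"
  have den: "0 < 8 * (C1 + \<eta>' + 1)" using C1 \<eta>' by simp
  have \<delta>: "0 < \<delta>" "\<delta> \<le> h0" "\<delta> \<le> \<rho>" "(C1 + \<eta>') * \<delta> \<le> \<eta> / 8"
  proof -
    show "0 < \<delta>" using h0 \<rho> \<eta> den by (auto simp: \<delta>_def)
    show "\<delta> \<le> h0" "\<delta> \<le> \<rho>" by (auto simp: \<delta>_def)
    have "(C1 + \<eta>') * \<delta> \<le> (C1 + \<eta>' + 1) * (\<eta> / (8 * (C1 + \<eta>' + 1)))"
      using C1 \<eta>' h0(1) \<rho>(1) \<eta> by (intro mult_mono) (auto simp: \<delta>_def)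
    also have "\<dots> = \<eta> / 8"
    proof -
      have "X * (\<eta> / (8 * X)) = \<eta> / 8" if "X \<noteq> 0" for X using that by simp
      moreover have "C1 + \<eta>' + 1 \<noteq> 0" using C1 \<eta>' by simp
      ultimately show ?thesis by blast
    qed
    finally show "(C1 + \<eta>') * \<delta> \<le> \<eta> / 8" .
  qed
  obtain n d where n0: "0 < n" and d: "0 < d" "d \<le> \<delta>" "s0 + real n * d = T"
    using mesh_exists[OF s0(2) \<delta>(1)] by metis
  define t where "t = (\<lambda>k. s0 + real k * d)"
  have tk: "s0 \<le> t k" "t (Suc k) = t k + d" "t k + d \<le> T" "t k \<le> T" if "k < n" for k
  proof -
    have "real (Suc k) * d \<le> real n * d" using that d by (intro mult_right_mono) auto
    then show "t k + d \<le> T" unfolding t_def using d(3) by (simp add: algebra_simps)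
    then show "t k \<le> T" using d by simp
    show "s0 \<le> t k" "t (Suc k) = t k + d" using d by (auto simp: t_def algebra_simps)
  qed
  let ?Q = "\<lambda>k a. \<sigma> * integral {t k..t k + d} (\<lambda>r. running (traj s0 x0 a) a r) - \<eta>' * d
      \<le> \<sigma> * (u (t k + d) (traj s0 x0 a) - u (t k) (traj s0 x0 a))"
  have "\<exists>a. a \<in> \<C> \<and> (\<forall>k<n. ?Q k a)"
  proof (rule mesh_induction[where P="\<lambda>a. a \<in> \<C>" and Q="?Q" and agree="\<lambda>k a a'. a \<in> \<C> \<and> a' \<in> \<C> \<and> (\<forall>r\<le>t k. a' r = a r)"])
    show "a0 \<in> \<C>" by (rule a0)
  next
    fix k a assume k: "k < n" and a: "a \<in> \<C>"
    note tk = tk[OF k]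
    have ac: "a \<in> controls T A" using a \<C> by blast
    let ?\<psi> = "traj s0 x0 a"
    obtain a' where a': "a' \<in> \<C>" "\<forall>r\<le>t k. a' r = a r"
      "\<sigma> * integral {t k..t k + d} (\<lambda>r. running (traj (t k) ?\<psi> a') a' r) - \<eta>' * d
          \<le> \<sigma> * (u (t k + d) (traj (t k) ?\<psi> a') - u (t k) (traj (t k) ?\<psi> a'))"
      using h0(2)[OF d(1) order_trans[OF d(2) \<delta>(2)] tk(1) tk(3) traj_path(2)[OF x0 ac s0(1) sT] a] by blast
    have a'c: "a' \<in> controls T A" using a'(1) \<C> by blast
    have "traj s0 x0 a' = traj (t k) ?\<psi> a'"
      by (rule traj_concat[OF x0 ac a'c s0(1) tk(1) tk(4)]) (use a'(2) in auto)
    then show "\<exists>a'. a' \<in> \<C> \<and> (a \<in> \<C> \<and> a' \<in> \<C> \<and> (\<forall>r\<le>t k. a' r = a r)) \<and> ?Q k a'"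
      using a' a by (intro exI[of _ a']) simp
  next
    fix j k a a' assume jk: "j < k" "k < n" and agree: "a \<in> \<C> \<and> a' \<in> \<C> \<and> (\<forall>r\<le>t k. a' r = a r)" and Q: "?Q j a"
    have "real (Suc j) * d \<le> real k * d" using jk d by (intro mult_right_mono) auto
    then have le: "t j + d \<le> t k" by (simp add: t_def algebra_simps)
    have jn: "j < n" using jk by simp
    note j = tk[OF jn]
    have ac: "a \<in> controls T A" "a' \<in> controls T A" using agree \<C> by auto
    note c = traj_path(1)[OF x0 ac(1) s0(1) sT] traj_path(1)[OF x0 ac(2) s0(1) sT]
    have teq: "traj s0 x0 a' r = traj s0 x0 a r" if "r \<in> {0..t k}" for r
      by (rule traj_agree[OF x0 ac s0(1) tk(1)[OF jk(2)] tk(4)[OF jk(2)] _ that]) (use agree in auto)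
    have ueq: "u r (traj s0 x0 a') = u r (traj s0 x0 a)" if "r \<in> {0..t k}" for r
      by (rule continuous_paths_nonanticipative[OF u _ c(2,1)]) (use teq that tk[OF jk(2)] in auto)
    have I: "integral {t j..t j + d} (\<lambda>r. running (traj s0 x0 a') a' r) = integral {t j..t j + d} (\<lambda>r. running (traj s0 x0 a) a r)"
      by (rule running_agree[OF c ac]) (use teq agree le j s0 in auto)
    have "t j + d \<in> {0..t k}" "t j \<in> {0..t k}" using le j s0 d by auto
    then show "?Q j a'" using Q unfolding I by (simp only: ueq)
  qed
  then obtain a where a: "a \<in> \<C>" "\<And>k. k < n \<Longrightarrow> ?Q k a" by blast
  have ac: "a \<in> controls T A" using a \<C> by blast
  let ?\<phi> = "traj s0 x0 a"
  note X = traj_path(2)[OF x0 ac s0(1) sT] and c\<phi> = traj_path(1)[OF x0 ac s0(1) sT]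
  have ri: "(\<lambda>r. running ?\<phi> a r) integrable_on {p..q}" if "s0 \<le> p" "p \<le> q" "q \<le> T" for p q
    by (rule running_u_integrable[OF x0 s0(1) X ac that])
  define V where "V = (\<lambda>q. \<sigma> * u q ?\<phi> - \<sigma> * integral {s0..q} (\<lambda>r. running ?\<phi> a r) + \<eta>' * q)"
  have Vdiff: "V q - V p = \<sigma> * (u q ?\<phi> - u p ?\<phi>) - \<sigma> * integral {p..q} (\<lambda>r. running ?\<phi> a r) + \<eta>' * (q - p)"
    if pq: "s0 \<le> p" "p \<le> q" "q \<le> T" for p q
  proof -
    have "s0 \<le> q" using pq by simp
    from Henstock_Kurzweil_Integration.integral_combine[OF pq(1,2) ri[OF order_refl this pq(3)]]
    have "\<sigma> * integral {s0..q} (\<lambda>r. running ?\<phi> a r) = \<sigma> * integral {s0..p} (\<lambda>r. running ?\<phi> a r) + \<sigma> * integral {p..q} (\<lambda>r. running ?\<phi> a r)"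
      by (simp only: distrib_left[symmetric])
    then show ?thesis unfolding V_def right_diff_distrib by linarith
  qed
  show thesis
  proof (rule that[OF a(1)])
    fix p q assume pq: "s0 \<le> p" "p \<le> q" "q \<le> T"
    have "V p \<le> V q + 2 * (\<eta> / 4)"
    proof (rule almost_mono_from_mesh[OF d(1) n0, where V=V and a=s0])
      fix k assume k: "k < n"
      note tk = tk[OF k]
      have "V (t k) \<le> V (t k + d)" using a(2)[OF k] Vdiff[OF tk(1) _ tk(3)] d(1) by simp
      then show "V (s0 + real k * d) \<le> V (s0 + real (Suc k) * d)" by (simp add: t_def algebra_simps)
      fix q assume q: "s0 + real k * d \<le> q" "q \<le> s0 + real (Suc k) * d"
      have q': "t k \<le> q" "q \<le> t k + d" "q \<le> T" "q - t k \<le> \<delta>" "q \<in> {s0..T}" "t k \<in> {s0..T}"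
      proof -
        show q1: "t k \<le> q" "q \<le> t k + d" using q by (auto simp: t_def algebra_simps)
        then show "q \<le> T" "q - t k \<le> \<delta>" "q \<in> {s0..T}" "t k \<in> {s0..T}" using tk d(2) by auto
      qed
      have "\<bar>u q ?\<phi> - u (t k) ?\<phi>\<bar> \<le> \<eta> / 8"
        by (rule \<rho>(2)[OF q'(5,6) X X]) (use q' \<delta> \<rho>(1) in auto)
      then have 1: "\<bar>\<sigma> * (u q ?\<phi> - u (t k) ?\<phi>)\<bar> \<le> \<eta> / 8" using \<sigma> by (simp add: abs_mult)
      have "norm (integral {t k..q} (\<lambda>r. running ?\<phi> a r)) \<le> C1 * (q - t k)"
      proof (rule norm_integral_le_const_ae[OF ri[OF tk(1) q'(1) q'(3)] N q'(1)])
        fix r assume r: "r \<in> {t k<..<q} - N"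
        have "r \<in> {0<..<T} - N" "s0 \<le> r" using r q' tk s0 by auto
        then show "norm (running ?\<phi> a r) \<le> C1" using running_bound[OF _ _ X ac] by simp
      qed
      then have "\<bar>\<sigma> * integral {t k..q} (\<lambda>r. running ?\<phi> a r)\<bar> \<le> C1 * (q - t k)" using \<sigma> by (simp add: abs_mult)
      moreover have "\<bar>\<eta>' * (q - t k)\<bar> = \<eta>' * (q - t k)" using \<eta>' q' by simp
      moreover have "(C1 + \<eta>') * (q - t k) \<le> \<eta> / 8"
        using C1 \<eta>'(1) by (intro order_trans[OF mult_left_mono[OF q'(4)] \<delta>(4)]) simp
      ultimately have "\<bar>V q - V (t k)\<bar> \<le> \<eta> / 4"
        using Vdiff[OF tk(1) q'(1) q'(3)] 1 unfolding distrib_right by linarith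
      then show "\<bar>V q - V (s0 + real k * d)\<bar> \<le> \<eta> / 4" by (simp add: t_def)
    qed (use pq d in simp_all)
    moreover have "\<eta>' * (q - p) \<le> \<eta> / 2"
      unfolding \<eta>'(2)[symmetric] using pq s0 \<eta>' by (intro mult_left_mono) auto
    ultimately show "\<sigma> * integral {p..q} (\<lambda>r. running ?\<phi> a r) - \<eta> \<le> \<sigma> * (u q ?\<phi> - u p ?\<phi>)"
      using Vdiff[OF pq] by linarith
  qed
qed

text \<open>
  Along the trajectory the payoff \<open>J\<close> grows at the rate \<open>lam J - l\<close>, and \<open>\<sigma> u\<close> grows at least
  at the rate \<open>\<sigma> (lam u - l)\<close> up to \<open>\<eta>\<close>; at \<open>T\<close> the two coincide. As long as the signed
  difference is nonnegative, \<open>lam \<ge> 0\<close> makes it increase in time up to \<open>\<eta>\<close>, so its initial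
  value is at most \<open>\<eta>\<close>.
\<close>

lemma aiming_payoff:
  assumes x0: "x0 \<in> \<Omega>" and s0: "0 \<le> s0" "s0 < T" and a0: "a0 \<in> \<C>" and \<eta>: "0 < \<eta>"
    and terminal: "\<And>x. x \<in> \<Omega> \<Longrightarrow> u T x = h x"
  obtains a where "a \<in> \<C>" "\<sigma> * (u s0 x0 - payoff s0 (traj s0 x0 a) a) \<le> \<eta>"
proof -
  have sT: "s0 \<le> T" using s0 by simp
  obtain a where a: "a \<in> \<C>"
    "\<And>p q. s0 \<le> p \<Longrightarrow> p \<le> q \<Longrightarrow> q \<le> T \<Longrightarrow>
      \<sigma> * integral {p..q} (\<lambda>r. running (traj s0 x0 a) a r) - \<eta> \<le> \<sigma> * (u q (traj s0 x0 a) - u p (traj s0 x0 a))"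
    using aiming_trajectory[OF x0 s0 a0 \<eta>] by blast
  have ac: "a \<in> controls T A" using a \<C> by blast
  let ?\<phi> = "traj s0 x0 a"
  note X = traj_path(2)[OF x0 ac s0(1) sT] and c\<phi> = traj_path(1)[OF x0 ac s0(1) sT]
  note ode = payoff_ode[OF c\<phi> ac s0(1)]
  note uc = u_along_continuous[OF x0 s0(1) sT X]
  let ?e = "\<lambda>t. \<sigma> * (u t ?\<phi> - payoff t ?\<phi> a)"
  have "?e s0 \<le> 0 + \<eta>"
  proof (rule first_zero_bound[OF sT, where e="?e"])
    show "continuous_on {s0..T} ?e" by (intro continuous_intros uc ode)
    show "?e T \<le> 0" using terminal[OF c\<phi>] ode(3) by simp
    fix t assume t: "s0 \<le> t" "t \<le> T" and pos: "\<And>r. r \<in> {s0..t} \<Longrightarrow> 0 \<le> ?e r"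
    let ?R = "\<lambda>r. lam r ?\<phi> (a r) * payoff r ?\<phi> a - l r ?\<phi> (a r)"
    have i1: "(\<lambda>r. running ?\<phi> a r) integrable_on {s0..t}" by (rule running_u_integrable[OF x0 s0(1) X ac order_refl t])
    have i2: "?R integrable_on {s0..t}"
      by (rule running_integrable[OF c\<phi> ac s0(1) t(2)]) (rule continuous_on_subset[OF ode(1)], use t in auto)
    have "integral {s0..t} (\<lambda>_. 0) \<le> integral {s0..t} (\<lambda>r. \<sigma> * (running ?\<phi> a r - ?R r))"
    proof (rule integral_le_ae[OF _ _ N])
      show "(\<lambda>r. \<sigma> * (running ?\<phi> a r - ?R r)) integrable_on {s0..t}"
        by (intro integrable_on_mult_right Henstock_Kurzweil_Integration.integrable_diff i1 i2)
      fix r assume r: "r \<in> {s0<..<t} - N"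
      have r': "r \<in> {0..T}" "a r \<in> A" using r t s0 control_in[OF ac, of r] by auto
      have "0 \<le> lam r ?\<phi> (a r) * ?e r" using r by (intro mult_nonneg_nonneg[OF lam_nonneg[OF r'(1) c\<phi> r'(2)] pos]) auto
      then show "0 \<le> \<sigma> * (running ?\<phi> a r - ?R r)" by (simp add: algebra_simps)
    qed (intro integrable_const_ivl)
    then have "0 \<le> \<sigma> * integral {s0..t} (\<lambda>r. running ?\<phi> a r) - \<sigma> * integral {s0..t} ?R"
      unfolding integral_mult_right Henstock_Kurzweil_Integration.integral_diff[OF i1 i2] by (simp add: right_diff_distrib)
    moreover have "\<sigma> * integral {s0..t} ?R = \<sigma> * (payoff t ?\<phi> a - payoff s0 ?\<phi> a)"
      using ode(2)[OF order_refl t] by simp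
    ultimately show "?e s0 \<le> ?e t + \<eta>"
      using a(2)[OF order_refl t] unfolding right_diff_distrib by linarith
  qed (use \<eta> in simp_all)
  moreover have "u s0 ?\<phi> = u s0 x0"
    by (rule continuous_paths_nonanticipative[OF u _ c\<phi> x0 traj_path(3)[OF x0 ac s0(1) sT]]) (use s0 in auto)
  ultimately show thesis using that[OF a(1)] by simp
qed

end

section \<open>Uniqueness and conclusion\<close>

context control_data
begin

text \<open>
  The subsolution property bounds \<open>u\<close> by the payoff of every control, the supersolution property
  bounds it from below by the payoff of some control up to \<open>\<eta>\<close>.
\<close>

lemma minimax_solution_unique:
  assumes sol: "minimax_solution T ham h Cf u" and s: "s \<in> {0..T}" and x: "x \<in> \<Omega>"
  shows "u s x = val s x"
proof (cases "s = T")
  case True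
  have "u T x \<ge> h x" "u T x \<le> h x"
    using sol x by (auto simp: minimax_solution_def minimax_supersolution_def minimax_subsolution_def)
  then show ?thesis using True val_terminal[OF x] by simp
next
  case False
  then have s': "0 \<le> s" "s < T" "s \<le> T" using s by auto
  have sup: "minimax_supersolution T ham h Cf u" and sub: "minimax_subsolution T ham h Cf u"
    using sol by (auto simp: minimax_solution_def)
  have u: "continuous_paths T u"
    using sup sub by (simp add: minimax_supersolution_def minimax_subsolution_def continuous_paths_def)
  have terminal: "u T x = h x" if "x \<in> \<Omega>" for x
    using sup sub that unfolding minimax_supersolution_def minimax_subsolution_def by (meson antisym)
  have "u s x \<le> payoff s (traj s x a) a" if a: "a \<in> controls T A" for a
  proof -
    \<comment> \<open>with \<open>\<C> = {a}\<close> the control is never modified\<close>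
    interpret sub: extremal_aiming T Cf Clam Lf A f lam l h N u 1 "{a}"
    proof
      fix s x z assume "s \<in> {0..<T}" "x \<in> \<Omega>"
      then show "\<exists>(x', y)\<in>Y_paths T ham Cf s x (u s x) z. \<forall>t\<in>{s..T}. 1 * (y t - u t x') \<le> 0"
        using sub by (force simp: minimax_subsolution_def)
    next
      fix a1 t x c z and \<eta> :: real assume *: "a1 \<in> {a}" "t \<in> {0..T}" "x \<in> \<Omega>" "0 < \<eta>"
      have "- \<eta> \<le> 1 * (preham r x (a r) c z - ham r x c z)" if "r \<in> {t<..<T} - N" for r
      proof -
        have "r \<in> {0<..<T} - N" "a r \<in> A" using that * control_in[OF a, of r] by auto
        from ham_le[OF this(1) *(3) this(2), of c z] show ?thesis using *(4) by simp
      qed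
      then show "\<exists>a'\<in>{a}. (\<forall>r\<le>t. a' r = a1 r) \<and> (\<forall>r\<in>{t<..<T} - N. - \<eta> \<le> 1 * (preham r x (a' r) c z - ham r x c z))"
        using *(1) by simp
    qed (use u a in auto)
    show ?thesis
    proof (rule field_le_epsilon)
      fix \<eta> :: real assume "0 < \<eta>"
      from sub.aiming_payoff[OF x s'(1,2) singletonI this terminal]
      show "u s x \<le> payoff s (traj s x a) a + \<eta>" by force
    qed
  qed
  then have "u s x \<le> val s x"
    unfolding value_eq_payoff[OF x s'(1,3)] by (intro cINF_greatest controls_nonempty)
  moreover have "val s x \<le> u s x"
  proof (rule field_le_epsilon)
    fix \<eta> :: real assume \<eta>: "0 < \<eta>"
    \<comment> \<open>the control may be replaced after each mesh point by an almost optimal one\<close>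
    interpret sup: extremal_aiming T Cf Clam Lf A f lam l h N u "-1" "controls T A"
    proof
      fix s x z assume "s \<in> {0..<T}" "x \<in> \<Omega>"
      then show "\<exists>(x', y)\<in>Y_paths T ham Cf s x (u s x) z. \<forall>t\<in>{s..T}. - 1 * (y t - u t x') \<le> 0"
        using sup by (force simp: minimax_supersolution_def)
    next
      fix a t x c z and \<eta> :: real assume *: "a \<in> controls T A" "t \<in> {0..T}" "x \<in> \<Omega>" "0 < \<eta>"
      obtain b where b: "b \<in> controls T A" "\<And>t. t \<in> {0<..<T} - N \<Longrightarrow> preham t x (b t) c z \<le> ham t x c z + \<eta>"
        using almost_optimal_selection[OF *(3,4)] by blast
      show "\<exists>a'\<in>controls T A. (\<forall>r\<le>t. a' r = a r) \<and> (\<forall>r\<in>{t<..<T} - N. - \<eta> \<le> - 1 * (preham r x (a' r) c z - ham r x c z))"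
      proof (intro bexI[OF _ control_concat[OF *(1) b(1), of t]] conjI ballI)
        fix r assume "r \<in> {t<..<T} - N"
        then show "- \<eta> \<le> - 1 * (preham r x (if r \<le> t then a r else b r) c z - ham r x c z)"
          using b(2)[of r] *(2) by auto
      qed simp
    qed (use u in auto)
    obtain a0 where a0: "a0 \<in> controls T A" using controls_nonempty by blast
    obtain a where a: "a \<in> controls T A" "- 1 * (u s x - payoff s (traj s x a) a) \<le> \<eta>"
      using sup.aiming_payoff[OF x s'(1,2) a0 \<eta> terminal] by blast
    then show "val s x \<le> u s x + \<eta>" using val_le[OF x a(1) s'(1,3)] by simp
  qed
  ultimately show ?thesis by simp
qed

end

theorem theorem7p7:
  fixes T Cf Clam Lf :: real
    and A :: "'p::polish_space set"
    and f :: "real \<Rightarrow> (real \<Rightarrow> real ^ 'd) \<Rightarrow> 'p \<Rightarrow> real ^ 'd"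
    and lam l :: "real \<Rightarrow> (real \<Rightarrow> real ^ 'd) \<Rightarrow> 'p \<Rightarrow> real"
    and h :: "(real \<Rightarrow> real ^ 'd) \<Rightarrow> real"
  assumes T_pos: "0 < T"
    and A_nonempty: "A \<noteq> {}"
    and A_sigma_compact: "\<exists>\<K>. countable \<K> \<and> (\<forall>K\<in>\<K>. compact K) \<and> A = \<Union>\<K>"
    and lam_nonneg: "\<forall>t\<in>{0..T}. \<forall>x\<in>cadlag_paths T. \<forall>a\<in>A. 0 \<le> lam t x a"
    and data_continuous:
      "AE t\<in>{0..T} in lebesgue.
         continuous_map (prod_topology (path_topology T) (top_of_set A)) euclidean
           (\<lambda>(x, a). (f t x a, lam t x a, l t x a))"
    and data_measurable:
      "\<forall>x\<in>cadlag_paths T. \<forall>a\<in>A.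
         (\<lambda>t. (f t x a, lam t x a, l t x a)) \<in> borel_measurable (restrict_space borel {0..T})"
    and constants_nonneg: "0 \<le> Cf" "0 \<le> Clam" "0 \<le> Lf"
    and data_growth:
      "AE t\<in>{0<..<T} in lebesgue. \<forall>x\<in>cadlag_paths T.
         (\<forall>a\<in>A. norm (f t x a) + \<bar>l t x a\<bar> \<le> Cf * (1 + sup_norm_upto t x)) \<and>
         (\<forall>a\<in>A. \<bar>lam t x a\<bar> \<le> Clam)"
    and data_lipschitz:
      "AE t\<in>{0<..<T} in lebesgue. \<forall>x\<in>cadlag_paths T. \<forall>x'\<in>cadlag_paths T. \<forall>a\<in>A.
         norm (f t x a - f t x' a) + \<bar>l t x a - l t x' a\<bar> + \<bar>lam t x a - lam t x' a\<bar>
           \<le> Lf * sup_dist t x x'"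
    and h_lipschitz:
      "\<forall>x\<in>cadlag_paths T. \<forall>x'\<in>cadlag_paths T. \<bar>h x - h x'\<bar> \<le> Lf * sup_dist T x x'"
  shows "minimax_solution T (hamiltonian A f lam l) h Cf (value_function T A f lam l h) \<and>
         (\<forall>u. minimax_solution T (hamiltonian A f lam l) h Cf u \<longrightarrow>
            (\<forall>s\<in>{0..T}. \<forall>x\<in>cadlag_paths T. u s x = value_function T A f lam l h s x))"
proof -
  obtain N1 where N1: "negligible N1" "\<forall>t\<in>{0..T} - N1.
      continuous_map (prod_topology (path_topology T) (top_of_set A)) euclidean
        (\<lambda>(x, a). (f t x a, lam t x a, l t x a))"
    using data_continuous unfolding ae_lebesgue_iff_negligible by blast
  obtain N2 where N2: "negligible N2" "\<forall>t\<in>{0<..<T} - N2. \<forall>x\<in>cadlag_paths T.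
         (\<forall>a\<in>A. norm (f t x a) + \<bar>l t x a\<bar> \<le> Cf * (1 + sup_norm_upto t x)) \<and> (\<forall>a\<in>A. \<bar>lam t x a\<bar> \<le> Clam)"
    using data_growth unfolding ae_lebesgue_iff_negligible by blast
  obtain N3 where N3: "negligible N3" "\<forall>t\<in>{0<..<T} - N3. \<forall>x\<in>cadlag_paths T. \<forall>x'\<in>cadlag_paths T. \<forall>a\<in>A.
         norm (f t x a - f t x' a) + \<bar>l t x a - l t x' a\<bar> + \<bar>lam t x a - lam t x' a\<bar> \<le> Lf * sup_dist t x x'"
    using data_lipschitz unfolding ae_lebesgue_iff_negligible by blast
  define N where "N = N1 \<union> N2 \<union> N3"
  have cont: "continuous_on A (\<lambda>a. (f t x a, lam t x a, l t x a))"
    if t: "t \<in> {0<..<T} - N" and x: "x \<in> cadlag_paths T" for t x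
  proof -
    have "0 \<le> T" using T_pos by simp
    have "x \<in> topspace (path_topology T)"
      unfolding path_topology_def Metric_space.topspace_mtopology[OF Metric_space_cadlag_paths[OF \<open>0 \<le> T\<close>]]
      by (rule x)
    then have "continuous_map (top_of_set A) (prod_topology (path_topology T) (top_of_set A)) (\<lambda>a. (x, a))"
      by (intro continuous_map_pairedI) auto
    moreover have "continuous_map (prod_topology (path_topology T) (top_of_set A)) euclidean
        (\<lambda>(x, a). (f t x a, lam t x a, l t x a))"
      using N1(2) t by (auto simp: N_def)
    ultimately have "continuous_map (top_of_set A) euclidean ((\<lambda>(x, a). (f t x a, lam t x a, l t x a)) \<circ> (\<lambda>a. (x, a)))"
      by (rule continuous_map_compose)
    then show ?thesis by (simp add: comp_def)
  qed
  interpret control_data T Cf Clam Lf A f lam l h N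
  proof
    show "negligible N" using N1 N2 N3 by (simp add: N_def)
    show "continuous_on A (f t x)" "continuous_on A (lam t x)" "continuous_on A (l t x)"
      if "t \<in> {0<..<T} - N" "x \<in> cadlag_paths T" for t x
      using continuous_on_fst[OF cont[OF that]] continuous_on_fst[OF continuous_on_snd[OF cont[OF that]]]
        continuous_on_snd[OF continuous_on_snd[OF cont[OF that]]] by simp_all
    show "(\<lambda>t. f t x a) \<in> borel_measurable (restrict_space borel {0..T})"
      "(\<lambda>t. lam t x a) \<in> borel_measurable (restrict_space borel {0..T})"
      "(\<lambda>t. l t x a) \<in> borel_measurable (restrict_space borel {0..T})"
      if "x \<in> cadlag_paths T" "a \<in> A" for x a
    proof -
      have m: "(\<lambda>t. (f t x a, lam t x a, l t x a)) \<in> borel_measurable (restrict_space borel {0..T})"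
        using data_measurable that by blast
      have proj: "(\<lambda>p. fst p) \<in> borel_measurable borel" "(\<lambda>p. fst (snd p)) \<in> borel_measurable borel"
        "(\<lambda>p. snd (snd p)) \<in> borel_measurable borel"
        for p :: "(real ^ 'd) \<times> real \<times> real"
        by (intro borel_measurable_continuous_onI continuous_intros)+
      show "(\<lambda>t. f t x a) \<in> borel_measurable (restrict_space borel {0..T})"
        "(\<lambda>t. lam t x a) \<in> borel_measurable (restrict_space borel {0..T})"
        "(\<lambda>t. l t x a) \<in> borel_measurable (restrict_space borel {0..T})"
        using measurable_compose[OF m proj(1)] measurable_compose[OF m proj(2)] measurable_compose[OF m proj(3)] by simp_all
    qed
  qed (use T_pos A_nonempty constants_nonneg lam_nonneg N2(2) N3(2) h_lipschitz in \<open>auto simp: N_def\<close>)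
  show ?thesis using val_minimax_solution minimax_solution_unique by blast
qed

end
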